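(* Let $G=\mathbb{R}^{n-1}\rtimes_\alpha\mathbb{R}$ ($n\ge2$) be a purely real Heintze group, where $\alpha$ has positive eigenvalues $\lambda_1\le\cdots\le\lambda_{n-1}$ (counted with multiplicity). For $k=1,\ldots,n-1$ write $w_k=\lambda_1+\cdots+\lambda_k$. Let $\infty\in\partial G$ be the common endpoint of the vertical geodesics $t\mapsto(x,t)$ as $t\to+\infty$, and let $p\in[1,+\infty)$. Then: (1) $L^pH^k(G,\infty)=0$ for $2\le k\le n$ and $p>\frac{\operatorname{tr}(\alpha)}{w_{k-1}}$; (2) $L^pH^k(G,\infty)\ne0$ for $2\le k\le n-1$ and $\frac{\operatorname{tr}(\alpha)}{w_k}<p\le\frac{\operatorname{tr}(\alpha)}{w_{k-1}}$; (3) $L^pH^1(G,\infty)\neq0$ for $p>\frac{\operatorname{tr}(\alpha)}{w_1}$.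
   Context: $G=\mathbb{R}^{n-1}\rtimes_\alpha\mathbb{R}$ denotes $\mathbb{R}^{n-1}\times\mathbb{R}$ with the product $(x,t)\cdot(y,s)=(x+e^{t\alpha}y,\,t+s)$, where $\alpha$ is a linear endomorphism of $\mathbb{R}^{n-1}$ (not necessarily diagonalizable). It is a Heintze group if all eigenvalues of $\alpha$ have positive real part, and purely real if all eigenvalues of $\alpha$ are real. $G$ carries a left-invariant Riemannian metric for which the factors $\mathbb{R}^{n-1}$ and $\mathbb{R}$ are orthogonal at the identity, i.e. $$\langle(v_1,v_2),(u_1,u_2)\rangle_{(x,t)}=\langle e^{-t\alpha}v_1,e^{-t\alpha}u_1\rangle_0+\lambda v_2u_2$$ for an inner product $\langle\cdot,\cdot\rangle_0$ on $\mathbb{R}^{n-1}$ and a constant $\lambda>0$. With this metric $G$ is complete and Gromov-hyperbolic; the curves $t\mapsto(x,t)$ are geodesics, asymptotic to each other as $t\to+\infty$, so they define one point $\infty$ of the boundary at infinity $\partial G$. A neighborhood system of $\infty$ in $\overline{G}=G\cup\partial G$ is given by the sets whose trace on $G$ is $G\setminus(B_R\times(-\infty,T])$, with $B_R=B(0,R)\subset\mathbb{R}^{n-1}$, $R>0$, $T\in\mathbb{R}$. Relative $L^p$-cohomology. Let $M$ be a Riemannian manifold with volume $dV$ and $p\ge1$. For a $k$-form $\omega$ put $|\omega|_x=\sup\{|\omega_x(v_1,\ldots,v_k)|: v_i\in T_xM,\ \|v_i\|_x=1\}$ and $\|\omega\|_{L^p}=\left(\int_M|\omega|_x^p\,dV(x)\right)^{1/p}$.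 Let $L^p\Omega^k(M)$ be the space of smooth differential $k$-forms $\omega$ with $|\omega|_{L^p}:=\|\omega\|_{L^p}+\|d\omega\|_{L^p}<+\infty$, and let $L^pC^k(M)$ be its completion for $|\cdot|_{L^p}$, to which $d$ extends continuously; elements of $L^pC^k(M)$ are identified with $L^p$-integrable measurable $k$-forms modulo almost everywhere zero forms. If $M$ is complete and Gromov-hyperbolic and $\xi\in\partial M$, let $L^pC^k(M,\xi)$ be the subspace of $L^pC^k(M)$ of elements that vanish almost everywhere on a neighborhood of $\xi$ in $\overline{M}=M\cup\partial M$ (the neighborhood may depend on the element). Then $d(L^pC^k(M,\xi))\subset L^pC^{k+1}(M,\xi)$ and $$L^pH^k(M,\xi)=\frac{\operatorname{Ker} d|_{L^pC^k(M,\xi)}}{\operatorname{Im} d|_{L^pC^{k-1}(M,\xi)}}$$ with the (quotient) topology induced by $|\cdot|_{L^p}$, where $L^pC^{-1}(M,\xi)=0$. *)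

theory Defs
  imports
    "HOL-Analysis.Analysis"
    "HOL-Computational_Algebra.Computational_Algebra"
    "HOL-Library.Function_Algebras"
    "HOL-Library.Set_Algebras"
begin

section \<open>Differential forms on a Euclidean space with a Riemannian metric\<close>

text \<open>
  The manifolds considered here have a single global chart, a Euclidean space \<^typ>\<open>'a\<close>, with which
  every tangent space is identified. A \<open>k\<close>-form assigns to each point a function of the tangent
  vectors \<open>v 0, \<dots>, v (k - 1)\<close>; the argument is a sequence \<^typ>\<open>nat \<Rightarrow> 'a\<close> of which only the first
  \<open>k\<close> entries matter. Sums, differences and \<^term>\<open>0\<close> of forms are the pointwise ones of
  \<^theory>\<open>HOL-Library.Function_Algebras\<close>.
\<close>

type_synonym 'a form = "'a \<Rightarrow> (nat \<Rightarrow> 'a) \<Rightarrow> real"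

type_synonym 'a metric = "'a \<Rightarrow> 'a \<Rightarrow> 'a \<Rightarrow> real"

definition alternating :: "nat \<Rightarrow> ((nat \<Rightarrow> 'a::real_vector) \<Rightarrow> real) \<Rightarrow> bool" where
  "alternating k f \<longleftrightarrow>
     (\<forall>v u. (\<forall>i<k. v i = u i) \<longrightarrow> f v = f u) \<and>
     (\<forall>v. \<forall>i<k. linear (\<lambda>y. f (v(i := y)))) \<and>
     (\<forall>v. \<forall>i<k. \<forall>j<k. i \<noteq> j \<longrightarrow> v i = v j \<longrightarrow> f v = 0)"

primrec Ck :: "nat \<Rightarrow> ('a::euclidean_space \<Rightarrow> real) \<Rightarrow> bool" where
  "Ck 0 f \<longleftrightarrow> continuous_on UNIV f"
| "Ck (Suc m) f \<longleftrightarrow>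
     (\<forall>x. f differentiable (at x)) \<and> (\<forall>v. Ck m (\<lambda>x. frechet_derivative f (at x) v))"

definition smooth :: "('a::euclidean_space \<Rightarrow> real) \<Rightarrow> bool" where
  "smooth f \<longleftrightarrow> (\<forall>m. Ck m f)"

definition smooth_form :: "nat \<Rightarrow> 'a::euclidean_space form \<Rightarrow> bool" where
  "smooth_form k \<omega> \<longleftrightarrow> (\<forall>x. alternating k (\<omega> x)) \<and> (\<forall>v. smooth (\<lambda>x. \<omega> x v))"

definition measurable_form :: "nat \<Rightarrow> 'a::euclidean_space form \<Rightarrow> bool" where
  "measurable_form k \<omega> \<longleftrightarrow>
     (\<forall>x. alternating k (\<omega> x)) \<and> (\<forall>v. (\<lambda>x. \<omega> x v) \<in> borel_measurable lebesgue)"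

text \<open>
  The usual formula \<open>d\<omega>(v\<^sub>0,\<dots>,v\<^sub>k) = \<Sum>\<^sub>i (-1)\<^sup>i D\<^bsub>v\<^sub>i\<^esub> \<omega>(v\<^sub>0,\<dots>,v\<^sub>i omitted,\<dots>,v\<^sub>k)\<close> for constant vector
  fields (whose brackets vanish).
\<close>

definition ext_deriv :: "nat \<Rightarrow> 'a::euclidean_space form \<Rightarrow> 'a form" where
  "ext_deriv k \<omega> = (\<lambda>x v. \<Sum>i\<le>k. (-1) ^ i *
     frechet_derivative (\<lambda>y. \<omega> y (\<lambda>j. if j < i then v j else v (Suc j))) (at x) (v i))"

definition gram_det :: "'a::euclidean_space metric \<Rightarrow> 'a \<Rightarrow> real" where
  "gram_det g x = (\<Sum>\<sigma> | \<sigma> permutes (Basis :: 'a set).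
     of_int (sign \<sigma>) * (\<Prod>b\<in>Basis. g x b (\<sigma> b)))"

definition riemannian_volume :: "'a::euclidean_space metric \<Rightarrow> 'a measure" where
  "riemannian_volume g = density lebesgue (\<lambda>x. ennreal (sqrt (gram_det g x)))"

definition pointwise_norm :: "'a::euclidean_space metric \<Rightarrow> nat \<Rightarrow> 'a form \<Rightarrow> 'a \<Rightarrow> real" where
  "pointwise_norm g k \<omega> x = (SUP v \<in> {v. \<forall>i<k. sqrt (g x (v i) (v i)) = 1}. \<bar>\<omega> x v\<bar>)"

text \<open>Only the case \<open>p \<ge> 1\<close> is intended; the value is \<^term>\<open>\<infinity>\<close> if the integral diverges.\<close>

definition Lp_norm :: "'a::euclidean_space metric \<Rightarrow> real \<Rightarrow> nat \<Rightarrow> 'a form \<Rightarrow> ennreal" where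
  "Lp_norm g p k \<omega> =
     (let I = (\<integral>\<^sup>+x. ennreal (pointwise_norm g k \<omega> x powr p) \<partial>riemannian_volume g)
      in if I = \<infinity> then \<infinity> else ennreal (enn2real I powr (1 / p)))"


section \<open>The Lp-complex and relative Lp-cohomology\<close>

definition Lp_smooth_forms :: "'a::euclidean_space metric \<Rightarrow> real \<Rightarrow> nat \<Rightarrow> 'a form set" where
  "Lp_smooth_forms g p k =
     {\<omega>. smooth_form k \<omega> \<and> Lp_norm g p k \<omega> + Lp_norm g p (Suc k) (ext_deriv k \<omega>) < \<infinity>}"

text \<open>
  The completion of \<^term>\<open>Lp_smooth_forms g p k\<close> for the norm \<open>\<parallel>\<omega>\<parallel> + \<parallel>d\<omega>\<parallel>\<close>, realised by measurable
  forms: \<open>\<omega>\<close> belongs to it, with differential \<open>\<theta>\<close>, if some sequence \<open>s\<close> of smooth forms satisfies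
  \<open>s i \<rightarrow> \<omega>\<close> and \<open>d (s i) \<rightarrow> \<theta>\<close> in the \<open>L\<^sup>p\<close>-norm. Forms are not identified modulo null sets: the
  sets and relations below are invariant under changes of \<open>\<omega>\<close> and \<open>\<theta>\<close> almost everywhere, so
  \<^term>\<open>Lp_diff g p k \<omega> \<theta>\<close> reads ``\<open>d\<omega> = \<theta>\<close> almost everywhere''.
\<close>

definition Lp_diff ::
    "'a::euclidean_space metric \<Rightarrow> real \<Rightarrow> nat \<Rightarrow> 'a form \<Rightarrow> 'a form \<Rightarrow> bool" where
  "Lp_diff g p k \<omega> \<theta> \<longleftrightarrow> measurable_form k \<omega> \<and> measurable_form (Suc k) \<theta> \<and>
     (\<exists>s. (\<forall>i. s i \<in> Lp_smooth_forms g p k) \<and>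
          (\<lambda>i::nat. Lp_norm g p k (s i - \<omega>)) \<longlonglongrightarrow> 0 \<and>
          (\<lambda>i. Lp_norm g p (Suc k) (ext_deriv k (s i) - \<theta>)) \<longlonglongrightarrow> 0)"

definition Lp_complex :: "'a::euclidean_space metric \<Rightarrow> real \<Rightarrow> nat \<Rightarrow> 'a form set" where
  "Lp_complex g p k = {\<omega>. \<exists>\<theta>. Lp_diff g p k \<omega> \<theta>}"

text \<open>
  In the following definitions a boundary point \<open>\<xi>\<close> is represented by the family \<open>\<N>\<close> of the traces on
  the manifold of a neighbourhood system of \<open>\<xi>\<close>.
\<close>

definition rel_Lp_complex ::
    "'a::euclidean_space metric \<Rightarrow> 'a set set \<Rightarrow> real \<Rightarrow> nat \<Rightarrow> 'a form set" where
  "rel_Lp_complex g \<N> p k =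
     {\<omega> \<in> Lp_complex g p k. \<exists>U\<in>\<N>. AE x in riemannian_volume g. x \<in> U \<longrightarrow> \<omega> x = 0}"

definition rel_Lp_kernel ::
    "'a::euclidean_space metric \<Rightarrow> 'a set set \<Rightarrow> real \<Rightarrow> nat \<Rightarrow> 'a form set" where
  "rel_Lp_kernel g \<N> p k = {\<omega> \<in> rel_Lp_complex g \<N> p k. Lp_diff g p k \<omega> 0}"

text \<open>In degree \<open>0\<close> the image is the zero subspace, i.e. the functions vanishing almost everywhere.\<close>

primrec rel_Lp_image ::
    "'a::euclidean_space metric \<Rightarrow> 'a set set \<Rightarrow> real \<Rightarrow> nat \<Rightarrow> 'a form set" where
  "rel_Lp_image g \<N> p 0 = {\<omega>. measurable_form 0 \<omega> \<and> (AE x in riemannian_volume g. \<omega> x = 0)}"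
| "rel_Lp_image g \<N> p (Suc k) = {\<omega>. \<exists>\<eta>\<in>rel_Lp_complex g \<N> p k. Lp_diff g p k \<eta> \<omega>}"

text \<open>
  The quotient space, as the set of cosets of the image in the kernel. Since the image contains the
  forms that vanish almost everywhere, it does not matter that these were not divided out before.
\<close>

definition rel_Lp_cohomology ::
    "'a::euclidean_space metric \<Rightarrow> 'a set set \<Rightarrow> real \<Rightarrow> nat \<Rightarrow> 'a form set set" where
  "rel_Lp_cohomology g \<N> p k = (\<lambda>\<omega>. \<omega> +o rel_Lp_image g \<N> p k) ` rel_Lp_kernel g \<N> p k"

text \<open>The cohomology space is zero iff its only element is the class of the zero form.\<close>

definition rel_Lp_cohomology_zero ::
    "'a::euclidean_space metric \<Rightarrow> 'a set set \<Rightarrow> real \<Rightarrow> nat \<Rightarrow> bool" where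
  "rel_Lp_cohomology_zero g \<N> p k \<longleftrightarrow>
     rel_Lp_cohomology g \<N> p k = {0 +o rel_Lp_image g \<N> p k}"


section \<open>Heintze groups\<close>

definition complex_matrix :: "(real ^ 'm \<Rightarrow> real ^ 'm) \<Rightarrow> complex ^ 'm ^ 'm" where
  "complex_matrix \<alpha> = map_matrix complex_of_real (matrix \<alpha>)"

definition eigenvalue :: "(real ^ 'm \<Rightarrow> real ^ 'm) \<Rightarrow> complex \<Rightarrow> bool" where
  "eigenvalue \<alpha> z \<longleftrightarrow> (\<exists>v. v \<noteq> 0 \<and> complex_matrix \<alpha> *v v = z *s v)"

definition charpoly :: "'a::comm_ring_1 ^ 'm ^ 'm \<Rightarrow> 'a poly" where
  "charpoly A = det (\<chi> i j. (if i = j then [:0, 1:] else 0) - [:A $ i $ j:])"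

text \<open>The complex eigenvalues counted with their algebraic multiplicities.\<close>

definition eigenvalues :: "(real ^ 'm \<Rightarrow> real ^ 'm) \<Rightarrow> complex multiset" where
  "eigenvalues \<alpha> = proots (charpoly (complex_matrix \<alpha>))"

definition heintze :: "(real ^ 'm \<Rightarrow> real ^ 'm) \<Rightarrow> bool" where
  "heintze \<alpha> \<longleftrightarrow> linear \<alpha> \<and> (\<forall>z. eigenvalue \<alpha> z \<longrightarrow> 0 < Re z)"

definition purely_real :: "(real ^ 'm \<Rightarrow> real ^ 'm) \<Rightarrow> bool" where
  "purely_real \<alpha> \<longleftrightarrow> (\<forall>z. eigenvalue \<alpha> z \<longrightarrow> z \<in> \<real>)"

definition inner_product :: "('v::real_vector \<Rightarrow> 'v \<Rightarrow> real) \<Rightarrow> bool" where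
  "inner_product B \<longleftrightarrow> (\<forall>v. linear (B v)) \<and> (\<forall>v u. B v u = B u v) \<and> (\<forall>v. v \<noteq> 0 \<longrightarrow> 0 < B v v)"

text \<open>The operator \<open>e\<^bsup>t\<alpha>\<^esup>\<close>; note that \<^const>\<open>exp\<close> is not available for endomorphisms.\<close>

definition exp_end :: "real \<Rightarrow> ('v \<Rightarrow> 'v) \<Rightarrow> 'v \<Rightarrow> 'v::real_normed_vector" where
  "exp_end t \<alpha> v = (\<Sum>k. (t ^ k / fact k) *\<^sub>R (\<alpha> ^^ k) v)"

definition heintze_mult :: "('v \<Rightarrow> 'v) \<Rightarrow> 'v \<times> real \<Rightarrow> 'v \<times> real \<Rightarrow> 'v::real_normed_vector \<times> real" where
  "heintze_mult \<alpha> = (\<lambda>(x, t) (y, s). (x + exp_end t \<alpha> y, t + s))"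

definition heintze_metric ::
    "('v \<Rightarrow> 'v) \<Rightarrow> ('v \<Rightarrow> 'v \<Rightarrow> real) \<Rightarrow> real \<Rightarrow> ('v::euclidean_space \<times> real) metric" where
  "heintze_metric \<alpha> B c = (\<lambda>(x, t) (v1, v2) (u1, u2).
     B (exp_end (- t) \<alpha> v1) (exp_end (- t) \<alpha> u1) + c * v2 * u2)"

lemma norm_funpow_linear_le:
  fixes \<alpha> :: "'v::euclidean_space \<Rightarrow> 'v"
  assumes "linear \<alpha>"
  obtains K where "0 \<le> K" "\<And>k v. norm ((\<alpha> ^^ k) v) \<le> K ^ k * norm v"
proof -
  obtain K where K: "K > 0" "\<And>v. norm (\<alpha> v) \<le> K * norm v"
    using linear_bounded_pos[OF assms] by blast
  have "norm ((\<alpha> ^^ k) v) \<le> K ^ k * norm v" for k v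
  proof (induction k)
    case (Suc k)
    have "norm ((\<alpha> ^^ Suc k) v) \<le> K * norm ((\<alpha> ^^ k) v)" using K by simp
    also have "\<dots> \<le> K * (K ^ k * norm v)" using K Suc by (intro mult_left_mono) auto
    finally show ?case by (simp add: mult.assoc)
  qed simp
  with K that show ?thesis by (meson less_imp_le)
qed

lemma linear_funpow:
  fixes \<alpha> :: "'v::real_vector \<Rightarrow> 'v"
  shows "linear \<alpha> \<Longrightarrow> linear (\<alpha> ^^ k)"
proof (induction k)
  case 0
  show ?case by (rule linearI) simp_all
next
  case (Suc k)
  then show ?case using linear_compose[of "\<alpha> ^^ k" \<alpha>] by (simp add: o_def)
qed

lemma exp_end_summable:
  fixes \<alpha> :: "'v::euclidean_space \<Rightarrow> 'v"
  assumes "linear \<alpha>"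
  shows "summable (\<lambda>k. norm ((t ^ k / fact k) *\<^sub>R (\<alpha> ^^ k) v))"
proof -
  obtain K where K: "0 \<le> K" "\<And>k v. norm ((\<alpha> ^^ k) v) \<le> K ^ k * norm v"
    using norm_funpow_linear_le[OF assms] by blast
  have "summable (\<lambda>k. inverse (fact k) * (\<bar>t\<bar> * K) ^ k * norm v)"
    by (intro summable_mult2 summable_exp)
  then show ?thesis
  proof (rule summable_comparison_test')
    fix k :: nat
    have "\<bar>t\<bar> ^ k / fact k * norm ((\<alpha> ^^ k) v) \<le> \<bar>t\<bar> ^ k / fact k * (K ^ k * norm v)"
      by (intro mult_left_mono K) auto
    then show "norm (norm ((t ^ k / fact k) *\<^sub>R (\<alpha> ^^ k) v))
        \<le> inverse (fact k) * (\<bar>t\<bar> * K) ^ k * norm v"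
      by (simp add: power_mult_distrib power_abs field_simps)
  qed
qed

lemma linear_exp_end:
  fixes \<alpha> :: "'v::euclidean_space \<Rightarrow> 'v"
  assumes "linear \<alpha>"
  shows "linear (exp_end t \<alpha>)"
proof (rule linearI)
  note s = summable_norm_cancel[OF exp_end_summable[OF assms]]
  note l = linear_funpow[OF assms]
  show "exp_end t \<alpha> (x + y) = exp_end t \<alpha> x + exp_end t \<alpha> y" for x y
    unfolding exp_end_def
    by (subst suminf_add[OF s s]) (simp add: linear_add[OF l] scaleR_add_right)
  show "exp_end t \<alpha> (r *\<^sub>R x) = r *\<^sub>R exp_end t \<alpha> x" for r x
    unfolding exp_end_def
    by (subst suminf_scaleR_right[OF s]) (simp add: linear_scale[OF l] mult.commute)
qed

lemma exp_end_add:
  fixes \<alpha> :: "'v::euclidean_space \<Rightarrow> 'v"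
  assumes "linear \<alpha>"
  shows "exp_end (s + t) \<alpha> v = exp_end s \<alpha> (exp_end t \<alpha> v)"
proof -
  define f where "f = (\<lambda>(j, k). (s ^ j / fact j) *\<^sub>R (t ^ k / fact k) *\<^sub>R (\<alpha> ^^ (j + k)) v)"
  obtain K where K: "0 \<le> K" "\<And>k v. norm ((\<alpha> ^^ k) v) \<le> K ^ k * norm v"
    using norm_funpow_linear_le[OF assms] by blast
  define a where "a = (\<lambda>r k. inverse (fact k) * (\<bar>r\<bar> * K) ^ k)"
  have a: "a r summable_on UNIV" "0 \<le> a r k" for r k
    using K by (auto simp: a_def intro!: summable_nonneg_imp_summable_on summable_exp)
  have "(\<lambda>z. norm (case z of (j, k) \<Rightarrow> a s j * (a t k * norm v))) summable_on UNIV \<times> UNIV"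
  proof -
    have "(\<lambda>k. norm (a s j * (a t k * norm v))) summable_on UNIV" for j
      using a by (simp add: abs_mult summable_on_cmult_left summable_on_cmult_right)
    moreover have "(\<lambda>j. norm (\<Sum>\<^sub>\<infinity>k. norm (a s j * (a t k * norm v)))) summable_on UNIV"
      using a by (simp add: abs_mult infsum_cmult_right' summable_on_cmult_left)
    ultimately show ?thesis
      by (subst Infinite_Sum.abs_summable_on_Sigma_iff) simp
  qed
  then have "(\<lambda>z. norm (f z)) summable_on UNIV \<times> UNIV"
  proof (rule Infinite_Sum.abs_summable_on_comparison_test)
    fix z :: "nat \<times> nat"
    obtain j k where z: "z = (j, k)" by force
    have "\<bar>s\<bar> ^ j / fact j * (\<bar>t\<bar> ^ k / fact k * norm ((\<alpha> ^^ (j + k)) v))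
        \<le> \<bar>s\<bar> ^ j / fact j * (\<bar>t\<bar> ^ k / fact k * (K ^ (j + k) * norm v))"
      by (intro mult_left_mono K) auto
    also have "\<dots> = a s j * (a t k * norm v)"
      by (simp add: a_def power_mult_distrib power_add field_simps)
    finally show "norm (f z) \<le> norm (case z of (j, k) \<Rightarrow> a s j * (a t k * norm v))"
      using a by (simp add: f_def z power_abs abs_mult)
  qed
  then have sf: "f summable_on UNIV \<times> UNIV"
    by (rule abs_summable_summable)
  have hs: "((\<lambda>k. (r ^ k / fact k) *\<^sub>R (\<alpha> ^^ k) u) has_sum exp_end r \<alpha> u) UNIV" for r u
    unfolding exp_end_def
    by (rule norm_summable_imp_has_sum[OF exp_end_summable[OF assms]
          summable_sums[OF summable_norm_cancel[OF exp_end_summable[OF assms]]]])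
  have inner: "(\<Sum>\<^sub>\<infinity>k. f (j, k)) = (s ^ j / fact j) *\<^sub>R (\<alpha> ^^ j) (exp_end t \<alpha> v)" for j
  proof -
    have "bounded_linear (\<lambda>u. (s ^ j / fact j) *\<^sub>R (\<alpha> ^^ j) u)"
      using linear_funpow[OF assms] linear_conv_bounded_linear
      by (intro bounded_linear_const_scaleR) blast
    from has_sum_bounded_linear[OF this hs[of t v]]
    show ?thesis
      by (intro infsumI) (simp add: f_def funpow_add o_def linear_scale[OF linear_funpow[OF assms]])
  qed
  have "exp_end s \<alpha> (exp_end t \<alpha> v) = (\<Sum>\<^sub>\<infinity>j. \<Sum>\<^sub>\<infinity>k. f (j, k))"
    unfolding inner by (rule infsumI[OF hs, symmetric])
  also have "\<dots> = infsum f (UNIV \<times> UNIV)"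
    using infsum_Sigma_banach[OF sf] by simp
  also have "\<dots> = infsum (\<lambda>(n, i). f (i, n - i)) (SIGMA n:UNIV. {..n})"
    by (rule infsum_reindex_bij_witness[of _ "\<lambda>(n, i). (i, n - i)" "\<lambda>(j, k). (j + k, j)"]) auto
  also have "\<dots> = (\<Sum>\<^sub>\<infinity>n. \<Sum>i\<le>n. f (i, n - i))"
  proof -
    have "(\<lambda>(n, i). f (i, n - i)) summable_on (SIGMA n:UNIV. {..n})"
      using sf
      by (subst summable_on_reindex_bij_witness[where T = "UNIV \<times> UNIV" and h = f and
            i = "\<lambda>(j, k). (j + k, j)" and j = "\<lambda>(n, i). (i, n - i)"]) auto
    from infsum_Sigma_banach[OF this] show ?thesis by simp
  qed
  also have "\<dots> = exp_end (s + t) \<alpha> v"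
  proof -
    have "(\<Sum>i\<le>n. f (i, n - i)) = ((s + t) ^ n / fact n) *\<^sub>R (\<alpha> ^^ n) v" for n
    proof -
      have "(\<Sum>i\<le>n. f (i, n - i)) =
          (\<Sum>i\<le>n. (s ^ i / fact i) * (t ^ (n - i) / fact (n - i))) *\<^sub>R (\<alpha> ^^ n) v"
        by (simp add: f_def scaleR_sum_left)
      also have "(\<Sum>i\<le>n. (s ^ i / fact i) * (t ^ (n - i) / fact (n - i))) = (s + t) ^ n / fact n"
        by (simp add: binomial_ring sum_divide_distrib binomial_fact field_simps)
      finally show ?thesis .
    qed
    then show ?thesis using hs by (simp add: infsumI)
  qed
  finally show ?thesis ..
qed

text \<open>The metric is invariant under the left translations of the group.\<close>

lemma heintze_metric_left_invariant:
  fixes \<alpha> :: "'v::euclidean_space \<Rightarrow> 'v"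
  assumes "linear \<alpha>"
  defines "dL \<equiv> \<lambda>g h. frechet_derivative (heintze_mult \<alpha> g) (at h)"
  shows "heintze_metric \<alpha> B c (heintze_mult \<alpha> g h) (dL g h v) (dL g h u) =
         heintze_metric \<alpha> B c h v u"
proof -
  obtain x t where g: "g = (x, t)" by force
  obtain y s where h: "h = (y, s)" by force
  obtain v1 v2 where v: "v = (v1, v2)" by force
  obtain u1 u2 where u: "u = (u1, u2)" by force
  have bl: "bounded_linear (exp_end t \<alpha>)"
    using linear_exp_end[OF assms(1)] linear_conv_bounded_linear by blast
  have "(heintze_mult \<alpha> g has_derivative (\<lambda>(w1, w2). (exp_end t \<alpha> w1, w2))) (at h)"
    unfolding heintze_mult_def g case_prod_unfold
    by (auto intro!: derivative_eq_intros bounded_linear.has_derivative[OF bl])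
  then have dL: "dL g h = (\<lambda>(w1, w2). (exp_end t \<alpha> w1, w2))"
    unfolding dL_def by (rule frechet_derivative_at[symmetric])
  have "exp_end (- (t + s)) \<alpha> (exp_end t \<alpha> w) = exp_end (- s) \<alpha> w" for w
    using exp_end_add[OF assms(1), of "- (t + s)" t w] by simp
  then show ?thesis
    unfolding dL by (simp add: g h v u heintze_metric_def heintze_mult_def)
qed

text \<open>
  The traces on \<open>G\<close> of a neighbourhood system of the point at infinity \<open>\<infinity>\<close> at which the vertical
  geodesics \<open>t \<mapsto> (x, t)\<close> end for \<open>t \<rightarrow> +\<infinity>\<close>.
\<close>

definition nhds_vertical_end :: "('v::euclidean_space \<times> real) set set" where
  "nhds_vertical_end = {UNIV - ball 0 R \<times> {..T} | R T. 0 < R}"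

end

theory Submission
  imports Defs
begin

text \<open>
  Put \<open>\<tau> = tr(\<alpha>)\<close>. In the left-invariant frame \<open>e\<^sup>t\<^sup>\<alpha> e\<^sub>i, \<partial>\<^sub>t\<close>, where \<open>e\<close> triangularises \<open>\<alpha>\<close> with increasing
  diagonal, horizontal \<open>k\<close>-forms invariant in \<open>t\<close> have norm at most of order \<open>e\<^bsup>t w\<^esup>\<close>, for any \<open>w < w\<^sub>k\<close>, as
  \<open>t \<rightarrow> -\<infinity>\<close>, whereas the volume is \<open>e\<^bsup>-t \<tau>\<^esup> dx dt\<close>.

  Vanishing: a closed \<open>(k+1)\<close>-form \<open>\<omega>\<close> that vanishes near \<open>\<infinity>\<close> has the primitive obtained by integrating
  \<open>- \<iota>\<^bsub>\<partial>\<^sub>t\<^esub>\<omega>\<close> up the vertical geodesics; if \<open>p w\<^sub>k > \<tau>\<close>, the decay above makes this operator bounded on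
  \<open>L\<^sup>p\<close>. It is applied to smooth approximations, cut off near \<open>\<infinity>\<close>.

  Nonvanishing: let \<open>\<psi>\<close> be a constant \<open>k\<close>-form on the span of \<open>e\<^sub>0, \<dots>, e\<^bsub>k-1\<^esub>\<close>, cut off in \<open>x\<close> and for large \<open>t\<close>.
  The \<open>(k+1)\<close>-form \<open>\<omega>\<^sub>0 = d\<psi>\<close> is in \<open>L\<^sup>p\<close> when \<open>p w\<^bsub>k+1\<^esub> > \<tau>\<close>, but \<open>\<psi>\<close> is not when \<open>p w\<^sub>k \<le> \<tau>\<close>. If \<open>s\<close> is a smooth
  compactly cut off form with \<open>ds\<close> close to \<open>\<omega>\<^sub>0\<close>, then by Stokes the horizontal slices of \<open>s\<close> and \<open>\<psi>\<close> have
  nearly the same integral of the component on \<open>e\<^sub>0, \<dots>, e\<^bsub>k-1\<^esub>\<close>, so the \<open>L\<^sup>p\<close>-norm of \<open>s\<close> on \<open>-S \<le> t \<le> 0\<close> grows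
  with \<open>S\<close>, and no primitive of \<open>\<omega>\<^sub>0\<close> lies in \<open>L\<^sup>p\<close>.
\<close>

section \<open>Calculus of smooth functions\<close>

text \<open>The two halves cope differently with the failure of diagonalisability. Jordan blocks put
  polynomial factors into \<open>exp_end\<close>. Vanishing has a strict inequality and pays for
  them with a small loss in the exponent. Nonvanishing includes the equality p w_k = \<tau>, where
  no loss is affordable; it therefore tests a single component, on the first k flag vectors: they
  span an invariant subspace, so \<open>exp_end\<close> multiplies this component by exactly e^(t
  w_k). Elements of the complex are limits whose smooth approximants are neither closed nor cut off.
  Cutting off is harmless because the limit vanishes where the cutoff acts. Non-closedness leaves
  the error \<open>hom\<close> of the differential, so \<open>hom\<close> has to be bounded in two
  consecutive degrees with the same w_k. For nonvanishing no global bound on \<open>hom\<close> is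
  at hand. On a slab of height S it has a bound depending on S, so S is fixed first and the
  approximant is chosen afterwards. Degree one is the case k = 0, with w_0 = 0. Norms are replaced
  throughout by integrals of p-th powers of frame components, so that only comparisons up to
  constants occur.\<close>

lemma Ck_imp_continuous: "Ck m f \<Longrightarrow> continuous_on UNIV f"
  by (cases m)
    (auto simp: continuous_on_eq_continuous_at differentiable_imp_continuous_within)

lemma Ck_Suc_D: "Ck (Suc m) f \<Longrightarrow> Ck m f"
proof (induction m arbitrary: f)
  case 0
  then show ?case using Ck_imp_continuous[OF 0] by simp
next
  case (Suc m)
  then show ?case by auto
qed

lemma Ck_const [simp]: "Ck m (\<lambda>_. c)"
  by (induction m arbitrary: c) (simp_all add: frechet_derivative_const)

lemma frechet_derivative_add:
  assumes "f differentiable at x" "g differentiable at x"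
  shows "frechet_derivative (\<lambda>x. f x + g x) (at x) v
    = frechet_derivative f (at x) v + frechet_derivative g (at x) v"
  using has_derivative_add[OF assms[unfolded frechet_derivative_works]]
  by (simp add: frechet_derivative_at[symmetric])

lemma frechet_derivative_mult:
  fixes f g :: "'a::real_normed_vector \<Rightarrow> real"
  assumes "f differentiable at x" "g differentiable at x"
  shows "frechet_derivative (\<lambda>x. f x * g x) (at x) v
    = f x * frechet_derivative g (at x) v + frechet_derivative f (at x) v * g x"
  using has_derivative_mult[OF assms[unfolded frechet_derivative_works]]
  by (simp add: frechet_derivative_at[symmetric])

lemma Ck_add: "Ck m f \<Longrightarrow> Ck m g \<Longrightarrow> Ck m (\<lambda>x. f x + g x)"
proof (induction m arbitrary: f g)
  case 0
  then show ?case by (auto intro: continuous_on_add)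
next
  case (Suc m)
  then show ?case by (simp add: frechet_derivative_add)
qed

lemma Ck_mult: "Ck m f \<Longrightarrow> Ck m g \<Longrightarrow> Ck m (\<lambda>x. f x * g x)"
proof (induction m arbitrary: f g)
  case 0
  then show ?case by (auto intro: continuous_on_mult)
next
  case (Suc m)
  show ?case
    using Suc Ck_Suc_D[OF Suc.prems(1)] Ck_Suc_D[OF Suc.prems(2)]
    by (auto simp: frechet_derivative_mult intro!: Ck_add)
qed

lemma Ck_uminus: "Ck m f \<Longrightarrow> Ck m (\<lambda>x. - f x)"
  using Ck_mult[OF Ck_const[of m "-1"], of f] by simp

lemma Ck_sum: "(\<And>i. i \<in> A \<Longrightarrow> Ck m (f i)) \<Longrightarrow> Ck m (\<lambda>x. \<Sum>i\<in>A. f i x)"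
  by (induction A rule: infinite_finite_induct) (auto intro: Ck_add)

lemma frechet_derivative_linear_real:
  fixes h :: "real \<Rightarrow> real"
  assumes "h differentiable at x"
  shows "frechet_derivative h (at x) v = frechet_derivative h (at x) 1 * v"
  using linear_scale[OF linear_frechet_derivative[OF assms], of v 1] by simp

text \<open>As \<open>h\<close> has a real argument, the chain rule yields a product with the scalar
  \<open>frechet_derivative h (at (q x)) 1\<close>, which is again a composition of the same kind;
  so the induction closes with \<open>Ck_mult\<close>.\<close>

lemma Ck_compose:
  fixes h :: "real \<Rightarrow> real"
  shows "Ck m h \<Longrightarrow> Ck m q \<Longrightarrow> Ck m (\<lambda>x. h (q x))"
proof (induction m arbitrary: h q)
  case 0
  then show ?case by (auto intro: continuous_on_compose2)
next
  case (Suc m)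
  have "((\<lambda>x. h (q x)) has_derivative
      (\<lambda>v. frechet_derivative h (at (q x)) 1 * frechet_derivative q (at x) v)) (at x)" for x
  proof -
    have "(h has_derivative frechet_derivative h (at (q x))) (at (q x))"
      "(q has_derivative frechet_derivative q (at x)) (at x)"
      using Suc.prems by (simp_all add: frechet_derivative_works[symmetric])
    from has_derivative_compose[OF this(2,1)] show ?thesis
      by (rule has_derivative_eq_rhs)
        (rule ext, rule frechet_derivative_linear_real, use Suc.prems in simp)
  qed
  note hd = this
  have D: "frechet_derivative (\<lambda>x. h (q x)) (at x) v =
      frechet_derivative h (at (q x)) 1 * frechet_derivative q (at x) v" for x v
    using frechet_derivative_at[OF hd[of x]] by metis
  have "Ck m (\<lambda>x. frechet_derivative h (at (q x)) 1 * frechet_derivative q (at x) v)" for v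
    using Suc.prems Ck_Suc_D[OF Suc.prems(2)]
    by (intro Ck_mult Suc.IH[of "\<lambda>y. frechet_derivative h (at y) 1"]) auto
  then show ?case
    unfolding Ck.simps D using hd by (auto simp: differentiable_def)
qed

lemma has_derivative_compose_affine:
  fixes A :: "'a::euclidean_space \<Rightarrow> 'b::euclidean_space"
  assumes A: "bounded_linear A" and f: "f differentiable at (A x + b)"
  shows "((\<lambda>x. f (A x + b)) has_derivative (\<lambda>v. frechet_derivative f (at (A x + b)) (A v))) (at x)"
  using has_derivative_compose[of "\<lambda>x. A x + b" A x UNIV f] f
    has_derivative_add_const[OF bounded_linear.has_derivative[OF A has_derivative_ident]]
  by (simp add: frechet_derivative_works)

lemma frechet_derivative_compose_affine:
  fixes A :: "'a::euclidean_space \<Rightarrow> 'b::euclidean_space"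
  assumes A: "bounded_linear A" and f: "f differentiable at (A x + b)"
  shows "frechet_derivative (\<lambda>x. f (A x + b)) (at x) v = frechet_derivative f (at (A x + b)) (A v)"
  using frechet_derivative_at[OF has_derivative_compose_affine[of A f, OF A f]] by metis

lemma Ck_compose_affine:
  fixes A :: "'a::euclidean_space \<Rightarrow> 'b::euclidean_space"
  assumes A: "bounded_linear A"
  shows "Ck m f \<Longrightarrow> Ck m (\<lambda>x. f (A x + b))"
proof (induction m arbitrary: f)
  case 0
  have "continuous_on UNIV (\<lambda>x. A x + b)"
    using A by (intro continuous_intros linear_continuous_on)
  then show ?case using 0 by (auto intro: continuous_on_compose2[of UNIV f])
next
  case (Suc m)
  have "Ck m (\<lambda>x. frechet_derivative f (at (A x + b)) (A v))" for v
    using Suc.IH[of "\<lambda>y. frechet_derivative f (at y) (A v)"] Suc.prems by simp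
  then show ?case
    using has_derivative_compose_affine[OF A, of f] Suc.prems
    by (auto simp: differentiable_def[of "\<lambda>x. f (A x + b)"] frechet_derivative_compose_affine[OF A])
qed

lemma Ck_bounded_linear:
  assumes "bounded_linear A"
  shows "Ck m A"
proof (cases m)
  case 0
  then show ?thesis using assms by (simp add: linear_continuous_on)
next
  case (Suc k)
  have hd: "(A has_derivative A) (at x)" for x
    by (rule bounded_linear_imp_has_derivative[OF assms])
  then show ?thesis
    unfolding Suc Ck.simps frechet_derivative_at[OF hd, symmetric]
    by (auto simp: differentiable_def)
qed

lemma smooth_Ck: "smooth f \<Longrightarrow> Ck m f"
  by (simp add: smooth_def)

lemma smooth_const [simp]: "smooth (\<lambda>_. c)"
  by (simp add: smooth_def)

lemma smooth_add: "smooth f \<Longrightarrow> smooth g \<Longrightarrow> smooth (\<lambda>x. f x + g x)"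
  by (simp add: smooth_def Ck_add)

lemma smooth_mult: "smooth f \<Longrightarrow> smooth g \<Longrightarrow> smooth (\<lambda>x. f x * g x)"
  by (simp add: smooth_def Ck_mult)

lemma smooth_uminus: "smooth f \<Longrightarrow> smooth (\<lambda>x. - f x)"
  by (simp add: smooth_def Ck_uminus)

lemma smooth_diff: "smooth f \<Longrightarrow> smooth g \<Longrightarrow> smooth (\<lambda>x. f x - g x)"
  using smooth_add[of f "\<lambda>x. - g x"] smooth_uminus[of g] by simp

lemma smooth_sum: "(\<And>i. i \<in> A \<Longrightarrow> smooth (f i)) \<Longrightarrow> smooth (\<lambda>x. \<Sum>i\<in>A. f i x)"
  by (simp add: smooth_def Ck_sum)

lemma smooth_compose:
  fixes h :: "real \<Rightarrow> real"
  shows "smooth h \<Longrightarrow> smooth q \<Longrightarrow> smooth (\<lambda>x. h (q x))"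
  by (simp add: smooth_def Ck_compose)

lemma smooth_compose_affine:
  fixes A :: "'a::euclidean_space \<Rightarrow> 'b::euclidean_space"
  shows "bounded_linear A \<Longrightarrow> smooth f \<Longrightarrow> smooth (\<lambda>x. f (A x + b))"
  by (simp add: smooth_def Ck_compose_affine)

lemma smooth_bounded_linear: "bounded_linear A \<Longrightarrow> smooth A"
  by (simp add: smooth_def Ck_bounded_linear)

lemma smooth_differentiable: "smooth f \<Longrightarrow> f differentiable at x"
  using smooth_Ck[of f 1] by simp

lemma smooth_frechet: "smooth f \<Longrightarrow> smooth (\<lambda>x. frechet_derivative f (at x) v)"
  unfolding smooth_def by (metis Ck.simps(2))

lemma smooth_continuous: "smooth f \<Longrightarrow> continuous_on A f"
  using smooth_Ck[of f 0] continuous_on_subset by fastforce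

lemma smooth_has_derivative:
  "smooth f \<Longrightarrow> (f has_derivative frechet_derivative f (at x)) (at x)"
  using smooth_differentiable frechet_derivative_works by blast

subsection \<open>Cutoff functions\<close>

text \<open>\<open>flat 1\<close> is the classical smooth function exp (- 1 / t). The polynomial
  factor in 1 / t makes the family closed under differentiation, so that smoothness of all members
  follows by one induction.\<close>

definition flat :: "real poly \<Rightarrow> real \<Rightarrow> real" where
  "flat P t = (if t > 0 then poly P (1 / t) * exp (- (1 / t)) else 0)"

lemma poly_times_exp_tendsto_0: "((\<lambda>y::real. poly P y * exp (- y)) \<longlongrightarrow> 0) at_top"
proof -
  have "((\<lambda>y::real. \<Sum>i\<le>degree P. coeff P i * (y ^ i / exp y)) \<longlongrightarrow> 0) at_top"
    by (intro tendsto_null_sum tendsto_mult_right_zero tendsto_power_div_exp_0)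
  then show ?thesis
    by (simp add: poly_altdef sum_distrib_right exp_minus divide_inverse mult.assoc)
qed

lemma flat_has_derivative:
  "(flat P has_real_derivative flat ([:0, 0, 1:] * (P - pderiv P)) t) (at t)"
proof -
  consider "t > 0" | "t < 0" | "t = 0" by linarith
  then show ?thesis
  proof cases
    case 1
    have "((\<lambda>t. poly P (1 / t) * exp (- (1 / t))) has_real_derivative
       flat ([:0, 0, 1:] * (P - pderiv P)) t) (at t)"
      using 1 by (auto intro!: derivative_eq_intros DERIV_chain2[OF poly_DERIV]
          simp: flat_def field_simps power2_eq_square)
    moreover have "\<forall>\<^sub>F s in nhds t. flat P s = poly P (1 / s) * exp (- (1 / s))"
      using eventually_nhds_in_open[of "{0<..}" t] 1
      by (auto elim!: eventually_mono simp: flat_def)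
    ultimately show ?thesis by (subst DERIV_cong_ev[OF refl _ refl])
  next
    case 2
    have "\<forall>\<^sub>F s in nhds t. flat P s = 0"
      using eventually_nhds_in_open[of "{..<0}" t] 2
      by (auto elim!: eventually_mono simp: flat_def)
    then show ?thesis using 2 by (subst DERIV_cong_ev[OF refl _ refl]) (auto simp: flat_def)
  next
    case 3
    \<comment> \<open>Division by \<open>h\<close> multiplies the polynomial by its variable, so the
      difference quotient at 0 from the right is again of the form polynomial times exponential in 1
      / h.\<close>
    have "((\<lambda>h. flat P h / h) \<longlongrightarrow> 0) (at_right 0)"
    proof (rule Lim_transform_eventually)
      show "((\<lambda>h. poly (P * [:0, 1:]) (inverse h) * exp (- inverse h)) \<longlongrightarrow> 0) (at_right 0)"
        by (rule filterlim_compose[OF poly_times_exp_tendsto_0 filterlim_inverse_at_top_right])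
      show "\<forall>\<^sub>F h in at_right 0.
          poly (P * [:0, 1:]) (inverse h) * exp (- inverse h) = flat P h / h"
        unfolding eventually_at_filter by (auto simp: flat_def field_simps)
    qed
    moreover have "((\<lambda>h. flat P h / h) \<longlongrightarrow> 0) (at_left 0)"
      by (rule Lim_transform_eventually[OF tendsto_const]) (auto simp: eventually_at_filter flat_def)
    ultimately have "((\<lambda>h. flat P h / h) \<longlongrightarrow> 0) (at 0)"
      by (simp add: filterlim_split_at_real)
    then show ?thesis using 3 by (simp add: DERIV_def flat_def)
  qed
qed

lemma smooth_flat: "smooth (flat P)"
proof -
  have "Ck m (flat P)" for m
  proof (induction m arbitrary: P)
    case 0
    then show ?case
      by (auto simp: continuous_on_eq_continuous_at intro: DERIV_isCont flat_has_derivative)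
  next
    case (Suc m)
    have "(flat P has_derivative (*) (flat ([:0, 0, 1:] * (P - pderiv P)) t)) (at t)" for t
      using flat_has_derivative by (simp add: has_field_derivative_def)
    note hd = this
    have D: "frechet_derivative (flat P) (at x) v = flat ([:0, 0, 1:] * (P - pderiv P)) x * v" for x v
      using frechet_derivative_at[OF hd] by metis
    show ?case unfolding Ck.simps D
      using hd Suc by (auto simp: differentiable_def intro!: Ck_mult)
  qed
  then show ?thesis by (simp add: smooth_def)
qed

text \<open>Composing \<open>exp (- 1 / t)\<close> with itself gives a smooth step without any division.\<close>

definition step :: "real \<Rightarrow> real" where
  "step t = exp 1 * flat 1 (1 - exp 1 * flat 1 t)"

lemma smooth_step: "smooth step"
proof -
  have "smooth (\<lambda>t. exp 1 * flat 1 (1 - exp 1 * flat 1 t))"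
    by (intro smooth_mult smooth_const smooth_compose[OF smooth_flat] smooth_flat smooth_diff)
  then show ?thesis by (simp add: step_def[abs_def])
qed

lemma step_nonneg: "0 \<le> step t"
  by (simp add: step_def flat_def)

lemma step_le_1: "step t \<le> 1"
proof -
  have "flat 1 s \<le> exp (- 1)" if "s \<le> 1" for s
    using that by (auto simp: flat_def)
  moreover have "1 - exp 1 * flat 1 t \<le> 1" by (simp add: flat_def)
  ultimately have "flat 1 (1 - exp 1 * flat 1 t) \<le> exp (- 1)" by blast
  then show ?thesis by (simp add: step_def exp_minus field_simps)
qed

lemma step_eq_1: "t \<le> 0 \<Longrightarrow> step t = 1"
  by (simp add: step_def flat_def exp_minus)

lemma step_eq_0: "t \<ge> 1 \<Longrightarrow> step t = 0"
proof -
  assume t: "t \<ge> 1"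
  then have "- 1 \<le> - (1 / t)" by simp
  then have "1 \<le> exp 1 * exp (- (1 / t))" by (simp flip: exp_add)
  then show ?thesis using t by (simp add: step_def flat_def)
qed

lemma smooth_inner_self: "smooth (\<lambda>x::'a::euclidean_space. x \<bullet> x)"
proof -
  have "smooth (\<lambda>x::'a. \<Sum>b\<in>Basis. (x \<bullet> b) * (x \<bullet> b))"
    by (intro smooth_sum smooth_mult smooth_bounded_linear[OF bounded_linear_inner_left])
  then show ?thesis by (simp only: euclidean_inner[symmetric])
qed

text \<open>The squared norm is used because it is smooth at the origin. The transition takes place
  for norms between R and sqrt (R^2 + 1), hence within R + 1.\<close>

definition radial_cutoff :: "real \<Rightarrow> 'a::euclidean_space \<Rightarrow> real" where
  "radial_cutoff R x = step (x \<bullet> x - R\<^sup>2)"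

lemma smooth_radial_cutoff: "smooth (radial_cutoff R)"
  unfolding radial_cutoff_def[abs_def]
  by (intro smooth_compose[OF smooth_step] smooth_diff smooth_inner_self smooth_const)

lemma radial_cutoff_eq_1: "norm x \<le> R \<Longrightarrow> radial_cutoff R x = 1"
  using power_mono[of "norm x" R 2]
  by (simp add: radial_cutoff_def step_eq_1 power2_norm_eq_inner)

lemma radial_cutoff_eq_0: "R \<ge> 0 \<Longrightarrow> norm x \<ge> R + 1 \<Longrightarrow> radial_cutoff R x = 0"
proof -
  assume R: "R \<ge> 0" "norm x \<ge> R + 1"
  then have "(R + 1)\<^sup>2 \<le> (norm x)\<^sup>2" by (intro power_mono) auto
  then show ?thesis
    using R by (simp add: radial_cutoff_def step_eq_0 power2_norm_eq_inner power2_sum)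
qed

subsection \<open>Integration along a direction\<close>

text \<open>Differentiation under the integral sign. It is used twice: for the symmetry of second
  derivatives, and with \<open>a = (0, 1)\<close> for the vertical homotopy.\<close>

lemma translate_integral_has_derivative:
  fixes F :: "'a::euclidean_space \<Rightarrow> real"
  assumes F: "Ck (Suc 0) F"
  shows "((\<lambda>z. integral {0..L} (\<lambda>r. F (z + r *\<^sub>R a))) has_derivative
     (\<lambda>w. integral {0..L} (\<lambda>r. frechet_derivative F (at (z + r *\<^sub>R a)) w))) (at z)"
proof -
  \<comment> \<open>\<open>leibniz_rule\<close> expects the derivative as a continuous map into the
    bounded linear functions; its continuity is tested on basis vectors, where it is the C^1
    hypothesis.\<close>
  define G where "G = (\<lambda>z r. Blinfun (frechet_derivative F (at (z + r *\<^sub>R a))))"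
  have diff: "F differentiable at x" for x using F by simp
  have bl: "bounded_linear (frechet_derivative F (at x))" for x
    using linear_frechet_derivative[OF diff] linear_conv_bounded_linear by blast
  have G: "blinfun_apply (G z r) = frechet_derivative F (at (z + r *\<^sub>R a))" for z r
    by (simp add: G_def bounded_linear_Blinfun_apply bl)
  have "continuous_on UNIV (\<lambda>(z, r). G z r)"
  proof (rule continuous_on_blinfun_componentwise)
    fix i :: 'a
    have "continuous_on UNIV (\<lambda>x. frechet_derivative F (at x) i)" using F by simp
    then have "continuous_on UNIV (\<lambda>x. frechet_derivative F (at (fst x + snd x *\<^sub>R a)) i)"
      by (rule continuous_on_compose2) (auto intro!: continuous_intros)
    then show "continuous_on UNIV (\<lambda>x. blinfun_apply (case x of (z, r) \<Rightarrow> G z r) i)"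
      by (simp add: G case_prod_beta)
  qed
  then have cG: "continuous_on (UNIV \<times> cbox 0 L) (\<lambda>(z, r). G z r)"
    by (rule continuous_on_subset) simp
  have cF: "continuous_on {0..L} (\<lambda>r. F (z + r *\<^sub>R a))" for z
    by (rule continuous_on_compose2[OF Ck_imp_continuous[OF F]]) (auto intro!: continuous_intros)
  have "((\<lambda>z. integral (cbox 0 L) (\<lambda>r. F (z + r *\<^sub>R a))) has_derivative
      blinfun_apply (integral (cbox 0 L) (G z))) (at z within UNIV)"
  proof (rule leibniz_rule[OF _ _ cG])
    fix x t
    show "((\<lambda>z. F (z + t *\<^sub>R a)) has_derivative blinfun_apply (G x t)) (at x within UNIV)"
      unfolding G using has_derivative_compose_affine[OF bounded_linear_ident diff] by simp
    show "(\<lambda>r. F (x + r *\<^sub>R a)) integrable_on cbox 0 L"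
      using cF[of x] by (simp add: integrable_continuous_real)
  qed auto
  moreover have "blinfun_apply (integral (cbox 0 L) (G z)) w =
      integral {0..L} (\<lambda>r. frechet_derivative F (at (z + r *\<^sub>R a)) w)" for w
  proof -
    have "continuous_on (cbox 0 L) (\<lambda>r. case (z, r) of (z, r) \<Rightarrow> G z r)"
      by (rule continuous_on_compose2[OF cG]) (auto intro!: continuous_intros)
    then have "G z integrable_on cbox 0 L" by (intro integrable_continuous) simp
    from blinfun_apply_integral[OF this] show ?thesis by (simp add: G)
  qed
  then have "blinfun_apply (integral (cbox 0 L) (G z)) =
      (\<lambda>w. integral {0..L} (\<lambda>r. frechet_derivative F (at (z + r *\<^sub>R a)) w))"
    by (rule ext)
  ultimately show ?thesis by simp
qed

lemma frechet_translate_integral: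
  assumes "smooth F"
  shows "frechet_derivative (\<lambda>z. integral {0..L} (\<lambda>r. F (z + r *\<^sub>R a))) (at z) v =
      integral {0..L} (\<lambda>r. frechet_derivative F (at (z + r *\<^sub>R a)) v)"
  using frechet_derivative_at[OF translate_integral_has_derivative[OF smooth_Ck[OF assms]]] by metis

lemma integral_directional_derivative:
  assumes "smooth F" "0 \<le> L"
  shows "integral {0..L} (\<lambda>r. frechet_derivative F (at (z + r *\<^sub>R a)) a) = F (z + L *\<^sub>R a) - F z"
proof -
  have "((\<lambda>r. F (z + r *\<^sub>R a)) has_vector_derivative
      frechet_derivative F (at (z + r *\<^sub>R a)) a) (at r within {0..L})" for r
  proof -
    have "((\<lambda>r. r *\<^sub>R a + z) has_derivative (\<lambda>r. r *\<^sub>R a)) (at r within {0..L})"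
      by (auto intro!: derivative_eq_intros)
    from has_derivative_compose[OF this smooth_has_derivative[OF assms(1)]] show ?thesis
      using linear_scale[OF linear_frechet_derivative[OF smooth_differentiable[OF assms(1)]]]
      by (simp add: has_vector_derivative_def add.commute)
  qed
  from fundamental_theorem_of_calculus[OF assms(2) this] show ?thesis
    by (simp add: integral_unique)
qed

text \<open>Along the segment from z to z + L a, both mixed derivatives integrate to D_b f (z + L a)
  - D_b f (z): one by differentiating under the integral, the other by the fundamental theorem.
  Differentiating in L at 0 compares the integrands at z; only L >= 0 is available, hence the
  one-sided derivative.\<close>

lemma frechet_derivative_commute:
  fixes f :: "'a::euclidean_space \<Rightarrow> real"
  assumes f: "smooth f"
  shows "frechet_derivative (\<lambda>y. frechet_derivative f (at y) a) (at z) b =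
         frechet_derivative (\<lambda>y. frechet_derivative f (at y) b) (at z) a"
proof -
  define Fa where "Fa = (\<lambda>y. frechet_derivative f (at y) a)"
  define Fb where "Fb = (\<lambda>y. frechet_derivative f (at y) b)"
  have sm: "smooth Fa" "smooth Fb" unfolding Fa_def Fb_def by (rule smooth_frechet[OF f])+
  have *: "integral {0..L} (\<lambda>r. frechet_derivative Fa (at (z + r *\<^sub>R a)) b) =
      integral {0..L} (\<lambda>r. frechet_derivative Fb (at (z + r *\<^sub>R a)) a)" if "0 \<le> L" for L
  proof -
    have eq: "(\<lambda>y. integral {0..L} (\<lambda>r. Fa (y + r *\<^sub>R a))) = (\<lambda>y. f (y + L *\<^sub>R a) - f y)"
      using integral_directional_derivative[OF f that] by (auto simp: Fa_def)
    have "integral {0..L} (\<lambda>r. frechet_derivative Fa (at (z + r *\<^sub>R a)) b) =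
        frechet_derivative (\<lambda>y. f (y + L *\<^sub>R a) - f y) (at z) b"
      using frechet_translate_integral[OF sm(1), where L = L and a = a] unfolding eq by simp
    also have "\<dots> = Fb (z + L *\<^sub>R a) - Fb z"
    proof -
      have "((\<lambda>y. f (y + L *\<^sub>R a) - f y) has_derivative
        (\<lambda>v. frechet_derivative f (at (z + L *\<^sub>R a)) v - frechet_derivative f (at z) v)) (at z)"
        using has_derivative_compose_affine[OF bounded_linear_ident smooth_differentiable[OF f]]
        by (intro has_derivative_diff smooth_has_derivative[OF f]) auto
      from frechet_derivative_at[OF this] show ?thesis unfolding Fb_def by metis
    qed
    also have "\<dots> = integral {0..L} (\<lambda>r. frechet_derivative Fb (at (z + r *\<^sub>R a)) a)"
      using integral_directional_derivative[OF sm(2) that] by simp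
    finally show ?thesis .
  qed
  have d: "((\<lambda>L. integral {0..L} (\<lambda>r. frechet_derivative F (at (z + r *\<^sub>R a)) c))
      has_vector_derivative frechet_derivative F (at z) c) (at 0 within {0..1})"
    if "smooth F" for F c
  proof -
    have "continuous_on {0..1} (\<lambda>r. frechet_derivative F (at (z + r *\<^sub>R a)) c)"
      by (rule continuous_on_compose2[OF smooth_continuous[OF smooth_frechet[OF that]]])
        (auto intro!: continuous_intros)
    from integral_has_vector_derivative[OF this, of 0] show ?thesis by simp
  qed
  have "((\<lambda>L. integral {0..L} (\<lambda>r. frechet_derivative Fa (at (z + r *\<^sub>R a)) b))
      has_vector_derivative frechet_derivative Fb (at z) a) (at 0 within {0..1})"
    by (rule has_vector_derivative_transform[OF _ _ d[OF sm(2)]]) (auto simp: *)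
  with d[OF sm(1)] have "frechet_derivative Fa (at z) b = frechet_derivative Fb (at z) a"
    using vector_derivative_unique_within[of 0 "{0..1::real}"]
    by (auto simp: trivial_limit_within)
  then show ?thesis by (simp add: Fa_def Fb_def)
qed

section \<open>Alternating maps and the exterior derivative\<close>

lemma alternating_cong: "alternating k f \<Longrightarrow> (\<And>i. i < k \<Longrightarrow> v i = u i) \<Longrightarrow> f v = f u"
  by (simp add: alternating_def)

lemma alternating_linear: "alternating k f \<Longrightarrow> i < k \<Longrightarrow> linear (\<lambda>y. f (v(i := y)))"
  by (simp add: alternating_def)

lemma alternating_eq_0:
  "alternating k f \<Longrightarrow> i < k \<Longrightarrow> j < k \<Longrightarrow> i \<noteq> j \<Longrightarrow> v i = v j \<Longrightarrow> f v = 0"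
  by (auto simp: alternating_def)

lemma alternating_upd_add:
  "alternating k f \<Longrightarrow> i < k \<Longrightarrow> f (v(i := a + b)) = f (v(i := a)) + f (v(i := b))"
  using linear_add[OF alternating_linear] by fastforce

lemma alternating_upd_scale:
  "alternating k f \<Longrightarrow> i < k \<Longrightarrow> f (v(i := c *\<^sub>R a)) = c * f (v(i := a))"
  using linear_scale[OF alternating_linear] by fastforce

lemma alternating_upd_sum:
  "alternating k f \<Longrightarrow> i < k \<Longrightarrow> f (v(i := (\<Sum>a\<in>A. g a))) = (\<Sum>a\<in>A. f (v(i := g a)))"
  by (rule linear_sum[OF alternating_linear])

lemma alternating_0: "alternating k f \<Longrightarrow> i < k \<Longrightarrow> v i = 0 \<Longrightarrow> f v = 0"
  using linear_0[OF alternating_linear, of k f i v] by (metis fun_upd_triv)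

lemma alternating_swap:
  assumes f: "alternating k f" and ij: "i < k" "j < k" "i \<noteq> j"
  shows "f (v(i := v j, j := v i)) = - f v"
proof -
  define F where "F = (\<lambda>a b. f (v(i := a, j := b)))"
  have F1: "F (a + b) c = F a c + F b c" for a b c
    using alternating_upd_add[OF f ij(1), of "v(j := c)"] ij(3) by (simp add: F_def fun_upd_twist)
  have F2: "F c (a + b) = F c a + F c b" for a b c
    using alternating_upd_add[OF f ij(2), of "v(i := c)"] by (simp add: F_def)
  have F0: "F a a = 0" for a
    unfolding F_def by (rule alternating_eq_0[OF f ij]) (use ij in auto)
  have "F (v i + v j) (v i + v j) = F (v i) (v i) + F (v i) (v j) + F (v j) (v i) + F (v j) (v j)"
    by (simp add: F1 F2)
  then have "F (v j) (v i) = - F (v i) (v j)"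
    using F0[of "v i"] F0[of "v j"] F0[of "v i + v j"] by linarith
  then show ?thesis by (simp add: F_def)
qed

lemma linear_cmult:
  fixes h :: "'a::real_vector \<Rightarrow> real"
  shows "linear h \<Longrightarrow> linear (\<lambda>y. c * h y)"
  by (simp add: linear_iff algebra_simps)

lemma alternating_cmult: "alternating k f \<Longrightarrow> alternating k (\<lambda>v. c * f v)"
  unfolding alternating_def by (auto intro: linear_cmult)

lemma alternating_add:
  assumes f: "alternating k f" and g: "alternating k g"
  shows "alternating k (\<lambda>v. f v + g v)"
  unfolding alternating_def
proof (intro conjI allI impI)
  fix v u :: "nat \<Rightarrow> 'a" assume "\<forall>i<k. v i = u i"
  then show "f v + g v = f u + g u"
    using alternating_cong[OF f, of v u] alternating_cong[OF g, of v u] by simp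
next
  fix v :: "nat \<Rightarrow> 'a" and i assume "i < k"
  then show "linear (\<lambda>y. f (v(i := y)) + g (v(i := y)))"
    by (intro linear_compose_add alternating_linear[OF f] alternating_linear[OF g])
next
  fix v :: "nat \<Rightarrow> 'a" and i j assume "i < k" "j < k" "i \<noteq> j" "v i = v j"
  then show "f v + g v = 0"
    using alternating_eq_0[OF f] alternating_eq_0[OF g] by simp
qed

lemma alternating_uminus: "alternating k f \<Longrightarrow> alternating k (\<lambda>v. - f v)"
  using alternating_cmult[of k f "-1"] by simp

lemma alternating_diff: "alternating k f \<Longrightarrow> alternating k g \<Longrightarrow> alternating k (\<lambda>v. f v - g v)"
  using alternating_add[of k f "\<lambda>v. - g v"] alternating_uminus by auto

lemma alternating_zero: "alternating k (\<lambda>_. 0)"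
  by (simp add: alternating_def linear_zero)

lemma case_nat_upd_Suc: "case_nat y (v(i := z)) = (case_nat y v)(Suc i := z)"
  by (auto split: nat.splits)

text \<open>\<open>case_nat y v\<close> inserts \<open>y\<close> in front of the sequence, so this
  is the interior product with \<open>y\<close>.\<close>

lemma alternating_contract:
  assumes f: "alternating (Suc k) f"
  shows "alternating k (\<lambda>v. f (case_nat y v))"
  unfolding alternating_def
proof (intro conjI allI impI)
  fix v u :: "nat \<Rightarrow> 'a" assume "\<forall>i<k. v i = u i"
  then show "f (case_nat y v) = f (case_nat y u)"
    by (intro alternating_cong[OF f]) (auto split: nat.splits)
next
  fix v :: "nat \<Rightarrow> 'a" and i assume "i < k"
  then show "linear (\<lambda>z. f (case_nat y (v(i := z))))"
    unfolding case_nat_upd_Suc by (intro alternating_linear[OF f]) simp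
next
  fix v :: "nat \<Rightarrow> 'a" and i j assume "i < k" "j < k" "i \<noteq> j" "v i = v j"
  then show "f (case_nat y v) = 0"
    by (intro alternating_eq_0[OF f, of "Suc i" "Suc j"]) auto
qed

lemma alternating_upd_last:
  assumes f: "alternating (Suc k) f"
  shows "alternating k (\<lambda>v. f (v(k := y)))"
  unfolding alternating_def
proof (intro conjI allI impI)
  fix v u :: "nat \<Rightarrow> 'a" assume "\<forall>i<k. v i = u i"
  then show "f (v(k := y)) = f (u(k := y))"
    by (intro alternating_cong[OF f]) auto
next
  fix v :: "nat \<Rightarrow> 'a" and i assume "i < k"
  then show "linear (\<lambda>z. f (v(i := z, k := y)))"
    using alternating_linear[OF f, of i "v(k := y)"] by (simp add: fun_upd_twist)
next
  fix v :: "nat \<Rightarrow> 'a" and i j assume "i < k" "j < k" "i \<noteq> j" "v i = v j"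
  then show "f (v(k := y)) = 0"
    by (intro alternating_eq_0[OF f, of i j]) auto
qed

lemma sum_PiE_lessThan_Suc:
  fixes h :: "(nat \<Rightarrow> 'b) \<Rightarrow> 'c::comm_monoid_add"
  assumes "finite A"
  shows "(\<Sum>I\<in>{..<Suc k} \<rightarrow>\<^sub>E A. h I) = (\<Sum>a\<in>A. \<Sum>I\<in>{..<k} \<rightarrow>\<^sub>E A. h (I(k := a)))"
proof -
  have inj: "inj_on (\<lambda>(a, I). I(k := a)) (A \<times> ({..<k} \<rightarrow>\<^sub>E A))"
    by (rule inj_combinator) simp
  have "(\<Sum>I\<in>{..<Suc k} \<rightarrow>\<^sub>E A. h I) = (\<Sum>I\<in>(\<lambda>(a, I). I(k := a)) ` (A \<times> ({..<k} \<rightarrow>\<^sub>E A)). h I)"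
    by (simp add: lessThan_Suc PiE_insert_eq)
  also have "\<dots> = (\<Sum>(a, I)\<in>A \<times> ({..<k} \<rightarrow>\<^sub>E A). h (I(k := a)))"
    by (subst sum.reindex[OF inj]) (simp add: case_prod_unfold)
  finally show ?thesis by (simp add: sum.cartesian_product)
qed

lemma alternating_expand:
  fixes f :: "(nat \<Rightarrow> 'a::real_vector) \<Rightarrow> real"
  assumes "finite A"
  shows "alternating k f \<Longrightarrow> f (\<lambda>i. \<Sum>a\<in>A. c i a *\<^sub>R e a) =
    (\<Sum>I\<in>{..<k} \<rightarrow>\<^sub>E A. (\<Prod>i<k. c i (I i)) * f (\<lambda>i. e (I i)))"
proof (induction k arbitrary: f)
  case 0
  \<comment> \<open>The only multi-index on the empty set is constantly \<open>undefined\<close>, so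
    the right-hand side of the claim evaluates \<open>f\<close> at this odd sequence; an alternating
    map of degree 0 ignores its arguments.\<close>
  have "f (\<lambda>i. \<Sum>a\<in>A. c i a *\<^sub>R e a) = f (\<lambda>i. e undefined)"
    by (rule alternating_cong[OF 0]) simp
  then show ?case by simp
next
  case (Suc k)
  let ?w = "\<lambda>i. \<Sum>a\<in>A. c i a *\<^sub>R e a"
  have "f ?w = f (?w(k := \<Sum>a\<in>A. c k a *\<^sub>R e a))"
    by (rule arg_cong[of _ _ f]) auto
  also have "\<dots> = (\<Sum>a\<in>A. c k a * f (?w(k := e a)))"
    by (simp only: alternating_upd_sum[OF Suc.prems lessI] alternating_upd_scale[OF Suc.prems lessI])
  also have "\<dots> = (\<Sum>a\<in>A. \<Sum>I\<in>{..<k} \<rightarrow>\<^sub>E A.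
      c k a * (\<Prod>i<k. c i (I i)) * f ((\<lambda>i. e (I i))(k := e a)))"
    by (simp only: Suc.IH[OF alternating_upd_last[OF Suc.prems]] sum_distrib_left mult.assoc)
  also have "\<dots> = (\<Sum>a\<in>A. \<Sum>I\<in>{..<k} \<rightarrow>\<^sub>E A.
      (\<Prod>i<Suc k. c i ((I(k := a)) i)) * f (\<lambda>i. e ((I(k := a)) i)))"
  proof (intro sum.cong refl)
    fix a I
    have "(\<Prod>i<Suc k. c i ((I(k := a)) i)) = c k a * (\<Prod>i<k. c i (I i))"
      by (simp add: mult.commute)
    moreover have "(\<lambda>i. e (I i))(k := e a) = (\<lambda>i. e ((I(k := a)) i))" by auto
    ultimately show "c k a * (\<Prod>i<k. c i (I i)) * f ((\<lambda>i. e (I i))(k := e a)) =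
        (\<Prod>i<Suc k. c i ((I(k := a)) i)) * f (\<lambda>i. e ((I(k := a)) i))" by simp
  qed
  finally show ?case
    by (simp only: sum_PiE_lessThan_Suc[OF assms])
qed

lemma alternating_span_eq_0:
  assumes f: "alternating k f" and j: "j < k" and r: "r \<in> span (w ` {..<j})"
  shows "f (w(j := r)) = 0"
  using r
proof (induction rule: span_induct)
  case base
  show ?case
    unfolding subspace_def mem_Collect_eq
    by (simp only: alternating_upd_add[OF f j] alternating_upd_scale[OF f j]
        alternating_0[OF f j fun_upd_same]) simp
next
  case (step x)
  then obtain i where "i < j" "x = w i" by auto
  then show ?case by (intro alternating_eq_0[OF f _ j, of i]) (use j in auto)
qed

text \<open>The vectors \<open>L (v i)\<close> are replaced from the lowest index on: the remainder
  of \<open>L (v j)\<close> lies in the span of vectors that already occupy earlier slots, so it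
  contributes nothing. The intermediate form, with only j slots treated, is what
  \<open>flag_exists\<close> uses.\<close>

lemma alternating_triangular_initial:
  assumes f: "alternating k f"
    and L: "\<And>i. i < j \<Longrightarrow> L (v i) - d i *\<^sub>R v i \<in> span (v ` {..<i})"
  shows "j \<le> k \<Longrightarrow>
    f (\<lambda>i. L (v i)) = (\<Prod>i<j. d i) * f (\<lambda>i. if i < j then v i else L (v i))"
  using L
proof (induction j)
  case (Suc j)
  then have j: "j < k" by simp
  let ?w = "\<lambda>i. if i < Suc j then v i else L (v i)"
  let ?r = "L (v j) - d j *\<^sub>R v j"
  have "f (\<lambda>i. if i < j then v i else L (v i)) = f (?w(j := d j *\<^sub>R v j + ?r))"
    by (rule arg_cong[of _ _ f]) auto
  also have "\<dots> = d j * f (?w(j := v j)) + f (?w(j := ?r))"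
    by (simp only: alternating_upd_add[OF f j] alternating_upd_scale[OF f j])
  also have "f (?w(j := ?r)) = 0"
  proof (rule alternating_span_eq_0[OF f j])
    have "?w ` {..<j} = v ` {..<j}" by (auto simp: image_def)
    then show "?r \<in> span (?w ` {..<j})" using Suc.prems(2)[of j] by simp
  qed
  also have "?w(j := v j) = ?w" by auto
  finally show ?case using Suc by simp
qed simp

lemma alternating_triangular:
  assumes f: "alternating k f"
    and L: "\<And>i. i < k \<Longrightarrow> L (v i) - d i *\<^sub>R v i \<in> span (v ` {..<i})"
  shows "f (\<lambda>i. L (v i)) = (\<Prod>i<k. d i) * f v"
  using alternating_triangular_initial[OF f L order_refl]
    alternating_cong[OF f, of "\<lambda>i. if i < k then v i else L (v i)" v] by simp

definition omit :: "nat \<Rightarrow> (nat \<Rightarrow> 'a) \<Rightarrow> nat \<Rightarrow> 'a" where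
  "omit i v = (\<lambda>j. if j < i then v j else v (Suc j))"

lemma ext_deriv_omit:
  "ext_deriv k \<omega> x v = (\<Sum>i\<le>k. (-1) ^ i * frechet_derivative (\<lambda>y. \<omega> y (omit i v)) (at x) (v i))"
  by (simp add: ext_deriv_def omit_def)

lemma omit_omit: "j < i \<Longrightarrow> omit j (omit i v) = omit (i - 1) (omit j v)"
  by (auto simp: omit_def fun_eq_iff)

lemma omit_fun_upd:
  "omit i (v(a := y)) = (if a = i then omit i v else (omit i v)((if a < i then a else a - 1) := y))"
  by (auto simp: omit_def fun_eq_iff)

lemma omit_case_nat_0: "omit 0 (case_nat y v) = v"
  by (auto simp: omit_def)

lemma omit_case_nat_Suc: "omit (Suc i) (case_nat y v) = case_nat y (omit i v)"
  by (auto simp: omit_def fun_eq_iff split: nat.splits)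

text \<open>Omitting either of two equal arguments leaves the same vectors in a different order;
  moving the surviving copy from slot b to slot a passes b - a - 1 others.\<close>

lemma alternating_omit_equal_args:
  assumes f: "alternating k f"
  shows "a < b \<Longrightarrow> b \<le> k \<Longrightarrow> v a = v b \<Longrightarrow>
    f (omit a v) = (-1) ^ (b - a - 1) * f (omit b v)"
proof (induction "b - a" arbitrary: a v)
  case (Suc d)
  show ?case
  proof (cases "Suc a = b")
    case True
    then have "omit a v = omit b v" using Suc.prems by (auto simp: omit_def fun_eq_iff less_Suc_eq)
    then show ?thesis using True by auto
  next
    case False
    with Suc.prems have ab: "Suc a < b" by simp
    \<comment> \<open>Swapping the neighbours a and a + 1 brings the repeated vector one slot closer
      to b, where the induction hypothesis applies, at the price of one sign.\<close>
    define u where "u = v(a := v (Suc a), Suc a := v a)"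
    have "f (omit (Suc a) u) = (-1) ^ (b - Suc a - 1) * f (omit b u)"
      using Suc ab by (intro Suc.hyps(1)) (auto simp: u_def)
    moreover have "omit (Suc a) u = omit a v"
      by (auto simp: omit_def fun_eq_iff u_def less_Suc_eq)
    moreover have "omit b u = (omit b v)(a := omit b v (Suc a), Suc a := omit b v a)"
      using ab by (auto simp: omit_def fun_eq_iff u_def)
    then have "f (omit b u) = - f (omit b v)"
      using alternating_swap[OF f, of a "Suc a" "omit b v"] ab Suc.prems by simp
    moreover have "b - a - 1 = Suc (b - Suc a - 1)" using ab by simp
    ultimately show ?thesis by simp
  qed
qed simp

text \<open>If two arguments agree, every term that omits neither of them vanishes, and the two
  remaining terms cancel by \<open>alternating_omit_equal_args\<close>. This one antisymmetrisation
  serves the exterior derivative, with \<open>L\<close> a directional derivative, and the wedge of a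
  covector with a form in \<open>flag_form_exists\<close>.\<close>

lemma alternating_wedge:
  assumes L: "\<And>u. linear (\<lambda>y. L y u)" and f: "\<And>y. alternating k (L y)"
  shows "alternating (Suc k) (\<lambda>v. \<Sum>i\<le>k. (-1) ^ i * L (v i) (omit i v))"
  unfolding alternating_def
proof (intro conjI allI impI)
  fix v u :: "nat \<Rightarrow> 'a" assume *: "\<forall>i<Suc k. v i = u i"
  have "L (v i) (omit i v) = L (u i) (omit i u)" if "i \<le> k" for i
    using alternating_cong[OF f, of "omit i v" "omit i u" "v i"] * that by (simp add: omit_def)
  then show "(\<Sum>i\<le>k. (-1) ^ i * L (v i) (omit i v)) = (\<Sum>i\<le>k. (-1) ^ i * L (u i) (omit i u))"
    by simp
next
  fix v :: "nat \<Rightarrow> 'a" and a assume a: "a < Suc k"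
  have "linear (\<lambda>y. L ((v(a := y)) i) (omit i (v(a := y))))" if "i \<le> k" for i
  proof (cases "a = i")
    case True
    then show ?thesis by (simp add: omit_fun_upd L)
  next
    case False
    then show ?thesis using a that
      by (simp add: omit_fun_upd) (intro conjI impI alternating_linear[OF f]; simp)
  qed
  then show "linear (\<lambda>y. \<Sum>i\<le>k. (-1) ^ i * L ((v(a := y)) i) (omit i (v(a := y))))"
    by (intro linear_compose_sum ballI linear_compose_scale_right[where 'b = real, simplified]) auto
next
  fix v :: "nat \<Rightarrow> 'a" and a b assume ab: "a < Suc k" "b < Suc k" "a \<noteq> b" "v a = v b"
  have main: "(\<Sum>i\<le>k. (-1) ^ i * L (v i) (omit i v)) = 0" if "a < b" "b \<le> k" "v a = v b" for a b
  proof -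
    have 0: "L (v i) (omit i v) = 0" if "i \<le> k" "i \<notin> {a, b}" for i
    proof (rule alternating_eq_0[OF f])
      show "(if a < i then a else a - 1) < k" "(if b < i then b else b - 1) < k"
        using that \<open>a < b\<close> \<open>b \<le> k\<close> by auto
    qed (use that \<open>a < b\<close> \<open>v a = v b\<close> in \<open>auto simp: omit_def\<close>)
    have "(\<Sum>i\<le>k. (-1) ^ i * L (v i) (omit i v)) = (\<Sum>i\<in>{a, b}. (-1) ^ i * L (v i) (omit i v))"
      using that 0 by (intro sum.mono_neutral_right) auto
    also have "\<dots> = (-1) ^ a * L (v a) (omit a v) + (-1) ^ b * L (v a) (omit b v)"
      using that by simp
    also have "\<dots> = ((-1) ^ (a + (b - a - 1)) + (-1) ^ b) * L (v a) (omit b v)"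
      by (simp add: alternating_omit_equal_args[OF f that] power_add algebra_simps)
    also have "b = Suc (a + (b - a - 1))" using that by simp
    then have "(-1 :: real) ^ (a + (b - a - 1)) + (-1) ^ b = 0" by (metis add.right_inverse power_Suc mult_minus1)
    finally show ?thesis by simp
  qed
  show "(\<Sum>i\<le>k. (-1) ^ i * L (v i) (omit i v)) = 0"
    using main[of a b] main[of b a] ab by (cases "a < b") auto
qed

lemma smooth_form_alternating: "smooth_form k \<omega> \<Longrightarrow> alternating k (\<omega> x)"
  by (simp add: smooth_form_def)

lemma smooth_form_smooth: "smooth_form k \<omega> \<Longrightarrow> smooth (\<lambda>x. \<omega> x v)"
  by (simp add: smooth_form_def)

lemma alternating_frechet:
  assumes "smooth_form k \<omega>"
  shows "alternating k (\<lambda>u. frechet_derivative (\<lambda>z. \<omega> z u) (at x) y)"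
proof -
  note a = smooth_form_alternating[OF assms]
  note d = smooth_differentiable[OF smooth_form_smooth[OF assms]]
  show ?thesis
    unfolding alternating_def
  proof (intro conjI allI impI)
    fix v u :: "nat \<Rightarrow> 'a" assume "\<forall>i<k. v i = u i"
    then have "(\<lambda>z. \<omega> z v) = (\<lambda>z. \<omega> z u)" using alternating_cong[OF a] by blast
    then show "frechet_derivative (\<lambda>z. \<omega> z v) (at x) y = frechet_derivative (\<lambda>z. \<omega> z u) (at x) y"
      by simp
  next
    fix v :: "nat \<Rightarrow> 'a" and i assume i: "i < k"
    have "frechet_derivative (\<lambda>z. c * \<omega> z u) (at x) y = c * frechet_derivative (\<lambda>z. \<omega> z u) (at x) y"
      for c u
      using frechet_derivative_mult[of "\<lambda>_. c" x "\<lambda>z. \<omega> z u" y] d by simp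
    then show "linear (\<lambda>ya. frechet_derivative (\<lambda>z. \<omega> z (v(i := ya))) (at x) y)"
      by (intro linearI)
        (simp_all add: alternating_upd_add[OF a i] alternating_upd_scale[OF a i]
          frechet_derivative_add d)
  next
    fix v :: "nat \<Rightarrow> 'a" and i j assume "i < k" "j < k" "i \<noteq> j" "v i = v j"
    then have "(\<lambda>z. \<omega> z v) = (\<lambda>z. 0)" using alternating_eq_0[OF a] by blast
    then show "frechet_derivative (\<lambda>z. \<omega> z v) (at x) y = 0"
      by (simp add: frechet_derivative_const)
  qed
qed

lemma smooth_form_ext_deriv:
  assumes "smooth_form k \<omega>"
  shows "smooth_form (Suc k) (ext_deriv k \<omega>)"
  unfolding smooth_form_def
proof (intro conjI allI)
  fix x
  have "alternating (Suc k)
      (\<lambda>v. \<Sum>i\<le>k. (-1) ^ i * frechet_derivative (\<lambda>y. \<omega> y (omit i v)) (at x) (v i))"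
    using alternating_wedge[of "\<lambda>y u. frechet_derivative (\<lambda>z. \<omega> z u) (at x) y" k]
      alternating_frechet[OF assms]
      linear_frechet_derivative[OF smooth_differentiable[OF smooth_form_smooth[OF assms]]] by blast
  then show "alternating (Suc k) (ext_deriv k \<omega> x)"
    by (simp add: ext_deriv_omit[abs_def])
next
  fix v
  show "smooth (\<lambda>x. ext_deriv k \<omega> x v)"
    unfolding ext_deriv_omit
    by (intro smooth_sum smooth_mult smooth_const smooth_frechet smooth_form_smooth[OF assms])
qed

lemma frechet_derivative_sum:
  assumes "\<And>i. i \<in> A \<Longrightarrow> smooth (f i)"
  shows "frechet_derivative (\<lambda>x. \<Sum>i\<in>A. f i x) (at x) v = (\<Sum>i\<in>A. frechet_derivative (f i) (at x) v)"
proof -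
  have "((\<lambda>x. \<Sum>i\<in>A. f i x) has_derivative (\<lambda>v. \<Sum>i\<in>A. frechet_derivative (f i) (at x) v)) (at x)"
    by (intro has_derivative_sum smooth_has_derivative assms)
  from frechet_derivative_at[OF this] show ?thesis by metis
qed

lemma frechet_derivative_cmult:
  assumes "smooth f"
  shows "frechet_derivative (\<lambda>x. c * f x) (at x) v = c * frechet_derivative f (at x) v"
  using frechet_derivative_mult[of "\<lambda>_. c" x f v] smooth_differentiable[OF assms] by simp

text \<open>The terms cancel in pairs: (i, j) with j < i against (j, i - 1). Both omit the same two
  arguments, their second derivatives agree by symmetry, and their signs are opposite.\<close>

lemma ext_deriv_ext_deriv:
  assumes w: "smooth_form k \<omega>"
  shows "ext_deriv (Suc k) (ext_deriv k \<omega>) = 0"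
proof (intro ext)
  fix x :: 'a and v :: "nat \<Rightarrow> 'a"
  note sm = smooth_form_smooth[OF w]
  define D where "D = (\<lambda>a b u. frechet_derivative (\<lambda>y. frechet_derivative (\<lambda>z. \<omega> z u) (at y) b) (at x) a)"
  define T where "T = (\<lambda>i j. (-1) ^ (i + j) * D (v i) (omit i v j) (omit j (omit i v)))"
  have "frechet_derivative (\<lambda>y. ext_deriv k \<omega> y u) (at x) a =
      (\<Sum>j\<le>k. (-1) ^ j * D a (u j) (omit j u))" for a u
  proof -
    have "frechet_derivative (\<lambda>y. ext_deriv k \<omega> y u) (at x) a = (\<Sum>j\<le>k. frechet_derivative
        (\<lambda>y. (-1) ^ j * frechet_derivative (\<lambda>z. \<omega> z (omit j u)) (at y) (u j)) (at x) a)"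
      unfolding ext_deriv_omit
      by (intro frechet_derivative_sum smooth_mult smooth_const smooth_frechet sm)
    then show ?thesis
      by (simp only: frechet_derivative_cmult[OF smooth_frechet[OF sm]] D_def)
  qed
  then have "ext_deriv (Suc k) (ext_deriv k \<omega>) x v = (\<Sum>i\<le>Suc k. \<Sum>j\<le>k. T i j)"
    by (simp only: ext_deriv_omit[of "Suc k"])
      (simp add: T_def sum_distrib_left power_add mult.assoc del: sum.atMost_Suc)
  also have "\<dots> = (\<Sum>(i, j)\<in>{..Suc k} \<times> {..k}. T i j)"
    by (simp add: sum.cartesian_product)
  also have "\<dots> = (\<Sum>(i, j)\<in>{(i, j). i \<le> Suc k \<and> j < i}. T i j) + (\<Sum>(i, j)\<in>{(i, j). i \<le> j \<and> j \<le> k}. T i j)"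
  proof -
    have "{..Suc k} \<times> {..k} = {(i, j). i \<le> Suc k \<and> j < i} \<union> {(i, j). i \<le> j \<and> j \<le> k}" by auto
    moreover have "finite {(i, j). i \<le> Suc k \<and> j < i}" "finite {(i, j). i \<le> j \<and> j \<le> k}"
      by (rule finite_subset[of _ "{..Suc k} \<times> {..Suc k}"]; force)+
    moreover have "{(i, j). i \<le> Suc k \<and> j < i} \<inter> {(i, j). i \<le> j \<and> j \<le> k} = {}" by auto
    ultimately show ?thesis by (simp only: sum.union_disjoint)
  qed
  also have "(\<Sum>(i, j)\<in>{(i, j). i \<le> Suc k \<and> j < i}. T i j) =
      (\<Sum>(i, j)\<in>{(i, j). i \<le> j \<and> j \<le> k}. - T i j)"
  proof (rule sum.reindex_bij_witness[of _ "\<lambda>(i, j). (Suc j, i)" "\<lambda>(i, j). (j, i - 1)"])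
    fix z assume "z \<in> {(i, j). i \<le> Suc k \<and> j < i}"
    then obtain i j where z: "z = (i, j)" "i \<le> Suc k" "j < i" by auto
    have "omit i v j = v j" "omit j v (i - 1) = v i" using z by (auto simp: omit_def)
    moreover have "(-1 :: real) ^ (i + j) = - ((-1) ^ (j + (i - 1)))"
      using z by (cases i) (auto simp: add.commute)
    moreover have "D a b u = D b a u" for a b u
      unfolding D_def by (rule frechet_derivative_commute[OF sm])
    ultimately have "T i j = - T j (i - 1)"
      unfolding T_def by (simp add: omit_omit[OF z(3)])
    then show "(case (case z of (i, j) \<Rightarrow> (j, i - 1)) of (i, j) \<Rightarrow> - T i j) = (case z of (i, j) \<Rightarrow> T i j)"
      using z by simp
  qed auto
  finally show "ext_deriv (Suc k) (ext_deriv k \<omega>) x v = 0 x v"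
    by (simp add: sum_negf case_prod_unfold)
qed

lemma smooth_form_diff:
  assumes "smooth_form k \<omega>" "smooth_form k \<theta>"
  shows "smooth_form k (\<omega> - \<theta>)"
  using assms by (auto simp: smooth_form_def fun_diff_def intro: alternating_diff smooth_diff)

lemma smooth_form_add:
  assumes "smooth_form k \<omega>" "smooth_form k \<theta>"
  shows "smooth_form k (\<omega> + \<theta>)"
  using assms by (auto simp: smooth_form_def plus_fun_def intro: alternating_add smooth_add)

lemma smooth_form_uminus:
  assumes "smooth_form k \<omega>"
  shows "smooth_form k (- \<omega>)"
  using assms by (auto simp: smooth_form_def fun_Compl_def intro: alternating_uminus smooth_uminus)

lemma smooth_form_0: "smooth_form k 0"
  by (simp add: smooth_form_def zero_fun_def alternating_zero)

lemma smooth_form_mult: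
  assumes "smooth h" "smooth_form k \<omega>"
  shows "smooth_form k (\<lambda>x v. h x * \<omega> x v)"
  using assms by (auto simp: smooth_form_def intro: alternating_cmult smooth_mult)

lemma ext_deriv_add:
  assumes "smooth_form k \<omega>" "smooth_form k \<theta>"
  shows "ext_deriv k (\<omega> + \<theta>) = ext_deriv k \<omega> + ext_deriv k \<theta>"
  using smooth_differentiable[OF smooth_form_smooth[OF assms(1)]]
    smooth_differentiable[OF smooth_form_smooth[OF assms(2)]]
  by (simp add: fun_eq_iff ext_deriv_omit frechet_derivative_add sum.distrib algebra_simps)

lemma ext_deriv_uminus:
  assumes "smooth_form k \<omega>"
  shows "ext_deriv k (- \<omega>) = - ext_deriv k \<omega>"
  using frechet_derivative_cmult[OF smooth_form_smooth[OF assms], of "-1"]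
  by (simp add: fun_eq_iff ext_deriv_omit sum_negf)

lemma ext_deriv_diff:
  assumes "smooth_form k \<omega>" "smooth_form k \<theta>"
  shows "ext_deriv k (\<omega> - \<theta>) = ext_deriv k \<omega> - ext_deriv k \<theta>"
  using ext_deriv_add[OF assms(1) smooth_form_uminus[OF assms(2)]] ext_deriv_uminus[OF assms(2)]
  by simp

lemma ext_deriv_0: "ext_deriv k 0 = 0"
  by (simp add: fun_eq_iff ext_deriv_omit zero_fun_def frechet_derivative_const)

lemma ext_deriv_mult:
  assumes "smooth h" "smooth_form k \<omega>"
  shows "ext_deriv k (\<lambda>x v. h x * \<omega> x v) x v =
    (\<Sum>i\<le>k. (-1) ^ i * (frechet_derivative h (at x) (v i) * \<omega> x (omit i v))) + h x * ext_deriv k \<omega> x v"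
  using smooth_differentiable[OF assms(1)] smooth_differentiable[OF smooth_form_smooth[OF assms(2)]]
  by (simp add: ext_deriv_omit frechet_derivative_mult sum.distrib sum_distrib_left algebra_simps)

text \<open>Cartan's formula for the constant vector field y: contraction of the differential is the
  derivative along y minus the differential of the contraction.\<close>

lemma ext_deriv_contract:
  "ext_deriv (Suc k) \<omega> x (case_nat y v) = frechet_derivative (\<lambda>z. \<omega> z v) (at x) y
     - (\<Sum>i\<le>k. (-1) ^ i * frechet_derivative (\<lambda>z. \<omega> z (case_nat y (omit i v))) (at x) (v i))"
  by (simp only: ext_deriv_omit sum.atMost_Suc_shift)
    (simp add: omit_case_nat_0 omit_case_nat_Suc sum_negf)

section \<open>Triangularisation\<close>

text \<open>A bridge between determinants, whose rows are indexed by the finite type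
  \<open>'m\<close>, and alternating maps on sequences; \<open>h\<close> will be a bijection from
  \<open>'m\<close> onto the first CARD('m) naturals.\<close>

definition rows_det :: "('m \<Rightarrow> nat) \<Rightarrow> (nat \<Rightarrow> real ^ 'm) \<Rightarrow> real" where
  "rows_det h v = det (\<chi> a. v (h a))"

lemma vector_scaleR_eq: "c *s (x :: real ^ 'm) = c *\<^sub>R x"
  by (simp add: vec_eq_iff)

lemma alternating_rows_det:
  fixes h :: "'m::finite \<Rightarrow> nat"
  assumes h: "bij_betw h UNIV {..<k}"
  shows "alternating k (rows_det h)"
  unfolding alternating_def
proof (intro conjI allI impI)
  fix v u :: "nat \<Rightarrow> real ^ 'm" assume "\<forall>i<k. v i = u i"
  moreover have "h a < k" for a using h by (auto simp: bij_betw_def)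
  ultimately show "rows_det h v = rows_det h u" by (simp add: rows_det_def)
next
  fix v :: "nat \<Rightarrow> real ^ 'm" and i assume "i < k"
  then obtain b where b: "i = h b" using h by (auto simp: bij_betw_def)
  have eq: "(\<chi> a. (v(i := y)) (h a)) = (\<chi> a. if a = b then y else v (h a))" for y
    using h by (auto simp: vec_eq_iff b bij_betw_def inj_eq)
  show "linear (\<lambda>y. rows_det h (v(i := y)))"
  proof (rule linearI)
    fix r :: real and x y :: "real ^ 'm"
    show "rows_det h (v(i := x + y)) = rows_det h (v(i := x)) + rows_det h (v(i := y))"
      unfolding rows_det_def eq by (rule det_row_add)
    have "rows_det h (v(i := r *\<^sub>R x)) = det (\<chi> a. if a = b then r *s x else v (h a))"
      unfolding rows_det_def eq vector_scaleR_eq ..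
    also have "\<dots> = r * rows_det h (v(i := x))"
      unfolding rows_det_def eq by (rule det_row_mul)
    finally show "rows_det h (v(i := r *\<^sub>R x)) = r *\<^sub>R rows_det h (v(i := x))" by simp
  qed
next
  fix v :: "nat \<Rightarrow> real ^ 'm" and i j assume ij: "i < k" "j < k" "i \<noteq> j" "v i = v j"
  then have "i \<in> range h" "j \<in> range h" using h by (auto simp: bij_betw_def)
  then obtain a b where "i = h a" "j = h b" by blast
  then show "rows_det h v = 0"
    using ij unfolding rows_det_def by (intro det_identical_rows[of a b]) (auto simp: row_def)
qed

lemma rows_det_matrix_vector:
  "rows_det h (\<lambda>i. A *v v i) = det A * rows_det h v"
proof -
  have "(\<chi> a. A *v v (h a)) = (\<chi> a. v (h a)) ** transpose A"
    by (simp add: vec_eq_iff matrix_matrix_mult_def matrix_vector_mult_def transpose_def mult.commute)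
  then show ?thesis by (simp add: rows_det_def det_mul)
qed

lemma rows_det_nonzero_iff:
  fixes h :: "'m::finite \<Rightarrow> nat"
  assumes h: "bij_betw h UNIV {..<k}"
  shows "rows_det h v \<noteq> 0 \<longleftrightarrow> (\<forall>c. (\<Sum>i<k. c i *\<^sub>R v i) = 0 \<longrightarrow> (\<forall>i<k. c i = 0))"
proof -
  let ?A = "(\<chi> a. v (h a)) :: real ^ 'm ^ 'm"
  have "rows_det h v \<noteq> 0 \<longleftrightarrow> (\<exists>B. ?A ** B = mat 1)"
    by (simp add: rows_det_def invertible_det_nz[symmetric] invertible_right_inverse)
  also have "\<dots> \<longleftrightarrow> (\<forall>d. (\<Sum>a\<in>UNIV. d a *\<^sub>R v (h a)) = 0 \<longrightarrow> (\<forall>a. d a = 0))"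
    by (simp add: matrix_right_invertible_independent_rows row_def scalar_mult_eq_scaleR)
  also have "\<dots> \<longleftrightarrow> (\<forall>c. (\<Sum>i<k. c i *\<^sub>R v i) = 0 \<longrightarrow> (\<forall>i<k. c i = 0))"
  proof safe
    fix c i assume *: "\<forall>d. (\<Sum>a\<in>UNIV. d a *\<^sub>R v (h a)) = 0 \<longrightarrow> (\<forall>a. d a = 0)"
      "(\<Sum>i<k. c i *\<^sub>R v i) = 0" "i < k"
    have "(\<Sum>a\<in>UNIV. c (h a) *\<^sub>R v (h a)) = 0"
      using sum.reindex_bij_betw[OF h, of "\<lambda>i. c i *\<^sub>R v i"] * by simp
    moreover obtain a where "i = h a" using h \<open>i < k\<close> by (auto simp: bij_betw_def)
    ultimately show "c i = 0" using *(1)[rule_format, of "\<lambda>a. c (h a)"] by simp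
  next
    fix d a assume *: "\<forall>c. (\<Sum>i<k. c i *\<^sub>R v i) = 0 \<longrightarrow> (\<forall>i<k. c i = 0)"
      "(\<Sum>a\<in>UNIV. d a *\<^sub>R v (h a)) = 0"
    have inv: "inv h (h b) = b" for b using h by (simp add: bij_betw_def)
    have "(\<Sum>i<k. d (inv h i) *\<^sub>R v i) = 0"
      using sum.reindex_bij_betw[OF h, of "\<lambda>i. d (inv h i) *\<^sub>R v i"] *(2) by (simp add: inv)
    moreover have "h a < k" using h by (auto simp: bij_betw_def)
    ultimately show "d a = 0" using *(1)[rule_format, of "\<lambda>i. d (inv h i)" "h a"] by (simp add: inv)
  qed
  finally show ?thesis .
qed

lemma isCont_rows_det:
  fixes v :: "'b::t2_space \<Rightarrow> nat \<Rightarrow> real ^ 'm::finite"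
  assumes "\<And>i. isCont (\<lambda>z. v z i) x"
  shows "isCont (\<lambda>z. rows_det h (v z)) x"
  unfolding rows_det_def det_def using assms by (simp add: continuous_intros)

section \<open>The characteristic polynomial and a complete flag with prescribed order of
  eigenvalues\<close>

lemma poly_det:
  fixes A :: "'a::comm_ring_1 poly ^ 'n ^ 'n"
  shows "poly (det A) x = det (\<chi> i j. poly (A $ i $ j) x)"
  by (simp add: det_def poly_sum poly_prod)

lemma of_real_det: "complex_of_real (det A) = det (\<chi> i j. complex_of_real (A $ i $ j))"
  by (simp add: det_def)

lemma poly_charpoly: "poly (charpoly A) z = det (\<chi> i j. (if i = j then z else 0) - A $ i $ j)"
  unfolding charpoly_def poly_det
  by (rule arg_cong[of _ _ det]) (simp add: vec_eq_iff)

text \<open>The complex characteristic polynomial splits, and its roots are the given real numbers.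
  \<open>\<kappa>\<close> is the real part of its leading coefficient; what
  \<open>flag_exists\<close> exploits is that the determinant vanishes at each \<open>d i\<close>
  with the right multiplicity.\<close>

lemma det_eq_prod_eigenvalues:
  fixes \<alpha> :: "real ^ 'm \<Rightarrow> real ^ 'm" and d :: "nat \<Rightarrow> real"
  assumes "eigenvalues \<alpha> = {# complex_of_real (d i). i \<in># mset_set {..<k} #}"
  obtains \<kappa> where "\<And>z. det (z *\<^sub>R mat 1 - matrix \<alpha>) = \<kappa> * (\<Prod>i<k. z - d i)"
proof
  let ?p = "charpoly (complex_matrix \<alpha>)"
  fix z :: real
  have "?p = smult (lead_coeff ?p) (\<Prod>x\<in>#proots ?p. [:-x, 1:])"
    by (rule complex_poly_decompose_multiset[symmetric])
  also have "(\<Prod>x\<in>#proots ?p. [:-x, 1:]) = (\<Prod>i<k. [:- complex_of_real (d i), 1:])"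
    using assms by (simp add: eigenvalues_def image_mset.compositionality o_def prod_unfold_prod_mset)
  finally have "poly ?p (of_real z) =
      poly (smult (lead_coeff ?p) (\<Prod>i<k. [:- complex_of_real (d i), 1:])) (of_real z)"
    by (rule arg_cong)
  also have "\<dots> = lead_coeff ?p * (\<Prod>i<k. of_real z - of_real (d i))"
    by (simp add: poly_prod)
  finally have "poly ?p (of_real z) = lead_coeff ?p * (\<Prod>i<k. of_real z - of_real (d i))" .
  moreover have "poly ?p (of_real z) = of_real (det (z *\<^sub>R mat 1 - matrix \<alpha>))"
    unfolding poly_charpoly of_real_det
    by (rule arg_cong[of _ _ det]) (simp add: vec_eq_iff complex_matrix_def mat_def map_matrix_def)
  ultimately have "of_real (det (z *\<^sub>R mat 1 - matrix \<alpha>)) = lead_coeff ?p * of_real (\<Prod>i<k. z - d i)"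
    by simp
  from arg_cong[OF this, of Re]
  show "det (z *\<^sub>R mat 1 - matrix \<alpha>) = Re (lead_coeff ?p) * (\<Prod>i<k. z - d i)"
    by (simp del: of_real_prod of_real_diff)
qed

lemma eigenvalue_of_mem:
  assumes "z \<in># eigenvalues \<alpha>"
  shows "eigenvalue \<alpha> z"
proof -
  let ?A = "(\<chi> i j. (if i = j then z else 0) - complex_matrix \<alpha> $ i $ j)"
  have "poly (charpoly (complex_matrix \<alpha>)) z = 0"
    using assms by (cases "charpoly (complex_matrix \<alpha>) = 0") (auto simp: eigenvalues_def)
  then have "det ?A = 0" by (simp add: poly_charpoly)
  then have "\<not> (\<exists>B. B ** ?A = mat 1)"
    by (simp add: invertible_left_inverse[symmetric] invertible_det_nz)
  then obtain v where v: "v \<noteq> 0" "?A *v v = 0"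
    by (auto simp: matrix_left_invertible_ker)
  have "?A *v v = z *s v - complex_matrix \<alpha> *v v"
  proof -
    have "(\<Sum>j\<in>UNIV. (if i = j then z else 0) * v $ j) = z * v $ i" for i
      by (simp add: if_distrib[of "\<lambda>x. x * _"] cong: if_cong)
    then show ?thesis
      by (simp add: vec_eq_iff matrix_vector_mult_def sum_subtractf
          left_diff_distrib[of "if _ then _ else _"])
  qed
  with v show ?thesis unfolding eigenvalue_def by (intro exI[of _ v]) simp
qed

text \<open>Independence of the indexed family, which excludes repetitions, in contrast to
  independence of its range.\<close>

definition lin_indep :: "nat \<Rightarrow> (nat \<Rightarrow> 'a::real_vector) \<Rightarrow> bool" where
  "lin_indep k v \<longleftrightarrow> (\<forall>c. (\<Sum>i<k. c i *\<^sub>R v i) = 0 \<longrightarrow> (\<forall>i<k. c i = 0))"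

lemma lin_indep_iff: "lin_indep k v \<longleftrightarrow> inj_on v {..<k} \<and> independent (v ` {..<k})"
proof
  assume v: "lin_indep k v"
  have inj: "inj_on v {..<k}"
  proof (rule inj_onI)
    fix i j assume ij: "i \<in> {..<k}" "j \<in> {..<k}" "v i = v j"
    show "i = j"
    proof (rule ccontr)
      assume "i \<noteq> j"
      let ?c = "\<lambda>l. if l = i then 1 else if l = j then -1 else (0::real)"
      have "(\<Sum>l<k. ?c l *\<^sub>R v l) = (\<Sum>l\<in>{i, j}. ?c l *\<^sub>R v l)"
        using ij by (intro sum.mono_neutral_right) auto
      also have "\<dots> = 0" using ij \<open>i \<noteq> j\<close> by simp
      finally show False using v ij unfolding lin_indep_def by fastforce
    qed
  qed
  moreover have "independent (v ` {..<k})"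
  proof (rule independent_if_scalars_zero)
    fix f x assume f: "(\<Sum>x\<in>v ` {..<k}. f x *\<^sub>R x) = 0" and x: "x \<in> v ` {..<k}"
    have "(\<Sum>i<k. f (v i) *\<^sub>R v i) = 0" using f by (simp add: sum.reindex[OF inj])
    then have "\<forall>i<k. f (v i) = 0"
      using v[unfolded lin_indep_def, rule_format, of "\<lambda>i. f (v i)"] by blast
    then show "f x = 0" using x by auto
  qed simp
  ultimately show "inj_on v {..<k} \<and> independent (v ` {..<k})" ..
next
  assume v: "inj_on v {..<k} \<and> independent (v ` {..<k})"
  show "lin_indep k v" unfolding lin_indep_def
  proof (intro allI impI)
    fix c i assume c: "(\<Sum>i<k. c i *\<^sub>R v i) = 0" and i: "i < k"
    have inv: "inv_into {..<k} v (v j) = j" if "j < k" for j using v that by simp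
    have "(\<Sum>x\<in>v ` {..<k}. c (inv_into {..<k} v x) *\<^sub>R x) = 0"
      using c v by (simp add: sum.reindex)
    then have "c (inv_into {..<k} v (v i)) = 0"
      using v i by (intro independentD[of "v ` {..<k}" "v ` {..<k}" "\<lambda>x. c (inv_into {..<k} v x)"]) auto
    then show "c i = 0" using inv[OF i] by simp
  qed
qed

lemma lin_indep_extend:
  fixes v :: "nat \<Rightarrow> 'a::euclidean_space"
  assumes v: "lin_indep j v"
  obtains u where "lin_indep DIM('a) u" "\<And>i. i < j \<Longrightarrow> u i = v i" "j \<le> DIM('a)"
proof -
  from v have inj: "inj_on v {..<j}" and ind: "independent (v ` {..<j})" by (auto simp: lin_indep_iff)
  obtain B where B: "v ` {..<j} \<subseteq> B" "independent B" "UNIV \<subseteq> span B"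
    using maximal_independent_subset_extend[OF subset_UNIV ind] by metis
  have cB: "card B = DIM('a)" using B by (metis basis_card_eq_dim dim_UNIV subset_UNIV)
  have fB: "finite B" using B(2) independent_imp_finite by blast
  have cv: "card (v ` {..<j}) = j" using inj by (simp add: card_image)
  have jN: "j \<le> DIM('a)" using card_mono[OF fB B(1)] cv cB by simp
  have "card (B - v ` {..<j}) = DIM('a) - j"
    using card_Diff_subset[OF _ B(1)] cv cB by simp
  then obtain g where g: "bij_betw g {0..<DIM('a) - j} (B - v ` {..<j})"
    using ex_bij_betw_nat_finite[of "B - v ` {..<j}"] fB by auto
  define u where "u = (\<lambda>i. if i < j then v i else g (i - j))"
  have gB: "g (i - j) \<in> B - v ` {..<j}" if "j \<le> i" "i < DIM('a)" for i
  proof -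
    have "i - j \<in> {0..<DIM('a) - j}" using that by auto
    then show ?thesis using bij_betwE[OF g] by blast
  qed
  have "inj_on u {..<DIM('a)}"
  proof (rule inj_onI)
    fix a b assume ab: "a \<in> {..<DIM('a)}" "b \<in> {..<DIM('a)}" "u a = u b"
    consider "a < j" "b < j" | "a < j" "j \<le> b" | "j \<le> a" "b < j" | "j \<le> a" "j \<le> b" by linarith
    then show "a = b"
    proof cases
      case 1 then show ?thesis using ab inj by (auto simp: u_def inj_on_def)
    next
      case 2 then show ?thesis using ab gB[of b] by (force simp: u_def)
    next
      case 3 then show ?thesis using ab gB[of a] by (force simp: u_def)
    next
      case 4
      have "inj_on g {0..<DIM('a) - j}" using g by (simp add: bij_betw_def)
      moreover have "a - j \<in> {0..<DIM('a) - j}" "b - j \<in> {0..<DIM('a) - j}" using ab 4 by auto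
      moreover have "g (a - j) = g (b - j)" using ab 4 by (simp add: u_def)
      ultimately have "a - j = b - j" by (meson inj_onD)
      then show ?thesis using 4 by simp
    qed
  qed
  moreover have "u ` {..<DIM('a)} \<subseteq> B" using gB B(1) by (auto simp: u_def)
  ultimately have "lin_indep DIM('a) u"
    using independent_mono[OF B(2)] by (simp add: lin_indep_iff)
  then show ?thesis using jN by (intro that[of u]) (auto simp: u_def)
qed

lemma span_image_lessThan:
  fixes v :: "nat \<Rightarrow> 'a::real_vector"
  assumes "y \<in> span (v ` {..<k})"
  obtains c where "y = (\<Sum>i<k. c i *\<^sub>R v i)"
proof -
  have "\<exists>c. y = (\<Sum>i<k. c i *\<^sub>R v i)"
    using assms
  proof (induction rule: span_induct)
    case base
    show ?case unfolding subspace_def mem_Collect_eq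
    proof safe
      show "\<exists>c. 0 = (\<Sum>i<k. c i *\<^sub>R v i)" by (rule exI[of _ "\<lambda>_. 0"]) simp
      fix c d :: "nat \<Rightarrow> real" and r
      show "\<exists>e. (\<Sum>i<k. c i *\<^sub>R v i) + (\<Sum>i<k. d i *\<^sub>R v i) = (\<Sum>i<k. e i *\<^sub>R v i)"
        by (rule exI[of _ "\<lambda>i. c i + d i"]) (simp add: scaleR_left_distrib sum.distrib)
      show "\<exists>e. r *\<^sub>R (\<Sum>i<k. c i *\<^sub>R v i) = (\<Sum>i<k. e i *\<^sub>R v i)"
        by (rule exI[of _ "\<lambda>i. r * c i"]) (simp add: scaleR_sum_right)
    qed
  next
    case (step x)
    then obtain j where "j < k" "x = v j" by auto
    then have "x = (\<Sum>i<k. (if i = j then 1 else 0) *\<^sub>R v i)"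
      by (simp add: if_distrib[of "\<lambda>t. t *\<^sub>R _"] cong: if_cong)
    then show ?case by (rule exI[of _ "\<lambda>i. if i = j then 1 else 0"])
  qed
  with that show ?thesis by blast
qed

text \<open>The flag is built one vector at a time. Given the first j vectors, the characteristic
  polynomial of the map induced on the quotient by their span is the product of the remaining
  factors z - d i, so it vanishes at \<open>d j\<close>. The resulting eigenvector of the quotient
  lifts to the next flag vector. This realises the eigenvalues in the order prescribed by
  \<open>d\<close>.\<close>

lemma flag_exists:
  fixes \<alpha> :: "real ^ 'm \<Rightarrow> real ^ 'm" and d :: "nat \<Rightarrow> real"
  assumes \<alpha>: "linear \<alpha>"
    and det: "\<And>z. det (z *\<^sub>R mat 1 - matrix \<alpha>) = \<kappa> * (\<Prod>i<CARD('m). z - d i)"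
  obtains e where "lin_indep CARD('m) e"
    "\<And>i. i < CARD('m) \<Longrightarrow> \<alpha> (e i) - d i *\<^sub>R e i \<in> span (e ` {..<i})"
proof -
  obtain h0 where "bij_betw h0 (UNIV :: 'm set) {0..<CARD('m)}"
    using ex_bij_betw_finite_nat[of "UNIV :: 'm set"] by auto
  then have h: "bij_betw h0 UNIV {..<CARD('m)}" by (simp add: atLeast0LessThan)
  have "\<exists>e. lin_indep j e \<and> (\<forall>i<j. \<alpha> (e i) - d i *\<^sub>R e i \<in> span (e ` {..<i}))"
    if "j \<le> CARD('m)" for j
    using that
  proof (induction j)
    case 0
    then show ?case by (simp add: lin_indep_def)
  next
    case (Suc j)
    then obtain e where e: "lin_indep j e" "\<And>i. i < j \<Longrightarrow> \<alpha> (e i) - d i *\<^sub>R e i \<in> span (e ` {..<i})"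
      by auto
    obtain u where u: "lin_indep CARD('m) u" "\<And>i. i < j \<Longrightarrow> u i = e i"
      using lin_indep_extend[OF e(1)] by auto
    have uspan: "u ` {..<i} = e ` {..<i}" if "i \<le> j" for i
      using u(2) that by (auto simp: image_def)
    define F where "F = rows_det h0"
    have F: "alternating CARD('m) F" unfolding F_def by (rule alternating_rows_det[OF h])
    \<comment> \<open>Up to the factor \<open>F u\<close>, this is the characteristic polynomial of
      the map induced by \<alpha> on the quotient by the span of the first j vectors.\<close>
    define g where "g = (\<lambda>z. F (\<lambda>i. if i < j then u i else z *\<^sub>R u i - \<alpha> (u i)))"
    have fact: "det (z *\<^sub>R mat 1 - matrix \<alpha>) * F u = (\<Prod>i<j. z - d i) * g z" for z
    proof -
      have "(z *\<^sub>R mat 1 - matrix \<alpha>) *v y = z *\<^sub>R y - \<alpha> y" for y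
        using matrix_works[OF \<alpha>[unfolded linear_matrix_vector_mul_eq[symmetric]]] \<alpha>
        by (simp add: matrix_vector_mult_diff_rdistrib scaleR_matrix_vector_assoc[symmetric] matrix_works)
      then have "det (z *\<^sub>R mat 1 - matrix \<alpha>) * F u = F (\<lambda>i. z *\<^sub>R u i - \<alpha> (u i))"
        unfolding F_def by (simp add: rows_det_matrix_vector[symmetric])
      also have "\<dots> = (\<Prod>i<j. z - d i) * g z"
        unfolding g_def
      proof (rule alternating_triangular_initial[OF F, where L = "\<lambda>y. z *\<^sub>R y - \<alpha> y"])
        fix i assume i: "i < j"
        have eq: "z *\<^sub>R u i - \<alpha> (u i) - (z - d i) *\<^sub>R u i = - (\<alpha> (e i) - d i *\<^sub>R e i)"
          using u(2)[OF i] by (simp add: algebra_simps)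
        show "z *\<^sub>R u i - \<alpha> (u i) - (z - d i) *\<^sub>R u i \<in> span (u ` {..<i})"
          unfolding eq uspan[OF less_imp_le[OF i]] by (rule span_neg[OF e(2)[OF i]])
      qed (use Suc in simp)
      finally show ?thesis .
    qed
    define G where "G = (\<lambda>z. \<kappa> * F u * (\<Prod>i\<in>{j..<CARD('m)}. z - d i))"
    have eq: "g z = G z" if "z \<notin> d ` {..<j}" for z
    proof -
      have "(\<Prod>i<CARD('m). z - d i) = (\<Prod>i<j. z - d i) * (\<Prod>i\<in>{j..<CARD('m)}. z - d i)"
        using Suc.prems by (subst prod.union_disjoint[symmetric]) (auto intro!: prod.cong)
      then have "(\<Prod>i<j. z - d i) * g z = (\<Prod>i<j. z - d i) * G z"
        unfolding fact[of z, symmetric] det G_def by (simp only: mult_ac)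
      moreover have "(\<Prod>i<j. z - d i) \<noteq> 0" using that by auto
      ultimately show ?thesis by simp
    qed
    \<comment> \<open>The common factor can be cancelled only away from the earlier eigenvalues,
      among which \<open>d j\<close> may occur again; continuity of both sides supplies the value at
      \<open>d j\<close>.\<close>
    have "isCont (\<lambda>z. if i < j then u i else z *\<^sub>R u i - \<alpha> (u i)) (d j)" for i
      by (cases "i < j") simp_all
    then have "isCont g (d j)"
      unfolding g_def F_def by (rule isCont_rows_det)
    moreover have "isCont G (d j)"
      unfolding G_def by (intro continuous_intros)
    moreover have "\<forall>\<^sub>F z in at (d j). g z = G z"
    proof -
      have "finite (d ` {..<j} - {d j})" by simp
      then have "\<forall>\<^sub>F z in at (d j). z \<in> - (d ` {..<j} - {d j})"
        by (intro eventually_at_in_open' open_Compl finite_imp_closed) auto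
      moreover have "\<forall>\<^sub>F z in at (d j). z \<noteq> d j" by (simp add: eventually_at_filter)
      ultimately show ?thesis by eventually_elim (use eq in blast)
    qed
    ultimately have "g (d j) = G (d j)"
      unfolding isCont_def by (metis (mono_tags) tendsto_cong tendsto_unique[OF at_neq_bot])
    moreover have "G (d j) = 0" using Suc.prems by (auto simp: G_def)
    ultimately have "rows_det h0 (\<lambda>i. if i < j then u i else d j *\<^sub>R u i - \<alpha> (u i)) = 0"
      by (simp add: g_def F_def)
    then obtain c l where c: "(\<Sum>i<CARD('m). c i *\<^sub>R (if i < j then u i else d j *\<^sub>R u i - \<alpha> (u i))) = 0"
      and l: "l < CARD('m)" "c l \<noteq> 0"
      using rows_det_nonzero_iff[OF h] by blast
    \<comment> \<open>The part of the linear dependency that involves vectors beyond the flag; the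
      dependency says exactly that \<alpha> y - d j y falls back into the span of the first j
      vectors.\<close>
    define y where "y = (\<Sum>i\<in>{j..<CARD('m)}. c i *\<^sub>R u i)"
    have split: "(\<Sum>i<CARD('m). f i) = (\<Sum>i<j. f i) + (\<Sum>i\<in>{j..<CARD('m)}. f i)"
      for f :: "nat \<Rightarrow> real ^ 'm"
      using Suc.prems by (subst sum.union_disjoint[symmetric]) (auto intro!: sum.cong)
    have *: "(\<Sum>i\<in>{j..<CARD('m)}. c i *\<^sub>R (d j *\<^sub>R u i - \<alpha> (u i))) = d j *\<^sub>R y - \<alpha> y"
      by (simp add: y_def linear_sum[OF \<alpha>] linear_scale[OF \<alpha>] scaleR_sum_right sum_subtractf
          scaleR_diff_right mult.commute)
    have "(\<Sum>i<CARD('m). c i *\<^sub>R (if i < j then u i else d j *\<^sub>R u i - \<alpha> (u i))) =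
        (\<Sum>i<j. c i *\<^sub>R u i) + (\<Sum>i\<in>{j..<CARD('m)}. c i *\<^sub>R (d j *\<^sub>R u i - \<alpha> (u i)))"
      unfolding split by (intro arg_cong2[of _ _ _ _ "(+)"] sum.cong) auto
    then have "(\<Sum>i<j. c i *\<^sub>R u i) + (d j *\<^sub>R y - \<alpha> y) = 0"
      unfolding c * by (rule sym)
    then have ay: "\<alpha> y - d j *\<^sub>R y = (\<Sum>i<j. c i *\<^sub>R u i)"
      by (simp add: algebra_simps eq_neg_iff_add_eq_0)
    \<comment> \<open>Otherwise independence of \<open>u\<close> kills the coefficients from j on,
      and then the dependency reduces to one among the first j vectors, so all of them vanish,
      against the choice of l.\<close>
    have ynot: "y \<notin> span (e ` {..<j})"
    proof
      assume "y \<in> span (e ` {..<j})"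
      then obtain b where "y = (\<Sum>i<j. b i *\<^sub>R e i)" by (rule span_image_lessThan)
      then have "(\<Sum>i<CARD('m). (if i < j then - b i else c i) *\<^sub>R u i) = 0"
        using u(2) by (simp add: split y_def sum_negf)
      then have 0: "(if i < j then - b i else c i) = 0" if "i < CARD('m)" for i
        using u(1)[unfolded lin_indep_def, rule_format, of "\<lambda>i. if i < j then - b i else c i" i] that
        by blast
      have c0: "c i = 0" if "j \<le> i" "i < CARD('m)" for i using 0[of i] that by simp
      then have "y = 0" by (simp add: y_def)
      then have "(\<Sum>i<j. c i *\<^sub>R u i) = 0" using ay linear_0[OF \<alpha>] by simp
      then have "(\<Sum>i<j. c i *\<^sub>R e i) = 0" using u(2) by simp
      then have "c i = 0" if "i < j" for i using e(1) that by (auto simp: lin_indep_def)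
      with c0 l show False by (cases "l < j") auto
    qed
    have "lin_indep (Suc j) (e(j := y))"
      unfolding lin_indep_iff
    proof
      have img: "(e(j := y)) ` {..<Suc j} = insert y (e ` {..<j})"
        by (auto simp: image_def less_Suc_eq)
      have "inj_on e {..<j}" using e(1) by (simp add: lin_indep_iff)
      then have "inj_on (e(j := y)) {..<j}"
        unfolding inj_on_def by (metis fun_upd_other lessThan_iff less_irrefl)
      moreover have "y \<notin> e ` {..<j}" using ynot span_base[of y "e ` {..<j}"] by argo
      ultimately show "inj_on (e(j := y)) {..<Suc j}"
        unfolding lessThan_Suc inj_on_insert by auto
      show "independent ((e(j := y)) ` {..<Suc j})"
        unfolding img using e(1) ynot by (intro independent_insertI) (auto simp: lin_indep_iff)
    qed
    moreover have "\<alpha> ((e(j := y)) i) - d i *\<^sub>R (e(j := y)) i \<in> span ((e(j := y)) ` {..<i})"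
      if "i < Suc j" for i
    proof -
      have img: "(e(j := y)) ` {..<i} = e ` {..<i}" using that by (auto simp: image_def)
      show ?thesis
      proof (cases "i = j")
        case True
        have "(\<Sum>i<j. c i *\<^sub>R u i) \<in> span (e ` {..<j})"
          using u(2) by (intro span_sum span_scale span_base) auto
        then show ?thesis using True ay img by simp
      next
        case False
        then show ?thesis using that e(2) unfolding img by simp
      qed
    qed
    ultimately show ?case by blast
  qed
  from this[OF order_refl] that show ?thesis by blast
qed

section \<open>The one-parameter group and the Riemannian volume\<close>

text \<open>Testing with linear functionals turns the operator exponential into scalar power series,
  which can be differentiated termwise.\<close>

lemma exp_end_functional_sums:
  fixes \<alpha> :: "'v::euclidean_space \<Rightarrow> 'v" and f :: "'v \<Rightarrow> real"
  assumes "linear \<alpha>" "linear f"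
  shows "(\<lambda>k. f ((\<alpha> ^^ k) v) / fact k * t ^ k) sums f (exp_end t \<alpha> v)"
proof -
  have "(\<lambda>k. (t ^ k / fact k) *\<^sub>R (\<alpha> ^^ k) v) sums exp_end t \<alpha> v"
    unfolding exp_end_def
    by (rule summable_sums[OF summable_norm_cancel[OF exp_end_summable[OF assms(1)]]])
  from bounded_linear.sums[OF _ this, of f] assms(2) show ?thesis
    by (simp add: linear_conv_bounded_linear linear_scale[OF assms(2)] mult.commute)
qed

lemma exp_end_functional_has_derivative:
  fixes \<alpha> :: "'v::euclidean_space \<Rightarrow> 'v" and f :: "'v \<Rightarrow> real"
  assumes "linear \<alpha>" "linear f"
  shows "((\<lambda>t. f (exp_end t \<alpha> v)) has_real_derivative f (exp_end t \<alpha> (\<alpha> v))) (at t)"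
proof -
  let ?c = "\<lambda>k. f ((\<alpha> ^^ k) v) / fact k"
  note s = exp_end_functional_sums[OF assms]
  have "diffs ?c = (\<lambda>k. f ((\<alpha> ^^ k) (\<alpha> v)) / fact k)"
  proof (rule ext)
    fix k
    have "(\<alpha> ^^ Suc k) v = (\<alpha> ^^ k) (\<alpha> v)" by (simp add: funpow_swap1)
    then show "diffs ?c k = f ((\<alpha> ^^ k) (\<alpha> v)) / fact k"
      unfolding diffs_def by (simp del: of_nat_Suc funpow.simps)
  qed
  moreover have "((\<lambda>x. \<Sum>n. ?c n * x ^ n) has_field_derivative (\<Sum>n. diffs ?c n * t ^ n)) (at t)"
    by (rule termdiffs_strong_converges_everywhere) (rule sums_summable[OF s])
  ultimately show ?thesis using s by (simp add: sums_iff)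
qed

lemma continuous_on_exp_end:
  fixes \<alpha> :: "'v::euclidean_space \<Rightarrow> 'v"
  assumes "linear \<alpha>"
  shows "continuous_on S (\<lambda>t. exp_end t \<alpha> v)"
proof (rule continuous_on_componentwise[THEN iffD2], intro ballI)
  fix b :: 'v
  have "isCont (\<lambda>t. exp_end t \<alpha> v \<bullet> b) t" for t
    by (rule DERIV_isCont[OF exp_end_functional_has_derivative[OF assms]])
      (simp add: bounded_linear.linear bounded_linear_inner_left)
  then show "continuous_on S (\<lambda>t. exp_end t \<alpha> v \<bullet> b)"
    by (simp add: continuous_at_imp_continuous_on)
qed

lemma exp_end_0 [simp]: "exp_end 0 \<alpha> v = v"
proof -
  have "(\<Sum>k. (0 ^ k / fact k) *\<^sub>R (\<alpha> ^^ k) v) = (0 ^ 0 / fact 0) *\<^sub>R (\<alpha> ^^ 0) v"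
    by (rule suminf_finite[of "{0}", simplified]) simp
  then show ?thesis by (simp add: exp_end_def)
qed

lemma exp_end_minus [simp]:
  fixes \<alpha> :: "'v::euclidean_space \<Rightarrow> 'v"
  assumes "linear \<alpha>"
  shows "exp_end t \<alpha> (exp_end (- t) \<alpha> v) = v" "exp_end (- t) \<alpha> (exp_end t \<alpha> v) = v"
  using exp_end_add[OF assms, of t "- t" v] exp_end_add[OF assms, of "- t" t v] by simp_all

text \<open>
  The basis \<open>e\<close> with dual basis \<open>ell\<close> spans a complete flag of \<open>\<alpha>\<close>-invariant subspaces; \<open>\<mu>\<close> lists the
  diagonal entries, i.e. \<open>\<mu> i\<close> is the eigenvalue \<open>\<lambda>\<^bsub>i+1\<^esub>\<close> of the informal statement.
\<close>

locale triangular =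
  fixes \<alpha> :: "'v::euclidean_space \<Rightarrow> 'v" and e :: "nat \<Rightarrow> 'v" and ell :: "nat \<Rightarrow> 'v \<Rightarrow> real"
    and \<mu> :: "nat \<Rightarrow> real" and N :: nat
  assumes lin: "linear \<alpha>" and ell_lin: "\<And>i. i < N \<Longrightarrow> linear (ell i)"
    and expand: "\<And>y. y = (\<Sum>i<N. ell i y *\<^sub>R e i)"
    and dual: "\<And>i j. i < N \<Longrightarrow> j < N \<Longrightarrow> ell i (e j) = (if i = j then 1 else 0)"
    and upper: "\<And>i j. i < N \<Longrightarrow> j < i \<Longrightarrow> ell i (\<alpha> (e j)) = 0"
    and diagonal: "\<And>i. i < N \<Longrightarrow> ell i (\<alpha> (e i)) = \<mu> i"
begin

lemma funpow_upper:
  assumes "i < N" "j \<le> i"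
  shows "ell i ((\<alpha> ^^ k) (e j)) = (if i = j then \<mu> i ^ k else 0)"
  using assms
proof (induction k arbitrary: j i)
  case 0
  then show ?case using dual by simp
next
  case (Suc k)
  let ?y = "(\<alpha> ^^ k) (e j)"
  have "ell i (\<alpha> ?y) = ell i (\<alpha> (\<Sum>l<N. ell l ?y *\<^sub>R e l))"
    using expand[of ?y] by simp
  also have "\<dots> = (\<Sum>l<N. ell l ?y * ell i (\<alpha> (e l)))"
    using ell_lin[OF Suc.prems(1)] by (simp add: linear_sum[OF lin] linear_scale[OF lin] linear_sum linear_scale)
  also have "\<dots> = (\<Sum>l<N. if l = i then ell i ?y * \<mu> i else 0)"
  proof (intro sum.cong refl)
    fix l assume l: "l \<in> {..<N}"
    consider "l < i" | "l = i" | "i < l" by linarith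
    then show "ell l ?y * ell i (\<alpha> (e l)) = (if l = i then ell i ?y * \<mu> i else 0)"
    proof cases
      case 1 then show ?thesis using upper Suc.prems by simp
    next
      case 2 then show ?thesis using diagonal Suc.prems by simp
    next
      case 3 then show ?thesis using Suc.IH[of l j] Suc.prems l by simp
    qed
  qed
  also have "\<dots> = (if i = j then \<mu> i ^ Suc k else 0)"
    using Suc by simp
  finally show ?case by simp
qed

lemma exp_end_upper:
  assumes "i < N" "j \<le> i"
  shows "ell i (exp_end t \<alpha> (e j)) = (if i = j then exp (t * \<mu> i) else 0)"
proof -
  have "(\<lambda>k. (if i = j then \<mu> i ^ k else 0) / fact k * t ^ k) sums ell i (exp_end t \<alpha> (e j))"
    using exp_end_functional_sums[OF lin ell_lin[OF assms(1)], of "e j" t]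
    by (simp add: funpow_upper[OF assms])
  moreover have "(\<lambda>k. \<mu> i ^ k / fact k * t ^ k) sums exp (t * \<mu> i)"
    using exp_converges[of "t * \<mu> i"] by (simp add: power_mult_distrib field_simps)
  moreover have "(\<lambda>k. 0 / fact k * t ^ k :: real) sums 0" by simp
  ultimately show ?thesis by (auto intro: sums_unique2)
qed

lemma exp_end_flag:
  assumes "i < N"
  shows "exp_end t \<alpha> (e i) - exp (t * \<mu> i) *\<^sub>R e i \<in> span (e ` {..<i})"
proof -
  let ?y = "exp_end t \<alpha> (e i)"
  have "(\<Sum>l<N. ell l ?y *\<^sub>R e l) = (\<Sum>l<Suc i. ell l ?y *\<^sub>R e l)"
    using assms exp_end_upper by (intro sum.mono_neutral_right) auto
  then have "?y = (\<Sum>l<Suc i. ell l ?y *\<^sub>R e l)" using expand[of ?y] by argo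
  moreover have "(\<Sum>l<Suc i. ell l ?y *\<^sub>R e l) = (\<Sum>l<i. ell l ?y *\<^sub>R e l) + exp (t * \<mu> i) *\<^sub>R e i"
    using exp_end_upper[OF assms, of i t] by simp
  ultimately have "?y - exp (t * \<mu> i) *\<^sub>R e i = (\<Sum>l<i. ell l ?y *\<^sub>R e l)"
    by (metis add_diff_cancel_right')
  also have "\<dots> \<in> span (e ` {..<i})"
    by (intro span_sum span_scale span_base imageI)
  finally show ?thesis .
qed

text \<open>On the invariant span of the first k flag vectors an alternating k-form sees only the
  determinant of \<open>exp_end t \<alpha>\<close>, and the strictly triangular part drops out. The
  factor is exact, without the loss of \<open>exp_coeff_bound\<close>; the borderline exponent in
  the nonvanishing part depends on this. With k = N it also gives the volume density.\<close>

lemma alternating_exp_end_flag: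
  assumes "alternating k f" "k \<le> N"
  shows "f (\<lambda>i. exp_end t \<alpha> (e i)) = exp (t * (\<Sum>i<k. \<mu> i)) * f e"
  using alternating_triangular[OF assms(1), of "exp_end t \<alpha>" e "\<lambda>i. exp (t * \<mu> i)"]
    exp_end_flag assms(2) by (simp add: exp_sum sum_distrib_left)

end

lemma triangular_exists:
  fixes \<alpha> :: "real ^ 'm \<Rightarrow> real ^ 'm"
  assumes \<alpha>: "linear \<alpha>" and e: "lin_indep CARD('m) e"
    and flag: "\<And>i. i < CARD('m) \<Longrightarrow> \<alpha> (e i) - \<mu> i *\<^sub>R e i \<in> span (e ` {..<i})"
  obtains ell where "triangular \<alpha> e ell \<mu> CARD('m)"
proof
  define B where "B = e ` {..<CARD('m)}"
  have inj: "inj_on e {..<CARD('m)}" and B: "independent B"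
    using e by (auto simp: lin_indep_iff B_def)
  have "card B = CARD('m)" using inj by (simp add: B_def card_image)
  then have "UNIV \<subseteq> span B" using card_ge_dim_independent[of B UNIV] B by simp
  then have sp: "y \<in> span B" for y by blast
  define ell where "ell = (\<lambda>i y. representation B y (e i))"
  have lin: "linear (ell i)" for i
    unfolding ell_def
    by (intro linearI) (simp_all add: representation_add[OF B sp sp] representation_scale[OF B sp])
  have dual: "ell i (e j) = (if i = j then 1 else 0)" if "i < CARD('m)" "j < CARD('m)" for i j
  proof -
    have "e j \<in> B" using that by (simp add: B_def)
    then have "ell i (e j) = (if e i = e j then 1 else 0)"
      by (simp add: ell_def representation_basis[OF B])
    then show ?thesis using that inj by (simp add: inj_on_eq_iff)
  qed
  have 0: "ell i y = 0" if "i < CARD('m)" "j \<le> i" "y \<in> span (e ` {..<j})" for i j y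
    using that(3)
  proof (induction rule: span_induct)
    case base
    show ?case using linear_0[OF lin] linear_add[OF lin] linear_scale[OF lin]
      by (auto simp: subspace_def)
  next
    case (step x)
    then show ?case using dual that by auto
  qed
  have flag': "\<alpha> (e i) = \<mu> i *\<^sub>R e i + (\<alpha> (e i) - \<mu> i *\<^sub>R e i)" for i by simp
  show "triangular \<alpha> e ell \<mu> CARD('m)"
  proof (rule triangular.intro)
    fix i j assume ij: "i < CARD('m)" "j < i"
    have "ell i (\<alpha> (e j)) = \<mu> j * ell i (e j) + ell i (\<alpha> (e j) - \<mu> j *\<^sub>R e j)"
      by (subst flag') (simp only: linear_add[OF lin] linear_scale[OF lin] real_scaleR_def)
    then show "ell i (\<alpha> (e j)) = 0" using dual[of i j] 0[OF _ _ flag, of i j] ij by simp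
  next
    fix i assume i: "i < CARD('m)"
    have "ell i (\<alpha> (e i)) = \<mu> i * ell i (e i) + ell i (\<alpha> (e i) - \<mu> i *\<^sub>R e i)"
      by (subst flag') (simp only: linear_add[OF lin] linear_scale[OF lin] real_scaleR_def)
    then show "ell i (\<alpha> (e i)) = \<mu> i" using dual[of i i] 0[OF _ _ flag, of i i] i by simp
  next
    fix y
    have "(\<Sum>b\<in>B. representation B y b *\<^sub>R b) = y"
      by (rule sum_representation_eq[OF B sp]) (auto simp: B_def)
    then show "y = (\<Sum>i<CARD('m). ell i y *\<^sub>R e i)"
      using inj by (simp add: ell_def B_def sum.reindex)
  qed (use \<alpha> lin dual in auto)
qed

lemma trace_eq_sum_diagonal:
  fixes \<alpha> :: "real ^ 'm \<Rightarrow> real ^ 'm"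
  assumes "triangular \<alpha> e ell \<mu> CARD('m)"
  shows "trace (matrix \<alpha>) = (\<Sum>i<CARD('m). \<mu> i)"
proof -
  interpret triangular \<alpha> e ell \<mu> "CARD('m)" by fact
  have "trace (matrix \<alpha>) = (\<Sum>a\<in>UNIV. \<alpha> (axis a 1) $ a)"
    by (simp add: trace_def matrix_def)
  also have "\<dots> = (\<Sum>a\<in>UNIV. \<Sum>i<CARD('m). ell i (\<alpha> (axis a 1)) * e i $ a)"
  proof (intro sum.cong refl)
    fix a :: 'm
    have "\<alpha> (axis a 1) $ a = (\<Sum>i<CARD('m). ell i (\<alpha> (axis a 1)) *\<^sub>R e i) $ a"
      using expand[of "\<alpha> (axis a 1)"] by simp
    then show "\<alpha> (axis a 1) $ a = (\<Sum>i<CARD('m). ell i (\<alpha> (axis a 1)) * e i $ a)"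
      by simp
  qed
  also have "\<dots> = (\<Sum>i<CARD('m). \<Sum>a\<in>UNIV. ell i (\<alpha> (axis a 1)) * e i $ a)"
    by (rule sum.swap)
  also have "\<dots> = (\<Sum>i<CARD('m). ell i (\<alpha> (e i)))"
  proof (intro sum.cong refl)
    fix i assume "i \<in> {..<CARD('m)}"
    then have l: "linear (\<lambda>y. ell i (\<alpha> y))"
      using linear_compose[OF lin ell_lin] by (simp add: o_def)
    have "e i = (\<Sum>a\<in>UNIV. (e i $ a) *\<^sub>R axis a 1)"
      by (metis (no_types) basis_expansion scalar_mult_eq_scaleR sum.cong)
    then have "ell i (\<alpha> (e i)) = ell i (\<alpha> (\<Sum>a\<in>UNIV. (e i $ a) *\<^sub>R axis a 1))" by simp
    then show "(\<Sum>a\<in>UNIV. ell i (\<alpha> (axis a 1)) * e i $ a) = ell i (\<alpha> (e i))"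
      by (simp only: linear_sum[OF l] linear_scale[OF l]) (simp add: mult.commute)
  qed
  also have "\<dots> = (\<Sum>i<CARD('m). \<mu> i)" using diagonal by simp
  finally show ?thesis .
qed

lemma det_exp_end:
  fixes \<alpha> :: "real ^ 'm \<Rightarrow> real ^ 'm"
  assumes "triangular \<alpha> e ell \<mu> CARD('m)" and e: "lin_indep CARD('m) e"
  shows "det (matrix (exp_end t \<alpha>)) = exp (t * (\<Sum>i<CARD('m). \<mu> i))"
proof -
  interpret triangular \<alpha> e ell \<mu> "CARD('m)" by fact
  obtain h0 where "bij_betw h0 (UNIV :: 'm set) {0..<CARD('m)}"
    using ex_bij_betw_finite_nat[of "UNIV :: 'm set"] by auto
  then have h: "bij_betw h0 UNIV {..<CARD('m)}" by (simp add: atLeast0LessThan)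
  have "det (matrix (exp_end t \<alpha>)) * rows_det h0 e = rows_det h0 (\<lambda>i. matrix (exp_end t \<alpha>) *v e i)"
    by (simp add: rows_det_matrix_vector)
  also have "\<dots> = rows_det h0 (\<lambda>i. exp_end t \<alpha> (e i))"
    by (simp add: matrix_works[OF linear_exp_end[OF lin, unfolded linear_matrix_vector_mul_eq[symmetric]]])
  also have "\<dots> = exp (t * (\<Sum>i<CARD('m). \<mu> i)) * rows_det h0 e"
    by (rule alternating_exp_end_flag[OF alternating_rows_det[OF h]]) simp
  finally show ?thesis
    using rows_det_nonzero_iff[OF h, of e] e by (simp add: lin_indep_def)
qed

section \<open>The Gram determinant of the metric\<close>

definition inner_matrix :: "(real ^ 'm \<Rightarrow> real ^ 'm \<Rightarrow> real) \<Rightarrow> real ^ 'm ^ 'm" where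
  "inner_matrix B = (\<chi> i j. B (axis i 1) (axis j 1))"

lemma inner_product_expand:
  fixes B :: "real ^ 'm \<Rightarrow> real ^ 'm \<Rightarrow> real"
  assumes "inner_product B"
  shows "B x y = (\<Sum>i\<in>UNIV. \<Sum>j\<in>UNIV. x $ i * y $ j * B (axis i 1) (axis j 1))"
proof -
  have l: "linear (B v)" and s: "B v u = B u v" for v u using assms by (auto simp: inner_product_def)
  have ex: "z = (\<Sum>a\<in>UNIV. (z $ a) *\<^sub>R axis a 1)" for z :: "real ^ 'm"
    by (metis (no_types) basis_expansion scalar_mult_eq_scaleR sum.cong)
  have 1: "B v z = (\<Sum>j\<in>UNIV. z $ j * B v (axis j 1))" for v z
    by (subst ex[of z]) (simp only: linear_sum[OF l] linear_scale[OF l] real_scaleR_def)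
  have "B x y = (\<Sum>j\<in>UNIV. y $ j * B (axis j 1) x)" using 1[of x y] s by simp
  also have "\<dots> = (\<Sum>j\<in>UNIV. \<Sum>i\<in>UNIV. x $ i * y $ j * B (axis i 1) (axis j 1))"
  proof (intro sum.cong refl)
    fix j
    show "y $ j * B (axis j 1) x = (\<Sum>i\<in>UNIV. x $ i * y $ j * B (axis i 1) (axis j 1))"
      unfolding 1[of _ x] sum_distrib_left by (intro sum.cong refl) (simp add: s[of "axis j 1"])
  qed
  finally show ?thesis by (subst sum.swap)
qed

text \<open>All matrices on the segment from the identity to the Gram matrix are positive definite,
  hence invertible. The determinant therefore cannot change sign along it, by the intermediate value
  theorem.\<close>

lemma det_inner_matrix_pos:
  assumes B: "inner_product B"
  shows "det (inner_matrix B) > 0"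
proof (rule ccontr)
  assume neg: "\<not> det (inner_matrix B) > 0"
  define A where "A = (\<lambda>s::real. (1 - s) *\<^sub>R mat 1 + s *\<^sub>R inner_matrix B)"
  have cont: "continuous_on {0..1} (\<lambda>s. det (A s))"
    unfolding A_def det_def by (intro continuous_intros)
  have "\<exists>s\<ge>0. s \<le> 1 \<and> det (A s) = 0"
    by (rule IVT2') (use neg cont in \<open>auto simp: A_def\<close>)
  then obtain s where s: "0 \<le> s" "s \<le> 1" "det (A s) = 0" by blast
  then have "\<not> (\<exists>B. B ** A s = mat 1)"
    by (simp add: invertible_left_inverse[symmetric] invertible_det_nz)
  then obtain x where x: "x \<noteq> 0" "A s *v x = 0" by (auto simp: matrix_left_invertible_ker)
  have "x \<bullet> (A s *v x) = (1 - s) * (x \<bullet> x) + s * B x x"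
  proof -
    have "x \<bullet> (inner_matrix B *v x) = B x x"
      by (simp add: inner_vec_def matrix_vector_mult_def inner_matrix_def inner_product_expand[OF B, of x x]
          sum_distrib_left mult_ac)
    then show ?thesis
      by (simp add: A_def matrix_vector_mult_add_rdistrib scaleR_matrix_vector_assoc[symmetric]
          inner_right_distrib)
  qed
  moreover have "B x x > 0" "x \<bullet> x > 0" using B x(1) by (auto simp: inner_product_def)
  then have "(1 - s) * (x \<bullet> x) + s * B x x > 0"
    using s by (cases "s = 0") (auto intro: add_nonneg_pos)
  ultimately show False using x(2) by simp
qed

lemma det_inner_matrix_compose:
  fixes P :: "real ^ 'm \<Rightarrow> real ^ 'm"
  assumes "inner_product B"
  shows "det (\<chi> i j. B (P (axis i 1)) (P (axis j 1))) = (det (matrix P))\<^sup>2 * det (inner_matrix B)"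
proof -
  have "(\<chi> i j. B (P (axis i 1)) (P (axis j 1))) =
      transpose (matrix P) ** inner_matrix B ** matrix P"
    unfolding vec_eq_iff
  proof (intro allI)
    fix i j
    have "(transpose (matrix P) ** inner_matrix B ** matrix P) $ i $ j =
      (\<Sum>l\<in>UNIV. \<Sum>k\<in>UNIV. P (axis i 1) $ k * B (axis k 1) (axis l 1) * P (axis j 1) $ l)"
      by (simp add: matrix_matrix_mult_def transpose_def matrix_def inner_matrix_def sum_distrib_right)
    also have "\<dots> = B (P (axis i 1)) (P (axis j 1))"
      by (subst sum.swap) (simp add: inner_product_expand[OF assms, of "P (axis i 1)"] mult_ac)
    finally show "(\<chi> i j. B (P (axis i 1)) (P (axis j 1))) $ i $ j =
        (transpose (matrix P) ** inner_matrix B ** matrix P) $ i $ j" by simp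
  qed
  then show ?thesis by (simp add: det_mul power2_eq_square)
qed

text \<open>The vertical basis vector is orthogonal to the horizontal ones, so permutations that
  move it contribute 0. The remaining ones are transported along \<open>\<iota>\<close> to
  permutations of the index type, which turns the sum over \<open>Basis\<close> into a determinant
  of a matrix.\<close>

lemma gram_det_heintze_metric:
  fixes \<alpha> :: "real ^ 'm \<Rightarrow> real ^ 'm"
  assumes "linear \<alpha>" "inner_product B"
  shows "gram_det (heintze_metric \<alpha> B c) (x, t) =
    c * ((det (matrix (exp_end (- t) \<alpha>)))\<^sup>2 * det (inner_matrix B))"
proof -
  let ?P = "exp_end (- t) \<alpha>" and ?g = "heintze_metric \<alpha> B c"
  have P0: "?P 0 = 0" by (rule linear_0[OF linear_exp_end[OF assms(1)]])
  have B0: "B v 0 = 0" "B 0 v = 0" for v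
    using assms(2) linear_0 unfolding inner_product_def by metis+
  define \<iota> :: "'m \<Rightarrow> (real ^ 'm) \<times> real" where "\<iota> = (\<lambda>i. (axis i 1, 0))"
  define b0 :: "(real ^ 'm) \<times> real" where "b0 = (0, 1)"
  define H where "H = range \<iota>"
  have Basis: "(Basis :: ((real ^ 'm) \<times> real) set) = insert b0 H"
    by (auto simp: Basis_prod_def H_def \<iota>_def b0_def Basis_vec_def image_iff)
  have b0: "b0 \<notin> H" by (auto simp: b0_def H_def \<iota>_def)
  have inj: "inj \<iota>" by (auto simp: inj_def \<iota>_def axis_eq_axis)
  then have bij: "bij_betw \<iota> UNIV H" by (simp add: bij_betw_def H_def)
  have fH: "finite H" by (simp add: H_def)
  have gb0: "?g (x, t) b0 b = c * snd b" for b
    by (simp add: heintze_metric_def b0_def P0 B0 case_prod_unfold)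
  have g\<iota>: "?g (x, t) (\<iota> i) (\<iota> j) = B (?P (axis i 1)) (?P (axis j 1))" for i j
    by (simp add: heintze_metric_def \<iota>_def)
  let ?T = "\<lambda>\<sigma>. of_int (sign \<sigma>) * (\<Prod>b\<in>insert b0 H. ?g (x, t) b (\<sigma> b))"
  have "gram_det ?g (x, t) = (\<Sum>\<sigma> | \<sigma> permutes insert b0 H. ?T \<sigma>)"
    by (simp add: gram_det_def Basis)
  also have "\<dots> = (\<Sum>\<sigma> | \<sigma> permutes H. ?T \<sigma>)"
  proof (rule sum.mono_neutral_right)
    show "finite {\<sigma>. \<sigma> permutes insert b0 H}" using fH by (simp add: finite_permutations)
    show "{\<sigma>. \<sigma> permutes H} \<subseteq> {\<sigma>. \<sigma> permutes insert b0 H}"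
      by (auto intro: permutes_subset)
    show "\<forall>\<sigma>\<in>{\<sigma>. \<sigma> permutes insert b0 H} - {\<sigma>. \<sigma> permutes H}. ?T \<sigma> = 0"
    proof
      fix \<sigma> assume \<sigma>: "\<sigma> \<in> {\<sigma>. \<sigma> permutes insert b0 H} - {\<sigma>. \<sigma> permutes H}"
      then have "\<sigma> b0 \<noteq> b0" using permutes_superset[of \<sigma> "insert b0 H" H] by auto
      moreover have "\<sigma> b0 \<in> insert b0 H" using \<sigma> permutes_in_image[of \<sigma> "insert b0 H" b0] by simp
      ultimately have "\<sigma> b0 \<in> H" by blast
      then have "?g (x, t) b0 (\<sigma> b0) = 0" by (auto simp: gb0 H_def \<iota>_def)
      then show "?T \<sigma> = 0" using fH b0 by simp
    qed
  qed
  also have "\<dots> = (\<Sum>\<sigma> | \<sigma> permutes (UNIV :: 'm set). ?T (map_permutation UNIV \<iota> \<sigma>))"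
  proof -
    have "(\<lambda>\<pi> x. if x \<in> H then \<iota> (\<pi> (inv_into UNIV \<iota> x)) else x) = map_permutation UNIV \<iota>"
      by (simp add: fun_eq_iff map_permutation_def restrict_id_def H_def)
    with bij_betw_permutations[OF bij]
    have "bij_betw (map_permutation UNIV \<iota>) {\<sigma>. \<sigma> permutes UNIV} {\<sigma>. \<sigma> permutes H}" by simp
    from sum.reindex_bij_betw[OF this, of ?T] show ?thesis by (rule sym)
  qed
  also have "\<dots> = (\<Sum>\<sigma> | \<sigma> permutes (UNIV :: 'm set).
      c * (of_int (sign \<sigma>) * (\<Prod>i\<in>UNIV. B (?P (axis i 1)) (?P (axis (\<sigma> i) 1)))))"
  proof (intro sum.cong refl)
    fix \<sigma> assume "\<sigma> \<in> {\<sigma>. \<sigma> permutes (UNIV :: 'm set)}"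
    then have \<sigma>: "\<sigma> permutes UNIV" by simp
    let ?\<sigma> = "map_permutation UNIV \<iota> \<sigma>"
    have "?\<sigma> permutes H" by (rule map_permutation_permutes[OF bij \<sigma>])
    then have "?\<sigma> b0 = b0" using b0 by (rule permutes_not_in)
    then have "?g (x, t) b0 (?\<sigma> b0) = c * snd b0" by (simp only: gb0)
    then have "?g (x, t) b0 (?\<sigma> b0) = c" by (simp add: b0_def)
    moreover have "(\<Prod>b\<in>H. ?g (x, t) b (?\<sigma> b)) = (\<Prod>i\<in>UNIV. B (?P (axis i 1)) (?P (axis (\<sigma> i) 1)))"
      unfolding H_def by (subst prod.reindex[OF inj]) (simp add: map_permutation_apply[OF inj] g\<iota>)
    ultimately show "?T ?\<sigma> = c * (of_int (sign \<sigma>) * (\<Prod>i\<in>UNIV. B (?P (axis i 1)) (?P (axis (\<sigma> i) 1))))"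
      using sign_map_permutation[OF inj \<sigma>] fH b0 by simp
  qed
  also have "\<dots> = c * det (\<chi> i j. B (?P (axis i 1)) (?P (axis j 1)))"
    by (simp add: det_def sum_distrib_left)
  finally show ?thesis by (simp only: det_inner_matrix_compose[OF assms(2)])
qed

section \<open>Left-invariant frames\<close>

lemma inner_product_coercive:
  fixes B :: "'v::euclidean_space \<Rightarrow> 'v \<Rightarrow> real"
  assumes B: "inner_product B"
  obtains b where "b > 0" "\<And>w. b * (norm w)\<^sup>2 \<le> B w w"
proof -
  have lin: "linear (B v)" and sym: "B v u = B u v" for v u using B by (auto simp: inner_product_def)
  have "linear (\<lambda>v. B v u)" for u using lin[of u] by (simp only: sym[of _ u])
  then have "bounded_bilinear B"
    using lin by (simp add: bilinear_conv_bounded_bilinear[symmetric] bilinear_def)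
  then have cont: "continuous_on (sphere 0 1) (\<lambda>w. B w w)"
    by (intro bounded_bilinear.continuous_on[of B] continuous_intros)
  have "sphere (0::'v) 1 \<noteq> {}" by simp
  then obtain w0 where w0: "w0 \<in> sphere 0 1" "\<And>w. w \<in> sphere 0 1 \<Longrightarrow> B w0 w0 \<le> B w w"
    using continuous_attains_inf[OF compact_sphere _ cont] by auto
  have "w0 \<noteq> 0" using w0(1) by auto
  then have pos: "B w0 w0 > 0" using B by (auto simp: inner_product_def)
  moreover have "B w0 w0 * (norm w)\<^sup>2 \<le> B w w" for w
  proof (cases "w = 0")
    case True
    then show ?thesis using linear_0[OF lin] by simp
  next
    case False
    let ?u = "(1 / norm w) *\<^sub>R w"
    have w: "w = norm w *\<^sub>R ?u" using False by simp
    have "B w w = B (norm w *\<^sub>R ?u) (norm w *\<^sub>R ?u)" by (rule arg_cong2[OF w w])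
    also have "\<dots> = (norm w)\<^sup>2 * B ?u ?u"
      using linear_scale[OF lin, of "norm w *\<^sub>R ?u" "norm w" ?u] linear_scale[OF lin, of ?u "norm w" ?u]
        sym[of "norm w *\<^sub>R ?u" ?u]
      by (simp only: real_scaleR_def power2_eq_square mult.assoc)
    also have "\<dots> \<ge> (norm w)\<^sup>2 * B w0 w0"
      using w0(2)[of ?u] False by (intro mult_left_mono) auto
    finally show ?thesis by (simp add: mult.commute)
  qed
  ultimately show ?thesis by (rule that)
qed

lemma alternating_scale_all:
  assumes f: "alternating k f"
  shows "f (\<lambda>i. r i *\<^sub>R v i) = (\<Prod>i<k. r i) * f v"
proof -
  have "f (\<lambda>i. if i < j then r i *\<^sub>R v i else v i) = (\<Prod>i<j. r i) * f v" if "j \<le> k" for j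
    using that
  proof (induction j)
    case (Suc j)
    let ?w = "\<lambda>i. if i < j then r i *\<^sub>R v i else v i"
    have "f (\<lambda>i. if i < Suc j then r i *\<^sub>R v i else v i) = f (?w(j := r j *\<^sub>R v j))"
      by (rule arg_cong[of _ _ f]) (auto simp: less_Suc_eq)
    also have "\<dots> = r j * f (?w(j := v j))"
      using Suc.prems by (intro alternating_upd_scale[OF f]) simp
    also have "?w(j := v j) = ?w" by auto
    finally show ?case using Suc by simp
  qed simp
  from this[of k] show ?thesis
    using alternating_cong[OF f, of "\<lambda>i. if i < k then r i *\<^sub>R v i else v i" "\<lambda>i. r i *\<^sub>R v i"] by simp
qed

text \<open>Induction by removing the maximum of S: a set of more than j naturals has maximum at
  least j, so the removed term is at least the j-th one by monotonicity.\<close>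

lemma sum_prefix_le_sum_subset:
  fixes \<mu> :: "nat \<Rightarrow> real"
  assumes "\<And>i. i < N \<Longrightarrow> 0 \<le> \<mu> i" "\<And>i j. i \<le> j \<Longrightarrow> j < N \<Longrightarrow> \<mu> i \<le> \<mu> j"
  shows "S \<subseteq> {..<N} \<Longrightarrow> j \<le> card S \<Longrightarrow> (\<Sum>i<j. \<mu> i) \<le> (\<Sum>i\<in>S. \<mu> i)"
proof (induction j arbitrary: S)
  case 0
  then show ?case using assms(1) by (auto intro: sum_nonneg)
next
  case (Suc j)
  have fin: "finite S" using Suc.prems finite_subset by blast
  have ne: "S \<noteq> {}" using Suc.prems by auto
  define s where "s = Max S"
  have s: "s \<in> S" using fin ne by (simp add: s_def)
  have "S \<subseteq> {..s}" using fin by (auto simp: s_def)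
  from card_mono[OF _ this] have "j \<le> s" using Suc.prems by simp
  moreover have "s < N" using s Suc.prems by auto
  ultimately have "\<mu> j \<le> \<mu> s" using assms(2) by blast
  moreover have "(\<Sum>i<j. \<mu> i) \<le> (\<Sum>i\<in>S - {s}. \<mu> i)"
    using Suc.prems s fin by (intro Suc.IH) auto
  ultimately show ?case using sum.remove[OF fin s, of \<mu>] by simp
qed

text \<open>The determinant computations enter the analysis only through \<open>gram\<close>: \<tau>
  will be the trace of \<alpha>, and \<open>V0\<close> the constant c times the Gram determinant of
  \<open>B\<close>.\<close>

locale heintze_space = triangular \<alpha> e ell \<mu> N
  for \<alpha> :: "'v::euclidean_space \<Rightarrow> 'v" and e ell \<mu> N +
  fixes B :: "'v \<Rightarrow> 'v \<Rightarrow> real" and c p \<tau> V0 :: real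
  assumes B: "inner_product B" and c: "c > 0" and p: "p \<ge> 1"
    and mu_pos: "\<And>i. i < N \<Longrightarrow> 0 < \<mu> i"
    and mu_mono: "\<And>i j. i \<le> j \<Longrightarrow> j < N \<Longrightarrow> \<mu> i \<le> \<mu> j"
    and gram: "\<And>x t. gram_det (heintze_metric \<alpha> B c) (x, t) = V0 * exp (- 2 * t * \<tau>)"
    and V0: "V0 > 0"
begin

abbreviation "met \<equiv> heintze_metric \<alpha> B c"
abbreviation "vol \<equiv> riemannian_volume met"

text \<open>The left translates to height t of the flag basis and of the vertical vector; the latter
  has index N, and every larger index also denotes it. Lengths are constant along the group, see
  \<open>met_frame\<close>.\<close>

definition frame :: "real \<Rightarrow> nat \<Rightarrow> 'v \<times> real" where
  "frame t a = (if a < N then (exp_end t \<alpha> (e a), 0) else (0, 1))"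

definition coord :: "real \<Rightarrow> nat \<Rightarrow> 'v \<times> real \<Rightarrow> real" where
  "coord t a y = (if a < N then ell a (exp_end (- t) \<alpha> (fst y)) else snd y)"

lemma frame_expand: "y = (\<Sum>a\<le>N. coord t a y *\<^sub>R frame t a)"
proof -
  have l: "linear (exp_end t \<alpha>)" by (rule linear_exp_end[OF lin])
  have "fst y = exp_end t \<alpha> (exp_end (- t) \<alpha> (fst y))" using lin by simp
  also have "exp_end (- t) \<alpha> (fst y) = (\<Sum>a<N. ell a (exp_end (- t) \<alpha> (fst y)) *\<^sub>R e a)"
    by (rule expand)
  finally have 1: "fst y = (\<Sum>a<N. coord t a y *\<^sub>R exp_end t \<alpha> (e a))"
    by (simp add: linear_sum[OF l] linear_scale[OF l] coord_def)
  have "(\<Sum>a\<le>N. coord t a y *\<^sub>R frame t a) = (\<Sum>a<N. coord t a y *\<^sub>R frame t a) + coord t N y *\<^sub>R frame t N"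
    by (simp add: lessThan_Suc_atMost[symmetric])
  also have "(\<Sum>a<N. coord t a y *\<^sub>R frame t a) = (\<Sum>a<N. (coord t a y *\<^sub>R exp_end t \<alpha> (e a), 0))"
    by (intro sum.cong) (auto simp: frame_def)
  also have "\<dots> = (fst y, 0)"
    using 1 by (simp add: prod_eq_iff fst_sum snd_sum)
  finally show ?thesis by (simp add: frame_def coord_def prod_eq_iff)
qed

definition frame_sq :: "nat \<Rightarrow> real" where
  "frame_sq a = (if a < N then B (e a) (e a) else c)"

lemma met_frame: "met (x, t) (frame t a) (frame t a) = frame_sq a"
proof -
  have "B 0 0 = 0" using B linear_0 unfolding inner_product_def by blast
  moreover have "exp_end s \<alpha> 0 = 0" for s by (rule linear_0[OF linear_exp_end[OF lin]])
  ultimately show ?thesis using lin by (simp add: frame_def heintze_metric_def frame_sq_def)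
qed

lemma e_nonzero: "a < N \<Longrightarrow> e a \<noteq> 0"
  using dual[of a a] linear_0[OF ell_lin[of a]] by auto

lemma frame_sq_pos: "frame_sq a > 0"
  using B c e_nonzero[of a] by (auto simp: frame_sq_def inner_product_def)

lemma coord_bounded:
  obtains C where "C > 0" "\<And>x t y a. a \<le> N \<Longrightarrow> met (x, t) y y = 1 \<Longrightarrow> \<bar>coord t a y\<bar> \<le> C"
proof -
  obtain b where b: "b > 0" "\<And>w. b * (norm w)\<^sup>2 \<le> B w w" using inner_product_coercive[OF B] by blast
  have "\<exists>K>0. \<forall>w. \<bar>ell a w\<bar> \<le> K * norm w" if "a < N" for a
    using linear_bounded_pos[OF ell_lin[OF that]] by (metis real_norm_def)
  then obtain K where K: "\<And>a. a < N \<Longrightarrow> K a > 0" "\<And>a w. a < N \<Longrightarrow> \<bar>ell a w\<bar> \<le> K a * norm w"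
    by metis
  define C where "C = 1 / sqrt c + (\<Sum>a<N. K a / sqrt b)"
  have nn: "0 \<le> (\<Sum>a<N. K a / sqrt b)" using K(1) b(1) by (intro sum_nonneg) (auto intro: less_imp_le)
  have "\<bar>coord t a y\<bar> \<le> C" if a: "a \<le> N" and y: "met (x, t) y y = 1" for x t y a
  proof -
    let ?w = "exp_end (- t) \<alpha> (fst y)"
    have eq: "B ?w ?w + c * (snd y)\<^sup>2 = 1"
      using y by (simp add: heintze_metric_def case_prod_unfold power2_eq_square mult.assoc)
    have B0: "0 \<le> B ?w ?w" using b(2)[of ?w] b(1) by (smt (verit) zero_le_power2 mult_nonneg_nonneg)
    show ?thesis
    proof (cases "a < N")
      case True
      have "b * (norm ?w)\<^sup>2 \<le> 1" using b(2)[of ?w] eq c by (smt (verit) zero_le_power2 mult_nonneg_nonneg)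
      then have "(norm ?w)\<^sup>2 \<le> 1 / b" using b(1) by (simp add: field_simps)
      then have "norm ?w \<le> 1 / sqrt b" using real_le_rsqrt by (fastforce simp: real_sqrt_divide)
      then have "K a * norm ?w \<le> K a * (1 / sqrt b)" using K(1)[OF True] by (intro mult_left_mono) auto
      with K(2)[OF True, of ?w] have "\<bar>ell a ?w\<bar> \<le> K a / sqrt b" by simp
      also have "\<dots> \<le> (\<Sum>a<N. K a / sqrt b)"
        using K(1) b(1) True by (intro member_le_sum) (auto intro: less_imp_le)
      also have "\<dots> \<le> C" using c by (simp add: C_def)
      finally show ?thesis using True by (simp add: coord_def)
    next
      case False
      have "(snd y)\<^sup>2 \<le> 1 / c" using eq B0 c by (simp add: field_simps)
      then have "\<bar>snd y\<bar> \<le> 1 / sqrt c" using real_le_rsqrt[of "\<bar>snd y\<bar>" "1 / c"] by (simp add: real_sqrt_divide)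
      then show ?thesis using False nn by (simp add: coord_def C_def)
    qed
  qed
  moreover have "C > 0" using nn c by (simp add: C_def add_pos_nonneg)
  ultimately show ?thesis using that by blast
qed

text \<open>A substitute for \<open>pointwise_norm\<close>: being a finite sum of absolute values of
  components, it is continuous or measurable whenever the components are, and decay can be proved
  component by component. All multi-indices are summed, including those with repetitions and
  permutations.\<close>

definition fnorm :: "nat \<Rightarrow> ('v \<times> real) form \<Rightarrow> 'v \<times> real \<Rightarrow> real" where
  "fnorm k \<omega> z = (\<Sum>I\<in>{..<k} \<rightarrow>\<^sub>E {..N}. \<bar>\<omega> z (\<lambda>i. frame (snd z) (I i))\<bar>)"

lemma finite_multi_index: "finite ({..<k::nat} \<rightarrow>\<^sub>E {..N::nat})" "finite ({..<k::nat} \<rightarrow>\<^sub>E {..<N::nat})"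
  by (auto intro!: finite_PiE)

lemma fnorm_nonneg: "0 \<le> fnorm k \<omega> z"
  by (simp add: fnorm_def sum_nonneg)

lemma le_fnorm:
  assumes "alternating k (\<omega> z)" "\<And>i. i < k \<Longrightarrow> I i \<le> N"
  shows "\<bar>\<omega> z (\<lambda>i. frame (snd z) (I i))\<bar> \<le> fnorm k \<omega> z"
proof -
  have "\<omega> z (\<lambda>i. frame (snd z) (I i)) = \<omega> z (\<lambda>i. frame (snd z) (restrict I {..<k} i))"
    by (rule alternating_cong[OF assms(1)]) simp
  moreover have "restrict I {..<k} \<in> {..<k} \<rightarrow>\<^sub>E {..N}"
    using assms(2) by (simp add: restrict_PiE_iff)
  then have "\<bar>\<omega> z (\<lambda>i. frame (snd z) (restrict I {..<k} i))\<bar> \<le> fnorm k \<omega> z"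
    unfolding fnorm_def
    by (rule member_le_sum[where f = "\<lambda>I. \<bar>\<omega> z (\<lambda>i. frame (snd z) (I i))\<bar>"])
      (simp_all add: finite_multi_index)
  ultimately show ?thesis by argo
qed

lemma abs_le_coord_fnorm:
  assumes f: "alternating k (\<omega> z)"
    and v: "\<And>i a. i < k \<Longrightarrow> a \<le> N \<Longrightarrow> \<bar>coord (snd z) a (v i)\<bar> \<le> C"
  shows "\<bar>\<omega> z v\<bar> \<le> C ^ k * fnorm k \<omega> z"
proof -
  let ?t = "snd z"
  have "v = (\<lambda>i. \<Sum>a\<le>N. coord ?t a (v i) *\<^sub>R frame ?t a)" by (rule ext) (rule frame_expand)
  then have "\<omega> z v = \<omega> z (\<lambda>i. \<Sum>a\<le>N. coord ?t a (v i) *\<^sub>R frame ?t a)" by (rule arg_cong)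
  also have "\<dots> = (\<Sum>I\<in>{..<k} \<rightarrow>\<^sub>E {..N}. (\<Prod>i<k. coord ?t (I i) (v i)) * \<omega> z (\<lambda>i. frame ?t (I i)))"
    by (rule alternating_expand[OF _ f]) simp
  finally have "\<bar>\<omega> z v\<bar> \<le> (\<Sum>I\<in>{..<k} \<rightarrow>\<^sub>E {..N}. \<bar>(\<Prod>i<k. coord ?t (I i) (v i)) * \<omega> z (\<lambda>i. frame ?t (I i))\<bar>)"
    by (simp only: sum_abs)
  also have "\<dots> \<le> (\<Sum>I\<in>{..<k} \<rightarrow>\<^sub>E {..N}. C ^ k * \<bar>\<omega> z (\<lambda>i. frame ?t (I i))\<bar>)"
  proof (rule sum_mono)
    fix I assume I: "I \<in> {..<k} \<rightarrow>\<^sub>E {..N}"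
    have "(\<Prod>i<k. \<bar>coord ?t (I i) (v i)\<bar>) \<le> (\<Prod>i<k. C)"
      using I v by (intro prod_mono) auto
    then show "\<bar>(\<Prod>i<k. coord ?t (I i) (v i)) * \<omega> z (\<lambda>i. frame ?t (I i))\<bar> \<le> C ^ k * \<bar>\<omega> z (\<lambda>i. frame ?t (I i))\<bar>"
      by (simp add: abs_mult abs_prod mult_right_mono)
  qed
  finally show ?thesis by (simp add: fnorm_def sum_distrib_left)
qed

text \<open>Unit vectors have uniformly bounded frame coordinates, which bounds the supremum; in
  particular it is taken over a bounded set, so it is a genuine supremum. Conversely the normalised
  frame vectors are admissible in it. Left invariance makes the constant independent of the
  point.\<close>

lemma pointwise_norm_equiv:
  obtains C where "C > 0"
    "\<And>\<omega> z. alternating k (\<omega> z) \<Longrightarrow> 0 \<le> pointwise_norm met k \<omega> z"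
    "\<And>\<omega> z. alternating k (\<omega> z) \<Longrightarrow> pointwise_norm met k \<omega> z \<le> C * fnorm k \<omega> z"
    "\<And>\<omega> z. alternating k (\<omega> z) \<Longrightarrow> fnorm k \<omega> z \<le> C * pointwise_norm met k \<omega> z"
proof -
  obtain K where K: "K > 0" "\<And>x t y a. a \<le> N \<Longrightarrow> met (x, t) y y = 1 \<Longrightarrow> \<bar>coord t a y\<bar> \<le> K"
    using coord_bounded by blast
  define Q where "Q = (\<Sum>I\<in>{..<k} \<rightarrow>\<^sub>E {..N}. (\<Prod>i<k. sqrt (frame_sq (I i))))"
  have Q0: "0 \<le> Q" unfolding Q_def by (intro sum_nonneg prod_nonneg) (auto simp: less_imp_le[OF frame_sq_pos])
  let ?S = "\<lambda>z. {v. \<forall>i<k. sqrt (met z (v i) (v i)) = 1}"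
  have up: "\<bar>\<omega> z v\<bar> \<le> K ^ k * fnorm k \<omega> z" if "alternating k (\<omega> z)" "v \<in> ?S z" for \<omega> z v
    using that K(2)[where x = "fst z" and t = "snd z"] by (intro abs_le_coord_fnorm) auto
  have bdd: "bdd_above ((\<lambda>v. \<bar>\<omega> z v\<bar>) ` ?S z)" if "alternating k (\<omega> z)" for \<omega> z
    using up[of \<omega> z] that by (intro bdd_aboveI2[where M = "K ^ k * fnorm k \<omega> z"]) blast
  have unit: "(\<lambda>i. (1 / sqrt (frame_sq (I i))) *\<^sub>R frame (snd z) (I i)) \<in> ?S z" for I z
  proof -
    have "met z (r *\<^sub>R y) (r *\<^sub>R y) = r\<^sup>2 * met z y y" for r y
    proof -
      have lB: "linear (B v)" "B v u = B u v" for v u using B by (auto simp: inner_product_def)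
      have lE: "linear (exp_end (- snd z) \<alpha>)" by (rule linear_exp_end[OF lin])
      have "B (r *\<^sub>R w) (r *\<^sub>R w) = r\<^sup>2 * B w w" for w
        by (simp only: linear_scale[OF lB(1)] lB(2)[of "r *\<^sub>R w" w] real_scaleR_def power2_eq_square mult.assoc)
      then show ?thesis
        by (simp add: heintze_metric_def case_prod_unfold linear_scale[OF lE] power2_eq_square algebra_simps)
    qed
    then have "met z ((1 / sqrt (frame_sq a)) *\<^sub>R frame (snd z) a) ((1 / sqrt (frame_sq a)) *\<^sub>R frame (snd z) a) = 1" for a
      using met_frame[of "fst z" "snd z" a] frame_sq_pos[of a] by (simp add: power_divide)
    then show ?thesis by simp
  qed
  have nonneg: "0 \<le> pointwise_norm met k \<omega> z" if "alternating k (\<omega> z)" for \<omega> z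
    unfolding pointwise_norm_def
    using cSUP_upper[OF unit[where z = z] bdd[of \<omega> z, OF that]] abs_ge_zero order_trans by blast
  have 1: "pointwise_norm met k \<omega> z \<le> K ^ k * fnorm k \<omega> z" if "alternating k (\<omega> z)" for \<omega> z
    unfolding pointwise_norm_def
  proof (rule cSUP_least)
    show "?S z \<noteq> {}" using unit[of _ z] by (metis empty_iff)
  qed (rule up[of \<omega> z, OF that])
  have 2: "fnorm k \<omega> z \<le> Q * pointwise_norm met k \<omega> z" if f: "alternating k (\<omega> z)" for \<omega> z
  proof -
    have "\<bar>\<omega> z (\<lambda>i. frame (snd z) (I i))\<bar> \<le> (\<Prod>i<k. sqrt (frame_sq (I i))) * pointwise_norm met k \<omega> z" for I
    proof -
      let ?u = "\<lambda>i. (1 / sqrt (frame_sq (I i))) *\<^sub>R frame (snd z) (I i)"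
      have "(\<lambda>i. frame (snd z) (I i)) = (\<lambda>i. sqrt (frame_sq (I i)) *\<^sub>R ?u i)"
        using frame_sq_pos by (auto simp: fun_eq_iff less_imp_neq[symmetric])
      then have "\<omega> z (\<lambda>i. frame (snd z) (I i)) = (\<Prod>i<k. sqrt (frame_sq (I i))) * \<omega> z ?u"
        by (simp only: alternating_scale_all[OF f])
      moreover have "\<bar>\<omega> z ?u\<bar> \<le> pointwise_norm met k \<omega> z"
        unfolding pointwise_norm_def by (rule cSUP_upper[OF unit bdd[of \<omega> z, OF f]])
      moreover have "0 \<le> (\<Prod>i<k. sqrt (frame_sq (I i)))"
        by (intro prod_nonneg) (auto simp: less_imp_le[OF frame_sq_pos])
      ultimately show ?thesis by (simp add: abs_mult mult_left_mono)
    qed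
    then show ?thesis unfolding fnorm_def Q_def sum_distrib_right by (intro sum_mono)
  qed
  show ?thesis
  proof (rule that[of "K ^ k + Q"])
    show "K ^ k + Q > 0" using K Q0 by (simp add: add_pos_nonneg)
    fix \<omega> :: "('v \<times> real) form" and z assume f: "alternating k (\<omega> z)"
    show "0 \<le> pointwise_norm met k \<omega> z" by (rule nonneg[of \<omega> z, OF f])
    show "pointwise_norm met k \<omega> z \<le> (K ^ k + Q) * fnorm k \<omega> z"
      using 1[of \<omega> z, OF f] mult_nonneg_nonneg[OF Q0 fnorm_nonneg[of k \<omega> z]] by (simp add: distrib_right)
    have "0 \<le> K ^ k * pointwise_norm met k \<omega> z" using K nonneg[of \<omega> z, OF f] by simp
    then show "fnorm k \<omega> z \<le> (K ^ k + Q) * pointwise_norm met k \<omega> z"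
      using 2[of \<omega> z, OF f] by (simp add: distrib_right)
  qed
qed

lemma continuous_frame: "continuous_on UNIV (\<lambda>t. frame t a)"
  unfolding frame_def by (cases "a < N") (auto intro!: continuous_intros continuous_on_exp_end[OF lin])

text \<open>The frame varies with the point, whereas regularity of forms is assumed for constant
  arguments; expanding in the standard basis separates the two dependences.\<close>

lemma frame_component_expand:
  assumes "alternating k (\<omega> z)"
  shows "\<omega> z (\<lambda>i. frame (snd z) (I i)) = (\<Sum>K\<in>{..<k} \<rightarrow>\<^sub>E Basis.
    (\<Prod>i<k. frame (snd z) (I i) \<bullet> K i) * \<omega> z (\<lambda>i. K i))"
  using alternating_expand[OF finite_Basis assms, of "\<lambda>i b. frame (snd z) (I i) \<bullet> b" "\<lambda>b. b"]
  by (simp only: euclidean_representation)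

lemma continuous_frame_component: "continuous_on UNIV (\<lambda>z :: 'v \<times> real. frame (snd z) a \<bullet> b)"
  by (intro continuous_intros continuous_on_compose2[OF continuous_frame]) auto

lemma continuous_smooth_component:
  assumes "smooth_form k \<omega>"
  shows "continuous_on UNIV (\<lambda>z. \<omega> z (\<lambda>i. frame (snd z) (I i)))"
proof -
  have eq: "\<omega> z (\<lambda>i. frame (snd z) (I i)) = (\<Sum>K\<in>{..<k} \<rightarrow>\<^sub>E Basis.
      (\<Prod>i<k. frame (snd z) (I i) \<bullet> K i) * \<omega> z (\<lambda>i. K i))" for z
    by (rule frame_component_expand) (rule smooth_form_alternating[OF assms])
  show ?thesis
    unfolding eq
    by (intro continuous_on_sum continuous_on_mult continuous_on_prod continuous_frame_component
        smooth_continuous smooth_form_smooth[OF assms])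
qed

lemma measurable_component:
  assumes "measurable_form k \<omega>"
  shows "(\<lambda>z. \<omega> z (\<lambda>i. frame (snd z) (I i))) \<in> borel_measurable lebesgue"
proof -
  have eq: "\<omega> z (\<lambda>i. frame (snd z) (I i)) = (\<Sum>K\<in>{..<k} \<rightarrow>\<^sub>E Basis.
      (\<Prod>i<k. frame (snd z) (I i) \<bullet> K i) * \<omega> z (\<lambda>i. K i))" for z
    using assms unfolding measurable_form_def by (intro frame_component_expand) blast
  have [measurable]: "(\<lambda>z :: 'v \<times> real. frame (snd z) a \<bullet> b) \<in> borel_measurable lebesgue" for a b
    by (intro measurable_completion) (simp add: borel_measurable_continuous_onI continuous_frame_component)
  have [measurable]: "(\<lambda>z. \<omega> z v) \<in> borel_measurable lebesgue" for v
    using assms by (simp add: measurable_form_def)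
  show ?thesis unfolding eq by measurable
qed

lemma measurable_fnorm: "measurable_form k \<omega> \<Longrightarrow> fnorm k \<omega> \<in> borel_measurable lebesgue"
  unfolding fnorm_def[abs_def] by (intro borel_measurable_sum borel_measurable_abs measurable_component)

lemma continuous_fnorm: "smooth_form k \<omega> \<Longrightarrow> continuous_on A (fnorm k \<omega>)"
  unfolding fnorm_def[abs_def]
  by (intro continuous_on_sum continuous_on_rabs
      continuous_on_subset[OF continuous_smooth_component subset_UNIV])

lemma measurable_smooth_form:
  assumes "smooth_form k \<omega>"
  shows "measurable_form k \<omega>"
  unfolding measurable_form_def
proof (intro conjI allI)
  fix v
  have "(\<lambda>x. \<omega> x v) \<in> borel_measurable borel"
    by (intro borel_measurable_continuous_onI smooth_continuous smooth_form_smooth[OF assms])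
  then show "(\<lambda>x. \<omega> x v) \<in> borel_measurable lebesgue" by (intro measurable_completion) simp
qed (rule smooth_form_alternating[OF assms])

lemma fnorm_add: "fnorm k (\<omega> + \<theta>) z \<le> fnorm k \<omega> z + fnorm k \<theta> z"
  unfolding fnorm_def sum.distrib[symmetric] by (intro sum_mono) (simp add: abs_triangle_ineq)

lemma fnorm_uminus: "fnorm k (- \<omega>) z = fnorm k \<omega> z"
  by (simp add: fnorm_def)

lemma fnorm_zero: "\<omega> z = 0 \<Longrightarrow> fnorm k \<omega> z = 0"
  by (simp add: fnorm_def)

lemma fnorm_cong: "\<omega> z = \<theta> z \<Longrightarrow> fnorm k \<omega> z = fnorm k \<theta> z"
  by (simp add: fnorm_def)

section \<open>The weighted p-energy in place of the Lp-norm\<close>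

definition density_p :: "nat \<Rightarrow> ('v \<times> real) form \<Rightarrow> 'v \<times> real \<Rightarrow> real" where
  "density_p k \<omega> z = fnorm k \<omega> z powr p * exp (- \<tau> * snd z)"

text \<open>Comparable to the p-th power of the Lp-norm. Finiteness and convergence to 0 are the
  same for both, and the triangle inequality is replaced by the cruder \<open>energy_add\<close>
  with its factor 2^p.\<close>

definition energy :: "nat \<Rightarrow> ('v \<times> real) form \<Rightarrow> ennreal" where
  "energy k \<omega> = (\<integral>\<^sup>+z. ennreal (density_p k \<omega> z) \<partial>lebesgue)"

lemma density_p_nonneg: "0 \<le> density_p k \<omega> z"
  by (simp add: density_p_def)

lemma measurable_snd_lebesgue [measurable]: "(\<lambda>z :: 'v \<times> real. snd z) \<in> borel_measurable lebesgue"
  by (intro measurable_completion) (simp add: borel_measurable_continuous_onI continuous_on_snd)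

lemma measurable_density_p [measurable]:
  "measurable_form k \<omega> \<Longrightarrow> density_p k \<omega> \<in> borel_measurable lebesgue"
  using measurable_fnorm[of k \<omega>] unfolding density_p_def[abs_def] by measurable

lemma powr_add_le:
  fixes a b :: real
  assumes "0 \<le> a" "0 \<le> b"
  shows "(a + b) powr p \<le> 2 powr p * (a powr p + b powr p)"
proof -
  have "(a + b) powr p \<le> (2 * max a b) powr p" using assms p by (intro powr_mono2) auto
  also have "\<dots> = 2 powr p * max a b powr p" using assms by (simp add: powr_mult)
  also have "max a b powr p \<le> a powr p + b powr p" by (simp add: max_def)
  finally show ?thesis by (simp add: mult_left_mono)
qed

lemma density_p_mono:
  assumes "fnorm j \<omega> z \<le> C * fnorm k \<theta> z" "0 \<le> C"
  shows "density_p j \<omega> z \<le> C powr p * density_p k \<theta> z"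
proof -
  have "fnorm j \<omega> z powr p \<le> (C * fnorm k \<theta> z) powr p"
    using assms fnorm_nonneg p by (intro powr_mono2) auto
  then show ?thesis
    using assms fnorm_nonneg by (simp add: density_p_def powr_mult mult_right_mono mult.assoc[symmetric])
qed

lemma density_p_add: "density_p k (\<omega> + \<theta>) z \<le> 2 powr p * (density_p k \<omega> z + density_p k \<theta> z)"
proof -
  have "fnorm k (\<omega> + \<theta>) z powr p \<le> (fnorm k \<omega> z + fnorm k \<theta> z) powr p"
    using fnorm_add fnorm_nonneg p by (intro powr_mono2) auto
  also have "\<dots> \<le> 2 powr p * (fnorm k \<omega> z powr p + fnorm k \<theta> z powr p)"
    by (rule powr_add_le[OF fnorm_nonneg fnorm_nonneg])
  finally show ?thesis
    unfolding density_p_def by (simp add: mult_right_mono flip: distrib_right mult.assoc)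
qed

lemma energy_add:
  assumes "measurable_form k \<omega>" "measurable_form k \<theta>"
  shows "energy k (\<omega> + \<theta>) \<le> ennreal (2 powr p) * (energy k \<omega> + energy k \<theta>)"
proof -
  note [measurable] = measurable_density_p[OF assms(1)] measurable_density_p[OF assms(2)]
  have "energy k (\<omega> + \<theta>) \<le> (\<integral>\<^sup>+z. ennreal (2 powr p) * (ennreal (density_p k \<omega> z) + ennreal (density_p k \<theta> z)) \<partial>lebesgue)"
    unfolding energy_def
    by (intro nn_integral_mono)
      (simp add: density_p_nonneg density_p_add flip: ennreal_plus ennreal_mult)
  also have "\<dots> = ennreal (2 powr p) * (energy k \<omega> + energy k \<theta>)"
    unfolding energy_def by (simp add: nn_integral_cmult nn_integral_add)
  finally show ?thesis .
qed

lemma energy_uminus: "energy k (- \<omega>) = energy k \<omega>"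
  by (simp add: energy_def density_p_def fnorm_uminus)

lemma energy_minus_commute: "energy k (\<omega> - \<theta>) = energy k (\<theta> - \<omega>)"
  using energy_uminus[of k "\<omega> - \<theta>"] by simp

lemma energy_0: "energy k 0 = 0"
  by (simp add: energy_def density_p_def fnorm_zero)

lemma energy_mono_AE:
  assumes "measurable_form k \<theta>" "0 \<le> C" "AE z in lebesgue. fnorm j \<omega> z \<le> C * fnorm k \<theta> z"
  shows "energy j \<omega> \<le> ennreal (C powr p) * energy k \<theta>"
proof -
  note [measurable] = measurable_density_p[OF assms(1)]
  have "energy j \<omega> \<le> (\<integral>\<^sup>+z. ennreal (C powr p) * ennreal (density_p k \<theta> z) \<partial>lebesgue)"
    unfolding energy_def using assms(3)
    by (intro nn_integral_mono_AE, eventually_elim)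
      (use assms(2) in \<open>simp add: density_p_nonneg density_p_mono flip: ennreal_mult\<close>)
  then show ?thesis by (simp add: nn_integral_cmult energy_def)
qed

lemma measurable_form_add: "measurable_form k \<omega> \<Longrightarrow> measurable_form k \<theta> \<Longrightarrow> measurable_form k (\<omega> + \<theta>)"
  by (auto simp: measurable_form_def plus_fun_def intro: alternating_add borel_measurable_add)

lemma measurable_form_uminus: "measurable_form k \<omega> \<Longrightarrow> measurable_form k (- \<omega>)"
  by (auto simp: measurable_form_def fun_Compl_def intro: alternating_uminus)

lemma measurable_form_diff: "measurable_form k \<omega> \<Longrightarrow> measurable_form k \<theta> \<Longrightarrow> measurable_form k (\<omega> - \<theta>)"
  using measurable_form_add[of k \<omega> "- \<theta>"] measurable_form_uminus[of k \<theta>] by simp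

lemma measurable_form_0: "measurable_form k 0"
  by (simp add: measurable_smooth_form smooth_form_0)

lemma AE_vol_iff: "(AE z in vol. P z) \<longleftrightarrow> (AE z in lebesgue. P z)"
proof -
  have "sqrt (gram_det met z) = sqrt V0 * exp (- \<tau> * snd z)" for z
    using gram[of "fst z" "snd z"] by (simp add: real_sqrt_mult exp_half_le2 real_sqrt_unique flip: exp_double)
  then show ?thesis
    unfolding riemannian_volume_def using V0 by (subst AE_density) (auto simp: mult_ac)
qed

lemma nn_integral_vol:
  assumes [measurable]: "f \<in> borel_measurable lebesgue"
  shows "(\<integral>\<^sup>+z. f z \<partial>vol) = ennreal (sqrt V0) * (\<integral>\<^sup>+z. ennreal (exp (- \<tau> * snd z)) * f z \<partial>lebesgue)"
proof -
  have eq: "ennreal (sqrt (gram_det met z)) = ennreal (sqrt V0) * ennreal (exp (- \<tau> * snd z))" for z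
  proof -
    have "exp (- 2 * t * \<tau>) = (exp (- \<tau> * t))\<^sup>2" for t by (simp add: algebra_simps flip: exp_double)
    then have "sqrt (gram_det met z) = sqrt V0 * exp (- \<tau> * snd z)"
      using gram[of "fst z" "snd z"] by (simp add: real_sqrt_mult)
    then show ?thesis using V0 by (simp add: ennreal_mult)
  qed
  show ?thesis
    unfolding riemannian_volume_def eq
    by (subst nn_integral_density) (simp_all add: nn_integral_cmult mult.assoc)
qed

lemma ennreal_lt_powr_iff:
  assumes "\<epsilon> > 0"
  shows "(if I = \<infinity> then \<infinity> else ennreal (enn2real I powr (1 / p))) < ennreal \<epsilon> \<longleftrightarrow> I < ennreal (\<epsilon> powr p)"
proof (cases I)
  case (real r)
  have "r powr (1 / p) < \<epsilon> \<longleftrightarrow> r < \<epsilon> powr p"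
  proof -
    have "r powr (1 / p) < \<epsilon> \<longleftrightarrow> (r powr (1 / p)) powr p < \<epsilon> powr p"
      using assms p powr_less_mono2[of p "r powr (1 / p)" \<epsilon>] powr_mono2[of p \<epsilon> "r powr (1 / p)"]
      by fastforce
    also have "(r powr (1 / p)) powr p = r" using real p by (simp add: powr_powr)
    finally show ?thesis .
  qed
  then show ?thesis using real assms by (simp add: ennreal_less_iff)
qed simp

lemma ennreal_tendsto_0_iff:
  "(X \<longlonglongrightarrow> (0::ennreal)) \<longleftrightarrow> (\<forall>\<epsilon>>0. \<forall>\<^sub>F i in sequentially. X i < ennreal \<epsilon>)"
proof
  assume "X \<longlonglongrightarrow> 0"
  then show "\<forall>\<epsilon>>0. \<forall>\<^sub>F i in sequentially. X i < ennreal \<epsilon>"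
    by (auto intro: order_tendstoD(2))
next
  assume *: "\<forall>\<epsilon>>0. \<forall>\<^sub>F i in sequentially. X i < ennreal \<epsilon>"
  show "X \<longlonglongrightarrow> 0"
  proof (rule order_tendstoI)
    fix a :: ennreal assume "0 < a"
    then obtain r where r: "0 < ennreal r" "ennreal r < a"
      by (metis dense ennreal_cases less_top_ennreal not_less_iff_gr_or_eq top_greatest order.strict_trans2)
    then have "r > 0" by (metis ennreal_neg less_irrefl not_less)
    with * have "\<forall>\<^sub>F i in sequentially. X i < ennreal r" by blast
    then show "\<forall>\<^sub>F i in sequentially. X i < a" by eventually_elim (use r in order)
  qed simp
qed

lemma Lp_norm_energy:
  obtains C where "C > 0"
    "\<And>\<omega>. measurable_form k \<omega> \<Longrightarrow> energy k \<omega> \<le> ennreal C * (\<integral>\<^sup>+z. ennreal (pointwise_norm met k \<omega> z powr p) \<partial>vol)"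
    "\<And>\<omega>. measurable_form k \<omega> \<Longrightarrow> (\<integral>\<^sup>+z. ennreal (pointwise_norm met k \<omega> z powr p) \<partial>vol) \<le> ennreal C * energy k \<omega>"
proof -
  obtain K where K: "K > 0"
    "\<And>\<omega> z. alternating k (\<omega> z) \<Longrightarrow> 0 \<le> pointwise_norm met k \<omega> z"
    "\<And>\<omega> z. alternating k (\<omega> z) \<Longrightarrow> pointwise_norm met k \<omega> z \<le> K * fnorm k \<omega> z"
    "\<And>\<omega> z. alternating k (\<omega> z) \<Longrightarrow> fnorm k \<omega> z \<le> K * pointwise_norm met k \<omega> z"
    using pointwise_norm_equiv[of k] by metis
  have en: "(\<integral>\<^sup>+z. ennreal (a * fnorm k \<omega> z powr p) \<partial>vol) = ennreal (a * sqrt V0) * energy k \<omega>"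
    if "measurable_form k \<omega>" "0 \<le> a" for \<omega> a
  proof -
    note [measurable] = measurable_fnorm[OF that(1)]
    have "(\<integral>\<^sup>+z. ennreal (a * fnorm k \<omega> z powr p) \<partial>vol) =
        ennreal (sqrt V0) * (\<integral>\<^sup>+z. ennreal a * ennreal (density_p k \<omega> z) \<partial>lebesgue)"
      using that(2) by (subst nn_integral_vol) (auto simp: density_p_def ennreal_mult mult_ac)
    also have "\<dots> = ennreal (sqrt V0) * (ennreal a * energy k \<omega>)"
      unfolding energy_def using that(1) by (subst nn_integral_cmult) auto
    finally show ?thesis using V0 that(2) by (simp add: ennreal_mult mult_ac)
  qed
  define C where "C = K powr p * sqrt V0 + K powr p / sqrt V0"
  have pos: "C > 0" "0 < K powr p * sqrt V0" "0 < K powr p / sqrt V0"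
    using K(1) V0 by (simp_all add: C_def add_pos_pos)
  have 1: "energy k \<omega> \<le> ennreal C * (\<integral>\<^sup>+z. ennreal (pointwise_norm met k \<omega> z powr p) \<partial>vol)" (is "_ \<le> _ * ?I")
    if m: "measurable_form k \<omega>" for \<omega>
  proof -
    have a: "alternating k (\<omega> z)" for z using m unfolding measurable_form_def by blast
    have e: "(\<integral>\<^sup>+z. ennreal ((1 / K powr p) * fnorm k \<omega> z powr p) \<partial>vol) =
        ennreal (1 / K powr p * sqrt V0) * energy k \<omega>"
      by (rule en[OF m]) simp
    have "ennreal (1 / K powr p * sqrt V0) * energy k \<omega> \<le> ?I"
      unfolding e[symmetric]
    proof (intro nn_integral_mono ennreal_leI)
      fix z
      have "fnorm k \<omega> z powr p \<le> (K * pointwise_norm met k \<omega> z) powr p"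
        using K(4)[of \<omega> z, OF a] fnorm_nonneg p by (intro powr_mono2) auto
      then show "1 / K powr p * fnorm k \<omega> z powr p \<le> pointwise_norm met k \<omega> z powr p"
        using K(1) K(2)[of \<omega> z, OF a] by (simp add: powr_mult field_simps)
    qed
    then have "ennreal (K powr p / sqrt V0) * (ennreal (1 / K powr p * sqrt V0) * energy k \<omega>) \<le>
        ennreal (K powr p / sqrt V0) * ?I" by (rule mult_left_mono) simp
    also have "ennreal (K powr p / sqrt V0) * (ennreal (1 / K powr p * sqrt V0) * energy k \<omega>) = energy k \<omega>"
      using K(1) V0 by (simp add: mult.assoc[symmetric] ennreal_mult[symmetric] del: ennreal_mult)
    also have "ennreal (K powr p / sqrt V0) * ?I \<le> ennreal C * ?I"
      using pos by (intro mult_right_mono ennreal_leI) (auto simp: C_def)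
    finally show ?thesis .
  qed
  have 2: "(\<integral>\<^sup>+z. ennreal (pointwise_norm met k \<omega> z powr p) \<partial>vol) \<le> ennreal C * energy k \<omega>"
    if m: "measurable_form k \<omega>" for \<omega>
  proof -
    have a: "alternating k (\<omega> z)" for z using m unfolding measurable_form_def by blast
    have "(\<integral>\<^sup>+z. ennreal (pointwise_norm met k \<omega> z powr p) \<partial>vol) \<le> (\<integral>\<^sup>+z. ennreal (K powr p * fnorm k \<omega> z powr p) \<partial>vol)"
    proof (intro nn_integral_mono ennreal_leI)
      fix z
      have "pointwise_norm met k \<omega> z powr p \<le> (K * fnorm k \<omega> z) powr p"
        using K(2)[of \<omega> z, OF a] K(3)[of \<omega> z, OF a] p by (intro powr_mono2) auto
      then show "pointwise_norm met k \<omega> z powr p \<le> K powr p * fnorm k \<omega> z powr p"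
        using K(1) fnorm_nonneg by (simp add: powr_mult)
    qed
    also have "\<dots> = ennreal (K powr p * sqrt V0) * energy k \<omega>" by (rule en[OF m]) simp
    also have "\<dots> \<le> ennreal C * energy k \<omega>"
      using pos by (intro mult_right_mono ennreal_leI) (auto simp: C_def)
    finally show ?thesis .
  qed
  from that[OF pos(1) 1 2] show ?thesis .
qed

lemma Lp_norm_finite_iff:
  assumes "measurable_form k \<omega>"
  shows "Lp_norm met p k \<omega> < \<infinity> \<longleftrightarrow> energy k \<omega> < \<infinity>"
proof -
  let ?I = "\<integral>\<^sup>+z. ennreal (pointwise_norm met k \<omega> z powr p) \<partial>vol"
  obtain C where C: "energy k \<omega> \<le> ennreal C * ?I" "?I \<le> ennreal C * energy k \<omega>"
    using Lp_norm_energy[of k] assms by metis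
  have "Lp_norm met p k \<omega> < \<infinity> \<longleftrightarrow> ?I < \<infinity>"
    by (cases "?I = \<infinity>") (simp_all add: Lp_norm_def Let_def less_top)
  also have "\<dots> \<longleftrightarrow> energy k \<omega> < \<infinity>"
  proof
    assume "?I < \<infinity>"
    then have "ennreal C * ?I < \<infinity>" by (simp add: ennreal_mult_less_top)
    with C(1) show "energy k \<omega> < \<infinity>" by (rule le_less_trans)
  next
    assume "energy k \<omega> < \<infinity>"
    then have "ennreal C * energy k \<omega> < \<infinity>" by (simp add: ennreal_mult_less_top)
    with C(2) show "?I < \<infinity>" by (rule le_less_trans)
  qed
  finally show ?thesis .
qed

lemma tendsto_0_mult_le:
  fixes X Y :: "nat \<Rightarrow> ennreal"
  assumes "\<And>i. X i \<le> ennreal C * Y i" "Y \<longlonglongrightarrow> 0"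
  shows "X \<longlonglongrightarrow> 0"
proof -
  have "(\<lambda>i. ennreal C * Y i) \<longlonglongrightarrow> ennreal C * 0"
    by (intro ennreal_tendsto_cmult assms) simp
  then have "(\<lambda>i. ennreal C * Y i) \<longlonglongrightarrow> 0" by simp
  then show ?thesis
    by (rule tendsto_sandwich[OF _ _ tendsto_const, rotated 2]) (simp_all add: assms(1))
qed

lemma Lp_norm_tendsto_iff:
  assumes "\<And>i. measurable_form k (\<omega> i)"
  shows "(\<lambda>i. Lp_norm met p k (\<omega> i)) \<longlonglongrightarrow> 0 \<longleftrightarrow> (\<lambda>i. energy k (\<omega> i)) \<longlonglongrightarrow> 0"
proof -
  let ?I = "\<lambda>i. \<integral>\<^sup>+z. ennreal (pointwise_norm met k (\<omega> i) z powr p) \<partial>vol"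
  obtain C where C: "\<And>i. energy k (\<omega> i) \<le> ennreal C * ?I i" "\<And>i. ?I i \<le> ennreal C * energy k (\<omega> i)"
    using Lp_norm_energy[of k] assms by metis
  have "(\<lambda>i. Lp_norm met p k (\<omega> i)) \<longlonglongrightarrow> 0 \<longleftrightarrow> (\<forall>\<epsilon>>0. \<forall>\<^sub>F i in sequentially. ?I i < ennreal (\<epsilon> powr p))"
    by (simp only: ennreal_tendsto_0_iff Lp_norm_def Let_def ennreal_lt_powr_iff cong: imp_cong)
  also have "\<dots> \<longleftrightarrow> (\<forall>\<epsilon>>0. \<forall>\<^sub>F i in sequentially. ?I i < ennreal \<epsilon>)"
  proof safe
    fix \<epsilon> :: real assume *: "\<forall>\<epsilon>>0. \<forall>\<^sub>F i in sequentially. ?I i < ennreal (\<epsilon> powr p)" "\<epsilon> > 0"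
    have "(\<epsilon> powr (1 / p)) powr p = \<epsilon>" using * p by (simp add: powr_powr)
    then show "\<forall>\<^sub>F i in sequentially. ?I i < ennreal \<epsilon>"
      using *(1)[rule_format, of "\<epsilon> powr (1 / p)"] *(2) by simp
  qed simp
  also have "\<dots> \<longleftrightarrow> (\<lambda>i. energy k (\<omega> i)) \<longlonglongrightarrow> 0"
    unfolding ennreal_tendsto_0_iff[symmetric]
    using tendsto_0_mult_le[of ?I C "\<lambda>i. energy k (\<omega> i)", OF C(2)]
      tendsto_0_mult_le[of "\<lambda>i. energy k (\<omega> i)" C ?I, OF C(1)] by (rule iffI[rotated])
  finally show ?thesis .
qed

definition smooth_energy :: "nat \<Rightarrow> ('v \<times> real) form \<Rightarrow> bool" where
  "smooth_energy k s \<longleftrightarrow> smooth_form k s \<and> energy k s < \<infinity> \<and> energy (Suc k) (ext_deriv k s) < \<infinity>"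

lemma Lp_smooth_forms_iff: "s \<in> Lp_smooth_forms met p k \<longleftrightarrow> smooth_energy k s"
  using Lp_norm_finite_iff[OF measurable_smooth_form] Lp_norm_finite_iff[OF measurable_smooth_form[OF smooth_form_ext_deriv]]
  by (auto simp: Lp_smooth_forms_def smooth_energy_def)

lemma Lp_diff_iff:
  "Lp_diff met p k \<omega> \<theta> \<longleftrightarrow> measurable_form k \<omega> \<and> measurable_form (Suc k) \<theta> \<and>
     (\<exists>s. (\<forall>i. smooth_energy k (s i)) \<and> (\<lambda>i. energy k (s i - \<omega>)) \<longlonglongrightarrow> 0 \<and>
        (\<lambda>i. energy (Suc k) (ext_deriv k (s i) - \<theta>)) \<longlonglongrightarrow> 0)"
proof -
  have "(\<lambda>i. Lp_norm met p k (s i - \<omega>)) \<longlonglongrightarrow> 0 \<longleftrightarrow> (\<lambda>i. energy k (s i - \<omega>)) \<longlonglongrightarrow> 0"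
    "(\<lambda>i. Lp_norm met p (Suc k) (ext_deriv k (s i) - \<theta>)) \<longlonglongrightarrow> 0 \<longleftrightarrow>
      (\<lambda>i. energy (Suc k) (ext_deriv k (s i) - \<theta>)) \<longlonglongrightarrow> 0"
    if "measurable_form k \<omega>" "measurable_form (Suc k) \<theta>" "\<forall>i. smooth_energy k (s i)" for s :: "nat \<Rightarrow> _"
    using that unfolding smooth_energy_def
    by (intro Lp_norm_tendsto_iff measurable_form_diff; simp add: measurable_smooth_form smooth_form_ext_deriv)+
  then show ?thesis unfolding Lp_diff_def Lp_smooth_forms_iff by metis
qed

end

section \<open>Contraction of the frames\<close>

lemma exp_end_commute:
  fixes \<alpha> :: "'v::euclidean_space \<Rightarrow> 'v"
  assumes "linear \<alpha>"
  shows "exp_end t \<alpha> (\<alpha> v) = \<alpha> (exp_end t \<alpha> v)"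
proof -
  have "bounded_linear \<alpha>" using assms by (simp add: linear_conv_bounded_linear)
  from bounded_linear.suminf[OF this summable_norm_cancel[OF exp_end_summable[OF assms]]]
  have "\<alpha> (exp_end t \<alpha> v) = (\<Sum>k. \<alpha> ((t ^ k / fact k) *\<^sub>R (\<alpha> ^^ k) v))"
    by (simp add: exp_end_def)
  then show ?thesis by (simp add: exp_end_def linear_scale[OF assms] funpow_swap1)
qed

context heintze_space
begin

lemma ell_expand:
  assumes "i < N"
  shows "ell i (\<alpha> w) = (\<Sum>l<N. ell l w * ell i (\<alpha> (e l)))"
proof -
  have l: "linear (\<lambda>x. ell i (\<alpha> x))"
    using linear_compose[OF lin ell_lin[OF assms]] by (simp add: o_def)
  have "ell i (\<alpha> w) = ell i (\<alpha> (\<Sum>l<N. ell l w *\<^sub>R e l))"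
    by (rule arg_cong[OF expand[of w], of "\<lambda>x. ell i (\<alpha> x)"])
  also have "\<dots> = (\<Sum>l<N. ell l w * ell i (\<alpha> (e l)))"
    by (simp only: linear_sum[OF l] linear_scale[OF l] real_scaleR_def)
  finally show ?thesis .
qed

text \<open>Descending induction on i. By triangularity the i-th coefficient solves y_i' = \<mu> i
  y_i + a combination of the y_l with l > i, and for t <= 0 these decay at least like e^(t (\<mu> i
  - \<epsilon>)), as \<mu> l >= \<mu> i. Variation of constants costs only a factor 1 / \<epsilon>.
  The loss \<epsilon> absorbs the polynomial factors that Jordan blocks would produce.\<close>

lemma exp_coeff_bound:
  assumes \<epsilon>: "\<epsilon> > 0"
  obtains C where "C \<ge> 0"
    "\<And>i j t. i < N \<Longrightarrow> j < N \<Longrightarrow> t \<le> 0 \<Longrightarrow> \<bar>ell i (exp_end t \<alpha> (e j))\<bar> \<le> C * exp (t * (\<mu> i - \<epsilon>))"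
proof -
  have "\<exists>C\<ge>0. \<forall>j<N. \<forall>t\<le>0. \<bar>ell i (exp_end t \<alpha> (e j))\<bar> \<le> C * exp (t * (\<mu> i - \<epsilon>))" if "i < N" for i
    using that
  proof (induction "N - i" arbitrary: i rule: less_induct)
    case less
    have "\<forall>l\<in>{i<..<N}. \<exists>C\<ge>0. \<forall>j<N. \<forall>t\<le>0. \<bar>ell l (exp_end t \<alpha> (e j))\<bar> \<le> C * exp (t * (\<mu> l - \<epsilon>))"
      using less by auto
    then obtain C where C: "\<And>l. l \<in> {i<..<N} \<Longrightarrow> C l \<ge> 0"
      "\<And>l j t. l \<in> {i<..<N} \<Longrightarrow> j < N \<Longrightarrow> t \<le> 0 \<Longrightarrow> \<bar>ell l (exp_end t \<alpha> (e j))\<bar> \<le> C l * exp (t * (\<mu> l - \<epsilon>))"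
      by metis
    define A where "A = (\<Sum>l\<in>{i<..<N}. C l * \<bar>ell i (\<alpha> (e l))\<bar>)"
    have A: "A \<ge> 0" unfolding A_def using C(1) by (intro sum_nonneg) auto
    have "\<bar>ell i (exp_end t \<alpha> (e j))\<bar> \<le> (1 + A / \<epsilon>) * exp (t * (\<mu> i - \<epsilon>))"
      if j: "j < N" and t: "t \<le> 0" for j t
    proof -
      define y where "y = (\<lambda>t. exp_end t \<alpha> (e j))"
      define S where "S = (\<lambda>t. \<Sum>l\<in>{i<..<N}. ell l (y t) * ell i (\<alpha> (e l)))"
      have split: "ell i (\<alpha> w) = \<mu> i * ell i w + (\<Sum>l\<in>{i<..<N}. ell l w * ell i (\<alpha> (e l)))" for w
      proof -
        have "ell i (\<alpha> w) = (\<Sum>l<N. ell l w * ell i (\<alpha> (e l)))"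
          by (rule ell_expand[OF less.prems])
        also have "\<dots> = (\<Sum>l\<in>insert i {i<..<N}. ell l w * ell i (\<alpha> (e l)))"
        proof (rule sum.mono_neutral_right)
          show "\<forall>l\<in>{..<N} - insert i {i<..<N}. ell l w * ell i (\<alpha> (e l)) = 0"
            using upper[OF less.prems] by auto
        qed (use less.prems in auto)
        also have "\<dots> = \<mu> i * ell i w + (\<Sum>l\<in>{i<..<N}. ell l w * ell i (\<alpha> (e l)))"
          using less.prems diagonal by simp
        finally show ?thesis .
      qed
      \<comment> \<open>Multiplication by the integrating factor leaves only the contribution of the
        later coefficients in the derivative.\<close>
      define g where "g = (\<lambda>t. exp (- t * \<mu> i) * ell i (y t))"
      have dg: "(g has_real_derivative exp (- s * \<mu> i) * S s) (at s)" for s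
      proof -
        have "((\<lambda>t. ell i (y t)) has_real_derivative \<mu> i * ell i (y s) + S s) (at s)"
          using exp_end_functional_has_derivative[OF lin ell_lin[OF less.prems], of "e j" s]
          unfolding exp_end_commute[OF lin] split[of "exp_end s \<alpha> (e j)"] y_def S_def .
        then show ?thesis unfolding g_def
          by (auto intro!: derivative_eq_intros simp: algebra_simps)
      qed
      have bound: "\<bar>exp (- s * \<mu> i) * S s\<bar> \<le> A * exp (- s * \<epsilon>)" if s: "s \<le> 0" for s
      proof -
        have "\<bar>S s\<bar> \<le> (\<Sum>l\<in>{i<..<N}. \<bar>ell l (y s) * ell i (\<alpha> (e l))\<bar>)" unfolding S_def by (rule sum_abs)
        also have "\<dots> \<le> (\<Sum>l\<in>{i<..<N}. C l * \<bar>ell i (\<alpha> (e l))\<bar> * exp (s * (\<mu> i - \<epsilon>)))"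
        proof (rule sum_mono)
          fix l assume l: "l \<in> {i<..<N}"
          have "s * \<mu> l \<le> s * \<mu> i" using s mu_mono[of i l] l by (simp add: mult_left_mono_neg)
          then have "C l * exp (s * (\<mu> l - \<epsilon>)) \<le> C l * exp (s * (\<mu> i - \<epsilon>))"
            using C(1)[OF l] by (intro mult_left_mono) (auto simp: algebra_simps)
          then have "\<bar>ell l (y s)\<bar> \<le> C l * exp (s * (\<mu> i - \<epsilon>))"
            using C(2)[OF l j s] by (simp add: y_def)
          then have "\<bar>ell l (y s)\<bar> * \<bar>ell i (\<alpha> (e l))\<bar> \<le> C l * exp (s * (\<mu> i - \<epsilon>)) * \<bar>ell i (\<alpha> (e l))\<bar>"
            by (rule mult_right_mono) simp
          then show "\<bar>ell l (y s) * ell i (\<alpha> (e l))\<bar> \<le> C l * \<bar>ell i (\<alpha> (e l))\<bar> * exp (s * (\<mu> i - \<epsilon>))"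
            by (simp add: abs_mult mult_ac)
        qed
        also have "\<dots> = A * exp (s * (\<mu> i - \<epsilon>))" by (simp add: A_def sum_distrib_right)
        finally have "exp (- s * \<mu> i) * \<bar>S s\<bar> \<le> exp (- s * \<mu> i) * (A * exp (s * (\<mu> i - \<epsilon>)))"
          by (rule mult_left_mono) simp
        also have "\<dots> = A * exp (- s * \<epsilon>)" by (simp add: algebra_simps flip: exp_add)
        finally show ?thesis by (simp add: abs_mult)
      qed
      \<comment> \<open>An antiderivative of the bound on g', so that the mean value inequality on
        [t, 0] controls g t by g 0.\<close>
      define \<phi> where "\<phi> = (\<lambda>s. - (A / \<epsilon>) * exp (- s * \<epsilon>))"
      have d\<phi>: "(\<phi> has_real_derivative A * exp (- s * \<epsilon>)) (at s)" for s
        unfolding \<phi>_def using \<epsilon> by (auto intro!: derivative_eq_intros)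
      have "\<bar>g 0 - g t\<bar> \<le> \<phi> 0 - \<phi> t"
      proof (cases "t = 0")
        case False
        have "norm (g 0 - g t) \<le> \<phi> 0 - \<phi> t"
        proof (rule differentiable_bound_general)
          show "t < 0" using False t by simp
          show "continuous_on {t..0} g" "continuous_on {t..0} \<phi>"
            using dg d\<phi> by (auto intro!: continuous_at_imp_continuous_on DERIV_isCont)
        qed (use dg d\<phi> bound in \<open>auto simp: has_real_derivative_iff_has_vector_derivative[symmetric]\<close>)
        then show ?thesis by simp
      qed simp
      moreover have "\<bar>g 0\<bar> \<le> 1" using dual[OF less.prems j] by (simp add: g_def y_def)
      moreover have "\<phi> 0 - \<phi> t = A / \<epsilon> * exp (- t * \<epsilon>) - A / \<epsilon>" by (simp add: \<phi>_def)
      moreover have "0 \<le> A / \<epsilon>" using A \<epsilon> by simp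
      moreover have "1 \<le> exp (- t * \<epsilon>)" using t \<epsilon> by (simp add: mult_nonpos_nonneg)
      ultimately have "\<bar>g t\<bar> \<le> (1 + A / \<epsilon>) * exp (- t * \<epsilon>)"
        unfolding distrib_right by linarith
      then have "exp (t * \<mu> i) * \<bar>g t\<bar> \<le> exp (t * \<mu> i) * ((1 + A / \<epsilon>) * exp (- t * \<epsilon>))"
        by (rule mult_left_mono) simp
      moreover have "exp (t * \<mu> i) * \<bar>g t\<bar> = \<bar>ell i (exp_end t \<alpha> (e j))\<bar>"
        by (simp add: g_def abs_mult y_def mult.assoc[symmetric] flip: exp_add)
      moreover have "exp (t * \<mu> i) * ((1 + A / \<epsilon>) * exp (- t * \<epsilon>)) = (1 + A / \<epsilon>) * exp (t * (\<mu> i - \<epsilon>))"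
        by (simp add: algebra_simps flip: exp_add)
      ultimately show ?thesis by linarith
    qed
    moreover have "0 \<le> 1 + A / \<epsilon>" using A \<epsilon> by simp
    ultimately show ?case by blast
  qed
  then obtain C where C: "\<And>i. i < N \<Longrightarrow> C i \<ge> 0"
    "\<And>i j t. i < N \<Longrightarrow> j < N \<Longrightarrow> t \<le> 0 \<Longrightarrow> \<bar>ell i (exp_end t \<alpha> (e j))\<bar> \<le> C i * exp (t * (\<mu> i - \<epsilon>))"
    by metis
  show ?thesis
  proof (rule that[of "\<Sum>i<N. C i"])
    show "0 \<le> (\<Sum>i<N. C i)" using C(1) by (intro sum_nonneg) auto
    fix i j t assume *: "i < N" "j < N" "t \<le> (0::real)"
    have "C i \<le> (\<Sum>i<N. C i)" using C(1) * by (intro member_le_sum) auto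
    then have "C i * exp (t * (\<mu> i - \<epsilon>)) \<le> (\<Sum>i<N. C i) * exp (t * (\<mu> i - \<epsilon>))"
      by (rule mult_right_mono) simp
    with C(2)[OF *] show "\<bar>ell i (exp_end t \<alpha> (e j))\<bar> \<le> (\<Sum>i<N. C i) * exp (t * (\<mu> i - \<epsilon>))"
      by (rule order_trans)
  qed
qed

lemma frame_transform:
  assumes "j < N"
  shows "frame t j = (\<Sum>i<N. ell i (exp_end (t - u) \<alpha> (e j)) *\<^sub>R frame u i)"
proof -
  have l: "linear (exp_end u \<alpha>)" by (rule linear_exp_end[OF lin])
  have "exp_end t \<alpha> (e j) = exp_end u \<alpha> (exp_end (t - u) \<alpha> (e j))"
    using exp_end_add[OF lin, of u "t - u" "e j"] by simp
  also have "exp_end (t - u) \<alpha> (e j) = (\<Sum>i<N. ell i (exp_end (t - u) \<alpha> (e j)) *\<^sub>R e i)"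
    by (rule expand)
  finally have "exp_end t \<alpha> (e j) = (\<Sum>i<N. ell i (exp_end (t - u) \<alpha> (e j)) *\<^sub>R exp_end u \<alpha> (e i))"
    by (simp add: linear_sum[OF l] linear_scale[OF l])
  then have "frame t j = (\<Sum>i<N. (ell i (exp_end (t - u) \<alpha> (e j)) *\<^sub>R exp_end u \<alpha> (e i), 0))"
    using assms by (simp add: frame_def prod_eq_iff fst_sum snd_sum)
  also have "\<dots> = (\<Sum>i<N. ell i (exp_end (t - u) \<alpha> (e j)) *\<^sub>R frame u i)"
    by (intro sum.cong) (auto simp: frame_def)
  finally show ?thesis .
qed

text \<open>
  An alternating form only sees distinct indices, whose exponents sum to at least the sum of the
  smallest ones.
\<close>

lemma horizontal_contraction:
  assumes j: "j \<le> k" "j \<le> N" and \<sigma>: "\<sigma> < (\<Sum>i<j. \<mu> i)"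
  obtains C where "C \<ge> 0"
    "\<And>f I t u. alternating k f \<Longrightarrow> t \<le> u \<Longrightarrow> (\<And>i. i < k \<Longrightarrow> I i < N) \<Longrightarrow>
      \<bar>f (\<lambda>i. frame t (I i))\<bar> \<le>
        C * exp (- ((u - t) * \<sigma>)) * (\<Sum>K\<in>{..<k} \<rightarrow>\<^sub>E {..<N}. \<bar>f (\<lambda>i. frame u (K i))\<bar>)"
proof -
  define W where "W = (\<Sum>i<j. \<mu> i)"
  \<comment> \<open>Each of the k factors loses \<epsilon> in the exponent, and together they must
    lose at most W - \<sigma>; the denominator k + 1 stays positive for k = 0.\<close>
  define \<epsilon> where "\<epsilon> = (W - \<sigma>) / (k + 1)"
  have \<epsilon>: "\<epsilon> > 0" using \<sigma> by (simp add: \<epsilon>_def W_def)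
  have k\<epsilon>: "k * \<epsilon> \<le> W - \<sigma>"
  proof -
    have "(k + 1) * \<epsilon> = W - \<sigma>" by (simp add: \<epsilon>_def)
    then show ?thesis using \<epsilon> by (simp add: distrib_right)
  qed
  obtain C where C: "C \<ge> 0"
    "\<And>i j t. i < N \<Longrightarrow> j < N \<Longrightarrow> t \<le> 0 \<Longrightarrow> \<bar>ell i (exp_end t \<alpha> (e j))\<bar> \<le> C * exp (t * (\<mu> i - \<epsilon>))"
    using exp_coeff_bound[OF \<epsilon>] by metis
  show ?thesis
  proof (rule that[of "C ^ k"])
    show "C ^ k \<ge> 0" using C by simp
    fix f :: "(nat \<Rightarrow> 'v \<times> real) \<Rightarrow> real" and I :: "nat \<Rightarrow> nat" and t u :: real
    assume f: "alternating k f" and tu: "t \<le> u" and I: "\<And>i. i < k \<Longrightarrow> I i < N"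
    let ?c = "\<lambda>i a. ell a (exp_end (t - u) \<alpha> (e (I i)))"
    have "f (\<lambda>i. frame t (I i)) = f (\<lambda>i. \<Sum>a<N. ?c i a *\<^sub>R frame u a)"
      by (rule alternating_cong[OF f]) (rule frame_transform[OF I])
    also have "\<dots> = (\<Sum>K\<in>{..<k} \<rightarrow>\<^sub>E {..<N}. (\<Prod>i<k. ?c i (K i)) * f (\<lambda>i. frame u (K i)))"
      by (rule alternating_expand[OF _ f]) simp
    finally have "\<bar>f (\<lambda>i. frame t (I i))\<bar> \<le>
        (\<Sum>K\<in>{..<k} \<rightarrow>\<^sub>E {..<N}. \<bar>(\<Prod>i<k. ?c i (K i)) * f (\<lambda>i. frame u (K i))\<bar>)"
      by (simp only: sum_abs)
    also have "\<dots> \<le> (\<Sum>K\<in>{..<k} \<rightarrow>\<^sub>E {..<N}. C ^ k * exp (- ((u - t) * \<sigma>)) * \<bar>f (\<lambda>i. frame u (K i))\<bar>)"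
    proof (rule sum_mono)
      fix K assume K: "K \<in> {..<k} \<rightarrow>\<^sub>E {..<N}"
      show "\<bar>(\<Prod>i<k. ?c i (K i)) * f (\<lambda>i. frame u (K i))\<bar> \<le>
          C ^ k * exp (- ((u - t) * \<sigma>)) * \<bar>f (\<lambda>i. frame u (K i))\<bar>"
      proof (cases "inj_on K {..<k}")
        case False
        then obtain a b where "a < k" "b < k" "a \<noteq> b" "K a = K b" by (auto simp: inj_on_def)
        then have "f (\<lambda>i. frame u (K i)) = 0" by (intro alternating_eq_0[OF f, of a b]) auto
        then show ?thesis by simp
      next
        case True
        have KN: "K i < N" if "i < k" for i using K that by auto
        have "(\<Prod>i<k. \<bar>?c i (K i)\<bar>) \<le> (\<Prod>i<k. C * exp ((t - u) * (\<mu> (K i) - \<epsilon>)))"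
          using tu KN I C by (intro prod_mono) auto
        also have "\<dots> = C ^ k * exp ((t - u) * ((\<Sum>i<k. \<mu> (K i)) - k * \<epsilon>))"
          by (simp add: prod.distrib exp_sum[symmetric] sum_distrib_left[symmetric] sum_subtractf)
        also have "\<dots> \<le> C ^ k * exp (- ((u - t) * \<sigma>))"
        proof -
          have "W \<le> (\<Sum>i\<in>K ` {..<k}. \<mu> i)"
            unfolding W_def
            by (rule sum_prefix_le_sum_subset[where N = N])
              (use mu_pos mu_mono KN j True in \<open>auto simp: card_image less_imp_le\<close>)
          then have "\<sigma> \<le> (\<Sum>i<k. \<mu> (K i)) - k * \<epsilon>"
            using k\<epsilon> by (simp add: sum.reindex[OF True])
          then have "(t - u) * ((\<Sum>i<k. \<mu> (K i)) - k * \<epsilon>) \<le> (t - u) * \<sigma>"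
            using tu by (intro mult_left_mono_neg) auto
          also have "\<dots> = - ((u - t) * \<sigma>)" by (simp add: algebra_simps)
          finally show ?thesis using C by (intro mult_left_mono) auto
        qed
        finally show ?thesis by (simp add: abs_mult abs_prod mult_right_mono)
      qed
    qed
    finally show "\<bar>f (\<lambda>i. frame t (I i))\<bar> \<le>
        C ^ k * exp (- ((u - t) * \<sigma>)) * (\<Sum>K\<in>{..<k} \<rightarrow>\<^sub>E {..<N}. \<bar>f (\<lambda>i. frame u (K i))\<bar>)"
      by (simp add: sum_distrib_left)
  qed
qed

lemma frame_bounded:
  obtains C where "C \<ge> 0" "\<And>t a. t \<le> T \<Longrightarrow> norm (frame t a) \<le> C"
proof -
  have "\<exists>C. \<forall>t\<le>0. norm (frame t a) \<le> C" for a
  proof (cases "a < N")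
    case False
    then show ?thesis by (auto simp: frame_def)
  next
    case True
    then have "\<mu> 0 > 0" using mu_pos by simp
    \<comment> \<open>With the loss taken to be the smallest eigenvalue, every exponent \<mu> i -
      \<mu> 0 is still nonnegative, which gives boundedness as t tends to minus infinity. The
      bounded interval above 0 is handled by compactness.\<close>
    then obtain C where C: "C \<ge> 0"
      "\<And>i j t. i < N \<Longrightarrow> j < N \<Longrightarrow> t \<le> 0 \<Longrightarrow> \<bar>ell i (exp_end t \<alpha> (e j))\<bar> \<le> C * exp (t * (\<mu> i - \<mu> 0))"
      using exp_coeff_bound[of "\<mu> 0"] by metis
    have "norm (frame t a) \<le> (\<Sum>i<N. C * norm (e i))" if t: "t \<le> 0" for t
    proof -
      have "norm (exp_end t \<alpha> (e a)) = norm (\<Sum>i<N. ell i (exp_end t \<alpha> (e a)) *\<^sub>R e i)"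
        by (rule arg_cong[OF expand])
      also have "\<dots> \<le> (\<Sum>i<N. norm (ell i (exp_end t \<alpha> (e a)) *\<^sub>R e i))" by (rule norm_sum)
      also have "\<dots> \<le> (\<Sum>i<N. C * norm (e i))"
      proof (rule sum_mono)
        fix i assume i: "i \<in> {..<N}"
        have "t * (\<mu> i - \<mu> 0) \<le> 0" using t mu_mono[of 0 i] i by (simp add: mult_nonpos_nonneg)
        then have "C * exp (t * (\<mu> i - \<mu> 0)) \<le> C" using C(1) by (simp add: mult_left_le)
        with C(2)[of i a t] i True t have "\<bar>ell i (exp_end t \<alpha> (e a))\<bar> \<le> C" by simp
        then show "norm (ell i (exp_end t \<alpha> (e a)) *\<^sub>R e i) \<le> C * norm (e i)"
          by (simp add: mult_right_mono)
      qed
      finally show ?thesis using True by (simp add: frame_def)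
    qed
    then show ?thesis by blast
  qed
  then obtain C1 where C1: "\<And>a t. t \<le> 0 \<Longrightarrow> norm (frame t a) \<le> C1 a" by metis
  have "\<exists>C. \<forall>t\<in>{0..T}. norm (frame t a) \<le> C" for a
    using compact_imp_bounded[OF compact_continuous_image[OF continuous_on_subset[OF continuous_frame subset_UNIV] compact_Icc]]
    unfolding bounded_iff by auto
  then obtain C2 where C2: "\<And>a t. t \<in> {0..T} \<Longrightarrow> norm (frame t a) \<le> C2 a" by metis
  define C where "C = (\<Sum>a\<le>N. \<bar>C1 a\<bar> + \<bar>C2 a\<bar>)"
  have "norm (frame t a) \<le> C" if "t \<le> T" for t a
  proof -
    have eq: "frame t a = frame t (min a N)" by (simp add: frame_def min_def)
    have "norm (frame t (min a N)) \<le> \<bar>C1 (min a N)\<bar> + \<bar>C2 (min a N)\<bar>"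
      using C1[of t "min a N"] C2[of t "min a N"] that by (cases "t \<le> 0") auto
    also have "\<dots> \<le> C" unfolding C_def by (rule member_le_sum) auto
    finally show ?thesis unfolding eq .
  qed
  moreover have "C \<ge> 0" unfolding C_def by (intro sum_nonneg) auto
  ultimately show ?thesis using that by blast
qed

end

section \<open>Cutting off near the boundary point\<close>

lemma frechet_derivative_locally_const:
  assumes "open S" "x \<in> S" "\<And>y. y \<in> S \<Longrightarrow> f y = c"
  shows "frechet_derivative f (at x) v = 0"
proof -
  have "(f has_derivative (\<lambda>_. 0)) (at x)"
    by (rule has_derivative_transform_within_open[OF has_derivative_const[of c] assms(1,2)])
      (simp add: assms(3))
  from frechet_derivative_at[OF this] show ?thesis by metis
qed

lemma smooth_frechet_bounded:
  fixes f :: "'a::euclidean_space \<Rightarrow> real"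
  assumes f: "smooth f" and 0: "\<And>x v. norm x > \<rho> \<Longrightarrow> frechet_derivative f (at x) v = 0"
  obtains D where "D \<ge> 0" "\<And>x v. \<bar>frechet_derivative f (at x) v\<bar> \<le> D * norm v"
proof -
  have "\<exists>C. \<forall>x\<in>cball 0 \<rho>. \<bar>frechet_derivative f (at x) b\<bar> \<le> C" for b
    using compact_imp_bounded[OF compact_continuous_image[OF smooth_continuous[OF smooth_frechet[OF f]] compact_cball]]
    unfolding bounded_iff by auto
  then obtain C where C: "\<And>b x. x \<in> cball 0 \<rho> \<Longrightarrow> \<bar>frechet_derivative f (at x) b\<bar> \<le> C b" by metis
  define D where "D = (\<Sum>b\<in>Basis. \<bar>C b\<bar>)"
  have "\<bar>frechet_derivative f (at x) v\<bar> \<le> D * norm v" for x v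
  proof -
    have l: "linear (frechet_derivative f (at x))"
      by (rule linear_frechet_derivative[OF smooth_differentiable[OF f]])
    have "frechet_derivative f (at x) v = frechet_derivative f (at x) (\<Sum>b\<in>Basis. (v \<bullet> b) *\<^sub>R b)"
      by (simp add: euclidean_representation)
    also have "\<dots> = (\<Sum>b\<in>Basis. (v \<bullet> b) * frechet_derivative f (at x) b)"
      by (simp only: linear_sum[OF l] linear_scale[OF l] real_scaleR_def)
    finally have "\<bar>frechet_derivative f (at x) v\<bar> \<le> (\<Sum>b\<in>Basis. \<bar>(v \<bullet> b) * frechet_derivative f (at x) b\<bar>)"
      by (simp only: sum_abs)
    also have "\<dots> \<le> (\<Sum>b\<in>Basis. norm v * \<bar>C b\<bar>)"
    proof (rule sum_mono)
      fix b :: 'a assume b: "b \<in> Basis"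
      have "\<bar>frechet_derivative f (at x) b\<bar> \<le> \<bar>C b\<bar>"
        using C[of x b] 0[of x b] by (cases "norm x \<le> \<rho>") auto
      then show "\<bar>(v \<bullet> b) * frechet_derivative f (at x) b\<bar> \<le> norm v * \<bar>C b\<bar>"
        using Basis_le_norm[OF b, of v] by (simp add: abs_mult mult_mono)
    qed
    finally show ?thesis by (simp add: D_def sum_distrib_left mult.commute)
  qed
  moreover have "D \<ge> 0" unfolding D_def by (intro sum_nonneg) auto
  ultimately show ?thesis using that by blast
qed

definition cut :: "real \<Rightarrow> real \<Rightarrow> 'v::euclidean_space \<times> real \<Rightarrow> real" where
  "cut R T z = radial_cutoff R (fst z) * step (snd z - T)"

text \<open>Open, so that the cutoff is locally constant on it and its derivative vanishes
  there.\<close>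

definition inner_region :: "real \<Rightarrow> real \<Rightarrow> ('v::euclidean_space \<times> real) set" where
  "inner_region R T = {z. norm (fst z) < R \<and> snd z < T}"

lemma smooth_compose_fst: "smooth f \<Longrightarrow> smooth (\<lambda>z :: 'a::euclidean_space \<times> 'b::euclidean_space. f (fst z))"
  using smooth_compose_affine[of fst f 0] by (simp add: bounded_linear_fst)

lemma smooth_compose_snd: "smooth f \<Longrightarrow> smooth (\<lambda>z :: 'a::euclidean_space \<times> 'b::euclidean_space. f (snd z + b))"
  by (rule smooth_compose_affine[OF bounded_linear_snd])

lemma smooth_cut: "smooth (cut R T)"
  unfolding cut_def[abs_def]
  using smooth_compose_snd[OF smooth_step, of "- T"]
  by (intro smooth_mult smooth_compose_fst smooth_radial_cutoff) simp

lemma cut_nonneg: "0 \<le> cut R T z"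
  by (simp add: cut_def radial_cutoff_def step_nonneg)

lemma cut_le_1: "cut R T z \<le> 1"
  by (simp add: cut_def radial_cutoff_def step_nonneg step_le_1 mult_le_one)

lemma cut_eq_1: "norm (fst z) \<le> R \<Longrightarrow> snd z \<le> T \<Longrightarrow> cut R T z = 1"
  by (simp add: cut_def radial_cutoff_eq_1 step_eq_1)

lemma cut_eq_0: "R \<ge> 0 \<Longrightarrow> norm (fst z) \<ge> R + 1 \<or> snd z \<ge> T + 1 \<Longrightarrow> cut R T z = 0"
  by (auto simp: cut_def radial_cutoff_eq_0 step_eq_0)

lemma open_inner_region: "open (inner_region R T)"
  unfolding inner_region_def by (intro open_Collect_conj open_Collect_less continuous_intros)

lemma frechet_cut_inner: "z \<in> inner_region R T \<Longrightarrow> frechet_derivative (cut R T) (at z) v = 0"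
  by (rule frechet_derivative_locally_const[OF open_inner_region, of _ R T _ 1])
    (auto simp: inner_region_def intro!: cut_eq_1)

lemma frechet_cut:
  "frechet_derivative (cut R T) (at z) w =
    radial_cutoff R (fst z) * frechet_derivative step (at (snd z - T)) (snd w) +
    frechet_derivative (radial_cutoff R) (at (fst z)) (fst w) * step (snd z - T)"
proof -
  have 1: "(\<lambda>z. radial_cutoff R (fst z)) differentiable (at z)"
    by (intro smooth_differentiable smooth_compose_fst smooth_radial_cutoff)
  have 2: "(\<lambda>z. step (snd z - T)) differentiable (at z)"
    using smooth_compose_snd[OF smooth_step, of "- T"] by (intro smooth_differentiable) simp
  have "frechet_derivative (\<lambda>z. radial_cutoff R (fst z)) (at z) w =
      frechet_derivative (radial_cutoff R) (at (fst z)) (fst w)"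
    using frechet_derivative_compose_affine[OF bounded_linear_fst, of "radial_cutoff R" z 0 w,
        OF smooth_differentiable[OF smooth_radial_cutoff]] by simp
  moreover have "frechet_derivative (\<lambda>z. step (snd z - T)) (at z) w =
      frechet_derivative step (at (snd z - T)) (snd w)"
    using frechet_derivative_compose_affine[OF bounded_linear_snd, of step z "- T"]
      smooth_differentiable[OF smooth_step] by simp
  ultimately show ?thesis
    unfolding cut_def[abs_def] frechet_derivative_mult[OF 1 2] by simp
qed

lemma frechet_cut_outer:
  assumes "R \<ge> 0" "norm (fst z) > R + 1 \<or> snd z > T + 1"
  shows "frechet_derivative (cut R T) (at z) w = 0"
  by (rule frechet_derivative_locally_const[of "{z. norm (fst z) > R + 1} \<union> {z. snd z > T + 1}" z _ 0])
    (use assms in \<open>auto intro!: open_Un open_Collect_less continuous_intros cut_eq_0\<close>)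

lemma frechet_cut_bounded:
  assumes "R \<ge> 0"
  obtains D where "D \<ge> 0"
    "\<And>z w. \<bar>frechet_derivative (cut R T) (at z) w\<bar> \<le> D * norm (w :: 'v::euclidean_space \<times> real)"
proof -
  have "frechet_derivative (radial_cutoff R) (at x) v = 0" if "norm x > R + 1" for x v :: 'v
    by (rule frechet_derivative_locally_const[of "{x. norm x > R + 1}" x _ 0])
      (use that assms in \<open>auto intro!: open_Collect_less continuous_intros radial_cutoff_eq_0\<close>)
  then obtain D1 where D1: "D1 \<ge> 0" "\<And>x v :: 'v. \<bar>frechet_derivative (radial_cutoff R) (at x) v\<bar> \<le> D1 * norm v"
    using smooth_frechet_bounded[OF smooth_radial_cutoff, of "R + 1" R] by metis
  have "frechet_derivative step (at s) v = 0" if "norm s > 1" for s v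
  proof (cases "s > 0")
    case True
    then show ?thesis
      by (intro frechet_derivative_locally_const[of "{1<..}" s _ 0]) (use that in \<open>auto simp: step_eq_0\<close>)
  next
    case False
    then show ?thesis
      by (intro frechet_derivative_locally_const[of "{..<0}" s _ 1]) (use that in \<open>auto simp: step_eq_1\<close>)
  qed
  then obtain D2 where D2: "D2 \<ge> 0" "\<And>x v. \<bar>frechet_derivative step (at x) v\<bar> \<le> D2 * norm v"
    using smooth_frechet_bounded[OF smooth_step, of 1] by metis
  have r1: "\<bar>radial_cutoff R x\<bar> \<le> 1" for x :: 'v
    by (simp add: radial_cutoff_def step_nonneg step_le_1)
  have r2: "\<bar>step s\<bar> \<le> 1" for s by (simp add: step_nonneg step_le_1)
  have "\<bar>frechet_derivative (cut R T) (at z) w\<bar> \<le> (D1 + D2) * norm w" for z w :: "'v \<times> real"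
  proof -
    have w: "norm (fst w) \<le> norm w" "norm (snd w) \<le> norm w"
      using norm_fst_le[of "fst w" "snd w"] norm_snd_le[of "snd w" "fst w"] by simp_all
    have "\<bar>frechet_derivative step (at (snd z - T)) (snd w)\<bar> \<le> D2 * norm w"
      using D2 w(2) by (meson mult_left_mono order_trans)
    then have "\<bar>radial_cutoff R (fst z)\<bar> * \<bar>frechet_derivative step (at (snd z - T)) (snd w)\<bar> \<le> 1 * (D2 * norm w)"
      using r1 by (intro mult_mono) auto
    moreover have "\<bar>frechet_derivative (radial_cutoff R) (at (fst z)) (fst w)\<bar> \<le> D1 * norm w"
      using D1 w(1) by (meson mult_left_mono order_trans)
    then have "\<bar>frechet_derivative (radial_cutoff R) (at (fst z)) (fst w)\<bar> * \<bar>step (snd z - T)\<bar> \<le> D1 * norm w * 1"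
      using r2 D1(1) by (intro mult_mono) auto
    ultimately show ?thesis unfolding frechet_cut
      by (intro order_trans[OF abs_triangle_ineq]) (simp add: abs_mult distrib_right)
  qed
  then show ?thesis using that[of "D1 + D2"] D1 D2 by simp
qed

context heintze_space
begin

text \<open>The frame vectors may grow upwards, but the derivative of the cutoff vanishes above
  height T + 1, and below it the frame is bounded by \<open>frame_bounded\<close>.\<close>

lemma frechet_cut_frame_bounded:
  assumes "R \<ge> 0"
  obtains C where "C \<ge> 0" "\<And>z a. \<bar>frechet_derivative (cut R T) (at z) (frame (snd z) a)\<bar> \<le> C"
proof -
  obtain D where D: "D \<ge> 0" "\<And>z w. \<bar>frechet_derivative (cut R T) (at z) w\<bar> \<le> D * norm (w :: 'v \<times> real)"
    using frechet_cut_bounded[OF assms, where 'v = 'v] by metis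
  obtain C where C: "C \<ge> 0" "\<And>t a. t \<le> T + 1 \<Longrightarrow> norm (frame t a) \<le> C"
    using frame_bounded[of "T + 1"] by metis
  have "\<bar>frechet_derivative (cut R T) (at z) (frame (snd z) a)\<bar> \<le> D * C" for z :: "'v \<times> real" and a
  proof (cases "snd z \<le> T + 1")
    case True
    then show ?thesis using D C(2) by (meson mult_left_mono order_trans)
  next
    case False
    then show ?thesis using frechet_cut_outer[OF assms, of z T] C D by simp
  qed
  then show ?thesis using that[of "D * C"] C D by simp
qed

lemma energy_le_add:
  assumes m: "measurable_form k \<omega>" "measurable_form l \<theta>" and nn: "0 \<le> C" "0 \<le> D"
    and le: "AE z in lebesgue. fnorm j \<xi> z \<le> C * fnorm k \<omega> z + D * fnorm l \<theta> z"
  shows "energy j \<xi> \<le> ennreal (2 powr p * C powr p) * energy k \<omega> + ennreal (2 powr p * D powr p) * energy l \<theta>"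
proof -
  note [measurable] = measurable_density_p[OF m(1)] measurable_density_p[OF m(2)]
  have dens: "density_p j \<xi> z \<le> 2 powr p * C powr p * density_p k \<omega> z + 2 powr p * D powr p * density_p l \<theta> z"
    if "fnorm j \<xi> z \<le> C * fnorm k \<omega> z + D * fnorm l \<theta> z" for z
  proof -
    have "fnorm j \<xi> z powr p \<le> (C * fnorm k \<omega> z + D * fnorm l \<theta> z) powr p"
      using that fnorm_nonneg p by (intro powr_mono2) auto
    also have "\<dots> \<le> 2 powr p * ((C * fnorm k \<omega> z) powr p + (D * fnorm l \<theta> z) powr p)"
      using nn fnorm_nonneg by (intro powr_add_le) auto
    finally have "fnorm j \<xi> z powr p * exp (- \<tau> * snd z) \<le>
        2 powr p * ((C * fnorm k \<omega> z) powr p + (D * fnorm l \<theta> z) powr p) * exp (- \<tau> * snd z)"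
      by (rule mult_right_mono) simp
    then show ?thesis
      using nn fnorm_nonneg by (simp add: density_p_def powr_mult algebra_simps)
  qed
  have "energy j \<xi> \<le> (\<integral>\<^sup>+z. ennreal (2 powr p * C powr p) * ennreal (density_p k \<omega> z) +
      ennreal (2 powr p * D powr p) * ennreal (density_p l \<theta> z) \<partial>lebesgue)"
    unfolding energy_def
  proof (rule nn_integral_mono_AE)
    show "AE z in lebesgue. ennreal (density_p j \<xi> z) \<le> ennreal (2 powr p * C powr p) * ennreal (density_p k \<omega> z) +
        ennreal (2 powr p * D powr p) * ennreal (density_p l \<theta> z)"
      using le
    proof eventually_elim
      case (elim z)
      from dens[OF elim] show ?case
        by (simp add: density_p_nonneg flip: ennreal_plus ennreal_mult)
    qed
  qed
  then show ?thesis
    unfolding energy_def by (simp add: nn_integral_cmult nn_integral_add)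
qed

definition cut_form :: "real \<Rightarrow> real \<Rightarrow> ('v \<times> real) form \<Rightarrow> ('v \<times> real) form" where
  "cut_form R T s = (\<lambda>z v. cut R T z * s z v)"

lemma smooth_cut_form: "smooth_form k s \<Longrightarrow> smooth_form k (cut_form R T s)"
  unfolding cut_form_def by (rule smooth_form_mult[OF smooth_cut])

lemma fnorm_scale: "fnorm k (\<lambda>z v. h z * s z v) z = \<bar>h z\<bar> * fnorm k s z"
  by (simp add: fnorm_def abs_mult sum_distrib_left)

lemma fnorm_cut_form: "fnorm k (cut_form R T s) z \<le> fnorm k s z"
  unfolding cut_form_def fnorm_scale
  using cut_nonneg[of R T z] cut_le_1[of R T z] fnorm_nonneg[of k s z] by (simp add: mult_left_le_one_le)

lemma cut_form_inner: "z \<in> inner_region R T \<Longrightarrow> cut_form R T s z = s z"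
  by (simp add: cut_form_def inner_region_def cut_eq_1)

lemma ext_deriv_cut_form_inner:
  "smooth_form k s \<Longrightarrow> z \<in> inner_region R T \<Longrightarrow> ext_deriv k (cut_form R T s) z = ext_deriv k s z"
  unfolding cut_form_def
  by (rule ext) (simp add: ext_deriv_mult[OF smooth_cut] frechet_cut_inner inner_region_def cut_eq_1)

text \<open>The Leibniz rule: the first term is the wedge of the differential of the cutoff with s,
  the second the cut differential. The trivial factor 1 matches the shape of
  \<open>energy_le_add\<close>.\<close>

lemma fnorm_ext_deriv_cut_form:
  assumes "R \<ge> 0"
  obtains C where "C \<ge> 0" "\<And>s z. smooth_form k s \<Longrightarrow>
    fnorm (Suc k) (ext_deriv k (cut_form R T s)) z \<le> C * fnorm k s z + 1 * fnorm (Suc k) (ext_deriv k s) z"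
proof -
  obtain D where D: "D \<ge> 0" "\<And>z a. \<bar>frechet_derivative (cut R T) (at z) (frame (snd z) a)\<bar> \<le> D"
    using frechet_cut_frame_bounded[OF assms] by metis
  let ?M = "real (card ({..<Suc k} \<rightarrow>\<^sub>E {..N}))"
  define C where "C = ?M * (real (Suc k) * D)"
  have "fnorm (Suc k) (ext_deriv k (cut_form R T s)) z \<le> C * fnorm k s z + 1 * fnorm (Suc k) (ext_deriv k s) z"
    if s: "smooth_form k s" for s z
  proof -
    have "\<bar>ext_deriv k (cut_form R T s) z (\<lambda>i. frame (snd z) (I i))\<bar> \<le>
        real (Suc k) * D * fnorm k s z + \<bar>ext_deriv k s z (\<lambda>i. frame (snd z) (I i))\<bar>"
      if I: "I \<in> {..<Suc k} \<rightarrow>\<^sub>E {..N}" for I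
    proof -
      let ?v = "\<lambda>i. frame (snd z) (I i)"
      let ?d = "\<lambda>i. (-1) ^ i * (frechet_derivative (cut R T) (at z) (?v i) * s z (omit i ?v))"
      have "\<bar>?d i\<bar> \<le> D * fnorm k s z" if i: "i \<le> k" for i
      proof -
        have "omit i ?v = (\<lambda>j. frame (snd z) (omit i I j))" by (auto simp: omit_def)
        moreover have "omit i I j \<le> N" if "j < k" for j
          using PiE_mem[OF I, of j] PiE_mem[OF I, of "Suc j"] that by (simp add: omit_def)
        ultimately have "\<bar>s z (omit i ?v)\<bar> \<le> fnorm k s z"
          using le_fnorm[OF smooth_form_alternating[OF s], where I = "omit i I"] by simp
        then show ?thesis using D by (simp add: abs_mult power_abs mult_mono)
      qed
      then have "\<bar>\<Sum>i\<le>k. ?d i\<bar> \<le> (\<Sum>i\<le>k. D * fnorm k s z)"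
        by (intro order_trans[OF sum_abs] sum_mono) auto
      also have "\<dots> = real (Suc k) * D * fnorm k s z" by simp
      finally have 1: "\<bar>\<Sum>i\<le>k. ?d i\<bar> \<le> real (Suc k) * D * fnorm k s z" .
      have 2: "\<bar>cut R T z * ext_deriv k s z ?v\<bar> \<le> \<bar>ext_deriv k s z ?v\<bar>"
        using cut_nonneg[of R T z] cut_le_1[of R T z] by (simp add: abs_mult mult_left_le_one_le)
      show ?thesis
        unfolding cut_form_def ext_deriv_mult[OF smooth_cut s]
        by (intro order_trans[OF abs_triangle_ineq] add_mono 1 2)
    qed
    then have "fnorm (Suc k) (ext_deriv k (cut_form R T s)) z \<le>
        (\<Sum>I\<in>{..<Suc k} \<rightarrow>\<^sub>E {..N}. real (Suc k) * D * fnorm k s z + \<bar>ext_deriv k s z (\<lambda>i. frame (snd z) (I i))\<bar>)"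
      unfolding fnorm_def[of "Suc k"] by (rule sum_mono)
    then show ?thesis by (simp only: sum.distrib sum_constant fnorm_def[of "Suc k"] C_def mult.assoc mult_1)
  qed
  moreover have "C \<ge> 0" using D by (simp add: C_def)
  ultimately show ?thesis using that by blast
qed

text \<open>On the inner region the cutoff changes neither s i nor its differential. Elsewhere the
  limits \<omega> and \<theta> vanish, so s i and its differential are themselves the approximation
  errors and dominate what the cutoff leaves of them.\<close>

lemma cut_form_converges:
  assumes R: "R \<ge> 0"
    and s: "\<And>i. smooth_energy k (s i)" "(\<lambda>i. energy k (s i - \<omega>)) \<longlonglongrightarrow> 0"
      "(\<lambda>i. energy (Suc k) (ext_deriv k (s i) - \<theta>)) \<longlonglongrightarrow> 0"
    and m: "measurable_form k \<omega>" "measurable_form (Suc k) \<theta>"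
    and ae: "AE z in lebesgue. z \<notin> inner_region R T \<longrightarrow> \<omega> z = 0 \<and> \<theta> z = 0"
  shows "smooth_energy k (cut_form R T (s i))"
    and "(\<lambda>i. energy k (cut_form R T (s i) - \<omega>)) \<longlonglongrightarrow> 0"
    and "(\<lambda>i. energy (Suc k) (ext_deriv k (cut_form R T (s i)) - \<theta>)) \<longlonglongrightarrow> 0"
proof -
  obtain C where C: "C \<ge> 0" "\<And>s z. smooth_form k s \<Longrightarrow>
    fnorm (Suc k) (ext_deriv k (cut_form R T s)) z \<le> C * fnorm k s z + 1 * fnorm (Suc k) (ext_deriv k s) z"
    using fnorm_ext_deriv_cut_form[OF R] by metis
  have sf: "smooth_form k (s i)" for i using s(1) by (simp add: smooth_energy_def)
  note ms = measurable_smooth_form[OF sf] measurable_smooth_form[OF smooth_form_ext_deriv[OF sf]]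
  have fin: "energy k (s i) < \<infinity>" "energy (Suc k) (ext_deriv k (s i)) < \<infinity>" for i
    using s(1) by (auto simp: smooth_energy_def)
  have le1: "energy k (cut_form R T (s i)) \<le> ennreal (1 powr p) * energy k (s i)" for i
    by (rule energy_mono_AE[OF ms(1)]) (simp_all add: fnorm_cut_form)
  have le2: "energy (Suc k) (ext_deriv k (cut_form R T (s i))) \<le>
      ennreal (2 powr p * C powr p) * energy k (s i) + ennreal (2 powr p * 1 powr p) * energy (Suc k) (ext_deriv k (s i))" for i
    by (rule energy_le_add[OF ms]) (use C sf in auto)
  show "smooth_energy k (cut_form R T (s i))"
    unfolding smooth_energy_def
  proof (intro conjI smooth_cut_form sf)
    show "energy k (cut_form R T (s i)) < \<infinity>"
      by (rule le_less_trans[OF le1]) (use fin in \<open>simp add: ennreal_mult_less_top\<close>)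
    show "energy (Suc k) (ext_deriv k (cut_form R T (s i))) < \<infinity>"
      by (rule le_less_trans[OF le2]) (use fin in \<open>simp add: ennreal_mult_less_top ennreal_add_less_top\<close>)
  qed
  have "energy k (cut_form R T (s i) - \<omega>) \<le> ennreal 1 * energy k (s i - \<omega>)" for i
  proof -
    have "AE z in lebesgue. fnorm k (cut_form R T (s i) - \<omega>) z \<le> 1 * fnorm k (s i - \<omega>) z"
      using ae
    proof eventually_elim
      case (elim z)
      show ?case
      proof (cases "z \<in> inner_region R T")
        case True
        then show ?thesis using fnorm_cong[of "cut_form R T (s i) - \<omega>" z "s i - \<omega>" k] by (simp add: cut_form_inner)
      next
        case False
        with elim have "\<omega> z = 0" by blast
        then show ?thesis
          using fnorm_cong[of "cut_form R T (s i) - \<omega>" z "cut_form R T (s i)" k]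
            fnorm_cong[of "s i - \<omega>" z "s i" k] fnorm_cut_form[of k R T "s i" z] by simp
      qed
    qed
    from energy_mono_AE[OF _ _ this] show ?thesis by (simp add: measurable_form_diff ms m)
  qed
  then show "(\<lambda>i. energy k (cut_form R T (s i) - \<omega>)) \<longlonglongrightarrow> 0"
    using s(2) by (rule tendsto_0_mult_le)
  have le: "energy (Suc k) (ext_deriv k (cut_form R T (s i)) - \<theta>) \<le>
      ennreal (2 powr p * C powr p) * energy k (s i - \<omega>) +
      ennreal (2 powr p * 1 powr p) * energy (Suc k) (ext_deriv k (s i) - \<theta>)" for i
  proof (rule energy_le_add)
    show "AE z in lebesgue. fnorm (Suc k) (ext_deriv k (cut_form R T (s i)) - \<theta>) z \<le>
        C * fnorm k (s i - \<omega>) z + 1 * fnorm (Suc k) (ext_deriv k (s i) - \<theta>) z"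
      using ae
    proof eventually_elim
      case (elim z)
      show ?case
      proof (cases "z \<in> inner_region R T")
        case True
        then have "fnorm (Suc k) (ext_deriv k (cut_form R T (s i)) - \<theta>) z = fnorm (Suc k) (ext_deriv k (s i) - \<theta>) z"
          by (intro fnorm_cong) (simp add: ext_deriv_cut_form_inner[OF sf])
        then show ?thesis using C(1) fnorm_nonneg by simp
      next
        case False
        with elim have "\<omega> z = 0" "\<theta> z = 0" by blast+
        then show ?thesis
          using fnorm_cong[of "ext_deriv k (cut_form R T (s i)) - \<theta>" z "ext_deriv k (cut_form R T (s i))" "Suc k"]
            fnorm_cong[of "s i - \<omega>" z "s i" k] fnorm_cong[of "ext_deriv k (s i) - \<theta>" z "ext_deriv k (s i)" "Suc k"]
            C(2)[OF sf, of i z] by simp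
      qed
    qed
  qed (use C in \<open>simp_all add: measurable_form_diff ms m\<close>)
  have "(\<lambda>i. ennreal (2 powr p * C powr p) * energy k (s i - \<omega>) +
      ennreal (2 powr p * 1 powr p) * energy (Suc k) (ext_deriv k (s i) - \<theta>)) \<longlonglongrightarrow> ennreal (2 powr p * C powr p) * 0 + ennreal (2 powr p * 1 powr p) * 0"
    by (intro tendsto_add ennreal_tendsto_cmult s) simp_all
  then have "(\<lambda>i. ennreal (2 powr p * C powr p) * energy k (s i - \<omega>) +
      ennreal (2 powr p * 1 powr p) * energy (Suc k) (ext_deriv k (s i) - \<theta>)) \<longlonglongrightarrow> 0" by simp
  then show "(\<lambda>i. energy (Suc k) (ext_deriv k (cut_form R T (s i)) - \<theta>)) \<longlonglongrightarrow> 0"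
    by (rule tendsto_sandwich[OF _ _ tendsto_const, rotated 2]) (intro always_eventually allI le zero_le)+
qed

end

section \<open>Integration along the vertical geodesics\<close>

definition vert_int :: "real \<Rightarrow> ('v::euclidean_space \<times> real \<Rightarrow> real) \<Rightarrow> 'v \<times> real \<Rightarrow> real" where
  "vert_int T F z = integral {0..T - snd z} (\<lambda>r. F (z + r *\<^sub>R (0, 1)))"

text \<open>The upper limit of \<open>vert_int\<close> moves with the base point. As F vanishes
  above T, any longer fixed interval gives the same value, and with fixed limits differentiation
  under the integral applies.\<close>

lemma vert_int_eq:
  assumes "\<And>z. snd z > T \<Longrightarrow> F z = 0" "T - snd z \<le> L"
  shows "vert_int T F z = integral {0..L} (\<lambda>r. F (z + r *\<^sub>R (0, 1)))"
  unfolding vert_int_def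
proof (rule integral_spike_set)
  have e1: "{r \<in> {0..T - snd z} - {0..L}. F (z + r *\<^sub>R (0, 1)) \<noteq> 0} = {}" using assms(2) by auto
  show "negligible {r \<in> {0..T - snd z} - {0..L}. F (z + r *\<^sub>R (0, 1)) \<noteq> 0}"
    unfolding e1 by (rule negligible_empty)
  have "F (z + r *\<^sub>R (0, 1)) = 0" if "r \<in> {0..L} - {0..T - snd z}" for r
    using that by (intro assms(1)) auto
  then have e2: "{r \<in> {0..L} - {0..T - snd z}. F (z + r *\<^sub>R (0, 1)) \<noteq> 0} = {}" by auto
  show "negligible {r \<in> {0..L} - {0..T - snd z}. F (z + r *\<^sub>R (0, 1)) \<noteq> 0}"
    unfolding e2 by (rule negligible_empty)
qed

lemma frechet_zero_above:
  fixes F :: "'v::euclidean_space \<times> real \<Rightarrow> real"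
  assumes "\<And>z. snd z > T \<Longrightarrow> F z = 0" "snd z > T"
  shows "frechet_derivative F (at z) w = 0"
  by (rule frechet_derivative_locally_const[of "{z. snd z > T}" z F 0])
    (use assms in \<open>auto intro!: open_Collect_less continuous_intros\<close>)

lemma vert_int_has_derivative:
  fixes F :: "'v::euclidean_space \<times> real \<Rightarrow> real"
  assumes F: "smooth F" and T: "\<And>z. snd z > T \<Longrightarrow> F z = 0"
  shows "(vert_int T F has_derivative (\<lambda>w. vert_int T (\<lambda>y. frechet_derivative F (at y) w) z)) (at z)"
proof -
  \<comment> \<open>The margin 1 makes the same length sufficient for all points higher than
    \<open>snd z - 1\<close>, an open neighbourhood of z.\<close>
  define L where "L = \<bar>T - snd z\<bar> + 1"
  have "((\<lambda>z. integral {0..L} (\<lambda>r. F (z + r *\<^sub>R (0, 1)))) has_derivative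
     (\<lambda>w. integral {0..L} (\<lambda>r. frechet_derivative F (at (z + r *\<^sub>R (0, 1))) w))) (at z)"
    by (rule translate_integral_has_derivative[OF smooth_Ck[OF F]])
  moreover have "integral {0..L} (\<lambda>r. frechet_derivative F (at (z + r *\<^sub>R (0, 1))) w) =
      vert_int T (\<lambda>y. frechet_derivative F (at y) w) z" for w
    by (rule vert_int_eq[symmetric]) (use frechet_zero_above[of T F] T in \<open>auto simp: L_def\<close>)
  ultimately have "((\<lambda>z. integral {0..L} (\<lambda>r. F (z + r *\<^sub>R (0, 1)))) has_derivative
     (\<lambda>w. vert_int T (\<lambda>y. frechet_derivative F (at y) w) z)) (at z)" by simp
  then show ?thesis
  proof (rule has_derivative_transform_within_open)
    show "open {y :: 'v \<times> real. snd y > snd z - 1}"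
      by (intro open_Collect_less continuous_intros)
    show "z \<in> {y. snd y > snd z - 1}" by simp
    fix y :: "'v \<times> real" assume "y \<in> {y. snd y > snd z - 1}"
    then have "T - snd y \<le> L" by (auto simp: L_def)
    then show "integral {0..L} (\<lambda>r. F (y + r *\<^sub>R (0, 1))) = vert_int T F y"
      by (intro vert_int_eq[symmetric] T)
  qed
qed

lemma frechet_vert_int:
  assumes "smooth F" "\<And>z. snd z > T \<Longrightarrow> F z = 0"
  shows "frechet_derivative (vert_int T F) (at z) w = vert_int T (\<lambda>y. frechet_derivative F (at y) w) z"
  using frechet_derivative_at[OF vert_int_has_derivative[OF assms]] by metis

lemma smooth_vert_int:
  assumes "smooth F" "\<And>z. snd z > T \<Longrightarrow> F z = 0"
  shows "smooth (vert_int T F)"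
proof -
  have "Ck m (vert_int T F)" for m
    using assms
  proof (induction m arbitrary: F)
    case 0
    have "isCont (vert_int T F) z" for z
      by (rule has_derivative_continuous[OF vert_int_has_derivative]) (use 0 in auto)
    then show ?case by (simp add: continuous_at_imp_continuous_on)
  next
    case (Suc m)
    have "Ck m (vert_int T (\<lambda>y. frechet_derivative F (at y) v))" for v
      using smooth_frechet[OF Suc.prems(1)] frechet_zero_above[of T F] Suc.prems(2)
      by (intro Suc.IH) auto
    moreover have "(\<lambda>z. frechet_derivative (vert_int T F) (at z) v) = vert_int T (\<lambda>y. frechet_derivative F (at y) v)" for v
      by (rule ext) (rule frechet_vert_int[OF Suc.prems])
    moreover have "vert_int T F differentiable (at z)" for z
      using vert_int_has_derivative[OF Suc.prems] unfolding differentiable_def by blast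
    ultimately show ?case by (simp only: Ck.simps) blast
  qed
  then show ?thesis by (simp add: smooth_def)
qed

lemma vertical_ray_integrable:
  fixes F :: "'v::euclidean_space \<times> real \<Rightarrow> real"
  assumes "continuous_on UNIV F"
  shows "(\<lambda>r. F (z + r *\<^sub>R (0, 1))) integrable_on {0..L}"
  by (intro integrable_continuous_real continuous_on_compose2[OF assms] continuous_intros) auto

text \<open>The homotopy operator of the upward vertical flow. In the chart this flow consists of
  translations, so pulling back leaves the arguments \<open>v\<close> unchanged. The minus sign is
  the one that makes \<open>ext_deriv_hom\<close> hold, since the flow starts at the identity and
  ends where the form vanishes.\<close>

definition hom :: "real \<Rightarrow> ('v::euclidean_space \<times> real) form \<Rightarrow> ('v \<times> real) form" where
  "hom T s = (\<lambda>z v. - vert_int T (\<lambda>y. s y (case_nat (0, 1) v)) z)"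

lemma smooth_form_hom:
  assumes s: "smooth_form (Suc k) s" and T: "\<And>z. snd z > T \<Longrightarrow> s z = 0"
  shows "smooth_form k (hom T s)"
  unfolding smooth_form_def
proof (intro conjI allI)
  fix z
  have a: "alternating k (\<lambda>v. s y (case_nat (0, 1) v))" for y
    by (rule alternating_contract[OF smooth_form_alternating[OF s]])
  note int = vertical_ray_integrable[OF smooth_continuous[OF smooth_form_smooth[OF s]]]
  have "alternating k (\<lambda>v. vert_int T (\<lambda>y. s y (case_nat (0, 1) v)) z)"
    unfolding alternating_def
  proof (intro conjI allI impI)
    fix v u :: "nat \<Rightarrow> 'a \<times> real" assume "\<forall>i<k. v i = u i"
    then have "(\<lambda>y. s y (case_nat (0, 1) v)) = (\<lambda>y. s y (case_nat (0, 1) u))"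
      by (intro ext alternating_cong[OF a]) simp
    then show "vert_int T (\<lambda>y. s y (case_nat (0, 1) v)) z = vert_int T (\<lambda>y. s y (case_nat (0, 1) u)) z"
      by simp
  next
    fix v :: "nat \<Rightarrow> 'a \<times> real" and i assume i: "i < k"
    show "linear (\<lambda>x. vert_int T (\<lambda>y. s y (case_nat (0, 1) (v(i := x)))) z)"
    proof (rule linearI)
      show "vert_int T (\<lambda>y. s y (case_nat (0, 1) (v(i := a + b)))) z =
          vert_int T (\<lambda>y. s y (case_nat (0, 1) (v(i := a)))) z +
          vert_int T (\<lambda>y. s y (case_nat (0, 1) (v(i := b)))) z" for a b
        unfolding vert_int_def alternating_upd_add[OF a i] by (rule integral_add[OF int int])
      show "vert_int T (\<lambda>y. s y (case_nat (0, 1) (v(i := r *\<^sub>R b)))) z =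
          r *\<^sub>R vert_int T (\<lambda>y. s y (case_nat (0, 1) (v(i := b)))) z" for r b
        unfolding vert_int_def alternating_upd_scale[OF a i] by simp
    qed
  next
    fix v :: "nat \<Rightarrow> 'a \<times> real" and i j assume ij: "i < k" "j < k" "i \<noteq> j" "v i = v j"
    show "vert_int T (\<lambda>y. s y (case_nat (0, 1) v)) z = 0"
      unfolding vert_int_def alternating_eq_0[OF a ij] by simp
  qed
  then show "alternating k (hom T s z)"
    unfolding hom_def by (rule alternating_uminus)
next
  fix v
  show "smooth (\<lambda>z. hom T s z v)"
    unfolding hom_def
    by (intro smooth_uminus smooth_vert_int[of "\<lambda>y. s y (case_nat (0, 1) v)"] smooth_form_smooth[OF s])
      (simp add: T)
qed

lemma ext_deriv_zero_above:
  assumes "\<And>z. snd z > T \<Longrightarrow> s z = 0" "snd z > T"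
  shows "ext_deriv k s (z :: 'v::euclidean_space \<times> real) = 0"
  by (rule ext) (use assms in \<open>simp add: ext_deriv_omit frechet_zero_above[of T]\<close>)

text \<open>The homotopy formula d h + h d = id. By \<open>ext_deriv_contract\<close> the sum of the
  two terms is the integral of the vertical derivative of s along the ray; this telescopes to s at
  z, as s vanishes at the upper end.\<close>

lemma ext_deriv_hom:
  fixes s :: "('v::euclidean_space \<times> real) form"
  assumes s: "smooth_form (Suc k) s" and T: "\<And>z. snd z > T \<Longrightarrow> s z = 0"
  shows "ext_deriv k (hom T s) z v = s z v - hom T (ext_deriv (Suc k) s) z v"
proof -
  let ?\<nu> = "(0, 1) :: 'v \<times> real"
  define L where "L = \<bar>T - snd z\<bar> + 1"
  have L: "T - snd z \<le> L" "0 \<le> L" by (auto simp: L_def)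
  define D where "D = (\<lambda>w u y. frechet_derivative (\<lambda>z. s z u) (at y) w)"
  have Dsm: "smooth (D w u)" for w u
    unfolding D_def by (rule smooth_frechet[OF smooth_form_smooth[OF s]])
  have D0: "D w u y = 0" if "snd y > T" for w u y
    unfolding D_def by (rule frechet_zero_above[of T]) (simp_all add: T that)
  have int: "(\<lambda>r. D w u (z + r *\<^sub>R ?\<nu>)) integrable_on {0..L}" for w u
    by (rule vertical_ray_integrable[OF smooth_continuous[OF Dsm]])
  have fd: "frechet_derivative (\<lambda>y. hom T s y u) (at z) w = - integral {0..L} (\<lambda>r. D w (case_nat ?\<nu> u) (z + r *\<^sub>R ?\<nu>))" for u w
  proof -
    let ?F = "\<lambda>y. s y (case_nat ?\<nu> u)"
    have F: "smooth ?F" "\<And>z. snd z > T \<Longrightarrow> ?F z = 0" using smooth_form_smooth[OF s] T by auto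
    have "frechet_derivative (\<lambda>y. hom T s y u) (at z) w = - frechet_derivative (vert_int T ?F) (at z) w"
      using frechet_derivative_cmult[OF smooth_vert_int[OF F], where c = "-1" and x = z and v = w] by (simp add: hom_def)
    also have "\<dots> = - vert_int T (D w (case_nat ?\<nu> u)) z"
      using frechet_vert_int[OF F] by (simp add: D_def)
    finally show ?thesis using vert_int_eq[of T "D w (case_nat ?\<nu> u)", OF _ L(1)] D0 by simp
  qed
  have "hom T (ext_deriv (Suc k) s) z v = - integral {0..L} (\<lambda>r. ext_deriv (Suc k) s (z + r *\<^sub>R ?\<nu>) (case_nat ?\<nu> v))"
    unfolding hom_def
    using vert_int_eq[of T "\<lambda>y. ext_deriv (Suc k) s y (case_nat ?\<nu> v)", OF _ L(1)] ext_deriv_zero_above[of T s] T by simp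
  also have "\<dots> = - integral {0..L} (\<lambda>r. D ?\<nu> v (z + r *\<^sub>R ?\<nu>) -
      (\<Sum>i\<le>k. (-1) ^ i * D (v i) (case_nat ?\<nu> (omit i v)) (z + r *\<^sub>R ?\<nu>)))"
    unfolding ext_deriv_contract D_def ..
  also have "\<dots> = - (integral {0..L} (\<lambda>r. D ?\<nu> v (z + r *\<^sub>R ?\<nu>)) -
      (\<Sum>i\<le>k. (-1) ^ i * integral {0..L} (\<lambda>r. D (v i) (case_nat ?\<nu> (omit i v)) (z + r *\<^sub>R ?\<nu>))))"
    by (subst integral_diff, rule int, intro integrable_sum integrable_on_mult_right int, simp)
      (subst integral_sum, simp, intro integrable_on_mult_right int, simp)
  also have "integral {0..L} (\<lambda>r. D ?\<nu> v (z + r *\<^sub>R ?\<nu>)) = s (z + L *\<^sub>R ?\<nu>) v - s z v"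
    unfolding D_def by (rule integral_directional_derivative[OF smooth_form_smooth[OF s] L(2)])
  also have "s (z + L *\<^sub>R ?\<nu>) v = 0"
    using T[of "z + L *\<^sub>R ?\<nu>"] by (simp add: L_def)
  also have "(\<Sum>i\<le>k. (-1) ^ i * integral {0..L} (\<lambda>r. D (v i) (case_nat ?\<nu> (omit i v)) (z + r *\<^sub>R ?\<nu>))) =
      - ext_deriv k (hom T s) z v"
    by (simp add: ext_deriv_omit fd sum_negf)
  finally show ?thesis by simp
qed

lemma exp_integral_le:
  fixes \<delta> :: real
  assumes "\<delta> > 0" "0 \<le> L"
  shows "integral {0..L} (\<lambda>r. exp (- \<delta> * r)) \<le> 1 / \<delta>"
proof -
  have "((\<lambda>r. exp (- \<delta> * r)) has_integral (- exp (- \<delta> * L) / \<delta> - (- exp (- \<delta> * 0) / \<delta>))) {0..L}"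
    using assms
    by (intro fundamental_theorem_of_calculus)
      (auto intro!: derivative_eq_intros simp: has_real_derivative_iff_has_vector_derivative[symmetric])
  then show ?thesis using assms by (simp add: integral_unique)
qed

text \<open>The tangent line of the convex function x^p at y lies below the graph; Young's
  inequality with weights 1 / p and 1 - 1 / p gives it.\<close>

lemma powr_tangent_le:
  fixes x y p :: real
  assumes "0 \<le> x" "0 < y" "1 \<le> p"
  shows "p * y powr (p - 1) * x - (p - 1) * y powr p \<le> x powr p"
proof (cases "x = 0")
  case False
  have "(x powr p) powr (1 / p) * (y powr p) powr (1 - 1 / p) \<le> 1 / p * x powr p + (1 - 1 / p) * y powr p"
    using assms False by (intro Youngs_inequality_0) auto
  moreover have "(x powr p) powr (1 / p) = x" using assms by (simp add: powr_powr)
  moreover have "(y powr p) powr (1 - 1 / p) = y powr (p - 1)"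
    using assms by (simp add: powr_powr right_diff_distrib)
  ultimately have "p * (x * y powr (p - 1)) \<le> p * (1 / p * x powr p + (1 - 1 / p) * y powr p)"
    using assms by (intro mult_left_mono) auto
  also have "\<dots> = x powr p + (p - 1) * y powr p"
    using assms by (simp add: field_simps)
  finally show ?thesis by (simp add: algebra_simps)
qed (use assms in simp)

text \<open>Jensen's inequality for the measure \<open>exp (- \<delta> r) dr\<close>, by integrating the tangent line at \<open>\<delta> A\<close>.\<close>

lemma exp_weighted_jensen:
  fixes f :: "real \<Rightarrow> real"
  assumes f: "continuous_on {0..L} f" "\<And>r. r \<in> {0..L} \<Longrightarrow> 0 \<le> f r" and \<delta>: "\<delta> > 0" and p: "1 \<le> p"
  shows "(integral {0..L} (\<lambda>r. exp (- \<delta> * r) * f r)) powr p \<le>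
    \<delta> powr (1 - p) * integral {0..L} (\<lambda>r. exp (- \<delta> * r) * f r powr p)"
proof (cases "0 \<le> L")
  case True
  define A where "A = integral {0..L} (\<lambda>r. exp (- \<delta> * r) * f r)"
  have i1: "(\<lambda>r. exp (- \<delta> * r) * f r) integrable_on {0..L}"
    by (intro integrable_continuous_real continuous_intros f)
  have i2: "(\<lambda>r. exp (- \<delta> * r) * f r powr p) integrable_on {0..L}"
    using p f(2) by (intro integrable_continuous_real continuous_intros continuous_on_powr' f) auto
  have i3: "(\<lambda>r. exp (- \<delta> * r)) integrable_on {0..L}"
    by (intro integrable_continuous_real continuous_intros)
  have A0: "0 \<le> A" unfolding A_def using f(2) by (intro integral_nonneg i1) auto
  show ?thesis
  proof (cases "A = 0")
    case True
    have "0 \<le> integral {0..L} (\<lambda>r. exp (- \<delta> * r) * f r powr p)" by (intro integral_nonneg i2) auto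
    then show ?thesis using True by (simp add: A_def)
  next
    case False
    then have A: "A > 0" using A0 by simp
    define y where "y = \<delta> * A"
    have y: "y > 0" using A \<delta> by (simp add: y_def)
    \<comment> \<open>The measure has total mass at most 1 / \<delta>; replacing its mass by this
      bound only lowers the left-hand side, as the coefficient p - 1 is nonnegative.\<close>
    have "p * y powr (p - 1) * A - (p - 1) * y powr p * (1 / \<delta>) \<le>
        p * y powr (p - 1) * A - (p - 1) * y powr p * integral {0..L} (\<lambda>r. exp (- \<delta> * r))"
      using exp_integral_le[OF \<delta> \<open>0 \<le> L\<close>] p by (intro diff_left_mono mult_left_mono) auto
    also have "\<dots> = integral {0..L} (\<lambda>r. p * y powr (p - 1) * (exp (- \<delta> * r) * f r) - (p - 1) * y powr p * exp (- \<delta> * r))"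
      unfolding A_def using i1 i3 by (subst integral_diff) (auto intro!: integrable_on_mult_right)
    also have "\<dots> \<le> integral {0..L} (\<lambda>r. exp (- \<delta> * r) * f r powr p)"
    proof (rule integral_le)
      fix r assume r: "r \<in> {0..L}"
      have "exp (- \<delta> * r) * (p * y powr (p - 1) * f r - (p - 1) * y powr p) \<le> exp (- \<delta> * r) * f r powr p"
        by (intro mult_left_mono powr_tangent_le f(2)[OF r] y p) simp
      then show "p * y powr (p - 1) * (exp (- \<delta> * r) * f r) - (p - 1) * y powr p * exp (- \<delta> * r) \<le> exp (- \<delta> * r) * f r powr p"
        by (simp add: algebra_simps)
    qed (intro integrable_diff integrable_on_mult_right i1 i3 i2)+
    also have "p * y powr (p - 1) * A - (p - 1) * y powr p * (1 / \<delta>) = \<delta> powr (p - 1) * A powr p"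
    proof -
      have "y powr (p - 1) * A = \<delta> powr (p - 1) * A powr p"
        using A \<delta> by (simp add: y_def powr_mult powr_diff)
      moreover have "y powr p * (1 / \<delta>) = \<delta> powr (p - 1) * A powr p"
        using A \<delta> by (simp add: y_def powr_mult powr_diff)
      ultimately show ?thesis by (simp add: algebra_simps)
    qed
    finally have "\<delta> powr (1 - p) * (\<delta> powr (p - 1) * A powr p) \<le>
        \<delta> powr (1 - p) * integral {0..L} (\<lambda>r. exp (- \<delta> * r) * f r powr p)"
      by (rule mult_left_mono) simp
    moreover have "\<delta> powr (1 - p) * \<delta> powr (p - 1) = 1"
      using \<delta> by (simp flip: powr_add)
    then have "\<delta> powr (1 - p) * (\<delta> powr (p - 1) * A powr p) = A powr p"
      by (simp only: mult.assoc[symmetric] mult_1)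
    ultimately show ?thesis by (simp only: A_def)
  qed
qed simp

lemma nn_integral_lborel_shift:
  fixes f :: "'a::euclidean_space \<Rightarrow> ennreal"
  assumes [measurable]: "f \<in> borel_measurable borel"
  shows "(\<integral>\<^sup>+z. f (z + c) \<partial>lborel) = (\<integral>\<^sup>+z. f z \<partial>lborel)"
proof -
  have "(\<integral>\<^sup>+z. f z \<partial>lborel) = (\<integral>\<^sup>+z. f z \<partial>distr lborel borel ((+) c))"
    by (simp add: lborel_distr_plus)
  also have "\<dots> = (\<integral>\<^sup>+z. f (c + z) \<partial>lborel)"
    by (subst nn_integral_distr) auto
  finally show ?thesis by (simp add: add.commute)
qed

lemma nn_integral_exp_atLeast:
  assumes "\<kappa> > 0"
  shows "(\<integral>\<^sup>+r. ennreal (exp (- \<kappa> * r)) * indicator {0..} r \<partial>lborel) = ennreal (1 / \<kappa>)"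
proof -
  have "((\<lambda>r. - exp (- \<kappa> * r) / \<kappa>) \<longlongrightarrow> - 0 / \<kappa>) at_top"
  proof (intro tendsto_intros)
    have "filterlim (\<lambda>r. \<kappa> * r) at_top at_top"
      using assms by (intro filterlim_tendsto_pos_mult_at_top[OF tendsto_const _ filterlim_ident])
    then have "filterlim (\<lambda>r. - \<kappa> * r) at_bot at_top" by (simp add: filterlim_uminus_at_top)
    then show "((\<lambda>r. exp (- \<kappa> * r)) \<longlongrightarrow> 0) at_top" by (rule filterlim_compose[OF exp_at_bot])
  qed (use assms in auto)
  moreover have "((\<lambda>r. - exp (- \<kappa> * r) / \<kappa>) has_real_derivative exp (- \<kappa> * r)) (at r)" for r
    using assms by (auto intro!: derivative_eq_intros)
  ultimately have "(\<integral>\<^sup>+r. ennreal (exp (- \<kappa> * r)) * indicator {0..} r \<partial>lborel) = ennreal (- 0 / \<kappa> - (- exp (- \<kappa> * 0) / \<kappa>))"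
    by (intro nn_integral_FTC_atLeast) auto
  then show ?thesis by simp
qed

context heintze_space
begin

text \<open>A component with a vertical argument vanishes, as the vertical vector is already
  inserted. For horizontal arguments, passing from the frame at height \<open>snd z\<close> to the
  one at height \<open>snd z + r\<close> gains the factor e^(- \<sigma> r) by
  \<open>horizontal_contraction\<close>. The number j of counted eigenvalues may be smaller than the
  degree k.\<close>

lemma hom_fnorm_le:
  assumes j: "j \<le> k" "j \<le> N" and \<sigma>: "\<sigma> < (\<Sum>i<j. \<mu> i)"
  shows "\<exists>C\<ge>0. \<forall>T s z. smooth_form (Suc k) s \<longrightarrow>
    fnorm k (hom T s) z \<le> C * integral {0..T - snd z} (\<lambda>r. exp (- \<sigma> * r) * fnorm (Suc k) s (z + r *\<^sub>R (0, 1)))"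
proof -
  let ?\<nu> = "(0, 1) :: 'v \<times> real"
  obtain C where C: "C \<ge> 0"
    "\<And>f I t u. alternating k f \<Longrightarrow> t \<le> u \<Longrightarrow> (\<And>i. i < k \<Longrightarrow> I i < N) \<Longrightarrow>
      \<bar>f (\<lambda>i. frame t (I i))\<bar> \<le> C * exp (- ((u - t) * \<sigma>)) * (\<Sum>K\<in>{..<k} \<rightarrow>\<^sub>E {..<N}. \<bar>f (\<lambda>i. frame u (K i))\<bar>)"
    using horizontal_contraction[OF j \<sigma>] by metis
  let ?M = "real (card ({..<k} \<rightarrow>\<^sub>E {..<N}))" and ?M' = "real (card ({..<k} \<rightarrow>\<^sub>E {..N}))"
  have pt: "\<bar>s (z + r *\<^sub>R ?\<nu>) (case_nat ?\<nu> (\<lambda>i. frame (snd z) (I i)))\<bar> \<le>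
      C * ?M * (exp (- \<sigma> * r) * fnorm (Suc k) s (z + r *\<^sub>R ?\<nu>))"
    if s: "smooth_form (Suc k) s" and I: "I \<in> {..<k} \<rightarrow>\<^sub>E {..N}" and r: "0 \<le> r" for s z r I
  proof (cases "\<exists>i<k. I i = N")
    case True
    then obtain i where i: "i < k" "I i = N" by blast
    have "s (z + r *\<^sub>R ?\<nu>) (case_nat ?\<nu> (\<lambda>i. frame (snd z) (I i))) = 0"
      by (rule alternating_eq_0[OF smooth_form_alternating[OF s], of 0 "Suc i"]) (use i in \<open>auto simp: frame_def\<close>)
    then show ?thesis using C(1) fnorm_nonneg by simp
  next
    case False
    have IN: "I i < N" if "i < k" for i
      using PiE_mem[OF I, of i] False that by (auto simp: le_less)
    let ?z = "z + r *\<^sub>R ?\<nu>"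
    let ?f = "\<lambda>v. s ?z (case_nat ?\<nu> v)"
    have "\<bar>?f (\<lambda>i. frame (snd z) (I i))\<bar> \<le> C * exp (- ((snd ?z - snd z) * \<sigma>)) *
        (\<Sum>K\<in>{..<k} \<rightarrow>\<^sub>E {..<N}. \<bar>?f (\<lambda>i. frame (snd ?z) (K i))\<bar>)"
      by (rule C(2)[OF alternating_contract[OF smooth_form_alternating[OF s]] _ IN]) (use r in simp)
    also have "\<dots> \<le> C * exp (- ((snd ?z - snd z) * \<sigma>)) * (\<Sum>K\<in>{..<k} \<rightarrow>\<^sub>E {..<N}. fnorm (Suc k) s ?z)"
    proof (intro mult_left_mono sum_mono)
      fix K assume K: "K \<in> {..<k} \<rightarrow>\<^sub>E {..<N}"
      have "case_nat ?\<nu> (\<lambda>i. frame (snd ?z) (K i)) = (\<lambda>i. frame (snd ?z) (case_nat N K i))"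
        by (auto simp: frame_def split: nat.splits)
      moreover have "case_nat N K i \<le> N" if "i < Suc k" for i
        using PiE_mem[OF K, of "i - 1"] that by (cases i) auto
      ultimately show "\<bar>?f (\<lambda>i. frame (snd ?z) (K i))\<bar> \<le> fnorm (Suc k) s ?z"
        using le_fnorm[of "Suc k" s ?z "case_nat N K", OF smooth_form_alternating[OF s]] by simp
    qed (use C(1) in auto)
    also have "\<dots> = C * ?M * (exp (- \<sigma> * r) * fnorm (Suc k) s ?z)" by (simp add: mult_ac)
    finally show ?thesis .
  qed
  have "fnorm k (hom T s) z \<le> (?M' * (C * ?M)) * integral {0..T - snd z} (\<lambda>r. exp (- \<sigma> * r) * fnorm (Suc k) s (z + r *\<^sub>R ?\<nu>))"
    if s: "smooth_form (Suc k) s" for T s z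
  proof -
    have ray: "continuous_on {0..T - snd z} (\<lambda>r. fnorm (Suc k) s (z + r *\<^sub>R ?\<nu>))"
      by (intro continuous_on_compose2[OF continuous_fnorm[OF s, of UNIV]] continuous_intros) auto
    have "\<bar>hom T s z (\<lambda>i. frame (snd z) (I i))\<bar> \<le>
        integral {0..T - snd z} (\<lambda>r. C * ?M * (exp (- \<sigma> * r) * fnorm (Suc k) s (z + r *\<^sub>R ?\<nu>)))"
      if I: "I \<in> {..<k} \<rightarrow>\<^sub>E {..N}" for I
    proof -
      have "norm (integral {0..T - snd z} (\<lambda>r. s (z + r *\<^sub>R ?\<nu>) (case_nat ?\<nu> (\<lambda>i. frame (snd z) (I i))))) \<le>
          integral {0..T - snd z} (\<lambda>r. C * ?M * (exp (- \<sigma> * r) * fnorm (Suc k) s (z + r *\<^sub>R ?\<nu>)))"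
      proof (rule integral_norm_bound_integral)
        show "(\<lambda>r. s (z + r *\<^sub>R ?\<nu>) (case_nat ?\<nu> (\<lambda>i. frame (snd z) (I i)))) integrable_on {0..T - snd z}"
          by (rule vertical_ray_integrable[OF smooth_continuous[OF smooth_form_smooth[OF s]]])
        show "(\<lambda>r. C * ?M * (exp (- \<sigma> * r) * fnorm (Suc k) s (z + r *\<^sub>R ?\<nu>))) integrable_on {0..T - snd z}"
          by (intro integrable_continuous_real continuous_intros ray)
      qed (use pt[OF s I] in auto)
      then show ?thesis by (simp add: hom_def vert_int_def)
    qed
    then have "fnorm k (hom T s) z \<le> (\<Sum>I\<in>{..<k} \<rightarrow>\<^sub>E {..N}.
        integral {0..T - snd z} (\<lambda>r. C * ?M * (exp (- \<sigma> * r) * fnorm (Suc k) s (z + r *\<^sub>R ?\<nu>))))"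
      unfolding fnorm_def[of k] by (rule sum_mono)
    then show ?thesis by (simp add: mult.assoc)
  qed
  moreover have "?M' * (C * ?M) \<ge> 0" using C(1) by simp
  ultimately show ?thesis by blast
qed

lemma continuous_density_p:
  assumes "smooth_form k s"
  shows "continuous_on A (density_p k s)"
  unfolding density_p_def[abs_def]
  using continuous_fnorm[OF assms, of A] fnorm_nonneg p
  by (intro continuous_intros continuous_on_powr') auto

lemma energy_smooth: "energy k s = (\<integral>\<^sup>+z. ennreal (density_p k s z) \<partial>lborel)"
  unfolding energy_def by (rule nn_integral_completion)

text \<open>Part of the decay serves as a finite measure for Jensen's inequality, the rest beats the
  change of volume along the ray. Fubini and translation invariance then leave the integral of e^(-
  \<kappa> r), whose value is 1 / \<kappa>.\<close>

lemma hom_energy_le: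
  assumes j: "j \<le> k" "j \<le> N" and pj: "\<tau> < p * (\<Sum>i<j. \<mu> i)"
  obtains C where "C \<ge> 0"
    "\<And>T s. smooth_form (Suc k) s \<Longrightarrow> energy k (hom T s) \<le> ennreal C * energy (Suc k) s"
proof -
  let ?\<nu> = "(0, 1) :: 'v \<times> real"
  have "\<tau> / p < (\<Sum>i<j. \<mu> i)" using pj p by (simp add: field_simps)
  then obtain \<sigma> where \<sigma>: "\<tau> / p < \<sigma>" "\<sigma> < (\<Sum>i<j. \<mu> i)" using dense by blast
  then obtain \<sigma>' where \<sigma>': "\<tau> / p < \<sigma>'" "\<sigma>' < \<sigma>" using dense by blast
  define \<delta> where "\<delta> = \<sigma> - \<sigma>'"
  \<comment> \<open>The net rate after Jensen: \<delta> from the weight, \<sigma>' p from the p-th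
    power of the remaining decay, and - \<tau> because the volume density at height t is e^(\<tau>
    r) times that at t + r. It is positive since \<tau> / p < \<sigma>'.\<close>
  define \<kappa> where "\<kappa> = \<delta> + (\<sigma>' * p - \<tau>)"
  have \<delta>: "\<delta> > 0" using \<sigma>' by (simp add: \<delta>_def)
  have \<kappa>: "\<kappa> > 0" using \<sigma>' p \<delta> by (simp add: \<kappa>_def field_simps add_pos_pos)
  obtain C where C0: "C \<ge> 0" and "\<forall>T s z. smooth_form (Suc k) s \<longrightarrow>
    fnorm k (hom T s) z \<le> C * integral {0..T - snd z} (\<lambda>r. exp (- \<sigma> * r) * fnorm (Suc k) s (z + r *\<^sub>R ?\<nu>))"
    using hom_fnorm_le[OF j \<sigma>(2)] by blast
  then have C: "fnorm k (hom T s) z \<le> C * integral {0..T - snd z} (\<lambda>r. exp (- \<sigma> * r) * fnorm (Suc k) s (z + r *\<^sub>R ?\<nu>))"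
    if "smooth_form (Suc k) s" for T s z using that by blast
  define K where "K = C powr p * \<delta> powr (1 - p)"
  have K: "K \<ge> 0" by (simp add: K_def)
  have "energy k (hom T s) \<le> ennreal (K * (1 / \<kappa>)) * energy (Suc k) s" if s: "smooth_form (Suc k) s" for T s
  proof -
    define d where "d = density_p (Suc k) s"
    have dc: "continuous_on UNIV d" unfolding d_def by (rule continuous_density_p[OF s])
    have dm [measurable]: "d \<in> borel_measurable borel" by (rule borel_measurable_continuous_onI[OF dc])
    have pt: "ennreal (density_p k (hom T s) z) \<le>
        (\<integral>\<^sup>+r. ennreal K * (ennreal (exp (- \<kappa> * r)) * indicator {0..} r * ennreal (d (z + r *\<^sub>R ?\<nu>))) \<partial>lborel)" for z
    proof -
      let ?b = "\<lambda>r. fnorm (Suc k) s (z + r *\<^sub>R ?\<nu>)" and ?L = "T - snd z"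
      have ray: "continuous_on {0..?L} ?b"
        by (intro continuous_on_compose2[OF continuous_fnorm[OF s, of UNIV]] continuous_intros) auto
      have b0: "0 \<le> ?b r" for r by (rule fnorm_nonneg)
      have e1: "exp (- \<sigma> * r) * ?b r = exp (- \<delta> * r) * (exp (- \<sigma>' * r) * ?b r)" for r
        by (simp add: \<delta>_def mult.assoc[symmetric] algebra_simps flip: exp_add)
      let ?I = "integral {0..?L} (\<lambda>r. exp (- \<delta> * r) * (exp (- \<sigma>' * r) * ?b r))"
      have I0: "0 \<le> ?I"
        using b0 by (intro integral_nonneg integrable_continuous_real continuous_intros ray) auto
      have "fnorm k (hom T s) z powr p \<le> (C * ?I) powr p"
        using C[OF s, of T z] fnorm_nonneg p unfolding e1 by (intro powr_mono2) auto
      also have "\<dots> = C powr p * ?I powr p" using C0 I0 by (simp add: powr_mult)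
      also have "\<dots> \<le> C powr p * (\<delta> powr (1 - p) * integral {0..?L} (\<lambda>r. exp (- \<delta> * r) * (exp (- \<sigma>' * r) * ?b r) powr p))"
        using b0 by (intro mult_left_mono exp_weighted_jensen continuous_intros ray \<delta> p) auto
      finally have "fnorm k (hom T s) z powr p \<le>
          K * integral {0..?L} (\<lambda>r. exp (- \<delta> * r) * (exp (- \<sigma>' * r) * ?b r) powr p)"
        unfolding K_def mult.assoc .
      then have "density_p k (hom T s) z \<le>
          K * integral {0..?L} (\<lambda>r. exp (- \<delta> * r) * (exp (- \<sigma>' * r) * ?b r) powr p) * exp (- \<tau> * snd z)"
        unfolding density_p_def by (rule mult_right_mono) simp
      also have "\<dots> = K * integral {0..?L} (\<lambda>r. exp (- \<kappa> * r) * d (z + r *\<^sub>R ?\<nu>))"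
      proof -
        have "exp (- \<delta> * r) * (exp (- \<sigma>' * r) * ?b r) powr p * exp (- \<tau> * snd z) = exp (- \<kappa> * r) * d (z + r *\<^sub>R ?\<nu>)" for r
        proof -
          have "(exp (- \<sigma>' * r) * ?b r) powr p = exp (- \<sigma>' * r * p) * ?b r powr p"
            using b0 by (simp add: powr_mult exp_powr_real)
          moreover have "exp (- \<delta> * r) * exp (- \<sigma>' * r * p) * exp (- \<tau> * snd z) = exp (- \<kappa> * r) * exp (- \<tau> * snd (z + r *\<^sub>R ?\<nu>))"
            by (simp add: \<kappa>_def algebra_simps flip: exp_add)
          ultimately show ?thesis by (simp add: d_def density_p_def mult_ac)
        qed
        then show ?thesis by (simp add: mult.assoc flip: integral_mult_left)
      qed
      finally have 1: "density_p k (hom T s) z \<le> K * integral {0..?L} (\<lambda>r. exp (- \<kappa> * r) * d (z + r *\<^sub>R ?\<nu>))" .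
      have d0: "0 \<le> d y" for y by (simp add: d_def density_p_nonneg)
      have cint: "(\<lambda>r. exp (- \<kappa> * r) * d (z + r *\<^sub>R ?\<nu>)) integrable_on {0..?L}"
        by (intro integrable_continuous_real continuous_intros continuous_on_compose2[OF dc]) auto
      have "ennreal (integral {0..?L} (\<lambda>r. exp (- \<kappa> * r) * d (z + r *\<^sub>R ?\<nu>))) =
          (\<integral>\<^sup>+r. ennreal (indicator {0..?L} r * (exp (- \<kappa> * r) * d (z + r *\<^sub>R ?\<nu>))) \<partial>lborel)"
        using d0 cint by (intro nn_integral_has_integral_lebesgue[symmetric]) (auto simp: integrable_integral)
      also have "\<dots> \<le> (\<integral>\<^sup>+r. ennreal (exp (- \<kappa> * r)) * indicator {0..} r * ennreal (d (z + r *\<^sub>R ?\<nu>)) \<partial>lborel)"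
        using d0 by (intro nn_integral_mono) (auto simp: indicator_def ennreal_mult)
      finally have "ennreal K * ennreal (integral {0..?L} (\<lambda>r. exp (- \<kappa> * r) * d (z + r *\<^sub>R ?\<nu>))) \<le>
          ennreal K * (\<integral>\<^sup>+r. ennreal (exp (- \<kappa> * r)) * indicator {0..} r * ennreal (d (z + r *\<^sub>R ?\<nu>)) \<partial>lborel)"
        by (rule mult_left_mono) simp
      moreover have "ennreal (density_p k (hom T s) z) \<le> ennreal K * ennreal (integral {0..?L} (\<lambda>r. exp (- \<kappa> * r) * d (z + r *\<^sub>R ?\<nu>)))"
        using 1 K by (simp add: ennreal_leI flip: ennreal_mult')
      moreover have "ennreal K * (\<integral>\<^sup>+r. ennreal (exp (- \<kappa> * r)) * indicator {0..} r * ennreal (d (z + r *\<^sub>R ?\<nu>)) \<partial>lborel) =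
          (\<integral>\<^sup>+r. ennreal K * (ennreal (exp (- \<kappa> * r)) * indicator {0..} r * ennreal (d (z + r *\<^sub>R ?\<nu>))) \<partial>lborel)"
        by (rule nn_integral_cmult[symmetric]) measurable
      ultimately show ?thesis by (auto intro: order_trans)
    qed
    have "energy k (hom T s) \<le> (\<integral>\<^sup>+z. (\<integral>\<^sup>+r. ennreal K * (ennreal (exp (- \<kappa> * r)) * indicator {0..} r * ennreal (d (z + r *\<^sub>R ?\<nu>))) \<partial>lborel) \<partial>lborel)"
      unfolding energy_smooth by (intro nn_integral_mono pt)
    also have "\<dots> = (\<integral>\<^sup>+r. (\<integral>\<^sup>+z. ennreal K * (ennreal (exp (- \<kappa> * r)) * indicator {0..} r * ennreal (d (z + r *\<^sub>R ?\<nu>))) \<partial>lborel) \<partial>lborel)"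
      by (rule lborel_pair.Fubini') measurable
    also have "\<dots> = (\<integral>\<^sup>+r. ennreal K * (ennreal (exp (- \<kappa> * r)) * indicator {0..} r) * energy (Suc k) s \<partial>lborel)"
    proof (rule nn_integral_cong)
      fix r :: real
      have "(\<integral>\<^sup>+z. ennreal (d (z + r *\<^sub>R ?\<nu>)) \<partial>lborel) = energy (Suc k) s"
        unfolding energy_smooth d_def[symmetric] by (rule nn_integral_lborel_shift) measurable
      then show "(\<integral>\<^sup>+z. ennreal K * (ennreal (exp (- \<kappa> * r)) * indicator {0..} r * ennreal (d (z + r *\<^sub>R ?\<nu>))) \<partial>lborel) =
          ennreal K * (ennreal (exp (- \<kappa> * r)) * indicator {0..} r) * energy (Suc k) s"
        by (simp add: nn_integral_cmult mult.assoc[symmetric])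
    qed
    also have "\<dots> = ennreal K * ennreal (1 / \<kappa>) * energy (Suc k) s"
      by (subst nn_integral_multc, measurable, subst nn_integral_cmult, measurable,
          simp only: nn_integral_exp_atLeast[OF \<kappa>])
    also have "ennreal K * ennreal (1 / \<kappa>) = ennreal (K * (1 / \<kappa>))"
      using K \<kappa> by (intro ennreal_mult[symmetric]) auto
    finally show ?thesis .
  qed
  then show ?thesis using that[of "K * (1 / \<kappa>)"] K \<kappa> by simp
qed

end

section \<open>Completeness\<close>

text \<open>Completeness of Lebesgue measure. It makes the set where a sequence of forms converges
  measurable, although that set is defined by a quantifier over uncountably many arguments.\<close>

lemma AE_lebesgue_measurable_set:
  assumes "AE z in lebesgue. P (z :: 'a::euclidean_space)"
  shows "{z. P z} \<in> sets lebesgue"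
proof -
  have "{z. \<not> P z} \<in> null_sets lebesgue"
    using assms by (simp add: completion.AE_iff_null_sets)
  then have "UNIV - {z. \<not> P z} \<in> sets lebesgue"
    using sets.compl_sets[OF null_setsD2, of "{z. \<not> P z}" lebesgue] by simp
  moreover have "UNIV - {z. \<not> P z} = {z. P z}" by auto
  ultimately show ?thesis by simp
qed

text \<open>The limit is discarded at a point as soon as one component diverges there, so that the
  result is alternating at every point, as \<open>measurable_form\<close> demands.\<close>

definition pointwise_limit :: "(nat \<Rightarrow> 'a form) \<Rightarrow> 'a form" where
  "pointwise_limit f z = (if \<forall>v. convergent (\<lambda>j. f j z v) then (\<lambda>v. lim (\<lambda>j. f j z v)) else 0)"

lemma alternating_limit:
  assumes f: "\<And>j. alternating k (f j)" and lim: "\<And>v. (\<lambda>j. f j v) \<longlonglongrightarrow> g v"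
  shows "alternating k g"
  unfolding alternating_def
proof (intro conjI allI impI)
  fix v u :: "nat \<Rightarrow> 'a" assume vu: "\<forall>i<k. v i = u i"
  have "(\<lambda>j. f j v) = (\<lambda>j. f j u)"
    by (rule ext) (rule alternating_cong[OF f], use vu in simp)
  with lim[of v] have "(\<lambda>j. f j u) \<longlonglongrightarrow> g v" by simp
  from LIMSEQ_unique[OF this lim] show "g v = g u" .
next
  fix v :: "nat \<Rightarrow> 'a" and i assume i: "i < k"
  show "linear (\<lambda>y. g (v(i := y)))"
  proof (rule linearI)
    fix a b :: 'a and r :: real
    have "(\<lambda>j. f j (v(i := a + b))) \<longlonglongrightarrow> g (v(i := a)) + g (v(i := b))"
      unfolding alternating_upd_add[OF f i] by (intro tendsto_add lim)
    from LIMSEQ_unique[OF lim this] show "g (v(i := a + b)) = g (v(i := a)) + g (v(i := b))" .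
    have "(\<lambda>j. f j (v(i := r *\<^sub>R a))) \<longlonglongrightarrow> r * g (v(i := a))"
      unfolding alternating_upd_scale[OF f i] by (intro tendsto_mult lim tendsto_const)
    from LIMSEQ_unique[OF lim this] show "g (v(i := r *\<^sub>R a)) = r *\<^sub>R g (v(i := a))" by simp
  qed
next
  fix v :: "nat \<Rightarrow> 'a" and i j assume ij: "i < k" "j < k" "i \<noteq> j" "v i = v j"
  have "(\<lambda>l. f l v) = (\<lambda>l. 0)" by (rule ext) (rule alternating_eq_0[OF f ij])
  with lim[of v] have "(\<lambda>l. 0) \<longlonglongrightarrow> g v" by simp
  from LIMSEQ_unique[OF this tendsto_const] show "g v = 0" .
qed

lemma pointwise_limit_tendsto:
  assumes "\<And>v. convergent (\<lambda>j. f j z v)"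
  shows "(\<lambda>j. f j z v) \<longlonglongrightarrow> pointwise_limit f z v"
  using assms by (simp add: pointwise_limit_def convergent_LIMSEQ_iff)

lemma measurable_pointwise_limit:
  assumes f: "\<And>j. measurable_form k (f j)" and ae: "AE z in lebesgue. \<forall>v. convergent (\<lambda>j. f j z v)"
  shows "measurable_form k (pointwise_limit f)"
  unfolding measurable_form_def
proof (intro conjI allI)
  fix z
  have a: "alternating k (f j z)" for j using f unfolding measurable_form_def by blast
  show "alternating k (pointwise_limit f z)"
  proof (cases "\<forall>v. convergent (\<lambda>j. f j z v)")
    case True
    show ?thesis
    proof (rule alternating_limit[of k "\<lambda>j. f j z"])
      show "(\<lambda>j. f j z v) \<longlonglongrightarrow> pointwise_limit f z v" for v
        by (rule pointwise_limit_tendsto) (use True in blast)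
    qed (rule a)
  next
    case False
    then have "pointwise_limit f z = (\<lambda>_. 0)"
      unfolding pointwise_limit_def zero_fun_def by (simp only: if_False)
    then show ?thesis by (simp add: alternating_zero)
  qed
next
  fix v
  have [measurable]: "(\<lambda>z. f j z v) \<in> borel_measurable lebesgue" for j
    using f unfolding measurable_form_def by blast
  have [measurable]: "{z. \<forall>v. convergent (\<lambda>j. f j z v)} \<in> sets lebesgue"
    by (rule AE_lebesgue_measurable_set[OF ae])
  have [measurable]: "(\<lambda>z. lim (\<lambda>j. f j z v)) \<in> borel_measurable lebesgue"
    by (rule borel_measurable_lim_metric) measurable
  have "(\<lambda>z. if z \<in> {z. \<forall>v. convergent (\<lambda>j. f j z v)} then lim (\<lambda>j. f j z v) else 0) \<in> borel_measurable lebesgue"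
    by measurable
  moreover have "(\<lambda>z. pointwise_limit f z v) = (\<lambda>z. if z \<in> {z. \<forall>v. convergent (\<lambda>j. f j z v)} then lim (\<lambda>j. f j z v) else 0)"
    by (auto simp: pointwise_limit_def)
  ultimately show "(\<lambda>z. pointwise_limit f z v) \<in> borel_measurable lebesgue" by (simp only:)
qed

lemma convergent_if_summable_diffs:
  fixes x :: "nat \<Rightarrow> real"
  assumes "summable d" "\<And>j. \<bar>x (Suc j) - x j\<bar> \<le> d j"
  shows "convergent x"
proof -
  have "summable (\<lambda>j. x (Suc j) - x j)"
    by (rule summable_comparison_test'[OF assms(1), of 0]) (use assms(2) in simp)
  then have "convergent (\<lambda>n. \<Sum>j<n. x (Suc j) - x j)" by (simp add: summable_iff_convergent)
  then have "convergent (\<lambda>n. (x n - x 0) + x 0)"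
    unfolding sum_lessThan_telescope by (intro convergent_add convergent_const)
  then show ?thesis by simp
qed

context heintze_space
begin

text \<open>The weights 2^(j p) still leave a convergent sum of energies, so almost everywhere the
  weighted sum of p-th powers is finite. Each of its terms is then bounded, that is, the norms are
  at most a multiple of 2^(-j).\<close>

lemma AE_summable_fnorm:
  assumes m: "\<And>j. measurable_form k (d j)"
    and E: "\<And>j. energy k (d j) \<le> ennreal ((1 / 2) ^ j / (2 ^ j) powr p)"
  shows "AE z in lebesgue. summable (\<lambda>j. fnorm k (d j) z)"
proof -
  let ?a = "\<lambda>j. ((2 ^ j) powr p) :: real"
  note [measurable] = measurable_density_p[OF m]
  have "(\<integral>\<^sup>+z. (\<Sum>j. ennreal (?a j * density_p k (d j) z)) \<partial>lebesgue) =
      (\<Sum>j. \<integral>\<^sup>+z. ennreal (?a j * density_p k (d j) z) \<partial>lebesgue)"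
    by (rule nn_integral_suminf) measurable
  also have "\<dots> \<le> (\<Sum>j. ennreal ((1 / 2) ^ j))"
  proof (rule suminf_le)
    fix j
    have "(\<integral>\<^sup>+z. ennreal (?a j * density_p k (d j) z) \<partial>lebesgue) = ennreal (?a j) * energy k (d j)"
      unfolding energy_def by (simp add: ennreal_mult density_p_nonneg nn_integral_cmult)
    also have "\<dots> \<le> ennreal (?a j) * ennreal ((1 / 2) ^ j / ?a j)"
      by (rule mult_left_mono[OF E]) simp
    also have "\<dots> = ennreal (?a j * ((1 / 2) ^ j / ?a j))"
      by (rule ennreal_mult[symmetric]) auto
    also have "?a j * ((1 / 2) ^ j / ?a j) = (1 / 2) ^ j" by simp
    finally show "(\<integral>\<^sup>+z. ennreal (?a j * density_p k (d j) z) \<partial>lebesgue) \<le> ennreal ((1 / 2) ^ j)" .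
  qed simp_all
  also have "\<dots> = ennreal (\<Sum>j. (1 / 2) ^ j)"
    by (rule suminf_ennreal2) (simp_all add: summable_geometric)
  also have "\<dots> < \<infinity>" by simp
  finally have "(\<integral>\<^sup>+z. (\<Sum>j. ennreal (?a j * density_p k (d j) z)) \<partial>lebesgue) \<noteq> \<infinity>" by simp
  then have "AE z in lebesgue. (\<Sum>j. ennreal (?a j * density_p k (d j) z)) \<noteq> \<infinity>"
    by (intro nn_integral_PInf_AE) measurable
  then show ?thesis
  proof eventually_elim
    case (elim z)
    then obtain S where S: "0 \<le> S" "(\<Sum>j. ennreal (?a j * density_p k (d j) z)) = ennreal S"
      by (cases "(\<Sum>j. ennreal (?a j * density_p k (d j) z))") auto
    have le: "fnorm k (d j) z \<le> (S * exp (\<tau> * snd z)) powr (1 / p) * (1 / 2) ^ j" for j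
    proof -
      have "ennreal (?a j * density_p k (d j) z) \<le> ennreal S"
        unfolding S(2)[symmetric]
        using sum_le_suminf[of "\<lambda>j. ennreal (?a j * density_p k (d j) z)" "{j}"] by simp
      then have "?a j * density_p k (d j) z \<le> S" using S(1) by simp
      then have "?a j * density_p k (d j) z * exp (\<tau> * snd z) \<le> S * exp (\<tau> * snd z)"
        by (rule mult_right_mono) simp
      moreover have "?a j * density_p k (d j) z * exp (\<tau> * snd z) = (2 ^ j * fnorm k (d j) z) powr p"
        using fnorm_nonneg[of k "d j" z] by (simp add: density_p_def powr_mult mult.assoc flip: exp_add)
      ultimately have "((2 ^ j * fnorm k (d j) z) powr p) powr (1 / p) \<le> (S * exp (\<tau> * snd z)) powr (1 / p)"
        using p by (intro powr_mono2) auto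
      moreover have "((2 ^ j * fnorm k (d j) z) powr p) powr (1 / p) = 2 ^ j * fnorm k (d j) z"
        using p fnorm_nonneg[of k "d j" z] by (simp add: powr_powr)
      ultimately show ?thesis by (simp add: field_simps)
    qed
    show ?case
    proof (rule summable_comparison_test')
      show "summable (\<lambda>j. (S * exp (\<tau> * snd z)) powr (1 / p) * (1 / 2) ^ j)"
        by (intro summable_mult summable_geometric) simp
      show "norm (fnorm k (d j) z) \<le> (S * exp (\<tau> * snd z)) powr (1 / p) * (1 / 2) ^ j" for j
        using le[of j] fnorm_nonneg by simp
    qed
  qed
qed

text \<open>Fatou's lemma, applied to the energies of \<omega> - f j.\<close>

lemma energy_limit_le:
  assumes m: "\<And>j. measurable_form k (f j)" "measurable_form k \<omega>"
    and lim: "AE z in lebesgue. \<forall>v. (\<lambda>j. f j z v) \<longlonglongrightarrow> g z v"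
    and E: "\<forall>\<^sub>F j in sequentially. energy k (\<omega> - f j) \<le> \<epsilon>"
  shows "energy k (\<omega> - g) \<le> \<epsilon>"
proof -
  note md = measurable_density_p[OF measurable_form_diff[OF m(2) m(1)]]
  have "AE z in lebesgue. ennreal (density_p k (\<omega> - g) z) = liminf (\<lambda>j. ennreal (density_p k (\<omega> - f j) z))"
    using lim
  proof eventually_elim
    case (elim z)
    have "(\<lambda>j. fnorm k (\<omega> - f j) z) \<longlonglongrightarrow> fnorm k (\<omega> - g) z"
      unfolding fnorm_def fun_diff_def using elim by (intro tendsto_intros) auto
    then have "(\<lambda>j. density_p k (\<omega> - f j) z) \<longlonglongrightarrow> density_p k (\<omega> - g) z"
      unfolding density_p_def using p fnorm_nonneg
      by (intro tendsto_mult tendsto_powr' tendsto_const) auto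
    then have "(\<lambda>j. ennreal (density_p k (\<omega> - f j) z)) \<longlonglongrightarrow> ennreal (density_p k (\<omega> - g) z)"
      by (rule tendsto_ennrealI)
    then show ?case by (simp add: lim_imp_Liminf)
  qed
  then have "energy k (\<omega> - g) = (\<integral>\<^sup>+z. liminf (\<lambda>j. ennreal (density_p k (\<omega> - f j) z)) \<partial>lebesgue)"
    unfolding energy_def by (rule nn_integral_cong_AE)
  also have "\<dots> \<le> liminf (\<lambda>j. energy k (\<omega> - f j))"
    unfolding energy_def using md by (intro nn_integral_liminf) simp
  also have "\<dots> \<le> limsup (\<lambda>j. energy k (\<omega> - f j))" by (rule Liminf_le_Limsup) simp
  also have "\<dots> \<le> \<epsilon>" by (rule Limsup_bounded[OF E])
  finally show ?thesis .
qed

text \<open>The Riesz-Fischer argument: a rapidly Cauchy subsequence converges almost everywhere,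
  and \<open>energy_limit_le\<close> identifies its limit. The last conclusion keeps track of
  pointwise zeros, which places the limit in the relative complex.\<close>

lemma energy_complete:
  assumes m: "\<And>i. measurable_form k (f i)"
    and cauchy: "\<And>\<epsilon>. \<epsilon> > 0 \<Longrightarrow> \<exists>M. \<forall>i\<ge>M. \<forall>j\<ge>M. energy k (f i - f j) < ennreal \<epsilon>"
  obtains g where "measurable_form k g" "(\<lambda>i. energy k (f i - g)) \<longlonglongrightarrow> 0"
    "\<And>z. (\<And>i. f i z = 0) \<Longrightarrow> g z = 0"
proof -
  define \<epsilon> where "\<epsilon> = (\<lambda>j::nat. (1 / 2) ^ j / ((2 ^ j) powr p) :: real)"
  have "\<epsilon> j > 0" for j by (simp add: \<epsilon>_def)
  then have "\<forall>j. \<exists>M. \<forall>i\<ge>M. \<forall>l\<ge>M. energy k (f i - f l) < ennreal (\<epsilon> j)" using cauchy by blast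
  then obtain M where M: "\<And>j i l. i \<ge> M j \<Longrightarrow> l \<ge> M j \<Longrightarrow> energy k (f i - f l) < ennreal (\<epsilon> j)" by metis
  \<comment> \<open>Cumulative sums make the indices increasing and unbounded while staying above
    every \<open>M j\<close>.\<close>
  define r where "r = (\<lambda>j. j + (\<Sum>i\<le>j. M i))"
  have r: "M j \<le> r j" "j \<le> r j" "r j \<le> r (Suc j)" for j
    by (auto simp: r_def intro: order_trans[OF member_le_sum[of j "{..j}" M]])
  define d where "d = (\<lambda>j. f (r (Suc j)) - f (r j))"
  define h where "h = (\<lambda>j. f (r j))"
  have md: "measurable_form k (d j)" for j unfolding d_def by (intro measurable_form_diff m)
  have "AE z in lebesgue. summable (\<lambda>j. fnorm k (d j) z)"
  proof (rule AE_summable_fnorm[OF md])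
    fix j
    have "M j \<le> r (Suc j)" using r(1)[of j] r(3)[of j] by linarith
    then show "energy k (d j) \<le> ennreal ((1 / 2) ^ j / (2 ^ j) powr p)"
      unfolding d_def \<epsilon>_def[symmetric] using M[of j "r (Suc j)" "r j"] r(1)[of j]
      by (simp add: \<epsilon>_def less_imp_le)
  qed
  then have conv: "AE z in lebesgue. \<forall>v. convergent (\<lambda>j. h j z v)"
  proof eventually_elim
    case (elim z)
    show ?case
    proof
      fix v
      define K where "K = (\<Sum>i<k. \<Sum>a\<le>N. \<bar>coord (snd z) a (v i)\<bar>)"
      have K: "\<bar>coord (snd z) a (v i)\<bar> \<le> K" if "i < k" "a \<le> N" for i a
      proof -
        have "\<bar>coord (snd z) a (v i)\<bar> \<le> (\<Sum>a\<le>N. \<bar>coord (snd z) a (v i)\<bar>)"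
          using that by (intro member_le_sum[where f = "\<lambda>a. \<bar>coord (snd z) a (v i)\<bar>"]) auto
        also have "\<dots> \<le> K" unfolding K_def
          using that by (intro member_le_sum[where f = "\<lambda>i. \<Sum>a\<le>N. \<bar>coord (snd z) a (v i)\<bar>"] sum_nonneg) auto
        finally show ?thesis .
      qed
      show "convergent (\<lambda>j. h j z v)"
      proof (rule convergent_if_summable_diffs)
        show "summable (\<lambda>j. K ^ k * fnorm k (d j) z)" by (rule summable_mult[OF elim])
        fix j
        have "alternating k (d j z)" using md unfolding measurable_form_def by blast
        from abs_le_coord_fnorm[of k "d j" z v K, OF this K]
        show "\<bar>h (Suc j) z v - h j z v\<bar> \<le> K ^ k * fnorm k (d j) z"
          by (simp add: d_def h_def)
      qed
    qed
  qed
  define g where "g = pointwise_limit h"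
  have mh: "measurable_form k (h j)" for j unfolding h_def by (rule m)
  have mg: "measurable_form k g" unfolding g_def by (rule measurable_pointwise_limit[OF mh conv])
  have lim: "AE z in lebesgue. \<forall>v. (\<lambda>j. h j z v) \<longlonglongrightarrow> g z v"
    using conv by eventually_elim (simp add: g_def pointwise_limit_tendsto)
  have "(\<lambda>i. energy k (f i - g)) \<longlonglongrightarrow> 0"
    unfolding ennreal_tendsto_0_iff
  proof (intro allI impI)
    fix \<epsilon> :: real assume \<epsilon>: "\<epsilon> > 0"
    obtain M where M: "\<And>i j. i \<ge> M \<Longrightarrow> j \<ge> M \<Longrightarrow> energy k (f i - f j) < ennreal (\<epsilon> / 2)"
      using cauchy[of "\<epsilon> / 2"] \<epsilon> by auto
    have "energy k (f i - g) < ennreal \<epsilon>" if i: "i \<ge> M" for i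
    proof -
      have "energy k (f i - g) \<le> ennreal (\<epsilon> / 2)"
      proof (rule energy_limit_le[OF mh m lim])
        show "\<forall>\<^sub>F j in sequentially. energy k (f i - h j) \<le> ennreal (\<epsilon> / 2)"
          using eventually_ge_at_top[of M]
        proof eventually_elim
          case (elim j)
          then have "r j \<ge> M" using r(2)[of j] by linarith
          then show ?case using M[OF i, of "r j"] by (simp add: h_def less_imp_le)
        qed
      qed
      also have "\<dots> < ennreal \<epsilon>" using \<epsilon> by (simp add: ennreal_less_iff)
      finally show ?thesis .
    qed
    then show "\<forall>\<^sub>F i in sequentially. energy k (f i - g) < ennreal \<epsilon>"
      using eventually_sequentially by blast
  qed
  moreover have "g z = 0" if "\<And>i. f i z = 0" for z
    using that by (auto simp: g_def pointwise_limit_def h_def fun_eq_iff)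
  ultimately show ?thesis using mg that by blast
qed

section \<open>Vanishing\<close>

lemma hom_diff:
  assumes "smooth_form (Suc k) s" "smooth_form (Suc k) s'"
  shows "hom T (s - s') = hom T s - hom T s'"
proof (intro ext)
  fix z v
  have "vert_int T (\<lambda>y. s y (case_nat (0, 1) v) - s' y (case_nat (0, 1) v)) z =
      vert_int T (\<lambda>y. s y (case_nat (0, 1) v)) z - vert_int T (\<lambda>y. s' y (case_nat (0, 1) v)) z"
    unfolding vert_int_def
    by (intro integral_diff vertical_ray_integrable smooth_continuous smooth_form_smooth[OF assms(1)] smooth_form_smooth[OF assms(2)])
  then show "hom T (s - s') z v = (hom T s - hom T s') z v" by (simp add: hom_def)
qed

lemma energy_diff_tendsto_0:
  assumes m: "\<And>i. measurable_form k (f i)" "\<And>i. measurable_form k (g i)"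
    and "(\<lambda>i. energy k (f i)) \<longlonglongrightarrow> 0" "(\<lambda>i. energy k (g i)) \<longlonglongrightarrow> 0"
  shows "(\<lambda>i. energy k (f i - g i)) \<longlonglongrightarrow> 0"
proof (rule tendsto_0_mult_le)
  show "energy k (f i - g i) \<le> ennreal (2 powr p) * (energy k (f i) + energy k (g i))" for i
    using energy_add[OF m(1) measurable_form_uminus[OF m(2)], of i i] by (simp add: energy_uminus)
  show "(\<lambda>i. energy k (f i) + energy k (g i)) \<longlonglongrightarrow> 0"
    using tendsto_add[OF assms(3,4)] by simp
qed

lemma energy_diff_finite:
  assumes "measurable_form k f" "measurable_form k g" "energy k f < \<infinity>" "energy k g < \<infinity>"
  shows "energy k (f - g) < \<infinity>"
proof -
  have "energy k (f - g) \<le> ennreal (2 powr p) * (energy k f + energy k g)"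
    using energy_add[OF assms(1) measurable_form_uminus[OF assms(2)]] by (simp add: energy_uminus)
  also have "\<dots> < \<infinity>" using assms by (simp add: ennreal_mult_less_top)
  finally show ?thesis .
qed

lemma Lp_diffI:
  assumes "measurable_form k \<omega>" "measurable_form (Suc k) \<theta>" "\<And>i. smooth_energy k (s i)"
    "(\<lambda>i. energy k (s i - \<omega>)) \<longlonglongrightarrow> 0" "(\<lambda>i. energy (Suc k) (ext_deriv k (s i) - \<theta>)) \<longlonglongrightarrow> 0"
  shows "Lp_diff met p k \<omega> \<theta>"
  unfolding Lp_diff_iff by (intro conjI exI[of _ s] allI assms)

lemma rel_Lp_complex_iff:
  "\<omega> \<in> rel_Lp_complex met nhds_vertical_end p k \<longleftrightarrow> \<omega> \<in> Lp_complex met p k \<and>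
    (\<exists>R>0. \<exists>T. AE z in lebesgue. norm (fst z) \<ge> R \<or> snd z > T \<longrightarrow> \<omega> z = 0)"
proof -
  have mem: "(z \<in> UNIV - ball 0 R \<times> {..T}) = (norm (fst z) \<ge> R \<or> snd z > T)" for z :: "'v \<times> real" and R T
    by (cases z) auto
  have ex: "(\<exists>U\<in>{UNIV - ball 0 R \<times> {..T} |R T. 0 < R}. P U) \<longleftrightarrow>
      (\<exists>R>0. \<exists>T. P (UNIV - ball 0 R \<times> {..T}))" for P :: "('v \<times> real) set \<Rightarrow> bool"
    by auto
  show ?thesis
    unfolding rel_Lp_complex_def nhds_vertical_end_def mem_Collect_eq ex AE_vol_iff mem ..
qed

text \<open>The approximants \<open>c i\<close> of \<omega> are not closed, so their vertical
  primitives \<eta> i satisfy d (\<eta> i) = c i - \<beta> i with the error \<beta> i =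
  \<open>hom\<close> of d (c i). Boundedness of \<open>hom\<close> makes \<beta> i tend to 0 and
  \<eta> i a Cauchy sequence; its limit is a primitive of \<omega> in the relative complex.\<close>

lemma rel_Lp_kernel_subset_image:
  assumes k: "1 \<le> k" "k \<le> N" and pk: "\<tau> < p * (\<Sum>i<k. \<mu> i)"
  shows "rel_Lp_kernel met nhds_vertical_end p (Suc k) \<subseteq> rel_Lp_image met nhds_vertical_end p (Suc k)"
proof
  fix \<omega> assume "\<omega> \<in> rel_Lp_kernel met nhds_vertical_end p (Suc k)"
  then have rel: "\<omega> \<in> rel_Lp_complex met nhds_vertical_end p (Suc k)" and "Lp_diff met p (Suc k) \<omega> 0"
    by (auto simp: rel_Lp_kernel_def)
  then obtain s where s: "\<And>i. smooth_energy (Suc k) (s i)" "(\<lambda>i. energy (Suc k) (s i - \<omega>)) \<longlonglongrightarrow> 0"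
    "(\<lambda>i. energy (Suc (Suc k)) (ext_deriv (Suc k) (s i) - 0)) \<longlonglongrightarrow> 0" and mw: "measurable_form (Suc k) \<omega>"
    unfolding Lp_diff_iff by blast
  obtain R T where R: "R > 0" and ae: "AE z in lebesgue. norm (fst z) \<ge> R \<or> snd z > T \<longrightarrow> \<omega> z = 0"
    using rel unfolding rel_Lp_complex_iff by blast
  \<comment> \<open>The given neighbourhood consists of heights > T, whereas the complement of an
    inner region contains its boundary height; raising the level by 1 reconciles them.\<close>
  have ae': "AE z in lebesgue. z \<notin> inner_region R (T + 1) \<longrightarrow> \<omega> z = 0 \<and> (0 :: ('v \<times> real) form) z = 0"
    using ae by eventually_elim (auto simp: inner_region_def)
  define c where "c = (\<lambda>i. cut_form R (T + 1) (s i))"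
  have cut: "smooth_energy (Suc k) (c i)" "(\<lambda>i. energy (Suc k) (c i - \<omega>)) \<longlonglongrightarrow> 0"
    "(\<lambda>i. energy (Suc (Suc k)) (ext_deriv (Suc k) (c i) - 0)) \<longlonglongrightarrow> 0" for i
    unfolding c_def by (rule cut_form_converges[OF less_imp_le[OF R] s mw measurable_form_0 ae'])+
  have sf: "smooth_form (Suc k) (c i)" for i using cut(1) by (simp add: smooth_energy_def)
  note sfd = smooth_form_ext_deriv[OF sf]
  define T2 where "T2 = T + 2"
  have c0: "c i z = 0" if "norm (fst z) \<ge> R + 1 \<or> snd z > T2" for i z
  proof -
    have "cut R (T + 1) z = 0" using that R by (intro cut_eq_0) (auto simp: T2_def)
    then show ?thesis by (simp add: c_def cut_form_def fun_eq_iff)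
  qed
  have cT: "c i z = 0" if "snd z > T2" for i z using c0 that by blast
  define \<eta> where "\<eta> = (\<lambda>i. hom T2 (c i))"
  have se: "smooth_form k (\<eta> i)" for i unfolding \<eta>_def by (rule smooth_form_hom[OF sf cT])
  obtain C where C: "\<And>T s. smooth_form (Suc k) s \<Longrightarrow> energy k (hom T s) \<le> ennreal C * energy (Suc k) s"
    using hom_energy_le[OF order_refl k(2) pk] by metis
  \<comment> \<open>The error term is one degree higher, where the contracted form has k + 1
    horizontal arguments. Only the k smallest eigenvalues are counted again: the hypothesis concerns
    w_k, and for k = N there is no further eigenvalue.\<close>
  have "k \<le> Suc k" by simp
  then obtain C' where C': "\<And>T s. smooth_form (Suc (Suc k)) s \<Longrightarrow> energy (Suc k) (hom T s) \<le> ennreal C' * energy (Suc (Suc k)) s"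
    using hom_energy_le[OF _ k(2) pk, of "Suc k"] by metis
  define \<beta> where "\<beta> = (\<lambda>i. hom T2 (ext_deriv (Suc k) (c i)))"
  have sb: "smooth_form (Suc k) (\<beta> i)" for i
    unfolding \<beta>_def by (rule smooth_form_hom[OF sfd]) (use ext_deriv_zero_above[of T2 "c i"] cT in auto)
  have d\<eta>: "ext_deriv k (\<eta> i) = c i - \<beta> i" for i
    using ext_deriv_hom[OF sf cT] by (simp add: fun_eq_iff \<eta>_def \<beta>_def)
  note mc = measurable_smooth_form[OF sf] and mb = measurable_smooth_form[OF sb] and me = measurable_smooth_form[OF se]
  have fin: "energy (Suc k) (c i) < \<infinity>" "energy (Suc (Suc k)) (ext_deriv (Suc k) (c i)) < \<infinity>" for i
    using cut(1) by (auto simp: smooth_energy_def)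
  have en1: "energy k (\<eta> i) < \<infinity>" for i
    unfolding \<eta>_def by (rule le_less_trans[OF C[OF sf]]) (use fin in \<open>simp add: ennreal_mult_less_top\<close>)
  have en2: "energy (Suc k) (\<beta> i) < \<infinity>" for i
    unfolding \<beta>_def by (rule le_less_trans[OF C'[OF sfd]]) (use fin in \<open>simp add: ennreal_mult_less_top\<close>)
  have "smooth_energy k (\<eta> i)" for i
    unfolding smooth_energy_def d\<eta> using se en1 energy_diff_finite[OF mc mb fin(1) en2] by blast
  note smooth_\<eta> = this
  have b0: "(\<lambda>i. energy (Suc k) (\<beta> i)) \<longlonglongrightarrow> 0"
  proof (rule tendsto_0_mult_le)
    show "energy (Suc k) (\<beta> i) \<le> ennreal C' * energy (Suc (Suc k)) (ext_deriv (Suc k) (c i))" for i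
      unfolding \<beta>_def by (rule C'[OF sfd])
    show "(\<lambda>i. energy (Suc (Suc k)) (ext_deriv (Suc k) (c i))) \<longlonglongrightarrow> 0" using cut(3) by simp
  qed
  have "(\<lambda>i. energy (Suc k) ((c i - \<omega>) - \<beta> i)) \<longlonglongrightarrow> 0"
    by (rule energy_diff_tendsto_0[OF measurable_form_diff[OF mc mw] mb cut(2) b0])
  moreover have "(c i - \<omega>) - \<beta> i = ext_deriv k (\<eta> i) - \<omega>" for i by (simp add: d\<eta>)
  ultimately have lim2: "(\<lambda>i. energy (Suc k) (ext_deriv k (\<eta> i) - \<omega>)) \<longlonglongrightarrow> 0" by simp
  have cauchy: "\<exists>M. \<forall>i\<ge>M. \<forall>j\<ge>M. energy k (\<eta> i - \<eta> j) < ennreal \<epsilon>" if \<epsilon>: "\<epsilon> > 0" for \<epsilon>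
  proof -
    have le: "energy k (\<eta> i - \<eta> j) \<le> ennreal (\<bar>C\<bar> * 2 powr p) * (energy (Suc k) (c i - \<omega>) + energy (Suc k) (c j - \<omega>))" for i j
    proof -
      have "energy k (\<eta> i - \<eta> j) \<le> ennreal C * energy (Suc k) (c i - c j)"
        using C[OF smooth_form_diff[OF sf sf], of T2 i j] by (simp add: \<eta>_def hom_diff[OF sf sf])
      also have "\<dots> \<le> ennreal \<bar>C\<bar> * energy (Suc k) ((c i - \<omega>) + (\<omega> - c j))"
        by (simp add: mult_right_mono ennreal_leI)
      also have "\<dots> \<le> ennreal \<bar>C\<bar> * (ennreal (2 powr p) * (energy (Suc k) (c i - \<omega>) + energy (Suc k) (c j - \<omega>)))"
        using energy_add[OF measurable_form_diff[OF mc mw] measurable_form_diff[OF mw mc], of i j]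
        by (intro mult_left_mono) (simp_all add: energy_minus_commute[of "Suc k" \<omega>])
      finally show ?thesis by (simp add: ennreal_mult mult.assoc)
    qed
    \<comment> \<open>The factor 2 accounts for the two distances from \<omega>, and the summand 1
      keeps the denominator positive and the final inequality strict.\<close>
    define \<delta> where "\<delta> = \<epsilon> / (2 * (\<bar>C\<bar> * 2 powr p + 1))"
    have \<delta>: "\<delta> > 0" using \<epsilon> by (simp add: \<delta>_def add_nonneg_pos)
    then obtain M where M: "\<And>i. i \<ge> M \<Longrightarrow> energy (Suc k) (c i - \<omega>) < ennreal \<delta>"
      using cut(2) unfolding ennreal_tendsto_0_iff eventually_sequentially by blast
    have "energy k (\<eta> i - \<eta> j) < ennreal \<epsilon>" if ij: "i \<ge> M" "j \<ge> M" for i j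
    proof -
      have "energy k (\<eta> i - \<eta> j) \<le> ennreal (\<bar>C\<bar> * 2 powr p) * (ennreal \<delta> + ennreal \<delta>)"
        using M[OF ij(1)] M[OF ij(2)] by (intro order_trans[OF le] mult_left_mono add_mono) auto
      also have "\<dots> = ennreal (\<bar>C\<bar> * 2 powr p * (\<delta> + \<delta>))"
        using \<delta> by (simp add: ennreal_mult flip: ennreal_plus)
      also have "\<dots> < ennreal \<epsilon>"
      proof (rule ennreal_lessI[OF \<epsilon>])
        have "\<bar>C\<bar> * 2 powr p * (\<delta> + \<delta>) < (\<bar>C\<bar> * 2 powr p + 1) * (\<delta> + \<delta>)"
          using \<delta> by (intro mult_strict_right_mono) auto
        also have "\<dots> = \<epsilon>"
        proof -
          have half: "Q * (\<epsilon> / (2 * Q) + \<epsilon> / (2 * Q)) = \<epsilon>" if "Q > 0" for Q :: real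
            using that by (simp add: field_simps)
          show ?thesis unfolding \<delta>_def by (rule half) (simp add: add_nonneg_pos)
        qed
        finally show "\<bar>C\<bar> * 2 powr p * (\<delta> + \<delta>) < \<epsilon>" .
      qed
      finally show ?thesis .
    qed
    then show ?thesis by blast
  qed
  obtain g where g: "measurable_form k g" "(\<lambda>i. energy k (\<eta> i - g)) \<longlonglongrightarrow> 0"
    "\<And>z. (\<And>i. \<eta> i z = 0) \<Longrightarrow> g z = 0"
    using energy_complete[OF me cauchy] by metis
  have diff: "Lp_diff met p k g \<omega>"
    by (rule Lp_diffI[OF g(1) mw smooth_\<eta> g(2) lim2])
  \<comment> \<open>Vertical integration does not leave the vertical line, so a horizontal bound on
    the support survives; above T2 the ray carries nothing. These zeros hold at every point, so the
    limit inherits them.\<close>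
  have "\<eta> i z = 0" if z: "norm (fst z) \<ge> R + 1 \<or> snd z > T2" for i z
  proof (rule ext)
    fix v
    have "c i (z + r *\<^sub>R (0, 1)) = 0" if "r \<in> {0..T2 - snd z}" for r
      using z that by (intro c0) auto
    then have "integral {0..T2 - snd z} (\<lambda>r. c i (z + r *\<^sub>R (0, 1)) (case_nat (0, 1) v)) = integral {0..T2 - snd z} (\<lambda>r. 0)"
      by (intro integral_cong) simp
    then show "\<eta> i z v = 0 v" by (simp add: \<eta>_def hom_def vert_int_def)
  qed
  then have "AE z in lebesgue. norm (fst z) \<ge> R + 1 \<or> snd z > T2 \<longrightarrow> g z = 0"
    by (intro AE_I2 impI g(3))
  moreover have "R + 1 > 0" using R by simp
  moreover have "g \<in> Lp_complex met p k" unfolding Lp_complex_def using diff by blast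
  ultimately have "g \<in> rel_Lp_complex met nhds_vertical_end p k"
    unfolding rel_Lp_complex_iff by blast
  then show "\<omega> \<in> rel_Lp_image met nhds_vertical_end p (Suc k)"
    using diff by auto
qed

section \<open>Additivity of the relative complex and the quotient\<close>

lemma Lp_diff_add:
  assumes "Lp_diff met p k \<omega> \<theta>" "Lp_diff met p k \<omega>' \<theta>'"
  shows "Lp_diff met p k (\<omega> + \<omega>') (\<theta> + \<theta>')"
proof -
  obtain s where s: "\<And>i. smooth_energy k (s i)" "(\<lambda>i. energy k (s i - \<omega>)) \<longlonglongrightarrow> 0"
      "(\<lambda>i. energy (Suc k) (ext_deriv k (s i) - \<theta>)) \<longlonglongrightarrow> 0" and m: "measurable_form k \<omega>" "measurable_form (Suc k) \<theta>"
    using assms(1) unfolding Lp_diff_iff by blast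
  obtain s' where s': "\<And>i. smooth_energy k (s' i)" "(\<lambda>i. energy k (s' i - \<omega>')) \<longlonglongrightarrow> 0"
      "(\<lambda>i. energy (Suc k) (ext_deriv k (s' i) - \<theta>')) \<longlonglongrightarrow> 0" and m': "measurable_form k \<omega>'" "measurable_form (Suc k) \<theta>'"
    using assms(2) unfolding Lp_diff_iff by blast
  have sf: "smooth_form k (s i)" "smooth_form k (s' i)" for i using s(1) s'(1) by (auto simp: smooth_energy_def)
  note ms = measurable_smooth_form[OF sf(1)] measurable_smooth_form[OF smooth_form_ext_deriv[OF sf(1)]]
    measurable_smooth_form[OF sf(2)] measurable_smooth_form[OF smooth_form_ext_deriv[OF sf(2)]]
  have se: "smooth_energy k (s i + s' i)" for i
    using energy_diff_finite[OF ms(1) measurable_form_uminus[OF ms(3)], of i i]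
      energy_diff_finite[OF ms(2) measurable_form_uminus[OF ms(4)], of i i] s(1)[of i] s'(1)[of i] sf
    by (simp add: smooth_energy_def energy_uminus ext_deriv_add smooth_form_add)
  have "(\<lambda>i. energy k ((s i - \<omega>) - (\<omega>' - s' i))) \<longlonglongrightarrow> 0"
    using s(2) s'(2)
    by (intro energy_diff_tendsto_0[of k "\<lambda>i. s i - \<omega>" "\<lambda>i. \<omega>' - s' i"] measurable_form_diff ms m m')
      (simp_all add: energy_minus_commute[of k \<omega>'])
  then have lim1: "(\<lambda>i. energy k ((s i + s' i) - (\<omega> + \<omega>'))) \<longlonglongrightarrow> 0"
    by (simp add: algebra_simps)
  have "(\<lambda>i. energy (Suc k) ((ext_deriv k (s i) - \<theta>) - (\<theta>' - ext_deriv k (s' i)))) \<longlonglongrightarrow> 0"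
    using s(3) s'(3)
    by (intro energy_diff_tendsto_0[of "Suc k" "\<lambda>i. ext_deriv k (s i) - \<theta>" "\<lambda>i. \<theta>' - ext_deriv k (s' i)"]
        measurable_form_diff ms m m')
      (simp_all add: energy_minus_commute[of "Suc k" \<theta>'])
  moreover have "(ext_deriv k (s i) - \<theta>) - (\<theta>' - ext_deriv k (s' i)) = ext_deriv k (s i + s' i) - (\<theta> + \<theta>')" for i
    unfolding ext_deriv_add[OF sf] by (simp add: algebra_simps)
  ultimately have "(\<lambda>i. energy (Suc k) (ext_deriv k (s i + s' i) - (\<theta> + \<theta>'))) \<longlonglongrightarrow> 0"
    by (simp only:)
  with se lim1 show ?thesis
    by (rule Lp_diffI[OF measurable_form_add[OF m(1) m'(1)] measurable_form_add[OF m(2) m'(2)]])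
qed

lemma Lp_diff_uminus:
  assumes "Lp_diff met p k \<omega> \<theta>"
  shows "Lp_diff met p k (- \<omega>) (- \<theta>)"
proof -
  obtain s where s: "\<And>i. smooth_energy k (s i)" "(\<lambda>i. energy k (s i - \<omega>)) \<longlonglongrightarrow> 0"
      "(\<lambda>i. energy (Suc k) (ext_deriv k (s i) - \<theta>)) \<longlonglongrightarrow> 0" and m: "measurable_form k \<omega>" "measurable_form (Suc k) \<theta>"
    using assms(1) unfolding Lp_diff_iff by blast
  have sf: "smooth_form k (s i)" for i using s(1) by (simp add: smooth_energy_def)
  have "smooth_energy k (- s i)" for i
    using s(1)[of i] by (simp add: smooth_energy_def smooth_form_uminus ext_deriv_uminus energy_uminus)
  moreover have "(\<lambda>i. energy k (- s i - - \<omega>)) \<longlonglongrightarrow> 0"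
    using s(2) by (simp add: energy_minus_commute[of k \<omega>])
  moreover have "(\<lambda>i. energy (Suc k) (ext_deriv k (- s i) - - \<theta>)) \<longlonglongrightarrow> 0"
    using s(3) by (simp add: energy_minus_commute[of "Suc k" \<theta>] ext_deriv_uminus[OF sf])
  ultimately show ?thesis
    by (rule Lp_diffI[OF measurable_form_uminus[OF m(1)] measurable_form_uminus[OF m(2)]])
qed

lemma smooth_energy_0: "smooth_energy k 0"
  by (simp add: smooth_energy_def smooth_form_0 energy_0 ext_deriv_0)

lemma Lp_diff_smooth:
  assumes "smooth_energy k s"
  shows "Lp_diff met p k s (ext_deriv k s)"
  using assms
  by (intro Lp_diffI[where s = "\<lambda>_. s"])
    (simp_all add: smooth_energy_def energy_0 measurable_smooth_form smooth_form_ext_deriv)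

lemma Lp_diff_0: "Lp_diff met p k 0 0"
  using Lp_diff_smooth[OF smooth_energy_0] by (simp add: ext_deriv_0)

lemma rel_Lp_complex_0: "0 \<in> rel_Lp_complex met nhds_vertical_end p k"
proof -
  have "0 \<in> Lp_complex met p k" unfolding Lp_complex_def using Lp_diff_0 by blast
  then show ?thesis unfolding rel_Lp_complex_iff by (auto intro!: exI[of _ 1])
qed

lemma rel_Lp_complex_uminus:
  "\<omega> \<in> rel_Lp_complex met nhds_vertical_end p k \<Longrightarrow> - \<omega> \<in> rel_Lp_complex met nhds_vertical_end p k"
  unfolding rel_Lp_complex_iff Lp_complex_def using Lp_diff_uminus by fastforce

lemma rel_Lp_complex_add:
  assumes "\<omega> \<in> rel_Lp_complex met nhds_vertical_end p k" "\<theta> \<in> rel_Lp_complex met nhds_vertical_end p k"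
  shows "\<omega> + \<theta> \<in> rel_Lp_complex met nhds_vertical_end p k"
proof -
  obtain R T where 1: "R > 0" "AE z in lebesgue. norm (fst z) \<ge> R \<or> snd z > T \<longrightarrow> \<omega> z = 0"
    using assms(1) unfolding rel_Lp_complex_iff by blast
  obtain R' T' where 2: "R' > 0" "AE z in lebesgue. norm (fst z) \<ge> R' \<or> snd z > T' \<longrightarrow> \<theta> z = 0"
    using assms(2) unfolding rel_Lp_complex_iff by blast
  have "AE z in lebesgue. norm (fst z) \<ge> max R R' \<or> snd z > max T T' \<longrightarrow> (\<omega> + \<theta>) z = 0"
    using 1(2) 2(2) by eventually_elim (auto simp: fun_eq_iff)
  moreover have "max R R' > 0" using 1 by simp
  moreover have "\<omega> + \<theta> \<in> Lp_complex met p k"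
    using assms Lp_diff_add unfolding rel_Lp_complex_iff Lp_complex_def by blast
  ultimately show ?thesis unfolding rel_Lp_complex_iff by blast
qed

lemma rel_Lp_image_0: "0 \<in> rel_Lp_image met nhds_vertical_end p (Suc k)"
  using rel_Lp_complex_0 Lp_diff_0 by auto

lemma rel_Lp_image_add:
  "\<omega> \<in> rel_Lp_image met nhds_vertical_end p (Suc k) \<Longrightarrow> \<theta> \<in> rel_Lp_image met nhds_vertical_end p (Suc k) \<Longrightarrow>
    \<omega> + \<theta> \<in> rel_Lp_image met nhds_vertical_end p (Suc k)"
  using rel_Lp_complex_add Lp_diff_add by auto blast

lemma rel_Lp_image_uminus:
  "\<omega> \<in> rel_Lp_image met nhds_vertical_end p (Suc k) \<Longrightarrow> - \<omega> \<in> rel_Lp_image met nhds_vertical_end p (Suc k)"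
  using rel_Lp_complex_uminus Lp_diff_uminus by auto blast

text \<open>In positive degree the image is closed under sums and negatives, so a coset equals the
  image exactly when its representative lies in it.\<close>

lemma rel_Lp_cohomology_zero_iff:
  "rel_Lp_cohomology_zero met nhds_vertical_end p (Suc k) \<longleftrightarrow>
    rel_Lp_kernel met nhds_vertical_end p (Suc k) \<subseteq> rel_Lp_image met nhds_vertical_end p (Suc k)"
proof -
  define I where "I = rel_Lp_image met nhds_vertical_end p (Suc k)"
  define Ke where "Ke = rel_Lp_kernel met nhds_vertical_end p (Suc k)"
  have I: "0 \<in> I" "\<And>a b. a \<in> I \<Longrightarrow> b \<in> I \<Longrightarrow> a + b \<in> I" "\<And>a. a \<in> I \<Longrightarrow> - a \<in> I"
    unfolding I_def by (fact rel_Lp_image_0, fact rel_Lp_image_add, fact rel_Lp_image_uminus)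
  have Ke: "0 \<in> Ke" unfolding Ke_def rel_Lp_kernel_def using rel_Lp_complex_0 Lp_diff_0 by blast
  have zero: "0 +o I = I" by (simp add: elt_set_plus_def)
  have "\<omega> +o I = I \<longleftrightarrow> \<omega> \<in> I" for \<omega>
  proof
    assume "\<omega> +o I = I"
    moreover have "\<omega> + 0 \<in> \<omega> +o I" using I(1) unfolding elt_set_plus_def by blast
    ultimately show "\<omega> \<in> I" by simp
  next
    assume \<omega>: "\<omega> \<in> I"
    show "\<omega> +o I = I"
    proof
      show "\<omega> +o I \<subseteq> I" using I(2)[OF \<omega>] by (auto simp: elt_set_plus_def)
      show "I \<subseteq> \<omega> +o I"
      proof
        fix \<theta> assume "\<theta> \<in> I"
        then have "- \<omega> + \<theta> \<in> I" using I \<omega> by blast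
        moreover have "\<theta> = \<omega> + (- \<omega> + \<theta>)" by simp
        ultimately show "\<theta> \<in> \<omega> +o I" unfolding elt_set_plus_def by blast
      qed
    qed
  qed
  then have "(\<lambda>\<omega>. \<omega> +o I) ` Ke = {I} \<longleftrightarrow> Ke \<subseteq> I" using Ke by auto
  then show ?thesis
    unfolding rel_Lp_cohomology_zero_def rel_Lp_cohomology_def I_def[symmetric] Ke_def[symmetric] zero .
qed

end

section \<open>Integration over horizontal slices\<close>

lemma integrable_lborel_compact_support:
  fixes f :: "'a::euclidean_space \<Rightarrow> real"
  assumes "continuous_on UNIV f" "\<And>x. norm x > \<rho> \<Longrightarrow> f x = 0"
  shows "integrable lborel f"
proof -
  have "integrable lborel (\<lambda>x. indicator (cball 0 \<rho>) x *\<^sub>R f x)"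
    by (rule borel_integrable_compact[OF compact_cball continuous_on_subset[OF assms(1) subset_UNIV]])
  moreover have "(\<lambda>x. indicator (cball 0 \<rho>) x *\<^sub>R f x) = f"
    using assms(2) by (auto simp: indicator_def fun_eq_iff)
  ultimately show ?thesis by simp
qed

lemma integral_lborel_shift:
  fixes f :: "'a::euclidean_space \<Rightarrow> real"
  assumes "continuous_on UNIV f"
  shows "(LINT x|lborel. f (x + c)) = (LINT x|lborel. f x)"
proof -
  have [measurable]: "f \<in> borel_measurable borel" by (rule borel_measurable_continuous_onI[OF assms])
  have "(LINT x|lborel. f x) = (LINT x|distr lborel borel ((+) c). f x)"
    by (simp add: lborel_distr_plus)
  also have "\<dots> = (LINT x|lborel. f (c + x))" by (rule integral_distr) auto
  finally show ?thesis by (simp add: add.commute)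
qed

text \<open>The integral of the derivative is averaged over its translates by r y with r in [0, 1],
  each of which has the same integral. Exchanging the integrations, the inner one becomes F (x + y)
  - F x, whose integral is 0 by translation invariance.\<close>

lemma integral_frechet_derivative_eq_0:
  fixes F :: "'a::euclidean_space \<Rightarrow> real"
  assumes F: "smooth F" and 0: "\<And>x. norm x > \<rho> \<Longrightarrow> F x = 0"
  shows "(LINT x|lborel. frechet_derivative F (at x) y) = 0"
proof -
  define G where "G = (\<lambda>x. frechet_derivative F (at x) y)"
  have G: "continuous_on UNIV G" unfolding G_def by (rule smooth_continuous[OF smooth_frechet[OF F]])
  have G0: "G x = 0" if "norm x > \<rho>" for x
    unfolding G_def
    by (rule frechet_derivative_locally_const[of "{x. norm x > \<rho>}" x F 0])
      (use 0 that in \<open>auto intro!: open_Collect_less continuous_intros\<close>)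
  define f where "f = (\<lambda>x r. indicator {0..1} r *\<^sub>R G (x + r *\<^sub>R y))"
  have cG: "continuous_on UNIV (\<lambda>z. G (fst z + snd z *\<^sub>R y))"
    by (intro continuous_on_compose2[OF G] continuous_intros) auto
  have "integrable lborel (\<lambda>z. indicator (cball 0 (\<rho> + norm y) \<times> {0..1}) z *\<^sub>R G (fst z + snd z *\<^sub>R y))"
    by (intro borel_integrable_compact compact_Times compact_cball compact_Icc continuous_on_subset[OF cG subset_UNIV])
  also have "(\<lambda>z. indicator (cball 0 (\<rho> + norm y) \<times> {0..1}) z *\<^sub>R G (fst z + snd z *\<^sub>R y)) = case_prod f"
  proof (rule ext)
    fix z :: "'a \<times> real"
    obtain x r where z: "z = (x, r)" by force
    have "G (x + r *\<^sub>R y) = 0" if "norm x > \<rho> + norm y" "0 \<le> r" "r \<le> 1"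
    proof (rule G0)
      have "norm x \<le> norm (x + r *\<^sub>R y) + norm (r *\<^sub>R y)"
        using norm_triangle_ineq4[of "x + r *\<^sub>R y" "r *\<^sub>R y"] by simp
      moreover have "norm (r *\<^sub>R y) \<le> norm y" using that by (simp add: mult_left_le_one_le)
      ultimately show "norm (x + r *\<^sub>R y) > \<rho>" using that by linarith
    qed
    then show "indicator (cball 0 (\<rho> + norm y) \<times> {0..1}) z *\<^sub>R G (fst z + snd z *\<^sub>R y) = case_prod f z"
      by (auto simp: z f_def indicator_def)
  qed
  finally have int: "integrable (lborel \<Otimes>\<^sub>M lborel) (case_prod f)" by (simp add: lborel_prod)
  have "(LINT r|lborel. LINT x|lborel. f x r) = (LINT r|lborel. indicator {0..1::real} r *\<^sub>R (LINT x|lborel. G x))"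
    unfolding f_def by (simp add: integral_lborel_shift[OF G])
  also have "\<dots> = (LINT x|lborel. G x)" by (simp add: content_real)
  finally have 1: "(LINT r|lborel. LINT x|lborel. f x r) = (LINT x|lborel. G x)" .
  have inner: "(LINT r|lborel. f x r) = F (x + y) - F x" for x
  proof -
    have "continuous_on {0..1} (\<lambda>r. G (x + r *\<^sub>R y))"
      by (intro continuous_on_compose2[OF G] continuous_intros) auto
    then have "set_integrable lborel {0..1} (\<lambda>r. G (x + r *\<^sub>R y))"
      unfolding set_integrable_def by (intro borel_integrable_compact) auto
    from set_borel_integral_eq_integral(2)[OF this]
    have "(LINT r|lborel. f x r) = integral {0..1} (\<lambda>r. G (x + r *\<^sub>R y))"
      unfolding f_def set_lebesgue_integral_def .
    also have "\<dots> = F (x + 1 *\<^sub>R y) - F x"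
      unfolding G_def by (rule integral_directional_derivative[OF F]) simp
    finally show ?thesis by simp
  qed
  have iF: "integrable lborel F" by (rule integrable_lborel_compact_support[OF smooth_continuous[OF F] 0])
  have iFs: "integrable lborel (\<lambda>x. F (x + y))"
  proof (rule integrable_lborel_compact_support)
    show "continuous_on UNIV (\<lambda>x. F (x + y))"
      by (intro continuous_on_compose2[OF smooth_continuous[OF F, of UNIV]] continuous_intros) auto
    fix x :: 'a assume "norm x > \<rho> + norm y"
    then show "F (x + y) = 0" using norm_triangle_ineq4[of "x + y" y] by (intro 0) simp
  qed
  have "(LINT x|lborel. LINT r|lborel. f x r) = (LINT x|lborel. F (x + y) - F x)"
    by (simp only: inner)
  also have "\<dots> = 0"
    using integral_lborel_shift[OF smooth_continuous[OF F], of y] by (simp add: Bochner_Integration.integral_diff[OF iFs iF])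
  finally have 2: "(LINT x|lborel. LINT r|lborel. f x r) = 0" .
  have "(LINT r|lborel. LINT x|lborel. f x r) = (LINT x|lborel. LINT r|lborel. f x r)"
    by (rule lborel_pair.Fubini_integral[OF int])
  then show ?thesis using 1 2 unfolding G_def by simp
qed

lemma smooth_slice:
  fixes F :: "'v::euclidean_space \<times> real \<Rightarrow> real"
  assumes "smooth F"
  shows "smooth (\<lambda>x. F (x, t))"
    and "frechet_derivative (\<lambda>x. F (x, t)) (at x) y = frechet_derivative F (at (x, t)) (y, 0)"
proof -
  have bl: "bounded_linear (\<lambda>x :: 'v. (x, 0 :: real))" by (intro bounded_linear_intros)
  show "smooth (\<lambda>x. F (x, t))" using smooth_compose_affine[OF bl assms, of "(0, t)"] by simp
  show "frechet_derivative (\<lambda>x. F (x, t)) (at x) y = frechet_derivative F (at (x, t)) (y, 0)"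
    using frechet_derivative_compose_affine[OF bl, of F x "(0, t)" y] smooth_differentiable[OF assms] by simp
qed

lemma nn_integral_lborel_prod_mult:
  fixes f :: "'a::euclidean_space \<Rightarrow> ennreal" and g :: "'b::euclidean_space \<Rightarrow> ennreal"
  assumes [measurable]: "f \<in> borel_measurable borel" "g \<in> borel_measurable borel"
  shows "(\<integral>\<^sup>+z. f (fst z) * g (snd z) \<partial>lborel) = (\<integral>\<^sup>+x. f x \<partial>lborel) * (\<integral>\<^sup>+t. g t \<partial>lborel)"
proof -
  have "(\<integral>\<^sup>+z. f (fst z) * g (snd z) \<partial>(lborel :: ('a \<times> 'b) measure)) =
      (\<integral>\<^sup>+z. f (fst z) * g (snd z) \<partial>(lborel \<Otimes>\<^sub>M lborel))" by (simp add: lborel_prod)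
  also have "\<dots> = (\<integral>\<^sup>+x. \<integral>\<^sup>+t. f x * g t \<partial>lborel \<partial>lborel)"
    by (subst lborel.nn_integral_fst[symmetric]) simp_all
  also have "\<dots> = (\<integral>\<^sup>+x. f x \<partial>lborel) * (\<integral>\<^sup>+t. g t \<partial>lborel)"
    by (simp add: nn_integral_cmult nn_integral_multc)
  finally show ?thesis .
qed

lemma ext_deriv_zero_outside:
  assumes "open S" "z \<in> S" "\<And>y. y \<in> S \<Longrightarrow> s y = 0"
  shows "ext_deriv k s z = 0"
proof (rule ext)
  fix v
  have "frechet_derivative (\<lambda>y. s y u) (at z) w = 0" for u w
    by (rule frechet_derivative_locally_const[OF assms(1,2), of _ 0]) (simp add: assms(3))
  then show "ext_deriv k s z v = 0 v" by (simp add: ext_deriv_omit)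
qed

lemma hom_zero_horizontal:
  assumes "\<And>z. norm (fst z) > \<rho> \<Longrightarrow> s z = 0" "norm (fst z) > \<rho>"
  shows "hom T s z = 0"
proof (rule ext)
  fix v
  have "s (z + r *\<^sub>R (0, 1)) = 0" for r by (rule assms(1)) (use assms(2) in simp)
  then show "hom T s z v = 0 v" by (simp add: hom_def vert_int_def)
qed

text \<open>By the homotopy formula the difference of the integrands is the differential of
  \<open>hom T d\<close>. On horizontal constant arguments this is a sum of derivatives along the
  slice of functions with compact support in x, so it integrates to 0.\<close>

lemma integral_slice_eq_hom:
  fixes d :: "('v::euclidean_space \<times> real) form"
  assumes d: "smooth_form k d" and T: "\<And>z. snd z > T \<Longrightarrow> d z = 0"
    and \<rho>: "\<And>z. norm (fst z) > \<rho> \<Longrightarrow> d z = 0" and v: "\<And>i. i < k \<Longrightarrow> snd (v i) = 0"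
  shows "(LINT x|lborel. d (x, t) v) = (LINT x|lborel. hom T (ext_deriv k d) (x, t) v)"
proof (cases k)
  case 0
  have "hom T (ext_deriv k d) z v = d z v" for z
  proof -
    define L where "L = \<bar>T - snd z\<bar> + 1"
    have "hom T (ext_deriv k d) z v = - integral {0..L} (\<lambda>r. frechet_derivative (\<lambda>y. d y v) (at (z + r *\<^sub>R (0, 1))) (0, 1))"
      unfolding hom_def
      by (subst vert_int_eq[where L = L])
        (simp_all add: 0 ext_deriv_omit omit_case_nat_0 frechet_zero_above[of T] T L_def)
    also have "\<dots> = - (d (z + L *\<^sub>R (0, 1)) v - d z v)"
      by (subst integral_directional_derivative[OF smooth_form_smooth[OF d]]) (simp_all add: L_def)
    also have "d (z + L *\<^sub>R (0, 1)) = 0" by (rule T) (simp add: L_def)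
    finally show ?thesis by simp
  qed
  then show ?thesis by simp
next
  case (Suc j)
  note d' = d[unfolded Suc]
  let ?\<beta> = "ext_deriv k d"
  have beta0: "?\<beta> z = 0" if "snd z > T" for z by (rule ext_deriv_zero_above[of T]) (use T that in auto)
  have betar: "?\<beta> z = 0" if "norm (fst z) > \<rho>" for z
    by (rule ext_deriv_zero_outside[of "{z. norm (fst z) > \<rho>}"])
      (use \<rho> that in \<open>auto intro!: open_Collect_less continuous_intros\<close>)
  have sb: "smooth_form k (hom T ?\<beta>)" by (rule smooth_form_hom[OF smooth_form_ext_deriv[OF d] beta0])
  have sh: "smooth_form j (hom T d)" by (rule smooth_form_hom[OF d' T])
  have int: "integrable lborel (\<lambda>x. s (x, t) u)" if "smooth_form l s" "\<And>z. norm (fst z) > \<rho> \<Longrightarrow> s z = 0" for s u l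
    by (rule integrable_lborel_compact_support[of _ \<rho>])
      (use smooth_continuous[OF smooth_slice(1)[OF smooth_form_smooth[OF that(1)]]] that(2) in auto)
  define F where "F = (\<lambda>i x. hom T d (x, t) (omit i v))"
  have F: "smooth (F i)" for i unfolding F_def by (rule smooth_slice(1)[OF smooth_form_smooth[OF sh]])
  have F0: "F i x = 0" if "norm x > \<rho>" for i x
    unfolding F_def using hom_zero_horizontal[of \<rho> d "(x, t)" T] \<rho> that by simp
  have iF: "integrable lborel (\<lambda>x. (-1) ^ i * frechet_derivative (F i) (at x) y)" for i y
  proof (intro integrable_mult_right integrable_lborel_compact_support[of _ \<rho>])
    show "continuous_on UNIV (\<lambda>x. frechet_derivative (F i) (at x) y)" by (rule smooth_continuous[OF smooth_frechet[OF F]])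
    show "frechet_derivative (F i) (at x) y = 0" if "norm x > \<rho>" for x
      by (rule frechet_derivative_locally_const[of "{x. norm x > \<rho>}" x "F i" 0])
        (use F0 that in \<open>auto intro!: open_Collect_less continuous_intros\<close>)
  qed
  have "d (x, t) v - hom T ?\<beta> (x, t) v = (\<Sum>i\<le>j. (-1) ^ i * frechet_derivative (F i) (at x) (fst (v i)))" for x
  proof -
    have "d (x, t) v - hom T ?\<beta> (x, t) v = ext_deriv j (hom T d) (x, t) v"
      using ext_deriv_hom[OF d' T, where z = "(x, t)" and v = v] by (simp add: Suc)
    also have "\<dots> = (\<Sum>i\<le>j. (-1) ^ i * frechet_derivative (F i) (at x) (fst (v i)))"
      unfolding ext_deriv_omit
    proof (intro sum.cong refl arg_cong2[of _ _ _ _ "(*)"])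
      fix i assume "i \<in> {..j}"
      then have "v i = (fst (v i), 0)" using v[of i] by (simp add: Suc prod_eq_iff)
      then show "frechet_derivative (\<lambda>y. hom T d y (omit i v)) (at (x, t)) (v i) = frechet_derivative (F i) (at x) (fst (v i))"
        unfolding F_def smooth_slice(2)[OF smooth_form_smooth[OF sh]] by simp
    qed
    finally show ?thesis .
  qed
  then have "(LINT x|lborel. d (x, t) v - hom T ?\<beta> (x, t) v) =
      (\<Sum>i\<le>j. (-1) ^ i * (LINT x|lborel. frechet_derivative (F i) (at x) (fst (v i))))"
    using iF by simp
  also have "\<dots> = 0" by (simp add: integral_frechet_derivative_eq_0[OF F F0])
  finally show ?thesis
    using Bochner_Integration.integral_diff[OF int[OF d \<rho>, of v] int[OF sb, of v]] hom_zero_horizontal[OF betar] by simp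
qed

lemma alternating_bounded:
  fixes f :: "(nat \<Rightarrow> 'a::euclidean_space) \<Rightarrow> real"
  assumes f: "alternating k f"
  obtains M where "M \<ge> 0" "\<And>u A. (\<And>i. i < k \<Longrightarrow> norm (u i) \<le> A) \<Longrightarrow> \<bar>f u\<bar> \<le> M * A ^ k"
proof -
  define M where "M = (\<Sum>K\<in>{..<k} \<rightarrow>\<^sub>E (Basis :: 'a set). \<bar>f (\<lambda>i. K i)\<bar>)"
  have "\<bar>f u\<bar> \<le> M * A ^ k" if u: "\<And>i. i < k \<Longrightarrow> norm (u i) \<le> A" for u A
  proof -
    have "f u = f (\<lambda>i. \<Sum>b\<in>Basis. (u i \<bullet> b) *\<^sub>R b)" by (simp add: euclidean_representation)
    also have "\<dots> = (\<Sum>K\<in>{..<k} \<rightarrow>\<^sub>E Basis. (\<Prod>i<k. u i \<bullet> K i) * f (\<lambda>i. K i))"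
      by (rule alternating_expand[OF finite_Basis f])
    finally have "\<bar>f u\<bar> \<le> (\<Sum>K\<in>{..<k} \<rightarrow>\<^sub>E Basis. \<bar>(\<Prod>i<k. u i \<bullet> K i) * f (\<lambda>i. K i)\<bar>)"
      by (simp only: sum_abs)
    also have "\<dots> \<le> (\<Sum>K\<in>{..<k} \<rightarrow>\<^sub>E (Basis :: 'a set). \<bar>f (\<lambda>i. K i)\<bar> * A ^ k)"
    proof (rule sum_mono)
      fix K assume K: "K \<in> {..<k} \<rightarrow>\<^sub>E (Basis :: 'a set)"
      have "(\<Prod>i<k. \<bar>u i \<bullet> K i\<bar>) \<le> (\<Prod>i<k. A)"
      proof (rule prod_mono)
        fix i assume i: "i \<in> {..<k}"
        have "\<bar>u i \<bullet> K i\<bar> \<le> norm (u i)" using PiE_mem[OF K i] by (rule Basis_le_norm)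
        also have "\<dots> \<le> A" using u i by simp
        finally show "0 \<le> \<bar>u i \<bullet> K i\<bar> \<and> \<bar>u i \<bullet> K i\<bar> \<le> A" by simp
      qed
      then show "\<bar>(\<Prod>i<k. u i \<bullet> K i) * f (\<lambda>i. K i)\<bar> \<le> \<bar>f (\<lambda>i. K i)\<bar> * A ^ k"
        by (simp add: abs_mult abs_prod mult.commute mult_left_mono)
    qed
    finally show ?thesis by (simp add: M_def sum_distrib_right)
  qed
  moreover have "M \<ge> 0" unfolding M_def by (intro sum_nonneg) auto
  ultimately show ?thesis using that by blast
qed

section \<open>A nontrivial class\<close>

context heintze_space
begin

definition flag_vec :: "nat \<Rightarrow> 'v \<times> real" where
  "flag_vec i = (e i, 0)"

text \<open>The form is the wedge of the dual covectors \<open>ell 0\<close>, ...,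
  \<open>ell (k - 1)\<close>, built by adding one factor at a time. It kills vertical vectors
  because each covector looks only at the horizontal part.\<close>

lemma flag_form_exists:
  assumes "k \<le> N"
  obtains f where "alternating k f" "f flag_vec \<noteq> 0"
    "\<And>v i. i < k \<Longrightarrow> v i = (0, 1) \<Longrightarrow> f v = 0"
proof -
  have "\<exists>f. alternating k f \<and> f flag_vec \<noteq> 0 \<and> (\<forall>v i. i < k \<longrightarrow> v i = (0, 1) \<longrightarrow> f v = 0)"
    using assms
  proof (induction k)
    case 0
    have "alternating 0 (\<lambda>v :: nat \<Rightarrow> 'v \<times> real. 1 :: real)" by (simp add: alternating_def)
    then show ?case by (intro exI[of _ "\<lambda>_. 1"]) simp
  next
    case (Suc k)
    then obtain f where f: "alternating k f" "f flag_vec \<noteq> 0" "\<And>v i. i < k \<Longrightarrow> v i = (0, 1) \<Longrightarrow> f v = 0"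
      by auto
    have kN: "k < N" using Suc.prems by simp
    define g where "g = (\<lambda>v. \<Sum>i\<le>k. (-1) ^ i * (ell k (fst (v i)) * f (omit i v)))"
    have "alternating (Suc k) g"
      unfolding g_def
    proof (rule alternating_wedge[of "\<lambda>y u. ell k (fst y) * f u"])
      show "linear (\<lambda>y. ell k (fst y) * f u)" for u
        using linear_cmult[OF linear_compose[OF linear_fst ell_lin[OF kN]], of "f u"] by (simp add: o_def mult.commute)
      show "alternating k (\<lambda>u. ell k (fst y) * f u)" for y by (rule alternating_cmult[OF f(1)])
    qed
    moreover have "g flag_vec \<noteq> 0"
    proof -
      \<comment> \<open>By duality \<open>ell k\<close> vanishes on the flag vectors of index below
        k, so only the term that feeds it the last vector survives.\<close>
      have "g flag_vec = (\<Sum>i\<le>k. if i = k then (-1) ^ k * f (omit k flag_vec) else 0)"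
        unfolding g_def using kN by (intro sum.cong) (auto simp: flag_vec_def dual)
      also have "\<dots> = (-1) ^ k * f (omit k flag_vec)" by simp
      also have "f (omit k flag_vec) = f flag_vec" by (rule alternating_cong[OF f(1)]) (simp add: omit_def)
      finally show ?thesis using f(2) by simp
    qed
    moreover have "g v = 0" if a: "a < Suc k" "v a = (0, 1)" for v a
      unfolding g_def
    proof (intro sum.neutral ballI)
      fix i assume i: "i \<in> {..k}"
      show "(-1) ^ i * (ell k (fst (v i)) * f (omit i v)) = 0"
      proof (cases "i = a")
        case True
        then show ?thesis using a linear_0[OF ell_lin[OF kN]] by simp
      next
        case False
        have "f (omit i v) = 0"
        proof (rule f(3))
          show "(if a < i then a else a - 1) < k" using False a i by auto
          show "omit i v (if a < i then a else a - 1) = (0, 1)" using False a by (auto simp: omit_def)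
        qed
        then show ?thesis by simp
      qed
    qed
    ultimately show ?case by blast
  qed
  then show ?thesis using that by blast
qed

end

locale flag_form = heintze_space +
  fixes k and f :: "(nat \<Rightarrow> 'a \<times> real) \<Rightarrow> real"
  assumes kN: "k < N" and f: "alternating k f" and f_flag: "f flag_vec \<noteq> 0"
    and f_vertical: "\<And>v i. i < k \<Longrightarrow> v i = (0, 1) \<Longrightarrow> f v = 0"
begin

definition \<psi> :: "('a \<times> real) form" where
  "\<psi> = (\<lambda>z v. cut 1 0 z * f v)"

lemma smooth_\<psi>: "smooth_form k \<psi>"
proof -
  have "smooth_form k (\<lambda>z. f)" using f by (simp add: smooth_form_def)
  then show ?thesis unfolding \<psi>_def by (rule smooth_form_mult[OF smooth_cut])
qed

definition \<omega>0 :: "('a \<times> real) form" where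
  "\<omega>0 = ext_deriv k \<psi>"

lemma smooth_\<omega>0: "smooth_form (Suc k) \<omega>0"
  unfolding \<omega>0_def by (rule smooth_form_ext_deriv[OF smooth_\<psi>])

lemma \<omega>0_eq: "\<omega>0 z v = (\<Sum>i\<le>k. (-1) ^ i * (frechet_derivative (cut 1 0) (at z) (v i) * f (omit i v)))"
proof -
  have "smooth_form k (\<lambda>z. f)" using f by (simp add: smooth_form_def)
  from ext_deriv_mult[OF smooth_cut this, of 1 0 z v] show ?thesis
    by (simp add: \<omega>0_def \<psi>_def ext_deriv_omit[of k "\<lambda>z. f"] frechet_derivative_const)
qed

lemma \<psi>_outer: "norm (fst z) > 2 \<or> snd z > 1 \<Longrightarrow> \<psi> z = 0"
  by (rule ext) (use cut_eq_0[of 1 z 0] in \<open>auto simp: \<psi>_def\<close>)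

lemma \<omega>0_outer: "norm (fst z) > 2 \<or> snd z > 1 \<Longrightarrow> \<omega>0 z = 0"
  by (rule ext) (use frechet_cut_outer[of 1 z 0] in \<open>auto simp: \<omega>0_eq\<close>)

text \<open>Below height 0 the cutoff depends on x alone, so its differential has no vertical part;
  the constant form has none either.\<close>

lemma \<omega>0_vertical:
  assumes "snd z < 0" "a \<le> k" "v a = (0, 1)"
  shows "\<omega>0 z v = 0"
  unfolding \<omega>0_eq
proof (intro sum.neutral ballI)
  fix i assume i: "i \<in> {..k}"
  show "(-1) ^ i * (frechet_derivative (cut 1 0) (at z) (v i) * f (omit i v)) = 0"
  proof (cases "i = a")
    case True
    have "frechet_derivative step (at (snd z - 0)) 1 = 0"
      by (rule frechet_derivative_locally_const[of "{..<0}" _ _ 1]) (use assms(1) in \<open>auto simp: step_eq_1\<close>)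
    moreover have "frechet_derivative (radial_cutoff 1) (at (fst z)) 0 = 0"
      by (rule linear_0[OF linear_frechet_derivative[OF smooth_differentiable[OF smooth_radial_cutoff]]])
    ultimately show ?thesis using True assms(3) by (simp add: frechet_cut)
  next
    case False
    have "f (omit i v) = 0"
    proof (rule f_vertical)
      show "(if a < i then a else a - 1) < k" using False assms i by auto
      show "omit i v (if a < i then a else a - 1) = (0, 1)" using False assms by (auto simp: omit_def)
    qed
    then show ?thesis by simp
  qed
qed

lemma \<omega>0_bounded: "\<exists>M\<ge>0. \<forall>z v. (\<forall>i\<le>k. norm (v i) \<le> A) \<longrightarrow> \<bar>\<omega>0 z v\<bar> \<le> M"
proof (cases "A \<ge> 0")
  case True
  obtain D where D: "D \<ge> 0" "\<And>z w. \<bar>frechet_derivative (cut 1 0) (at z) w\<bar> \<le> D * norm (w :: 'a \<times> real)"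
    using frechet_cut_bounded[of 1 0, where 'v = 'a] by auto
  obtain M where M: "M \<ge> 0" "\<And>u A. (\<And>i. i < k \<Longrightarrow> norm (u i) \<le> A) \<Longrightarrow> \<bar>f u\<bar> \<le> M * A ^ k"
    using alternating_bounded[OF f] by metis
  have "\<bar>\<omega>0 z v\<bar> \<le> real (Suc k) * ((D * A) * (M * A ^ k))" if v: "\<forall>i\<le>k. norm (v i) \<le> A" for z v
  proof -
    have "\<bar>\<omega>0 z v\<bar> \<le> (\<Sum>i\<le>k. \<bar>(-1) ^ i * (frechet_derivative (cut 1 0) (at z) (v i) * f (omit i v))\<bar>)"
      unfolding \<omega>0_eq by (rule sum_abs)
    also have "\<dots> \<le> (\<Sum>i\<le>k. (D * A) * (M * A ^ k))"
    proof (rule sum_mono)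
      fix i assume i: "i \<in> {..k}"
      have "D * norm (v i) \<le> D * A" using v i D by (intro mult_left_mono) auto
      then have 1: "\<bar>frechet_derivative (cut 1 0) (at z) (v i)\<bar> \<le> D * A" using D(2)[of z "v i"] by linarith
      have 2: "\<bar>f (omit i v)\<bar> \<le> M * A ^ k" by (rule M(2)) (use v in \<open>auto simp: omit_def\<close>)
      show "\<bar>(-1) ^ i * (frechet_derivative (cut 1 0) (at z) (v i) * f (omit i v))\<bar> \<le> (D * A) * (M * A ^ k)"
        using mult_mono[OF 1 2] D M True by (simp add: abs_mult power_abs)
    qed
    finally show ?thesis by simp
  qed
  moreover have "0 \<le> real (Suc k) * ((D * A) * (M * A ^ k))" using D M True by simp
  ultimately show ?thesis by blast
next
  case False
  then have "\<not> (\<forall>i\<le>k. norm (v i) \<le> A)" for v :: "nat \<Rightarrow> 'a \<times> real"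
    using norm_ge_zero[of "v 0"] by (auto intro!: exI[of _ 0] simp: not_le intro: less_le_trans)
  then show ?thesis by (intro exI[of _ 0]) auto
qed

text \<open>Above height 1 the form is zero, and between 0 and 1 frame and form are bounded. Below 0
  the form is horizontal with coefficients bounded in the frame at height 0, so
  \<open>horizontal_contraction\<close> in degree k + 1 from height \<open>snd z\<close> to height 0
  supplies the exponential.\<close>

lemma \<omega>0_fnorm_le:
  assumes \<sigma>: "\<sigma> < (\<Sum>i<Suc k. \<mu> i)" "0 \<le> \<sigma>"
  obtains C where "C \<ge> 0" "\<And>z. fnorm (Suc k) \<omega>0 z \<le> C * exp (snd z * \<sigma>)"
proof -
  have a: "alternating (Suc k) (\<omega>0 z)" for z by (rule smooth_form_alternating[OF smooth_\<omega>0])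
  obtain C1 where C1: "C1 \<ge> 0"
    "\<And>f I t u. alternating (Suc k) f \<Longrightarrow> t \<le> u \<Longrightarrow> (\<And>i. i < Suc k \<Longrightarrow> I i < N) \<Longrightarrow>
      \<bar>f (\<lambda>i. frame t (I i))\<bar> \<le> C1 * exp (- ((u - t) * \<sigma>)) * (\<Sum>K\<in>{..<Suc k} \<rightarrow>\<^sub>E {..<N}. \<bar>f (\<lambda>i. frame u (K i))\<bar>)"
    using horizontal_contraction[OF order_refl _ \<sigma>(1)] kN by (metis Suc_leI)
  obtain A where A: "A \<ge> 0" "\<And>t a. t \<le> 1 \<Longrightarrow> norm (frame t a) \<le> A"
    using frame_bounded[of 1] by metis
  obtain M where M: "M \<ge> 0" "\<And>z v. (\<forall>i\<le>k. norm (v i) \<le> A) \<Longrightarrow> \<bar>\<omega>0 z v\<bar> \<le> M"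
    using \<omega>0_bounded[of A] by blast
  let ?c = "real (card ({..<Suc k} \<rightarrow>\<^sub>E {..<N}))" and ?c' = "real (card ({..<Suc k} \<rightarrow>\<^sub>E {..N}))"
  define C where "C = C1 * (?c * M) + M"
  have C: "C \<ge> 0" using C1 M by (simp add: C_def)
  have "\<bar>\<omega>0 z (\<lambda>i. frame (snd z) (I i))\<bar> \<le> C * exp (snd z * \<sigma>)" if I: "I \<in> {..<Suc k} \<rightarrow>\<^sub>E {..N}" for z I
  proof -
    consider "snd z > 1" | "0 \<le> snd z" "snd z \<le> 1" | "snd z < 0" by linarith
    then show ?thesis
    proof cases
      case 1
      then have "\<omega>0 z = 0" using \<omega>0_outer by blast
      then show ?thesis using C by simp
    next
      case 2
      have "\<bar>\<omega>0 z (\<lambda>i. frame (snd z) (I i))\<bar> \<le> M" using A(2) 2 by (intro M(2)) auto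
      also have "\<dots> \<le> C" using C1 M by (simp add: C_def)
      also have "\<dots> \<le> C * exp (snd z * \<sigma>)" using C 2 \<sigma>(2) by (simp add: mult_le_cancel_left1)
      finally show ?thesis .
    next
      case 3
      show ?thesis
      proof (cases "\<exists>a\<le>k. I a = N")
        case True
        then obtain a where "a \<le> k" "I a = N" by blast
        then have "\<omega>0 z (\<lambda>i. frame (snd z) (I i)) = 0"
          by (intro \<omega>0_vertical[OF 3, of a]) (auto simp: frame_def)
        then show ?thesis using C by simp
      next
        case False
        have IN: "I i < N" if "i < Suc k" for i
        proof -
          have "I i \<noteq> N" using False that less_Suc_eq_le by blast
          then show ?thesis using PiE_mem[OF I, of i] that by simp
        qed
        have "\<bar>\<omega>0 z (\<lambda>i. frame (snd z) (I i))\<bar> \<le> C1 * exp (- ((0 - snd z) * \<sigma>)) * (\<Sum>K\<in>{..<Suc k} \<rightarrow>\<^sub>E {..<N}. \<bar>\<omega>0 z (\<lambda>i. frame 0 (K i))\<bar>)"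
          by (rule C1(2)[OF a _ IN]) (use 3 in simp)
        also have "\<dots> \<le> C1 * exp (- ((0 - snd z) * \<sigma>)) * (\<Sum>K\<in>{..<Suc k} \<rightarrow>\<^sub>E {..<N}. M)"
          using A(2)[of 0] C1(1) by (intro mult_left_mono sum_mono M(2)) auto
        also have "\<dots> = C1 * (?c * M) * exp (snd z * \<sigma>)" by simp
        also have "\<dots> \<le> C * exp (snd z * \<sigma>)" using M by (intro mult_right_mono) (auto simp: C_def)
        finally show ?thesis .
      qed
    qed
  qed
  then have "fnorm (Suc k) \<omega>0 z \<le> (\<Sum>I\<in>{..<Suc k} \<rightarrow>\<^sub>E {..N}. C * exp (snd z * \<sigma>))" for z
    unfolding fnorm_def by (intro sum_mono)
  then have "fnorm (Suc k) \<omega>0 z \<le> (?c' * C) * exp (snd z * \<sigma>)" for z by (simp add: mult.assoc)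
  then show ?thesis using that[of "?c' * C"] C by simp
qed

lemma nn_integral_exp_atMost:
  assumes "\<kappa> > 0"
  shows "(\<integral>\<^sup>+t. ennreal (exp (\<kappa> * t)) * indicator {..1} t \<partial>lborel) < \<infinity>"
proof -
  have "(\<integral>\<^sup>+t. ennreal (exp (\<kappa> * t)) * indicator {..1} t \<partial>lborel) =
      ennreal \<bar>-1\<bar> * (\<integral>\<^sup>+r. ennreal (exp (\<kappa> * (1 + (-1) * r))) * indicator {..1} (1 + (-1) * r) \<partial>lborel)"
    by (rule nn_integral_real_affine) auto
  also have "\<dots> = (\<integral>\<^sup>+r. ennreal (exp \<kappa>) * (ennreal (exp (- \<kappa> * r)) * indicator {0..} r) \<partial>lborel)"
    by (auto intro!: nn_integral_cong simp: indicator_def algebra_simps simp flip: ennreal_mult exp_add)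
  also have "\<dots> = ennreal (exp \<kappa>) * ennreal (1 / \<kappa>)"
    by (subst nn_integral_cmult, measurable, simp only: nn_integral_exp_atLeast[OF assms])
  also have "\<dots> < \<infinity>" by (simp add: ennreal_mult_less_top)
  finally show ?thesis .
qed

lemma \<omega>0_energy:
  assumes "\<tau> < p * (\<Sum>i<Suc k. \<mu> i)"
  shows "energy (Suc k) \<omega>0 < \<infinity>"
proof -
  have "\<tau> / p < (\<Sum>i<Suc k. \<mu> i)" using assms p by (simp add: field_simps)
  moreover have "0 < (\<Sum>i<Suc k. \<mu> i)" using mu_pos kN by (intro sum_pos) auto
  \<comment> \<open>\<sigma> must exceed \<tau> / p for integrability and be nonnegative for
    \<open>\<omega>0_fnorm_le\<close>.\<close>
  ultimately have "max (\<tau> / p) 0 < (\<Sum>i<Suc k. \<mu> i)" by simp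
  then obtain \<sigma> where "max (\<tau> / p) 0 < \<sigma>" "\<sigma> < (\<Sum>i<Suc k. \<mu> i)" using dense by blast
  then have \<sigma>: "\<tau> / p < \<sigma>" "0 < \<sigma>" "\<sigma> < (\<Sum>i<Suc k. \<mu> i)" by auto
  define \<kappa> where "\<kappa> = p * \<sigma> - \<tau>"
  have \<kappa>: "\<kappa> > 0" using \<sigma>(1) p by (simp add: \<kappa>_def field_simps)
  obtain C where C: "C \<ge> 0" "\<And>z. fnorm (Suc k) \<omega>0 z \<le> C * exp (snd z * \<sigma>)"
    using \<omega>0_fnorm_le[OF \<sigma>(3)] \<sigma>(2) by (metis less_imp_le)
  define g where "g = (\<lambda>x :: 'a. ennreal (C powr p) * indicator (cball 0 2) x)"
  define h where "h = (\<lambda>t. ennreal (exp (\<kappa> * t)) * indicator {..1} t)"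
  have g: "g \<in> borel_measurable borel"
    unfolding g_def
    by (intro borel_measurable_times_ennreal borel_measurable_const borel_measurable_indicator borel_closed closed_cball)
  have h: "h \<in> borel_measurable borel"
    unfolding h_def
    by (intro borel_measurable_times_ennreal borel_measurable_indicator borel_closed closed_atMost) measurable
  have "energy (Suc k) \<omega>0 \<le> (\<integral>\<^sup>+z. g (fst z) * h (snd z) \<partial>lborel)"
    unfolding energy_smooth
  proof (rule nn_integral_mono)
    fix z :: "'a \<times> real"
    show "ennreal (density_p (Suc k) \<omega>0 z) \<le> g (fst z) * h (snd z)"
    proof (cases "norm (fst z) > 2 \<or> snd z > 1")
      case True
      then show ?thesis using \<omega>0_outer[OF True] p by (simp add: density_p_def fnorm_zero)
    next
      case False
      have "fnorm (Suc k) \<omega>0 z powr p \<le> (C * exp (snd z * \<sigma>)) powr p"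
        using C fnorm_nonneg p by (intro powr_mono2) auto
      also have "\<dots> = C powr p * exp (snd z * \<sigma> * p)" using C(1) by (simp add: powr_mult exp_powr_real)
      finally have "density_p (Suc k) \<omega>0 z \<le> C powr p * exp (snd z * \<sigma> * p) * exp (- \<tau> * snd z)"
        unfolding density_p_def by (rule mult_right_mono) simp
      also have "\<dots> = C powr p * exp (\<kappa> * snd z)"
        by (simp add: \<kappa>_def algebra_simps flip: exp_add)
      finally show ?thesis using False by (simp add: g_def h_def ennreal_leI flip: ennreal_mult)
    qed
  qed
  also have "\<dots> = (\<integral>\<^sup>+x. g x \<partial>lborel) * (\<integral>\<^sup>+t. h t \<partial>lborel)"
    by (rule nn_integral_lborel_prod_mult[OF g h])
  also have "(\<integral>\<^sup>+x. g x \<partial>lborel) = ennreal (C powr p) * emeasure lborel (cball 0 2 :: 'a set)"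
    unfolding g_def by (rule nn_integral_cmult_indicator) simp
  also have "\<dots> * (\<integral>\<^sup>+t. h t \<partial>lborel) < \<infinity>"
    unfolding h_def using nn_integral_exp_atMost[OF \<kappa>] emeasure_lborel_cball_finite[of "0 :: 'a" 2]
    by (simp add: ennreal_mult_less_top)
  finally show ?thesis .
qed

lemma \<omega>0_in_kernel:
  assumes "\<tau> < p * (\<Sum>i<Suc k. \<mu> i)"
  shows "\<omega>0 \<in> rel_Lp_kernel met nhds_vertical_end p (Suc k)"
proof -
  have d0: "ext_deriv (Suc k) \<omega>0 = 0" unfolding \<omega>0_def by (rule ext_deriv_ext_deriv[OF smooth_\<psi>])
  have "smooth_energy (Suc k) \<omega>0"
    using \<omega>0_energy[OF assms] smooth_\<omega>0 by (simp add: smooth_energy_def d0 energy_0)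
  from Lp_diff_smooth[OF this] have diff: "Lp_diff met p (Suc k) \<omega>0 0" by (simp add: d0)
  moreover have "AE z in lebesgue. norm (fst z) \<ge> 3 \<or> snd z > 1 \<longrightarrow> \<omega>0 z = 0"
    by (intro AE_I2 impI \<omega>0_outer) auto
  moreover have "(3::real) > 0" by simp
  moreover have "\<omega>0 \<in> Lp_complex met p (Suc k)" unfolding Lp_complex_def using diff by blast
  ultimately show ?thesis unfolding rel_Lp_kernel_def rel_Lp_complex_iff by blast
qed

end

text \<open>For y > \<delta> this is y = y^(1 - p) y^p with 1 - p <= 0. It plays the role of
  Hoelder's inequality: an L^1 integral over a set of finite volume is at most \<delta> times the
  volume plus a multiple of the energy, with \<delta> free.\<close>

lemma le_powr_interpolate:
  fixes y \<delta> p :: real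
  assumes "0 \<le> y" "0 < \<delta>" "1 \<le> p"
  shows "y \<le> \<delta> + \<delta> powr (1 - p) * y powr p"
proof (cases "y \<le> \<delta>")
  case True
  then show ?thesis by (simp add: add_increasing2)
next
  case False
  have "y = y powr (1 - p) * y powr p" using assms False by (simp flip: powr_add)
  also have "\<dots> \<le> \<delta> powr (1 - p) * y powr p"
    using assms False by (intro mult_right_mono powr_mono2') auto
  finally show ?thesis using assms by linarith
qed

lemma nn_integral_indicator_slab:
  fixes \<rho> a b :: real
  assumes "a \<le> b"
  shows "(\<integral>\<^sup>+z. indicator (cball (0 :: 'a::euclidean_space) \<rho>) (fst z) * indicator {a..b} (snd z) \<partial>lborel) =
    ennreal (measure lborel (cball (0 :: 'a) \<rho>) * (b - a))"
proof -
  have "(\<integral>\<^sup>+z. indicator (cball (0 :: 'a) \<rho>) (fst z) * indicator {a..b} (snd z) \<partial>lborel) =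
      (\<integral>\<^sup>+x. indicator (cball (0 :: 'a) \<rho>) x \<partial>lborel) * (\<integral>\<^sup>+t. indicator {a..b} t \<partial>lborel)"
    by (rule nn_integral_lborel_prod_mult) (intro borel_measurable_indicator borel_closed closed_cball closed_atLeastAtMost)+
  also have "\<dots> = ennreal (measure lborel (cball (0 :: 'a) \<rho>)) * ennreal (b - a)"
    using assms emeasure_lborel_cball_finite[of "0 :: 'a" \<rho>] by (simp add: emeasure_eq_ennreal_measure)
  also have "\<dots> = ennreal (measure lborel (cball (0 :: 'a) \<rho>) * (b - a))"
    using assms by (intro ennreal_mult[symmetric]) auto
  finally show ?thesis .
qed

lemma measurable_indicator_snd:
  "(\<lambda>z. indicator {a..b} (snd z) :: ennreal) \<in> borel_measurable (borel :: ('a::euclidean_space \<times> real) measure)"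
proof -
  have "(\<lambda>z :: 'a \<times> real. indicator {a..b} (snd z) :: ennreal) = indicator (snd -` {a..b})" by (auto simp: indicator_def)
  then show ?thesis
    by (simp only:) (intro borel_measurable_indicator borel_closed closed_vimage closed_atLeastAtMost continuous_intros)
qed

lemma measurable_indicator_fst:
  "(\<lambda>z. indicator (cball a \<rho>) (fst z) :: ennreal) \<in> borel_measurable (borel :: ('a::euclidean_space \<times> real) measure)"
proof -
  have "(\<lambda>z :: 'a \<times> real. indicator (cball a \<rho>) (fst z) :: ennreal) = indicator (fst -` cball a \<rho>)" by (auto simp: indicator_def)
  then show ?thesis
    by (simp only:) (intro borel_measurable_indicator borel_closed closed_vimage closed_cball continuous_intros)
qed

lemma radial_cutoff_integral_pos: "0 < (LINT x|lborel. radial_cutoff 1 (x :: 'a::euclidean_space))"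
proof -
  have int: "integrable lborel (radial_cutoff 1 :: 'a \<Rightarrow> real)"
    by (rule integrable_lborel_compact_support[of _ 2]) (simp_all add: smooth_continuous[OF smooth_radial_cutoff] radial_cutoff_eq_0)
  have "0 < measure lborel (cball (0 :: 'a) 1)" by (rule content_cball_pos) simp
  also have "\<dots> = (LINT x|lborel. indicator (cball (0 :: 'a) 1) x)" by simp
  also have "\<dots> \<le> (LINT x|lborel. radial_cutoff 1 (x :: 'a))"
  proof (rule integral_mono[OF _ int])
    show "integrable lborel (indicator (cball (0 :: 'a) 1) :: 'a \<Rightarrow> real)"
      using emeasure_lborel_cball_finite[of "0 :: 'a" 1] by simp
    show "indicator (cball 0 1) x \<le> radial_cutoff 1 x" for x :: 'a
    proof (cases "norm x \<le> 1")
      case True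
      then show ?thesis by (simp add: radial_cutoff_eq_1)
    next
      case False
      then show ?thesis by (simp add: radial_cutoff_def step_nonneg)
    qed
  qed
  finally show ?thesis .
qed

context flag_form
begin

section \<open>Slice integrals and the lower bound for primitives\<close>

definition mass :: real where
  "mass = \<bar>f flag_vec\<bar> * (LINT x|lborel. radial_cutoff 1 (x :: 'a))"

lemma mass_pos: "mass > 0"
  unfolding mass_def using radial_cutoff_integral_pos[where 'a = 'a] f_flag by simp

lemma \<psi>_slice: "t \<le> 0 \<Longrightarrow> \<bar>LINT x|lborel. \<psi> (x, t) flag_vec\<bar> = mass"
  using radial_cutoff_integral_pos[where 'a = 'a]
  by (simp add: \<psi>_def cut_def step_eq_1 mass_def abs_mult)

text \<open>\<open>integral_slice_eq_hom\<close> is applied to the difference of s and \<psi>, whose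
  differential is that of s minus \<omega>0. As the slice integral of \<psi> has absolute value
  \<open>mass\<close> at every height t <= 0, s must carry this mass up to the error of its
  differential.\<close>

lemma slice_mass_le:
  assumes s: "smooth_form k s" and T: "\<And>z. snd z > T \<Longrightarrow> s z = 0" "1 \<le> T"
    and \<rho>: "\<And>z. norm (fst z) > \<rho> \<Longrightarrow> s z = 0" "2 \<le> \<rho>" and t: "t \<le> 0"
  shows "ennreal mass \<le> (\<integral>\<^sup>+x. ennreal \<bar>s (x, t) flag_vec\<bar> \<partial>lborel) +
    (\<integral>\<^sup>+x. ennreal \<bar>hom T (ext_deriv k s - \<omega>0) (x, t) flag_vec\<bar> \<partial>lborel)"
proof -
  define d where "d = s - \<psi>"
  have sd: "smooth_form k d" unfolding d_def by (rule smooth_form_diff[OF s smooth_\<psi>])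
  have dT: "d z = 0" if "snd z > T" for z
    using T(1)[OF that] \<psi>_outer[of z] that T(2) by (simp add: d_def)
  have d\<rho>: "d z = 0" if "norm (fst z) > \<rho>" for z
    using \<rho>(1)[OF that] \<psi>_outer[of z] that \<rho>(2) by (simp add: d_def)
  have dd: "ext_deriv k d = ext_deriv k s - \<omega>0"
    unfolding d_def \<omega>0_def by (rule ext_deriv_diff[OF s smooth_\<psi>])
  have int: "integrable lborel (\<lambda>x. s (x, t) u)" if "smooth_form l s" "\<And>z. norm (fst z) > \<rho> \<Longrightarrow> s z = 0" for s u l
    by (rule integrable_lborel_compact_support[of _ \<rho>])
      (use smooth_continuous[OF smooth_slice(1)[OF smooth_form_smooth[OF that(1)]]] that(2) in auto)
  have i\<psi>: "integrable lborel (\<lambda>x. \<psi> (x, t) flag_vec)"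
    by (rule int[OF smooth_\<psi>]) (use \<psi>_outer \<rho>(2) in auto)
  have b0: "ext_deriv k d z = 0" if "norm (fst z) > \<rho>" for z
    by (rule ext_deriv_zero_outside[of "{z. norm (fst z) > \<rho>}"])
      (use d\<rho> that in \<open>auto intro!: open_Collect_less continuous_intros\<close>)
  have sh: "smooth_form k (hom T (ext_deriv k d))"
    by (rule smooth_form_hom[OF smooth_form_ext_deriv[OF sd] ext_deriv_zero_above]) (use dT in auto)
  have ih: "integrable lborel (\<lambda>x. hom T (ext_deriv k d) (x, t) flag_vec)"
    by (rule int[OF sh hom_zero_horizontal[OF b0]])
  have "(LINT x|lborel. \<psi> (x, t) flag_vec) = (LINT x|lborel. s (x, t) flag_vec) - (LINT x|lborel. d (x, t) flag_vec)"
    using Bochner_Integration.integral_diff[OF int[OF s \<rho>(1), of flag_vec] i\<psi>] by (simp add: d_def)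
  also have "(LINT x|lborel. d (x, t) flag_vec) = (LINT x|lborel. hom T (ext_deriv k d) (x, t) flag_vec)"
    by (rule integral_slice_eq_hom[OF sd dT d\<rho>]) (simp_all add: flag_vec_def)
  finally have "mass = \<bar>(LINT x|lborel. s (x, t) flag_vec) - (LINT x|lborel. hom T (ext_deriv k d) (x, t) flag_vec)\<bar>"
    using \<psi>_slice[OF t] by simp
  also have "\<dots> \<le> \<bar>LINT x|lborel. s (x, t) flag_vec\<bar> + \<bar>LINT x|lborel. hom T (ext_deriv k d) (x, t) flag_vec\<bar>"
    by (rule abs_triangle_ineq4)
  finally have "ennreal mass \<le> ennreal \<bar>LINT x|lborel. s (x, t) flag_vec\<bar> + ennreal \<bar>LINT x|lborel. hom T (ext_deriv k d) (x, t) flag_vec\<bar>"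
    by (simp add: ennreal_leI flip: ennreal_plus)
  also have "\<dots> \<le> (\<integral>\<^sup>+x. ennreal \<bar>s (x, t) flag_vec\<bar> \<partial>lborel) + (\<integral>\<^sup>+x. ennreal \<bar>hom T (ext_deriv k d) (x, t) flag_vec\<bar> \<partial>lborel)"
    using integral_norm_bound_ennreal[OF int[OF s \<rho>(1), of flag_vec]] integral_norm_bound_ennreal[OF ih]
    by (intro add_mono) simp_all
  finally show ?thesis by (simp add: dd)
qed

text \<open>Taken with respect to Lebesgue measure in the chart, without the volume density: it is
  compared with slice integrals, which carry no weight.\<close>

definition slab_integral :: "real \<Rightarrow> real \<Rightarrow> ('a \<times> real \<Rightarrow> real) \<Rightarrow> ennreal" where
  "slab_integral a b h = (\<integral>\<^sup>+z. indicator {a..b} (snd z) * ennreal \<bar>h z\<bar> \<partial>lborel)"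

lemma slab_integral_Fubini:
  assumes h: "continuous_on UNIV h"
  shows "slab_integral a b h = (\<integral>\<^sup>+t. indicator {a..b} t * (\<integral>\<^sup>+x. ennreal \<bar>h (x, t)\<bar> \<partial>lborel) \<partial>lborel)"
    and "slab_integral a b h = (\<integral>\<^sup>+x. (\<integral>\<^sup>+t. indicator {a..b} t * ennreal \<bar>h (x, t)\<bar> \<partial>lborel) \<partial>lborel)"
proof -
  have hm: "h \<in> borel_measurable borel" by (rule borel_measurable_continuous_onI[OF h])
  have m: "(\<lambda>z. indicator {a..b} (snd z) * ennreal \<bar>h z\<bar>) \<in> borel_measurable (lborel \<Otimes>\<^sub>M lborel)"
    unfolding lborel_prod measurable_lborel2
    by (intro borel_measurable_times_ennreal measurable_indicator_snd) (use hm in measurable)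
  have hx: "(\<lambda>x. h (x, t)) \<in> borel_measurable borel" for t
    by (intro borel_measurable_continuous_onI continuous_on_compose2[OF h] continuous_intros) auto
  have e: "slab_integral a b h = (\<integral>\<^sup>+z. indicator {a..b} (snd z) * ennreal \<bar>h z\<bar> \<partial>(lborel \<Otimes>\<^sub>M lborel))"
    by (simp add: slab_integral_def lborel_prod)
  also have "\<dots> = (\<integral>\<^sup>+t. (\<integral>\<^sup>+x. indicator {a..b} t * ennreal \<bar>h (x, t)\<bar> \<partial>lborel) \<partial>lborel)"
    using lborel_pair.nn_integral_snd[OF m] by simp
  also have "\<dots> = (\<integral>\<^sup>+t. indicator {a..b} t * (\<integral>\<^sup>+x. ennreal \<bar>h (x, t)\<bar> \<partial>lborel) \<partial>lborel)"
    using hx by (intro nn_integral_cong nn_integral_cmult) auto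
  finally show "slab_integral a b h = (\<integral>\<^sup>+t. indicator {a..b} t * (\<integral>\<^sup>+x. ennreal \<bar>h (x, t)\<bar> \<partial>lborel) \<partial>lborel)" .
  show "slab_integral a b h = (\<integral>\<^sup>+x. (\<integral>\<^sup>+t. indicator {a..b} t * ennreal \<bar>h (x, t)\<bar> \<partial>lborel) \<partial>lborel)"
    unfolding e using lborel.nn_integral_fst[OF m] by simp
qed

lemma slab_mass_le:
  assumes s: "smooth_form k s" and T: "\<And>z. snd z > T \<Longrightarrow> s z = 0" "1 \<le> T"
    and \<rho>: "\<And>z. norm (fst z) > \<rho> \<Longrightarrow> s z = 0" "2 \<le> \<rho>" and S: "0 \<le> S"
  shows "ennreal (S * mass) \<le> slab_integral (- S) 0 (\<lambda>z. s z flag_vec) +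
    slab_integral (- S) 0 (\<lambda>z. hom T (ext_deriv k s - \<omega>0) z flag_vec)"
proof -
  let ?h = "\<lambda>z. hom T (ext_deriv k s - \<omega>0) z flag_vec"
  have "smooth_form (Suc k) (ext_deriv k s - \<omega>0)" by (rule smooth_form_diff[OF smooth_form_ext_deriv[OF s] smooth_\<omega>0])
  moreover have "(ext_deriv k s - \<omega>0) z = 0" if "snd z > T" for z
    using ext_deriv_zero_above[of T s z k] T that \<omega>0_outer[of z] by simp
  ultimately have sh: "smooth_form k (hom T (ext_deriv k s - \<omega>0))" by (rule smooth_form_hom)
  have c1: "continuous_on UNIV (\<lambda>z. s z flag_vec)" by (rule smooth_continuous[OF smooth_form_smooth[OF s]])
  have c2: "continuous_on UNIV ?h" by (rule smooth_continuous[OF smooth_form_smooth[OF sh]])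
  have mm: "(\<lambda>t. \<integral>\<^sup>+x. ennreal \<bar>h (x, t)\<bar> \<partial>lborel) \<in> borel_measurable lborel" if "continuous_on UNIV h" for h :: "'a \<times> real \<Rightarrow> real"
  proof (rule lborel.borel_measurable_nn_integral)
    have "(\<lambda>z. h (snd z, fst z)) \<in> borel_measurable borel"
      by (intro borel_measurable_continuous_onI continuous_on_compose2[OF that] continuous_intros) auto
    then show "(\<lambda>(t, x). ennreal \<bar>h (x, t)\<bar>) \<in> borel_measurable (lborel \<Otimes>\<^sub>M lborel)"
      unfolding lborel_prod case_prod_beta by measurable
  qed
  have "ennreal (S * mass) = (\<integral>\<^sup>+t. indicator {- S..0} t * ennreal mass \<partial>lborel)"
    using S mass_pos by (simp add: nn_integral_multc ennreal_mult)
  also have "\<dots> \<le> (\<integral>\<^sup>+t. indicator {- S..0} t * (\<integral>\<^sup>+x. ennreal \<bar>s (x, t) flag_vec\<bar> \<partial>lborel) +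
      indicator {- S..0} t * (\<integral>\<^sup>+x. ennreal \<bar>?h (x, t)\<bar> \<partial>lborel) \<partial>lborel)"
    unfolding distrib_left[symmetric]
  proof (intro nn_integral_mono)
    fix t :: real
    show "indicator {- S..0} t * ennreal mass \<le> indicator {- S..0} t *
        ((\<integral>\<^sup>+x. ennreal \<bar>s (x, t) flag_vec\<bar> \<partial>lborel) + (\<integral>\<^sup>+x. ennreal \<bar>?h (x, t)\<bar> \<partial>lborel))"
      using slice_mass_le[OF s T \<rho>, of t] by (auto simp: indicator_def)
  qed
  also have "\<dots> = slab_integral (- S) 0 (\<lambda>z. s z flag_vec) + slab_integral (- S) 0 ?h"
    unfolding slab_integral_Fubini(1)[OF c1] slab_integral_Fubini(1)[OF c2]
    by (intro nn_integral_add borel_measurable_times_ennreal mm c1 c2) simp_all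
  finally show ?thesis .
qed

text \<open>This is where \<open>p * w \<le> \<tau>\<close> enters: the weight of the flag component does not decay downwards.\<close>

lemma slab_flag_component_le:
  assumes s: "smooth_form k s" and \<rho>: "\<And>z. norm (fst z) > \<rho> \<Longrightarrow> s z = 0"
    and pw: "p * (\<Sum>i<k. \<mu> i) \<le> \<tau>" and S: "0 \<le> S" and \<delta>: "0 < \<delta>"
  shows "slab_integral (- S) 0 (\<lambda>z. s z flag_vec) \<le>
    ennreal (\<delta> * (measure lborel (cball (0 :: 'a) \<rho>) * S)) + ennreal (\<delta> powr (1 - p)) * energy k s"
proof -
  define W where "W = (\<Sum>i<k. \<mu> i)"
  have comp: "\<bar>s z flag_vec\<bar> powr p \<le> density_p k s z" if "snd z \<le> 0" for z
  proof -
    let ?t = "snd z"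
    have alt: "alternating k (s z)" by (rule smooth_form_alternating[OF s])
    \<comment> \<open>The restriction to horizontal vectors, to which
      \<open>alternating_exp_end_flag\<close> applies: it relates the component on the constant flag
      vectors to the one on the frame at height t.\<close>
    define g where "g = (\<lambda>u. s z (\<lambda>i. (u i, 0)))"
    have "alternating k g"
      unfolding alternating_def
    proof (intro conjI allI impI)
      fix v u :: "nat \<Rightarrow> 'a" assume "\<forall>i<k. v i = u i"
      then show "g v = g u" unfolding g_def by (intro alternating_cong[OF alt]) simp
    next
      fix v :: "nat \<Rightarrow> 'a" and i assume i: "i < k"
      have eq: "(\<lambda>j. ((v(i := y)) j, 0 :: real)) = (\<lambda>j. (v j, 0))(i := (y, 0))" for y by (auto simp: fun_eq_iff)
      show "linear (\<lambda>y. g (v(i := y)))"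
      proof (rule linearI)
        show "g (v(i := a + b)) = g (v(i := a)) + g (v(i := b))" for a b
          unfolding g_def eq using alternating_upd_add[OF alt i, of "\<lambda>j. (v j, 0)" "(a, 0)" "(b, 0)"] by simp
        show "g (v(i := r *\<^sub>R b)) = r *\<^sub>R g (v(i := b))" for r b
          unfolding g_def eq using alternating_upd_scale[OF alt i, of "\<lambda>j. (v j, 0)" r "(b, 0)"] by simp
      qed
    next
      fix v :: "nat \<Rightarrow> 'a" and i j assume ij: "i < k" "j < k" "i \<noteq> j" "v i = v j"
      then show "g v = 0" unfolding g_def by (intro alternating_eq_0[OF alt ij(1-3)]) simp
    qed
    from alternating_exp_end_flag[OF this, of ?t] kN
    have "s z (\<lambda>i. (exp_end ?t \<alpha> (e i), 0)) = exp (?t * W) * s z flag_vec"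
      by (simp add: g_def W_def flag_vec_def[abs_def])
    moreover have "s z (\<lambda>i. frame ?t i) = s z (\<lambda>i. (exp_end ?t \<alpha> (e i), 0))"
      by (rule alternating_cong[OF alt]) (use kN in \<open>simp add: frame_def\<close>)
    moreover have "\<bar>s z (\<lambda>i. frame ?t i)\<bar> \<le> fnorm k s z"
      using le_fnorm[of k s z "\<lambda>i. i", OF alt] kN by simp
    ultimately have "exp (?t * W) * \<bar>s z flag_vec\<bar> \<le> fnorm k s z" by (simp add: abs_mult)
    then have "(exp (?t * W) * \<bar>s z flag_vec\<bar>) powr p \<le> fnorm k s z powr p" using p by (intro powr_mono2) auto
    then have "exp (?t * W * p) * \<bar>s z flag_vec\<bar> powr p \<le> fnorm k s z powr p"
      by (simp add: powr_mult exp_powr_real)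
    then have "exp (?t * W * p) * \<bar>s z flag_vec\<bar> powr p * exp (- \<tau> * ?t) \<le> density_p k s z"
      unfolding density_p_def by (rule mult_right_mono) simp
    moreover have "exp (?t * W * p) * \<bar>s z flag_vec\<bar> powr p * exp (- \<tau> * ?t) = exp (?t * (p * W - \<tau>)) * \<bar>s z flag_vec\<bar> powr p"
      by (simp add: algebra_simps flip: exp_add)
    moreover have "1 \<le> exp (?t * (p * W - \<tau>))" using that pw by (simp add: W_def mult_nonpos_nonpos)
    then have "1 * \<bar>s z flag_vec\<bar> powr p \<le> exp (?t * (p * W - \<tau>)) * \<bar>s z flag_vec\<bar> powr p" by (rule mult_right_mono) simp
    ultimately show ?thesis by linarith
  qed
  have "slab_integral (- S) 0 (\<lambda>z. s z flag_vec) \<le>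
      (\<integral>\<^sup>+z. ennreal \<delta> * (indicator (cball (0 :: 'a) \<rho>) (fst z) * indicator {- S..0} (snd z)) + ennreal (\<delta> powr (1 - p)) * ennreal (density_p k s z) \<partial>lborel)"
    unfolding slab_integral_def
  proof (rule nn_integral_mono)
    fix z :: "'a \<times> real"
    show "indicator {- S..0} (snd z) * ennreal \<bar>s z flag_vec\<bar> \<le>
        ennreal \<delta> * (indicator (cball (0 :: 'a) \<rho>) (fst z) * indicator {- S..0} (snd z)) + ennreal (\<delta> powr (1 - p)) * ennreal (density_p k s z)"
    proof (cases "snd z \<in> {- S..0} \<and> norm (fst z) \<le> \<rho>")
      case True
      have "\<bar>s z flag_vec\<bar> \<le> \<delta> + \<delta> powr (1 - p) * \<bar>s z flag_vec\<bar> powr p"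
        by (rule le_powr_interpolate) (use \<delta> p in auto)
      also have "\<dots> \<le> \<delta> + \<delta> powr (1 - p) * density_p k s z"
        using comp[of z] True by (intro add_left_mono mult_left_mono) auto
      finally show ?thesis using True \<delta> density_p_nonneg by (simp add: ennreal_leI flip: ennreal_plus ennreal_mult)
    next
      case False
      then show ?thesis using \<rho>[of z] by (auto simp: indicator_def)
    qed
  qed
  also have "\<dots> = ennreal \<delta> * ennreal (measure lborel (cball (0 :: 'a) \<rho>) * S) + ennreal (\<delta> powr (1 - p)) * energy k s"
  proof -
    have m1: "(\<lambda>z :: 'a \<times> real. indicator (cball (0 :: 'a) \<rho>) (fst z) * indicator {- S..0} (snd z) :: ennreal) \<in> borel_measurable lborel"
      unfolding measurable_lborel2 by (intro borel_measurable_times_ennreal measurable_indicator_fst measurable_indicator_snd)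
    have m2: "(\<lambda>z. ennreal (density_p k s z)) \<in> borel_measurable lborel"
      using borel_measurable_continuous_onI[OF continuous_density_p[OF s]] by simp
    show ?thesis
      using nn_integral_indicator_slab[of "- S" 0 \<rho>, where 'a = 'a] S m1 m2
      by (simp add: nn_integral_add nn_integral_cmult energy_smooth)
  qed
  finally show ?thesis using \<delta> S by (simp add: ennreal_mult)
qed

text \<open>The bound does not depend on t in the slab; integrating over the slab therefore costs
  only a factor S.\<close>

lemma hom_le_nn_integral:
  assumes \<beta>: "smooth_form (Suc k) \<beta>" and t: "- S \<le> t"
  shows "ennreal \<bar>hom T \<beta> (x, t) v\<bar> \<le> (\<integral>\<^sup>+u. indicator {- S..T} u * ennreal \<bar>\<beta> (x, u) (case_nat (0, 1) v)\<bar> \<partial>lborel)"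
proof -
  let ?h = "\<lambda>r. \<beta> ((x, t) + r *\<^sub>R (0, 1)) (case_nat (0, 1) v)"
  have cb: "continuous_on UNIV (\<lambda>z. \<beta> z (case_nat (0, 1) v))" by (rule smooth_continuous[OF smooth_form_smooth[OF \<beta>]])
  have i1: "?h integrable_on {0..T - t}" by (rule vertical_ray_integrable[OF cb])
  have i2: "(\<lambda>r. \<bar>?h r\<bar>) integrable_on {0..T - t}"
    by (rule vertical_ray_integrable[OF continuous_on_rabs[OF cb]])
  have "norm (integral {0..T - t} ?h) \<le> integral {0..T - t} (\<lambda>r. \<bar>?h r\<bar>)"
    by (rule integral_norm_bound_integral[OF i1 i2]) simp
  then have "\<bar>hom T \<beta> (x, t) v\<bar> \<le> integral {0..T - t} (\<lambda>r. \<bar>?h r\<bar>)"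
    by (simp add: hom_def vert_int_def)
  then have "ennreal \<bar>hom T \<beta> (x, t) v\<bar> \<le> ennreal (integral {0..T - t} (\<lambda>r. \<bar>?h r\<bar>))" by (rule ennreal_leI)
  also have "\<dots> = (\<integral>\<^sup>+r. ennreal \<bar>?h r\<bar> * indicator {0..T - t} r \<partial>lborel)"
    by (rule nn_integral_has_integral_lebesgue'[symmetric]) (use i2 in \<open>auto simp: integrable_integral\<close>)
  also have "\<dots> = (\<integral>\<^sup>+r. (\<lambda>u. indicator {t..T} u * ennreal \<bar>\<beta> (x, u) (case_nat (0, 1) v)\<bar>) (r + t) \<partial>lborel)"
    by (intro nn_integral_cong) (auto simp: indicator_def add.commute)
  also have "\<dots> = (\<integral>\<^sup>+u. indicator {t..T} u * ennreal \<bar>\<beta> (x, u) (case_nat (0, 1) v)\<bar> \<partial>lborel)"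
  proof (rule nn_integral_lborel_shift)
    have "(\<lambda>u. \<beta> (x, u) (case_nat (0, 1) v)) \<in> borel_measurable borel"
      by (intro borel_measurable_continuous_onI continuous_on_compose2[OF cb] continuous_intros) auto
    then show "(\<lambda>u. indicator {t..T} u * ennreal \<bar>\<beta> (x, u) (case_nat (0, 1) v)\<bar>) \<in> borel_measurable borel"
      by measurable
  qed
  also have "\<dots> \<le> (\<integral>\<^sup>+u. indicator {- S..T} u * ennreal \<bar>\<beta> (x, u) (case_nat (0, 1) v)\<bar> \<partial>lborel)"
    using t by (intro nn_integral_mono) (auto simp: indicator_def)
  finally show ?thesis .
qed

text \<open>On a slab of fixed height nothing has to decay: the constant arguments have bounded
  frame coordinates, and the volume density is bounded below. The constants depend on S and T, so
  \<epsilon> is found only after S has been fixed.\<close>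

lemma slab_hom_small:
  assumes S: "0 \<le> S" and T: "0 \<le> T" and \<eta>: "0 < \<eta>"
  obtains \<epsilon> where "\<epsilon> > 0" "\<And>\<beta>. smooth_form (Suc k) \<beta> \<Longrightarrow> (\<And>z. snd z > T \<Longrightarrow> \<beta> z = 0) \<Longrightarrow>
    (\<And>z. norm (fst z) > \<rho> \<Longrightarrow> \<beta> z = 0) \<Longrightarrow> energy (Suc k) \<beta> < ennreal \<epsilon> \<Longrightarrow>
    slab_integral (- S) 0 (\<lambda>z. hom T \<beta> z flag_vec) \<le> ennreal \<eta>"
proof -
  let ?v = "case_nat (0, 1) flag_vec :: nat \<Rightarrow> 'a \<times> real"
  let ?V = "measure lborel (cball (0 :: 'a) \<rho>)"
  have "\<exists>C. \<forall>t\<in>{- S..T}. \<bar>coord t a (?v i)\<bar> \<le> C" for a i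
  proof -
    have "continuous_on {- S..T} (\<lambda>t. coord t a (?v i))"
    proof (cases "a < N")
      case True
      have "isCont (\<lambda>t. ell a (exp_end (- t) \<alpha> (fst (?v i)))) t" for t
        by (rule isCont_o2[where g = "\<lambda>s. ell a (exp_end s \<alpha> (fst (?v i)))"])
          (auto intro!: DERIV_isCont exp_end_functional_has_derivative[OF lin ell_lin[OF True]])
      then show ?thesis using True by (simp add: coord_def continuous_at_imp_continuous_on)
    next
      case False
      then show ?thesis by (simp add: coord_def)
    qed
    from compact_imp_bounded[OF compact_continuous_image[OF this compact_Icc]]
    show ?thesis unfolding bounded_iff by auto
  qed
  then obtain C where C: "\<And>a i t. t \<in> {- S..T} \<Longrightarrow> \<bar>coord t a (?v i)\<bar> \<le> C a i" by metis
  define A where "A = (\<Sum>i<Suc k. \<Sum>a\<le>N. \<bar>C a i\<bar>)"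
  have A: "\<bar>coord t a (?v i)\<bar> \<le> A" if "t \<in> {- S..T}" "i < Suc k" "a \<le> N" for t i a
  proof -
    have "\<bar>coord t a (?v i)\<bar> \<le> \<bar>C a i\<bar>" using C[OF that(1), of a i] by linarith
    also have "\<dots> \<le> (\<Sum>a\<le>N. \<bar>C a i\<bar>)" using that by (intro member_le_sum[where f = "\<lambda>a. \<bar>C a i\<bar>"]) auto
    also have "\<dots> \<le> A" unfolding A_def
      using that by (intro member_le_sum[where f = "\<lambda>i. \<Sum>a\<le>N. \<bar>C a i\<bar>"] sum_nonneg) auto
    finally show ?thesis .
  qed
  have A0: "0 \<le> A" unfolding A_def by (intro sum_nonneg) auto
  define M where "M = A ^ Suc k"
  have M: "M \<ge> 0" using A0 by (simp add: M_def)
  \<comment> \<open>A bound for e^(\<tau> t) on the slab from -S to T, which removes the weight from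
    the energy density.\<close>
  define K where "K = exp (\<bar>\<tau>\<bar> * (S + T))"
  \<comment> \<open>\<delta> makes the volume term at most \<eta> / 2; then \<epsilon>, which
    depends on \<delta>, does the same for the energy term. The summands 1 keep the denominators
    positive.\<close>
  define \<delta> where "\<delta> = \<eta> / (2 * (S * (M * (?V * (T + S))) + 1))"
  have pos1: "0 < S * (M * (?V * (T + S))) + 1" using S T M by (simp add: add_nonneg_pos)
  have \<delta>: "\<delta> > 0" using \<eta> pos1 by (simp add: \<delta>_def)
  define \<epsilon> where "\<epsilon> = \<eta> / (2 * (S * (M * (\<delta> powr (1 - p) * K)) + 1))"
  have pos2: "0 < S * (M * (\<delta> powr (1 - p) * K)) + 1" using S M by (simp add: K_def add_nonneg_pos)
  have \<epsilon>: "\<epsilon> > 0" using \<eta> pos2 by (simp add: \<epsilon>_def)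
  have "slab_integral (- S) 0 (\<lambda>z. hom T \<beta> z flag_vec) \<le> ennreal \<eta>"
    if \<beta>: "smooth_form (Suc k) \<beta>" and \<beta>T: "\<And>z. snd z > T \<Longrightarrow> \<beta> z = 0"
      and \<beta>\<rho>: "\<And>z. norm (fst z) > \<rho> \<Longrightarrow> \<beta> z = 0" and E: "energy (Suc k) \<beta> < ennreal \<epsilon>" for \<beta>
  proof -
    have ch: "continuous_on UNIV (\<lambda>z. hom T \<beta> z flag_vec)"
      by (rule smooth_continuous[OF smooth_form_smooth[OF smooth_form_hom[OF \<beta> \<beta>T]]])
    have cb: "continuous_on UNIV (\<lambda>z. \<beta> z ?v)" by (rule smooth_continuous[OF smooth_form_smooth[OF \<beta>]])
    let ?G = "\<lambda>x. \<integral>\<^sup>+u. indicator {- S..T} u * ennreal \<bar>\<beta> (x, u) ?v\<bar> \<partial>lborel"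
    have Gm: "?G \<in> borel_measurable lborel"
    proof (rule lborel.borel_measurable_nn_integral)
      have "(\<lambda>z. \<beta> z ?v) \<in> borel_measurable borel" by (rule borel_measurable_continuous_onI[OF cb])
      then show "(\<lambda>(x, u). indicator {- S..T} u * ennreal \<bar>\<beta> (x, u) ?v\<bar>) \<in> borel_measurable (lborel \<Otimes>\<^sub>M lborel)"
        unfolding lborel_prod case_prod_beta prod.collapse measurable_lborel2
        by (intro borel_measurable_times_ennreal measurable_indicator_snd) measurable
    qed
    have "slab_integral (- S) 0 (\<lambda>z. hom T \<beta> z flag_vec) =
        (\<integral>\<^sup>+x. (\<integral>\<^sup>+t. indicator {- S..0} t * ennreal \<bar>hom T \<beta> (x, t) flag_vec\<bar> \<partial>lborel) \<partial>lborel)"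
      by (rule slab_integral_Fubini(2)[OF ch])
    also have "\<dots> \<le> (\<integral>\<^sup>+x. (\<integral>\<^sup>+t. indicator {- S..0} t * ?G x \<partial>lborel) \<partial>lborel)"
    proof (intro nn_integral_mono)
      fix x t
      show "indicator {- S..0} t * ennreal \<bar>hom T \<beta> (x, t) flag_vec\<bar> \<le> indicator {- S..0} t * ?G x"
        using hom_le_nn_integral[OF \<beta>, of S t T x flag_vec] by (auto simp: indicator_def)
    qed
    also have "\<dots> = (\<integral>\<^sup>+x. ennreal S * ?G x \<partial>lborel)"
      using S by (simp add: nn_integral_multc)
    also have "\<dots> = ennreal S * slab_integral (- S) T (\<lambda>z. \<beta> z ?v)"
      unfolding slab_integral_Fubini(2)[OF cb] by (rule nn_integral_cmult[OF Gm])
    also have "slab_integral (- S) T (\<lambda>z. \<beta> z ?v) \<le>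
        (\<integral>\<^sup>+z. ennreal (M * \<delta>) * (indicator (cball (0 :: 'a) \<rho>) (fst z) * indicator {- S..T} (snd z)) +
          ennreal (M * (\<delta> powr (1 - p) * K)) * ennreal (density_p (Suc k) \<beta> z) \<partial>lborel)"
      unfolding slab_integral_def
    proof (rule nn_integral_mono)
      fix z :: "'a \<times> real"
      show "indicator {- S..T} (snd z) * ennreal \<bar>\<beta> z ?v\<bar> \<le>
          ennreal (M * \<delta>) * (indicator (cball (0 :: 'a) \<rho>) (fst z) * indicator {- S..T} (snd z)) +
          ennreal (M * (\<delta> powr (1 - p) * K)) * ennreal (density_p (Suc k) \<beta> z)"
      proof (cases "snd z \<in> {- S..T} \<and> norm (fst z) \<le> \<rho>")
        case True
        have "\<bar>\<beta> z ?v\<bar> \<le> M * fnorm (Suc k) \<beta> z"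
          unfolding M_def
          by (rule abs_le_coord_fnorm[OF smooth_form_alternating[OF \<beta>]]) (use A True in auto)
        also have "\<dots> \<le> M * (\<delta> + \<delta> powr (1 - p) * fnorm (Suc k) \<beta> z powr p)"
          by (intro mult_left_mono le_powr_interpolate fnorm_nonneg \<delta> p M)
        also have "\<dots> \<le> M * (\<delta> + \<delta> powr (1 - p) * (K * density_p (Suc k) \<beta> z))"
        proof (intro mult_left_mono add_left_mono M)
          have "\<tau> * snd z \<le> \<bar>\<tau>\<bar> * \<bar>snd z\<bar>" by (metis abs_ge_self abs_mult)
          also have "\<dots> \<le> \<bar>\<tau>\<bar> * (S + T)" using True S T by (intro mult_left_mono) auto
          finally have "1 \<le> K * exp (- \<tau> * snd z)" by (simp add: K_def flip: exp_add)
          then have "1 * fnorm (Suc k) \<beta> z powr p \<le> K * exp (- \<tau> * snd z) * fnorm (Suc k) \<beta> z powr p"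
            by (rule mult_right_mono) simp
          then show "fnorm (Suc k) \<beta> z powr p \<le> K * density_p (Suc k) \<beta> z"
            by (simp add: density_p_def mult_ac)
        qed simp
        also have "\<dots> = M * \<delta> + M * (\<delta> powr (1 - p) * K) * density_p (Suc k) \<beta> z" by (simp add: algebra_simps)
        finally have "ennreal \<bar>\<beta> z ?v\<bar> \<le> ennreal (M * \<delta> + M * (\<delta> powr (1 - p) * K) * density_p (Suc k) \<beta> z)" by (rule ennreal_leI)
        also have "\<dots> = ennreal (M * \<delta>) + ennreal (M * (\<delta> powr (1 - p) * K)) * ennreal (density_p (Suc k) \<beta> z)"
          using M \<delta> density_p_nonneg[of "Suc k" \<beta> z]
          by (subst ennreal_plus) (auto simp: K_def ennreal_mult[symmetric])
        finally show ?thesis using True by simp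
      next
        case False
        then show ?thesis using \<beta>\<rho>[of z] by (auto simp: indicator_def)
      qed
    qed
    also have "\<dots> = ennreal (M * \<delta>) * ennreal (?V * (T + S)) + ennreal (M * (\<delta> powr (1 - p) * K)) * energy (Suc k) \<beta>"
    proof -
      have m1: "(\<lambda>z :: 'a \<times> real. indicator (cball (0 :: 'a) \<rho>) (fst z) * indicator {- S..T} (snd z) :: ennreal) \<in> borel_measurable lborel"
        unfolding measurable_lborel2 by (intro borel_measurable_times_ennreal measurable_indicator_fst measurable_indicator_snd)
      have m2: "(\<lambda>z. ennreal (density_p (Suc k) \<beta> z)) \<in> borel_measurable lborel"
        using borel_measurable_continuous_onI[OF continuous_density_p[OF \<beta>]] by simp
      show ?thesis
        using nn_integral_indicator_slab[of "- S" T \<rho>, where 'a = 'a] S T m1 m2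
        by (simp add: nn_integral_add nn_integral_cmult energy_smooth)
    qed
    also have "\<dots> \<le> ennreal (M * \<delta>) * ennreal (?V * (T + S)) + ennreal (M * (\<delta> powr (1 - p) * K)) * ennreal \<epsilon>"
      using E by (intro add_left_mono mult_left_mono) auto
    also have "\<dots> = ennreal (M * \<delta> * (?V * (T + S)) + M * (\<delta> powr (1 - p) * K) * \<epsilon>)"
      using M \<delta> \<epsilon> S T by (subst ennreal_plus) (auto simp: K_def ennreal_mult[symmetric])
    finally have "slab_integral (- S) 0 (\<lambda>z. hom T \<beta> z flag_vec) \<le>
        ennreal S * ennreal (M * \<delta> * (?V * (T + S)) + M * (\<delta> powr (1 - p) * K) * \<epsilon>)"
      by (simp add: mult_left_mono)
    also have "\<dots> = ennreal (S * (M * \<delta> * (?V * (T + S)) + M * (\<delta> powr (1 - p) * K) * \<epsilon>))"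
      using S M \<delta> \<epsilon> T by (subst ennreal_mult) (auto simp: K_def)
    also have "\<dots> \<le> ennreal \<eta>"
    proof (rule ennreal_leI)
      have half: "Q * (\<eta> / (2 * (Q + 1))) \<le> \<eta> / 2" if "0 < Q + 1" for Q :: real
        using that \<eta> by (simp add: field_simps)
      have "S * (M * \<delta> * (?V * (T + S)) + M * (\<delta> powr (1 - p) * K) * \<epsilon>) =
          (S * (M * (?V * (T + S)))) * \<delta> + (S * (M * (\<delta> powr (1 - p) * K))) * \<epsilon>"
        by (simp add: algebra_simps)
      also have "\<dots> \<le> \<eta> / 2 + \<eta> / 2"
      proof (rule add_mono)
        show "(S * (M * (?V * (T + S)))) * \<delta> \<le> \<eta> / 2" unfolding \<delta>_def by (rule half[OF pos1])
        show "(S * (M * (\<delta> powr (1 - p) * K))) * \<epsilon> \<le> \<eta> / 2" unfolding \<epsilon>_def by (rule half[OF pos2])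
      qed
      finally show "S * (M * \<delta> * (?V * (T + S)) + M * (\<delta> powr (1 - p) * K) * \<epsilon>) \<le> \<eta>" by simp
    qed
    finally show ?thesis .
  qed
  with \<epsilon> that show ?thesis by blast
qed

text \<open>Approximants of a primitive have bounded energy. Over a slab of height S they carry a
  mass of at least S times \<open>mass\<close> up to 1, while the energy bound allows at most S
  \<open>mass\<close> / 4 plus a constant independent of S; this is absurd for large S.\<close>

lemma \<omega>0_not_in_image:
  assumes pw: "p * (\<Sum>i<k. \<mu> i) \<le> \<tau>"
  shows "\<omega>0 \<notin> rel_Lp_image met nhds_vertical_end p (Suc k)"
proof
  assume "\<omega>0 \<in> rel_Lp_image met nhds_vertical_end p (Suc k)"
  then obtain \<eta> where rel: "\<eta> \<in> rel_Lp_complex met nhds_vertical_end p k" and diff: "Lp_diff met p k \<eta> \<omega>0" by auto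
  obtain s where s: "\<And>i. smooth_energy k (s i)" "(\<lambda>i. energy k (s i - \<eta>)) \<longlonglongrightarrow> 0"
    "(\<lambda>i. energy (Suc k) (ext_deriv k (s i) - \<omega>0)) \<longlonglongrightarrow> 0" and m: "measurable_form k \<eta>" "measurable_form (Suc k) \<omega>0"
    using diff unfolding Lp_diff_iff by blast
  obtain R T0 where R: "R > 0" and ae: "AE z in lebesgue. norm (fst z) \<ge> R \<or> snd z > T0 \<longrightarrow> \<eta> z = 0"
    using rel unfolding rel_Lp_complex_iff by blast
  \<comment> \<open>The region is enlarged so that both the primitive and \<omega>0, which lives
    over norms up to 2 and heights up to 1, vanish outside it.\<close>
  define R' where "R' = max R 3"
  define T' where "T' = max T0 1 + 1"
  have ae': "AE z in lebesgue. z \<notin> inner_region R' T' \<longrightarrow> \<eta> z = 0 \<and> \<omega>0 z = 0"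
    using ae
  proof eventually_elim
    case (elim z)
    show ?case
    proof
      assume "z \<notin> inner_region R' T'"
      then have z: "norm (fst z) \<ge> R' \<or> snd z \<ge> T'" by (auto simp: inner_region_def)
      then have "norm (fst z) \<ge> R \<or> snd z > T0" by (auto simp: R'_def T'_def)
      moreover have "norm (fst z) > 2 \<or> snd z > 1" using z by (auto simp: R'_def T'_def)
      ultimately show "\<eta> z = 0 \<and> \<omega>0 z = 0" using elim \<omega>0_outer by blast
    qed
  qed
  have R'0: "R' \<ge> 0" by (simp add: R'_def)
  define c where "c = (\<lambda>i. cut_form R' T' (s i))"
  have cut: "smooth_energy k (c i)" "(\<lambda>i. energy k (c i - \<eta>)) \<longlonglongrightarrow> 0"
    "(\<lambda>i. energy (Suc k) (ext_deriv k (c i) - \<omega>0)) \<longlonglongrightarrow> 0" for i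
    unfolding c_def by (rule cut_form_converges[OF R'0 s m ae'])+
  have sf: "smooth_form k (c i)" and fin: "energy k (c i) < \<infinity>" for i using cut(1) by (auto simp: smooth_energy_def)
  define \<rho> where "\<rho> = R' + 1"
  define T where "T = T' + 1"
  have \<rho>2: "2 \<le> \<rho>" and T1: "1 \<le> T" by (auto simp: \<rho>_def R'_def T_def T'_def)
  have c0: "c i z = 0" if "norm (fst z) > \<rho> \<or> snd z > T" for i z
  proof -
    have "cut R' T' z = 0" by (rule cut_eq_0[OF R'0]) (use that in \<open>auto simp: \<rho>_def T_def\<close>)
    then show ?thesis by (simp add: c_def cut_form_def fun_eq_iff)
  qed
  define \<beta> where "\<beta> = (\<lambda>i. ext_deriv k (c i) - \<omega>0)"
  have s\<beta>: "smooth_form (Suc k) (\<beta> i)" for i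
    unfolding \<beta>_def by (rule smooth_form_diff[OF smooth_form_ext_deriv[OF sf] smooth_\<omega>0])
  have \<beta>0: "\<beta> i z = 0" if "norm (fst z) > \<rho> \<or> snd z > T" for i z
  proof -
    have "ext_deriv k (c i) z = 0"
      by (rule ext_deriv_zero_outside[of "{z. norm (fst z) > \<rho>} \<union> {z. snd z > T}"])
        (use c0 that in \<open>auto intro!: open_Un open_Collect_less continuous_intros\<close>)
    moreover have "\<omega>0 z = 0" by (rule \<omega>0_outer) (use that \<rho>2 T1 in auto)
    ultimately show ?thesis by (simp add: \<beta>_def)
  qed
  have "\<forall>\<^sub>F i in sequentially. energy k (c i - \<eta>) < ennreal 1"
    using cut(2)[unfolded ennreal_tendsto_0_iff, rule_format, of 1] by simp
  then obtain i0 where i0: "\<And>i. i \<ge> i0 \<Longrightarrow> energy k (c i - \<eta>) < ennreal 1"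
    unfolding eventually_sequentially by blast
  note mc = measurable_smooth_form[OF sf]
  have "energy k \<eta> = energy k (c i0 - (c i0 - \<eta>))" by simp
  also have "\<dots> < \<infinity>"
    by (rule energy_diff_finite[OF mc measurable_form_diff[OF mc m(1)] fin]) (use i0[of i0] in \<open>auto intro: less_trans\<close>)
  finally have E\<eta>: "energy k \<eta> < \<infinity>" .
  \<comment> \<open>A bound on the energies of late approximants that does not depend on S; it has
    to be available before S is chosen.\<close>
  define \<Lambda> where "\<Lambda> = enn2real (ennreal (2 powr p) * (1 + energy k \<eta>))"
  have \<Lambda>: "energy k (c i) \<le> ennreal \<Lambda>" if "i \<ge> i0" for i
  proof -
    have "energy k (c i) = energy k ((c i - \<eta>) + \<eta>)" by simp
    also have "\<dots> \<le> ennreal (2 powr p) * (energy k (c i - \<eta>) + energy k \<eta>)"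
      by (rule energy_add[OF measurable_form_diff[OF mc m(1)] m(1)])
    also have "\<dots> \<le> ennreal (2 powr p) * (1 + energy k \<eta>)"
      using i0[OF that] by (intro mult_left_mono add_right_mono) auto
    also have "\<dots> = ennreal \<Lambda>"
      unfolding \<Lambda>_def using E\<eta> by (subst ennreal_enn2real) (auto simp: ennreal_mult_less_top)
    finally show ?thesis .
  qed
  let ?V = "measure lborel (cball (0 :: 'a) \<rho>)"
  \<comment> \<open>This makes the volume term \<delta> V S at most a quarter of S
    \<open>mass\<close>. S is then chosen so that the remaining constant terms equal another
    quarter.\<close>
  define \<delta> where "\<delta> = mass / (4 * (?V + 1))"
  have V1: "?V + 1 > 0" by (simp add: add_nonneg_pos)
  have \<delta>: "\<delta> > 0" using mass_pos V1 by (simp add: \<delta>_def)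
  define S where "S = 4 * (\<delta> powr (1 - p) * \<Lambda> + 1) / mass"
  have L0: "0 \<le> \<Lambda>" by (simp add: \<Lambda>_def)
  have Spos: "S > 0" using mass_pos L0 by (simp add: S_def add_nonneg_pos)
  then have S0: "0 \<le> S" by simp
  have T0': "0 \<le> T" using T1 by simp
  \<comment> \<open>Only now, with S fixed, is the required closeness of the differentials known;
    the index i is taken accordingly.\<close>
  obtain \<epsilon> where \<epsilon>: "\<epsilon> > 0" "\<And>\<beta>. smooth_form (Suc k) \<beta> \<Longrightarrow> (\<And>z. snd z > T \<Longrightarrow> \<beta> z = 0) \<Longrightarrow>
    (\<And>z. norm (fst z) > \<rho> \<Longrightarrow> \<beta> z = 0) \<Longrightarrow> energy (Suc k) \<beta> < ennreal \<epsilon> \<Longrightarrow>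
    slab_integral (- S) 0 (\<lambda>z. hom T \<beta> z flag_vec) \<le> ennreal 1"
    using slab_hom_small[OF S0 T0' zero_less_one, of \<rho>] by metis
  have "\<forall>\<^sub>F i in sequentially. energy (Suc k) (\<beta> i) < ennreal \<epsilon>"
    using cut(3) \<epsilon>(1) unfolding ennreal_tendsto_0_iff \<beta>_def by simp
  then obtain i where i: "i \<ge> i0" "energy (Suc k) (\<beta> i) < ennreal \<epsilon>"
    unfolding eventually_sequentially using nat_le_linear by blast
  have "ennreal (S * mass) \<le> slab_integral (- S) 0 (\<lambda>z. c i z flag_vec) + slab_integral (- S) 0 (\<lambda>z. hom T (\<beta> i) z flag_vec)"
    unfolding \<beta>_def by (rule slab_mass_le[OF sf _ T1 _ \<rho>2 S0]) (use c0 in auto)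
  also have "\<dots> \<le> (ennreal (\<delta> * (?V * S)) + ennreal (\<delta> powr (1 - p)) * energy k (c i)) + ennreal 1"
  proof (rule add_mono)
    show "slab_integral (- S) 0 (\<lambda>z. c i z flag_vec) \<le> ennreal (\<delta> * (?V * S)) + ennreal (\<delta> powr (1 - p)) * energy k (c i)"
      by (rule slab_flag_component_le[OF sf _ pw S0 \<delta>]) (use c0 in auto)
    show "slab_integral (- S) 0 (\<lambda>z. hom T (\<beta> i) z flag_vec) \<le> ennreal 1"
      by (rule \<epsilon>(2)[OF s\<beta> _ _ i(2)]) (use \<beta>0 in auto)
  qed
  also have "\<dots> \<le> (ennreal (\<delta> * (?V * S)) + ennreal (\<delta> powr (1 - p)) * ennreal \<Lambda>) + ennreal 1"
    by (intro add_mono mult_left_mono \<Lambda> i(1)) auto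
  also have "\<dots> = ennreal (\<delta> * (?V * S) + \<delta> powr (1 - p) * \<Lambda> + 1)"
    using \<delta> S0 L0 by (simp add: ennreal_mult)
  finally have "S * mass \<le> \<delta> * (?V * S) + \<delta> powr (1 - p) * \<Lambda> + 1"
    using \<delta> S0 L0 by (subst (asm) ennreal_le_iff) (auto intro!: add_nonneg_nonneg)
  moreover have "\<delta> * (?V * S) \<le> S * mass / 4"
  proof -
    have "\<delta> * ?V \<le> \<delta> * (?V + 1)" using \<delta> by simp
    also have "\<dots> = mass / 4" using V1 by (simp add: \<delta>_def field_simps)
    finally have "\<delta> * ?V * S \<le> mass / 4 * S" using S0 by (rule mult_right_mono)
    then show ?thesis by (simp add: mult_ac)
  qed
  moreover have "\<delta> powr (1 - p) * \<Lambda> + 1 = S * mass / 4" using mass_pos by (simp add: S_def)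
  ultimately have "S * mass \<le> S * mass / 4 + S * mass / 4" by linarith
  moreover have "S * mass > 0" using Spos mass_pos by simp
  ultimately show False by linarith
qed

end

lemma (in heintze_space) rel_Lp_cohomology_nonzero:
  assumes k: "k < N" and p1: "\<tau> < p * (\<Sum>i<Suc k. \<mu> i)" and p2: "p * (\<Sum>i<k. \<mu> i) \<le> \<tau>"
  shows "\<not> rel_Lp_cohomology_zero met nhds_vertical_end p (Suc k)"
proof -
  obtain f where f: "alternating k f" "f flag_vec \<noteq> 0" "\<And>v i. i < k \<Longrightarrow> v i = (0, 1) \<Longrightarrow> f v = 0"
    using flag_form_exists[of k] k by (metis less_imp_le)
  interpret flag_form \<alpha> e ell \<mu> N B c p \<tau> V0 k f
    by unfold_locales (use k f in auto)
  show ?thesis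
    using rel_Lp_cohomology_zero_iff \<omega>0_in_kernel[OF p1] \<omega>0_not_in_image[OF p2] by blast
qed

lemma heintze_space_exists:
  fixes \<alpha> :: "real ^ 'm \<Rightarrow> real ^ 'm" and \<mu> :: "nat \<Rightarrow> real"
  assumes \<alpha>: "heintze \<alpha>" and ev: "eigenvalues \<alpha> = {# complex_of_real (\<mu> i). i \<in># mset_set {..<CARD('m)} #}"
    and mono: "mono_on {..<CARD('m)} \<mu>" and B: "inner_product B" and c: "c > 0" and p: "p \<ge> 1"
  obtains e ell V0 where "heintze_space \<alpha> e ell \<mu> CARD('m) B c p (trace (matrix \<alpha>)) V0"
proof -
  have lin: "linear \<alpha>" using \<alpha> by (simp add: heintze_def)
  obtain \<kappa> where "\<And>z. det (z *\<^sub>R mat 1 - matrix \<alpha>) = \<kappa> * (\<Prod>i<CARD('m). z - \<mu> i)"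
    using det_eq_prod_eigenvalues[OF ev] by metis
  from flag_exists[OF lin this] obtain e where e: "lin_indep CARD('m) e"
    "\<And>i. i < CARD('m) \<Longrightarrow> \<alpha> (e i) - \<mu> i *\<^sub>R e i \<in> span (e ` {..<i})" by metis
  from triangular_exists[OF lin e] obtain ell where tri: "triangular \<alpha> e ell \<mu> CARD('m)" by metis
  have gram: "gram_det (heintze_metric \<alpha> B c) (x, t) =
      (c * det (inner_matrix B)) * exp (- 2 * t * trace (matrix \<alpha>))" for x t
    by (simp add: gram_det_heintze_metric[OF lin B] det_exp_end[OF tri e(1)] trace_eq_sum_diagonal[OF tri]
      power2_eq_square mult_ac flip: exp_add)
  have pos: "0 < \<mu> i" if "i < CARD('m)" for i
  proof -
    have "complex_of_real (\<mu> i) \<in># eigenvalues \<alpha>" using that by (simp add: ev)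
    from eigenvalue_of_mem[OF this] \<alpha> show ?thesis by (auto simp: heintze_def)
  qed
  have "heintze_space \<alpha> e ell \<mu> CARD('m) B c p (trace (matrix \<alpha>)) (c * det (inner_matrix B))"
    unfolding heintze_space_def heintze_space_axioms_def
    using tri B c p pos gram det_inner_matrix_pos[OF B] mono_onD[OF mono] by simp
  with that show ?thesis .
qed

theorem theorem1p3:
  fixes \<alpha> :: "real ^ 'm \<Rightarrow> real ^ 'm"
    and B :: "real ^ 'm \<Rightarrow> real ^ 'm \<Rightarrow> real"
    and c p :: real and n :: nat and lam w :: "nat \<Rightarrow> real"
  assumes "n \<ge> 2" and "CARD('m) = n - 1"
    and "heintze \<alpha>" and "purely_real \<alpha>"
    and "eigenvalues \<alpha> = {# complex_of_real (lam i). i \<in># mset_set {1..n - 1} #}"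
    and "mono_on {1..n - 1} lam"
    and "\<And>k. w k = (\<Sum>i = 1..k. lam i)"
    and "inner_product B" and "c > 0"
    and "p \<ge> 1"
  shows "(\<forall>k. 2 \<le> k \<and> k \<le> n \<and> p > trace (matrix \<alpha>) / w (k - 1) \<longrightarrow>
            rel_Lp_cohomology_zero (heintze_metric \<alpha> B c) nhds_vertical_end p k) \<and>
         (\<forall>k. 2 \<le> k \<and> k \<le> n - 1 \<and>
            trace (matrix \<alpha>) / w k < p \<and> p \<le> trace (matrix \<alpha>) / w (k - 1) \<longrightarrow>
            \<not> rel_Lp_cohomology_zero (heintze_metric \<alpha> B c) nhds_vertical_end p k) \<and>
         (p > trace (matrix \<alpha>) / w 1 \<longrightarrow>
            \<not> rel_Lp_cohomology_zero (heintze_metric \<alpha> B c) nhds_vertical_end p 1)"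
proof -
  let ?N = "CARD('m)"
  \<comment> \<open>The eigenvalues are shifted to start at index 0, so that w k is the sum over i <
    k and degree k corresponds to k - 1 in the lemmas above.\<close>
  define \<mu> where "\<mu> i = lam (Suc i)" for i
  let ?\<tau> = "trace (matrix \<alpha>)"
  have "mset_set {1..n - 1} = image_mset Suc (mset_set {..<?N})"
    unfolding assms(2) image_mset_mset_set[OF inj_Suc[THEN inj_on_subset, OF subset_UNIV]]
    by (simp add: image_Suc_lessThan)
  then have ev: "eigenvalues \<alpha> = {# complex_of_real (\<mu> i). i \<in># mset_set {..<?N} #}"
    by (simp add: assms(5) multiset.map_comp o_def \<mu>_def)
  have "mono_on {..<?N} \<mu>"
    by (rule mono_onI) (use assms(2) mono_onD[OF assms(6)] in \<open>auto simp: \<mu>_def\<close>)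
  from heintze_space_exists[OF assms(3) ev this assms(8-10)] obtain e ell V0
    where hs: "heintze_space \<alpha> e ell \<mu> ?N B c p ?\<tau> V0" by blast
  interpret heintze_space \<alpha> e ell \<mu> ?N B c p ?\<tau> V0 by (rule hs)
  have w: "w k = (\<Sum>i<k. \<mu> i)" for k
    unfolding assms(7) \<mu>_def by (rule sum.reindex_bij_witness[of _ Suc "\<lambda>i. i - 1"]) auto
  have w_pos: "w k > 0" if "1 \<le> k" "k \<le> ?N" for k
    unfolding w using that mu_pos by (intro sum_pos) (auto simp: lessThan_empty_iff)
  have tr: "?\<tau> = w ?N" unfolding w by (rule trace_eq_sum_diagonal) unfold_locales
  show ?thesis
  proof (intro conjI allI impI; (elim conjE)?)
    fix k assume k: "2 \<le> k" "k \<le> n" and p: "?\<tau> / w (k - 1) < p"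
    then obtain j where j: "k = Suc j" "1 \<le> j" "j \<le> ?N" using assms(2) by (cases k) auto
    then have "?\<tau> < p * (\<Sum>i<j. \<mu> i)" using p w_pos[of j] by (simp add: field_simps flip: w)
    from rel_Lp_kernel_subset_image[OF j(2,3) this]
    show "rel_Lp_cohomology_zero met nhds_vertical_end p k" by (simp add: rel_Lp_cohomology_zero_iff j(1))
  next
    fix k assume k: "2 \<le> k" "k \<le> n - 1" and p: "?\<tau> / w k < p" "p \<le> ?\<tau> / w (k - 1)"
    then obtain j where j: "k = Suc j" "1 \<le> j" "j < ?N" using assms(2) by (cases k) auto
    have "?\<tau> < p * (\<Sum>i<Suc j. \<mu> i)" "p * (\<Sum>i<j. \<mu> i) \<le> ?\<tau>"
      unfolding w[symmetric] using p w_pos[of j] w_pos[of "Suc j"] j by (simp_all add: field_simps)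
    from rel_Lp_cohomology_nonzero[OF j(3) this]
    show "\<not> rel_Lp_cohomology_zero met nhds_vertical_end p k" by (simp add: j(1))
  next
    \<comment> \<open>Degree one is the case k = 0 of \<open>rel_Lp_cohomology_nonzero\<close>: the
      empty sum turns its second condition into \<tau> >= 0, which holds as \<tau> is the sum of all
      eigenvalues.\<close>
    assume p: "?\<tau> / w 1 < p"
    have N: "0 < ?N" by simp
    then have "?\<tau> < p * w (Suc 0)" "?\<tau> \<ge> 0" using p w_pos[of "Suc 0"] w_pos[of ?N] by (simp_all add: field_simps tr)
    with rel_Lp_cohomology_nonzero[of 0] N
    show "\<not> rel_Lp_cohomology_zero met nhds_vertical_end p 1" by (simp add: w)
  qed
qed

end
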